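(* Let $R$ be a complete, torsion-free bornological $V$-algebra. If $\widehat\Omega^1(R)$ has a connection of finite degree, then the dagger completion $R^\dagger$ is analytically quasi-free.
   Context: Base: $V$ is a complete discrete valuation ring with uniformiser $\pi$ and fraction field $F$. Tensor products are over $V$; algebras may be non-unital. Bornologies: A bornology on a set is a family of "bounded" subsets closed under finite unions and subsets and containing all finite subsets. A map is bounded if it maps bounded sets to bounded sets; an injective map is a bornological embedding if a subset is bounded exactly when its image is. A bornological $V$-module is a $V$-module with a bornology in which every bounded subset lies in a bounded $V$-submodule; a bornological $V$-algebra also has bounded multiplication. It is complete if every bounded subset lies in a bounded $\pi$-adically complete $V$-submodule; the completion is the universal complete bornological module receiving a bounded linear map. The bornology on $M_1\otimes M_2$ is generated by $S_1\otimes S_2$ with $S_j\subseteq M_j$ bounded submodules; $M_1\widehat\otimes M_2$ is the completion. A bornological module is torsion-free if multiplication by $\pi$ is a bornological embedding. A bornological algebra is semi-dagger if every bounded subset lies in a bounded $V$-submodule $T$ with $\pi TT\subseteq T$. A dagger algebra is a complete, torsion-free, semi-dagger bornological algebra; $R\to R^\dagger$ is the universal bounded homomorphism to a dagger algebra (for torsion-free $R$ it is the completion of $R$ in the bornology consisting of all subsets of $\sum_{i\ge0}\pi^iM^{i+1}$ for bounded $V$-submodules $M\subseteq R$). Connections: $R^+=R\oplus V$ is the unitalisation. $\widehat\Omega^0(R)=R$ and $\widehat\Omega^n(R)=R^+\widehat\otimes R^{\widehat\otimes n}$ for $n\ge1$, with $x_0\otimes x_1\otimes\dots\otimes x_n$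 written $x_0\,\mathrm dx_1\dots\mathrm dx_n$; products of forms (in particular the bimodule structure) are determined by the Leibniz rule $\mathrm d(xy)=x\,\mathrm dy+(\mathrm dx)y$. A connection is a linear map $\nabla\colon\widehat\Omega^1(R)\to\widehat\Omega^2(R)$ with $\nabla(a\omega)=a\nabla(\omega)$ and $\nabla(\omega a)=\nabla(\omega)a+\omega\,\mathrm da$ for $a\in R$, $\omega\in\widehat\Omega^1(R)$. For a bounded $V$-submodule $M\subseteq R$, let $M^i$ be the $V$-span of $i$-fold products, $M^{(n)}=\sum_{i=1}^nM^i$, $M^{(\infty)}=\bigcup_nM^{(n)}$, and $$\mathcal F^M_r\widehat\Omega^jR=\sum_{i_0+\dots+i_j\le r}M^{(i_0)}\,\mathrm dM^{(i_1)}\dots\mathrm dM^{(i_j)}\oplus\sum_{i_1+\dots+i_j\le r}\mathrm dM^{(i_1)}\dots\mathrm dM^{(i_j)}$$ (submodules generated by such forms), an increasing filtration on the $j$-forms of the subalgebra $M^{(\infty)}$. The connection $\nabla$ has finite degree on $M$ if there is $a\in\mathbb N$ with $\nabla(\mathcal F^M_n\widehat\Omega^1R)\subseteq\mathcal F^M_{n+a}\widehat\Omega^2R$ for all $n\in\mathbb N$. It has finite degree (on $R$) if every bounded subset of $R$ is contained in a bounded submodule on which $\nabla$ has finite degree. Analytic quasi-freeness: "Algebra" means complete, torsion-free bornological $V$-algebra; a pro-algebra is a projective system of algebras $(A_n,\alpha_{m,n})$ indexed by a (countable) directed set, with bounded algebra homomorphisms $\alpha_{m,n}\colon A_n\to A_m$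 ($n\ge m$), and $\mathrm{Hom}((A_l),(B_n))=\varprojlim_n\varinjlim_l\mathrm{Hom}(A_l,B_n)$; algebras are constant pro-algebras. A pro-linear map is a morphism of projective systems of bornological $V$-modules. An extension of pro-algebras is a diagram $J\to E\to A$ of pro-algebra homomorphisms in which the first map is a kernel of the second and the second a cokernel of the first in the category of projective systems of bornological $V$-modules; it is semi-split if it has a pro-linear section. A pro-algebra $(A_n)$ is nilpotent mod $\pi$ if for each $m$ there are $n\ge m$, $l\ge1$ with $\alpha_{m,n}(A_n^l)\subseteq\pi A_m$. It is analytically nilpotent if it is nilpotent mod $\pi$ and isomorphic to a projective system of dagger algebras; an extension is analytically nilpotent if its kernel $J$ is. A pro-algebra $A$ is analytically quasi-free if every semi-split analytically nilpotent extension $J\rightarrowtail E\twoheadrightarrow A$ splits by a pro-algebra homomorphism $A\to E$. *)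

theory Defs
  imports "HOL-Algebra.Ring_Divisibility" "HOL-Algebra.Module"
begin

section \<open>The base ring\<close>

definition scaled :: "('a, 'b, 'k) module_scheme \<Rightarrow> 'a \<Rightarrow> 'b set \<Rightarrow> 'b set" where
  "scaled M c S = (\<lambda>x. c \<odot>\<^bsub>M\<^esub> x) ` S"

text \<open>
  Bijectivity of the map from \<open>S\<close> to the inverse limit of the quotients of \<open>S\<close> by
  \<open>\<pi>\<^sup>n S\<close>: a point of the limit is represented by a sequence \<open>x\<close>, existence of \<open>y\<close> is
  surjectivity, uniqueness is injectivity.
\<close>

definition adic_cauchy :: "('v, 'k) ring_scheme \<Rightarrow> 'v \<Rightarrow> ('v, 'a, 'l) module_scheme \<Rightarrow> 'a set \<Rightarrow> (nat \<Rightarrow> 'a) set"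
  where "adic_cauchy V \<pi> M S =
    {x. \<forall>n. x n \<in> S \<and> x (Suc n) \<ominus>\<^bsub>M\<^esub> x n \<in> scaled M (\<pi> [^]\<^bsub>V\<^esub> n) S}"

definition adic_complete :: "('v, 'k) ring_scheme \<Rightarrow> 'v \<Rightarrow> ('v, 'a, 'l) module_scheme \<Rightarrow> 'a set \<Rightarrow> bool"
  where "adic_complete V \<pi> M S \<longleftrightarrow>
    (\<forall>x \<in> adic_cauchy V \<pi> M S. \<exists>!y. y \<in> S \<and> (\<forall>n. y \<ominus>\<^bsub>M\<^esub> x n \<in> scaled M (\<pi> [^]\<^bsub>V\<^esub> n) S))"

text \<open>
  Algebras may lack a unit, so bornological modules and algebras share one record. For modules the
  fields \<open>mult\<close> and \<open>one\<close> are irrelevant, for algebras the field \<open>one\<close> is.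
\<close>

record ('v, 'a) bmod = "('v, 'a) module" +
  bounded :: "'a set set"

definition regular_module :: "('v, 'k) ring_scheme \<Rightarrow> ('v, 'v) bmod" where
  "regular_module V =
    \<lparr>carrier = carrier V, monoid.mult = monoid.mult V, one = one V, ring.zero = zero V, add = add V,
     smult = monoid.mult V, bounded = Pow (carrier V)\<rparr>"

text \<open>A discrete valuation ring is a principal ideal domain with a single maximal ideal, which is
  non-zero; a uniformiser is a generator of that ideal.\<close>

definition complete_dvr :: "('v, 'k) ring_scheme \<Rightarrow> 'v \<Rightarrow> bool" where
  "complete_dvr V \<pi> \<longleftrightarrow>
    principal_domain V \<and> \<pi> \<in> carrier V \<and> \<pi> \<noteq> \<zero>\<^bsub>V\<^esub> \<and>
    {I. maximalideal I V} = {PIdl\<^bsub>V\<^esub> \<pi>} \<and>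
    adic_complete V \<pi> (regular_module V) (carrier V)"

section \<open>Bornological modules and algebras\<close>

definition bornology_on :: "'a set \<Rightarrow> 'a set set \<Rightarrow> bool" where
  "bornology_on X \<B> \<longleftrightarrow>
    \<B> \<subseteq> Pow X \<and> (\<forall>A\<in>\<B>. \<forall>B\<in>\<B>. A \<union> B \<in> \<B>) \<and> (\<forall>B\<in>\<B>. \<forall>A\<subseteq>B. A \<in> \<B>) \<and>
    (\<forall>A\<subseteq>X. finite A \<longrightarrow> A \<in> \<B>)"

definition bornological_embedding :: "('v, 'a) bmod \<Rightarrow> ('v, 'b) bmod \<Rightarrow> ('a \<Rightarrow> 'b) \<Rightarrow> bool" where
  "bornological_embedding M N f \<longleftrightarrow>
    f \<in> carrier M \<rightarrow> carrier N \<and> inj_on f (carrier M) \<and>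
    (\<forall>B\<subseteq>carrier M. B \<in> bounded M \<longleftrightarrow> f ` B \<in> bounded N)"

definition bdd_submodules :: "('v, 'k) ring_scheme \<Rightarrow> ('v, 'a) bmod \<Rightarrow> 'a set set" where
  "bdd_submodules V M = {S \<in> bounded M. submodule S V M}"

definition born_module :: "('v, 'k) ring_scheme \<Rightarrow> ('v, 'a) bmod \<Rightarrow> bool" where
  "born_module V M \<longleftrightarrow>
    module V M \<and> bornology_on (carrier M) (bounded M) \<and>
    (\<forall>B\<in>bounded M. \<exists>S\<in>bdd_submodules V M. B \<subseteq> S)"

definition complete_born_module :: "('v, 'k) ring_scheme \<Rightarrow> 'v \<Rightarrow> ('v, 'a) bmod \<Rightarrow> bool" where
  "complete_born_module V \<pi> M \<longleftrightarrow>
    born_module V M \<and>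
    (\<forall>B\<in>bounded M. \<exists>S\<in>bdd_submodules V M. adic_complete V \<pi> M S \<and> B \<subseteq> S)"

definition torsion_free :: "'v \<Rightarrow> ('v, 'a) bmod \<Rightarrow> bool" where
  "torsion_free \<pi> M \<longleftrightarrow> bornological_embedding M M (\<lambda>x. \<pi> \<odot>\<^bsub>M\<^esub> x)"

definition linear_map :: "('v, 'k) ring_scheme \<Rightarrow> ('v, 'a) bmod \<Rightarrow> ('v, 'b) bmod \<Rightarrow> ('a \<Rightarrow> 'b) \<Rightarrow> bool" where
  "linear_map V M N f \<longleftrightarrow>
    f \<in> carrier M \<rightarrow> carrier N \<and>
    (\<forall>x\<in>carrier M. \<forall>y\<in>carrier M. f (x \<oplus>\<^bsub>M\<^esub> y) = f x \<oplus>\<^bsub>N\<^esub> f y) \<and>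
    (\<forall>c\<in>carrier V. \<forall>x\<in>carrier M. f (c \<odot>\<^bsub>M\<^esub> x) = c \<odot>\<^bsub>N\<^esub> f x)"

definition bdd_linear_map :: "('v, 'k) ring_scheme \<Rightarrow> ('v, 'a) bmod \<Rightarrow> ('v, 'b) bmod \<Rightarrow> ('a \<Rightarrow> 'b) \<Rightarrow> bool" where
  "bdd_linear_map V M N f \<longleftrightarrow>
    linear_map V M N f \<and> (\<forall>B\<in>bounded M. f ` B \<in> bounded N)"

definition set_prod :: "('v, 'a, 'l) module_scheme \<Rightarrow> 'a set \<Rightarrow> 'a set \<Rightarrow> 'a set" where
  "set_prod A S T = {x \<otimes>\<^bsub>A\<^esub> y | x y. x \<in> S \<and> y \<in> T}"

definition born_algebra :: "('v, 'k) ring_scheme \<Rightarrow> ('v, 'a) bmod \<Rightarrow> bool" where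
  "born_algebra V A \<longleftrightarrow>
    born_module V A \<and>
    (\<forall>x\<in>carrier A. \<forall>y\<in>carrier A. x \<otimes>\<^bsub>A\<^esub> y \<in> carrier A) \<and>
    (\<forall>x\<in>carrier A. \<forall>y\<in>carrier A. \<forall>z\<in>carrier A.
      (x \<otimes>\<^bsub>A\<^esub> y) \<otimes>\<^bsub>A\<^esub> z = x \<otimes>\<^bsub>A\<^esub> (y \<otimes>\<^bsub>A\<^esub> z) \<and>
      (x \<oplus>\<^bsub>A\<^esub> y) \<otimes>\<^bsub>A\<^esub> z = (x \<otimes>\<^bsub>A\<^esub> z) \<oplus>\<^bsub>A\<^esub> (y \<otimes>\<^bsub>A\<^esub> z) \<and>
      x \<otimes>\<^bsub>A\<^esub> (y \<oplus>\<^bsub>A\<^esub> z) = (x \<otimes>\<^bsub>A\<^esub> y) \<oplus>\<^bsub>A\<^esub> (x \<otimes>\<^bsub>A\<^esub> z)) \<and>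
    (\<forall>c\<in>carrier V. \<forall>x\<in>carrier A. \<forall>y\<in>carrier A.
      (c \<odot>\<^bsub>A\<^esub> x) \<otimes>\<^bsub>A\<^esub> y = c \<odot>\<^bsub>A\<^esub> (x \<otimes>\<^bsub>A\<^esub> y) \<and>
      x \<otimes>\<^bsub>A\<^esub> (c \<odot>\<^bsub>A\<^esub> y) = c \<odot>\<^bsub>A\<^esub> (x \<otimes>\<^bsub>A\<^esub> y)) \<and>
    (\<forall>B\<in>bounded A. \<forall>C\<in>bounded A. set_prod A B C \<in> bounded A)"

definition bdd_alg_hom :: "('v, 'k) ring_scheme \<Rightarrow> ('v, 'a) bmod \<Rightarrow> ('v, 'b) bmod \<Rightarrow> ('a \<Rightarrow> 'b) \<Rightarrow> bool" where
  "bdd_alg_hom V A B f \<longleftrightarrow>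
    bdd_linear_map V A B f \<and>
    (\<forall>x\<in>carrier A. \<forall>y\<in>carrier A. f (x \<otimes>\<^bsub>A\<^esub> y) = f x \<otimes>\<^bsub>B\<^esub> f y)"

definition ctf_algebra :: "('v, 'k) ring_scheme \<Rightarrow> 'v \<Rightarrow> ('v, 'a) bmod \<Rightarrow> bool" where
  "ctf_algebra V \<pi> A \<longleftrightarrow>
    born_algebra V A \<and> complete_born_module V \<pi> A \<and> torsion_free \<pi> A"

definition semi_dagger :: "('v, 'k) ring_scheme \<Rightarrow> 'v \<Rightarrow> ('v, 'a) bmod \<Rightarrow> bool" where
  "semi_dagger V \<pi> A \<longleftrightarrow>
    (\<forall>B\<in>bounded A. \<exists>T\<in>bdd_submodules V A. B \<subseteq> T \<and> scaled A \<pi> (set_prod A T T) \<subseteq> T)"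

definition dagger_algebra :: "('v, 'k) ring_scheme \<Rightarrow> 'v \<Rightarrow> ('v, 'a) bmod \<Rightarrow> bool" where
  "dagger_algebra V \<pi> A \<longleftrightarrow> ctf_algebra V \<pi> A \<and> semi_dagger V \<pi> A"

definition span_in :: "('v, 'k) ring_scheme \<Rightarrow> ('v, 'a, 'l) module_scheme \<Rightarrow> 'a set \<Rightarrow> 'a set" where
  "span_in V M X = \<Inter>{S. submodule S V M \<and> X \<subseteq> S}"

fun fold_prods :: "('v, 'a, 'l) module_scheme \<Rightarrow> 'a set \<Rightarrow> nat \<Rightarrow> 'a set" where
  "fold_prods A M 0 = {}"
| "fold_prods A M (Suc 0) = M"
| "fold_prods A M (Suc (Suc n)) = set_prod A M (fold_prods A M (Suc n))"

definition sub_power :: "('v, 'k) ring_scheme \<Rightarrow> ('v, 'a, 'l) module_scheme \<Rightarrow> 'a set \<Rightarrow> nat \<Rightarrow> 'a set" where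
  "sub_power V A M i = span_in V A (fold_prods A M i)"

definition sub_powers_upto :: "('v, 'k) ring_scheme \<Rightarrow> ('v, 'a, 'l) module_scheme \<Rightarrow> 'a set \<Rightarrow> nat \<Rightarrow> 'a set" where
  "sub_powers_upto V A M n = span_in V A (\<Union>i\<in>{1..n}. sub_power V A M i)"

section \<open>Quotients, tensor products and completions\<close>

definition quot_module :: "('v, 'a) bmod \<Rightarrow> 'a set \<Rightarrow> ('v, 'a set) bmod" where
  "quot_module M K =
    \<lparr>carrier = a_rcosets\<^bsub>M\<^esub> K,
     monoid.mult = (\<lambda>X Y. \<Union>x\<in>X. \<Union>y\<in>Y. K +>\<^bsub>M\<^esub> (x \<otimes>\<^bsub>M\<^esub> y)),
     one = K +>\<^bsub>M\<^esub> \<one>\<^bsub>M\<^esub>,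
     ring.zero = K,
     add = (\<lambda>X Y. X <+>\<^bsub>M\<^esub> Y),
     smult = (\<lambda>c X. \<Union>x\<in>X. K +>\<^bsub>M\<^esub> (c \<odot>\<^bsub>M\<^esub> x)),
     bounded = {(\<lambda>x. K +>\<^bsub>M\<^esub> x) ` B | B. B \<in> bounded M}\<rparr>"

text \<open>The free module on a set, with the bornology in which every subset is bounded; that bornology
  is only a placeholder, as the tensor product below carries its own.\<close>

definition free_module :: "('v, 'k) ring_scheme \<Rightarrow> 'x set \<Rightarrow> ('v, 'x \<Rightarrow> 'v) bmod" where
  "free_module V X =
    (let F = {f. (\<forall>p\<in>X. f p \<in> carrier V) \<and> (\<forall>p. p \<notin> X \<longrightarrow> f p = \<zero>\<^bsub>V\<^esub>) \<and> finite {p. f p \<noteq> \<zero>\<^bsub>V\<^esub>}} in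
    \<lparr>carrier = F, monoid.mult = undefined, one = undefined,
     ring.zero = (\<lambda>p. \<zero>\<^bsub>V\<^esub>), add = (\<lambda>f g p. f p \<oplus>\<^bsub>V\<^esub> g p), smult = (\<lambda>c f p. c \<otimes>\<^bsub>V\<^esub> f p),
     bounded = Pow F\<rparr>)"

definition basis_elt :: "('v, 'k) ring_scheme \<Rightarrow> 'x \<Rightarrow> 'x \<Rightarrow> 'v" where
  "basis_elt V p = (\<lambda>q. if q = p then \<one>\<^bsub>V\<^esub> else \<zero>\<^bsub>V\<^esub>)"

definition tensor_relations ::
  "('v, 'k) ring_scheme \<Rightarrow> ('v, 'a) bmod \<Rightarrow> ('v, 'b) bmod \<Rightarrow> ('a \<times> 'b \<Rightarrow> 'v) set" where
  "tensor_relations V M N =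
    (let F = free_module V (carrier M \<times> carrier N); e = basis_elt V in
    span_in V F
     ({e (x \<oplus>\<^bsub>M\<^esub> x', y) \<ominus>\<^bsub>F\<^esub> (e (x, y) \<oplus>\<^bsub>F\<^esub> e (x', y)) | x x' y.
         x \<in> carrier M \<and> x' \<in> carrier M \<and> y \<in> carrier N} \<union>
      {e (x, y \<oplus>\<^bsub>N\<^esub> y') \<ominus>\<^bsub>F\<^esub> (e (x, y) \<oplus>\<^bsub>F\<^esub> e (x, y')) | x y y'.
         x \<in> carrier M \<and> y \<in> carrier N \<and> y' \<in> carrier N} \<union>
      {e (c \<odot>\<^bsub>M\<^esub> x, y) \<ominus>\<^bsub>F\<^esub> c \<odot>\<^bsub>F\<^esub> e (x, y) | c x y.
         c \<in> carrier V \<and> x \<in> carrier M \<and> y \<in> carrier N} \<union>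
      {e (x, c \<odot>\<^bsub>N\<^esub> y) \<ominus>\<^bsub>F\<^esub> c \<odot>\<^bsub>F\<^esub> e (x, y) | c x y.
         c \<in> carrier V \<and> x \<in> carrier M \<and> y \<in> carrier N}))"

definition pure_tensor ::
  "('v, 'k) ring_scheme \<Rightarrow> ('v, 'a) bmod \<Rightarrow> ('v, 'b) bmod \<Rightarrow> 'a \<Rightarrow> 'b \<Rightarrow> ('a \<times> 'b \<Rightarrow> 'v) set" where
  "pure_tensor V M N x y =
    tensor_relations V M N +>\<^bsub>free_module V (carrier M \<times> carrier N)\<^esub> basis_elt V (x, y)"

text \<open>The images of \<open>S \<otimes> T\<close> form a directed family of submodules that covers the tensor product, so
  their subsets already form the bornology that they generate.\<close>

definition tensor :: "('v, 'k) ring_scheme \<Rightarrow> ('v, 'a) bmod \<Rightarrow> ('v, 'b) bmod \<Rightarrow> ('v, ('a \<times> 'b \<Rightarrow> 'v) set) bmod" where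
  "tensor V M N =
    (let Q = quot_module (free_module V (carrier M \<times> carrier N)) (tensor_relations V M N) in
    Q\<lparr>bounded := {B. \<exists>S\<in>bdd_submodules V M. \<exists>T\<in>bdd_submodules V N.
        B \<subseteq> span_in V Q {pure_tensor V M N x y | x y. x \<in> S \<and> y \<in> T}}\<rparr>)"

text \<open>
  The completion of a bornological module \<open>M\<close> is built from sequences that are Cauchy for the
  \<open>\<pi>\<close>-adic topology of some bounded submodule. For a bounded submodule \<open>S\<close>, the sequences
  in \<open>adic_cauchy V \<pi> M S\<close> modulo those with \<open>x n \<in> \<pi>\<^sup>n S\<close> for all \<open>n\<close> form the \<open>\<pi>\<close>-adic
  completion of \<open>S\<close>. The union of these over all \<open>S\<close> need not be separated, so it is divided by the
  smallest submodule that is closed in each of them. The universal property is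
  \<open>completion_universal\<close> at the end of this theory.
\<close>

definition cauchy_module :: "('v, 'k) ring_scheme \<Rightarrow> 'v \<Rightarrow> ('v, 'a) bmod \<Rightarrow> ('v, nat \<Rightarrow> 'a) bmod" where
  "cauchy_module V \<pi> M =
    \<lparr>carrier = (\<Union>S\<in>bdd_submodules V M. adic_cauchy V \<pi> M S),
     monoid.mult = (\<lambda>x y n. x n \<otimes>\<^bsub>M\<^esub> y n), one = (\<lambda>n. \<one>\<^bsub>M\<^esub>),
     ring.zero = (\<lambda>n. \<zero>\<^bsub>M\<^esub>), add = (\<lambda>x y n. x n \<oplus>\<^bsub>M\<^esub> y n), smult = (\<lambda>c x n. c \<odot>\<^bsub>M\<^esub> x n),
     bounded = {B. \<exists>S\<in>bdd_submodules V M. B \<subseteq> adic_cauchy V \<pi> M S}\<rparr>"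

definition limit_closed :: "('v, 'k) ring_scheme \<Rightarrow> 'v \<Rightarrow> ('v, 'a) bmod \<Rightarrow> (nat \<Rightarrow> 'a) set \<Rightarrow> bool" where
  "limit_closed V \<pi> M K \<longleftrightarrow>
    (\<forall>S\<in>bdd_submodules V M. \<forall>x\<in>adic_cauchy V \<pi> M S.
      (\<forall>n. \<exists>k\<in>K \<inter> adic_cauchy V \<pi> M S. x n \<ominus>\<^bsub>M\<^esub> k n \<in> scaled M (\<pi> [^]\<^bsub>V\<^esub> n) S) \<longrightarrow> x \<in> K)"

definition null_module :: "('v, 'k) ring_scheme \<Rightarrow> 'v \<Rightarrow> ('v, 'a) bmod \<Rightarrow> (nat \<Rightarrow> 'a) set" where
  "null_module V \<pi> M = \<Inter>{K. submodule K V (cauchy_module V \<pi> M) \<and> limit_closed V \<pi> M K}"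

definition completion :: "('v, 'k) ring_scheme \<Rightarrow> 'v \<Rightarrow> ('v, 'a) bmod \<Rightarrow> ('v, (nat \<Rightarrow> 'a) set) bmod" where
  "completion V \<pi> M = quot_module (cauchy_module V \<pi> M) (null_module V \<pi> M)"

definition to_completion :: "('v, 'k) ring_scheme \<Rightarrow> 'v \<Rightarrow> ('v, 'a) bmod \<Rightarrow> 'a \<Rightarrow> (nat \<Rightarrow> 'a) set" where
  "to_completion V \<pi> M x = null_module V \<pi> M +>\<^bsub>cauchy_module V \<pi> M\<^esub> (\<lambda>n. x)"

definition ctensor :: "('v, 'k) ring_scheme \<Rightarrow> 'v \<Rightarrow> ('v, 'a) bmod \<Rightarrow> ('v, 'b) bmod \<Rightarrow>
    ('v, (nat \<Rightarrow> ('a \<times> 'b \<Rightarrow> 'v) set) set) bmod" where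
  "ctensor V \<pi> M N = completion V \<pi> (tensor V M N)"

definition pure_ctensor :: "('v, 'k) ring_scheme \<Rightarrow> 'v \<Rightarrow> ('v, 'a) bmod \<Rightarrow> ('v, 'b) bmod \<Rightarrow> 'a \<Rightarrow> 'b \<Rightarrow>
    (nat \<Rightarrow> ('a \<times> 'b \<Rightarrow> 'v) set) set" where
  "pure_ctensor V \<pi> M N x y = to_completion V \<pi> (tensor V M N) (pure_tensor V M N x y)"

section \<open>The dagger completion of a torsion-free algebra\<close>

definition linear_growth :: "('v, 'k) ring_scheme \<Rightarrow> 'v \<Rightarrow> ('v, 'a) bmod \<Rightarrow> 'a set set" where
  "linear_growth V \<pi> R =
    {B. \<exists>M\<in>bdd_submodules V R.
      B \<subseteq> span_in V R (\<Union>i. scaled R (\<pi> [^]\<^bsub>V\<^esub> i) (sub_power V R M (Suc i)))}"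

definition dagger_completion :: "('v, 'k) ring_scheme \<Rightarrow> 'v \<Rightarrow> ('v, 'a) bmod \<Rightarrow> ('v, (nat \<Rightarrow> 'a) set) bmod" where
  "dagger_completion V \<pi> R = completion V \<pi> (R\<lparr>bounded := linear_growth V \<pi> R\<rparr>)"

section \<open>Noncommutative differential forms and connections\<close>

definition unitalisation :: "('v, 'k) ring_scheme \<Rightarrow> ('v, 'a) bmod \<Rightarrow> ('v, 'a \<times> 'v) bmod" where
  "unitalisation V R =
    \<lparr>carrier = carrier R \<times> carrier V,
     monoid.mult = (\<lambda>(x, a) (y, b). ((x \<otimes>\<^bsub>R\<^esub> y) \<oplus>\<^bsub>R\<^esub> (b \<odot>\<^bsub>R\<^esub> x) \<oplus>\<^bsub>R\<^esub> (a \<odot>\<^bsub>R\<^esub> y), a \<otimes>\<^bsub>V\<^esub> b)),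
     one = (\<zero>\<^bsub>R\<^esub>, \<one>\<^bsub>V\<^esub>),
     ring.zero = (\<zero>\<^bsub>R\<^esub>, \<zero>\<^bsub>V\<^esub>),
     add = (\<lambda>(x, a) (y, b). (x \<oplus>\<^bsub>R\<^esub> y, a \<oplus>\<^bsub>V\<^esub> b)),
     smult = (\<lambda>c (x, a). (c \<odot>\<^bsub>R\<^esub> x, c \<otimes>\<^bsub>V\<^esub> a)),
     bounded = {B. B \<subseteq> carrier R \<times> carrier V \<and> fst ` B \<in> bounded R}\<rparr>"

definition in_unital :: "('v, 'k) ring_scheme \<Rightarrow> 'a \<Rightarrow> 'a \<times> 'v" where
  "in_unital V x = (x, \<zero>\<^bsub>V\<^esub>)"

definition omega1 where
  "omega1 V \<pi> R = ctensor V \<pi> (unitalisation V R) R"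

definition omega2 where
  "omega2 V \<pi> R = ctensor V \<pi> (unitalisation V R) (ctensor V \<pi> R R)"

text \<open>\<open>form1 V \<pi> R x y\<close> is \<open>x dy\<close> and \<open>form2 V \<pi> R x y z\<close> is \<open>x dy dz\<close>, where \<open>x\<close> belongs to the
  unitalisation of \<open>R\<close>.\<close>

definition form1 where
  "form1 V \<pi> R x y = pure_ctensor V \<pi> (unitalisation V R) R x y"

definition form2 where
  "form2 V \<pi> R x y z =
    pure_ctensor V \<pi> (unitalisation V R) (ctensor V \<pi> R R) x (pure_ctensor V \<pi> R R y z)"

text \<open>
  The following bounded linear maps are unique since finite sums of elementary forms are dense. The
  formulas for right multiplication come from iterating \<open>(dx) a = d(xa) - x da\<close>.
\<close>

definition left_mult1 where
  "left_mult1 V \<pi> R a = (THE g. g \<in> extensional (carrier (omega1 V \<pi> R)) \<and>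
    bdd_linear_map V (omega1 V \<pi> R) (omega1 V \<pi> R) g \<and>
    (\<forall>x\<in>carrier (unitalisation V R). \<forall>y\<in>carrier R.
      g (form1 V \<pi> R x y) = form1 V \<pi> R (in_unital V a \<otimes>\<^bsub>unitalisation V R\<^esub> x) y))"

definition left_mult2 where
  "left_mult2 V \<pi> R a = (THE g. g \<in> extensional (carrier (omega2 V \<pi> R)) \<and>
    bdd_linear_map V (omega2 V \<pi> R) (omega2 V \<pi> R) g \<and>
    (\<forall>x\<in>carrier (unitalisation V R). \<forall>y\<in>carrier R. \<forall>z\<in>carrier R.
      g (form2 V \<pi> R x y z) = form2 V \<pi> R (in_unital V a \<otimes>\<^bsub>unitalisation V R\<^esub> x) y z))"

definition right_mult1 where
  "right_mult1 V \<pi> R a = (THE g. g \<in> extensional (carrier (omega1 V \<pi> R)) \<and>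
    bdd_linear_map V (omega1 V \<pi> R) (omega1 V \<pi> R) g \<and>
    (\<forall>x\<in>carrier (unitalisation V R). \<forall>y\<in>carrier R.
      g (form1 V \<pi> R x y) =
        form1 V \<pi> R x (y \<otimes>\<^bsub>R\<^esub> a) \<ominus>\<^bsub>omega1 V \<pi> R\<^esub>
        form1 V \<pi> R (x \<otimes>\<^bsub>unitalisation V R\<^esub> in_unital V y) a))"

definition right_mult2 where
  "right_mult2 V \<pi> R a = (THE g. g \<in> extensional (carrier (omega2 V \<pi> R)) \<and>
    bdd_linear_map V (omega2 V \<pi> R) (omega2 V \<pi> R) g \<and>
    (\<forall>x\<in>carrier (unitalisation V R). \<forall>y\<in>carrier R. \<forall>z\<in>carrier R.
      g (form2 V \<pi> R x y z) =
        (form2 V \<pi> R x y (z \<otimes>\<^bsub>R\<^esub> a) \<ominus>\<^bsub>omega2 V \<pi> R\<^esub>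
         form2 V \<pi> R x (y \<otimes>\<^bsub>R\<^esub> z) a) \<oplus>\<^bsub>omega2 V \<pi> R\<^esub>
         form2 V \<pi> R (x \<otimes>\<^bsub>unitalisation V R\<^esub> in_unital V y) z a))"

definition times_d where
  "times_d V \<pi> R a = (THE g. g \<in> extensional (carrier (omega1 V \<pi> R)) \<and>
    bdd_linear_map V (omega1 V \<pi> R) (omega2 V \<pi> R) g \<and>
    (\<forall>x\<in>carrier (unitalisation V R). \<forall>y\<in>carrier R.
      g (form1 V \<pi> R x y) = form2 V \<pi> R x y a))"

definition connection where
  "connection V \<pi> R D \<longleftrightarrow>
    linear_map V (omega1 V \<pi> R) (omega2 V \<pi> R) D \<and>
    (\<forall>a\<in>carrier R. \<forall>\<omega>\<in>carrier (omega1 V \<pi> R).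
      D (left_mult1 V \<pi> R a \<omega>) = left_mult2 V \<pi> R a (D \<omega>) \<and>
      D (right_mult1 V \<pi> R a \<omega>) =
        right_mult2 V \<pi> R a (D \<omega>) \<oplus>\<^bsub>omega2 V \<pi> R\<^esub> times_d V \<pi> R a \<omega>)"

definition filtration1 where
  "filtration1 V \<pi> R M r = span_in V (omega1 V \<pi> R)
    ({form1 V \<pi> R (in_unital V x0) x1 | x0 x1 i0 i1. i0 + i1 \<le> r \<and>
        x0 \<in> sub_powers_upto V R M i0 \<and> x1 \<in> sub_powers_upto V R M i1} \<union>
     {form1 V \<pi> R \<one>\<^bsub>unitalisation V R\<^esub> x1 | x1 i1. i1 \<le> r \<and>
        x1 \<in> sub_powers_upto V R M i1})"

definition filtration2 where
  "filtration2 V \<pi> R M r = span_in V (omega2 V \<pi> R)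
    ({form2 V \<pi> R (in_unital V x0) x1 x2 | x0 x1 x2 i0 i1 i2. i0 + i1 + i2 \<le> r \<and>
        x0 \<in> sub_powers_upto V R M i0 \<and> x1 \<in> sub_powers_upto V R M i1 \<and>
        x2 \<in> sub_powers_upto V R M i2} \<union>
     {form2 V \<pi> R \<one>\<^bsub>unitalisation V R\<^esub> x1 x2 | x1 x2 i1 i2. i1 + i2 \<le> r \<and>
        x1 \<in> sub_powers_upto V R M i1 \<and> x2 \<in> sub_powers_upto V R M i2})"

definition finite_degree_on where
  "finite_degree_on V \<pi> R D M \<longleftrightarrow>
    (\<exists>a::nat. \<forall>n. D ` filtration1 V \<pi> R M n \<subseteq> filtration2 V \<pi> R M (n + a))"

definition finite_degree where
  "finite_degree V \<pi> R D \<longleftrightarrow>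
    (\<forall>B\<in>bounded R. \<exists>M\<in>bdd_submodules V R. B \<subseteq> M \<and> finite_degree_on V \<pi> R D M)"

section \<open>Projective systems\<close>

text \<open>
  Every countable directed set is isomorphic to one whose underlying set consists of natural
  numbers. The relation \<open>pro_le\<close> is an arbitrary directed preorder, unrelated to the usual order.
  \<open>pro_map A m n\<close> is the structure map from \<open>pro_obj A n\<close> to \<open>pro_obj A m\<close>.
\<close>

record ('v, 'a) pro =
  pro_index :: "nat set"
  pro_le :: "nat \<Rightarrow> nat \<Rightarrow> bool"
  pro_obj :: "nat \<Rightarrow> ('v, 'a) bmod"
  pro_map :: "nat \<Rightarrow> nat \<Rightarrow> 'a \<Rightarrow> 'a"

definition directed :: "'i set \<Rightarrow> ('i \<Rightarrow> 'i \<Rightarrow> bool) \<Rightarrow> bool" where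
  "directed I r \<longleftrightarrow>
    I \<noteq> {} \<and> (\<forall>i\<in>I. r i i) \<and> (\<forall>i\<in>I. \<forall>j\<in>I. \<forall>k\<in>I. r i j \<longrightarrow> r j k \<longrightarrow> r i k) \<and>
    (\<forall>i\<in>I. \<forall>j\<in>I. \<exists>k\<in>I. r i k \<and> r j k)"

definition pro_module :: "('v, 'k) ring_scheme \<Rightarrow> ('v, 'a) pro \<Rightarrow> bool" where
  "pro_module V A \<longleftrightarrow>
    directed (pro_index A) (pro_le A) \<and>
    (\<forall>n\<in>pro_index A. born_module V (pro_obj A n)) \<and>
    (\<forall>m\<in>pro_index A. \<forall>n\<in>pro_index A. pro_le A m n \<longrightarrow>
      bdd_linear_map V (pro_obj A n) (pro_obj A m) (pro_map A m n)) \<and>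
    (\<forall>n\<in>pro_index A. \<forall>x\<in>carrier (pro_obj A n). pro_map A n n x = x) \<and>
    (\<forall>l\<in>pro_index A. \<forall>m\<in>pro_index A. \<forall>n\<in>pro_index A. pro_le A l m \<longrightarrow> pro_le A m n \<longrightarrow>
      (\<forall>x\<in>carrier (pro_obj A n). pro_map A l m (pro_map A m n x) = pro_map A l n x))"

definition pro_algebra :: "('v, 'k) ring_scheme \<Rightarrow> 'v \<Rightarrow> ('v, 'a) pro \<Rightarrow> bool" where
  "pro_algebra V \<pi> A \<longleftrightarrow>
    pro_module V A \<and>
    (\<forall>n\<in>pro_index A. ctf_algebra V \<pi> (pro_obj A n)) \<and>
    (\<forall>m\<in>pro_index A. \<forall>n\<in>pro_index A. pro_le A m n \<longrightarrow>
      bdd_alg_hom V (pro_obj A n) (pro_obj A m) (pro_map A m n))"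

definition constant_pro :: "('v, 'a) bmod \<Rightarrow> ('v, 'a) pro" where
  "constant_pro A =
    \<lparr>pro_index = {0}, pro_le = (\<lambda>m n. True), pro_obj = (\<lambda>n. A), pro_map = (\<lambda>m n x. x)\<rparr>"

text \<open>
  A morphism \<open>\<phi>\<close> from \<open>A\<close> to \<open>B\<close> is given by representatives: \<open>\<phi> n = (l, f)\<close> stands for the class
  of \<open>f\<close>, mapping \<open>pro_obj A l\<close> to \<open>pro_obj B n\<close>, in the colimit over \<open>l\<close>. Equality in the colimit
  is \<open>same_germ\<close>, and two families of representatives give the same morphism if they are related by
  \<open>pro_eq\<close>.
\<close>

type_synonym ('a, 'b) pro_family = "nat \<Rightarrow> nat \<times> ('a \<Rightarrow> 'b)"

definition same_germ :: "('v, 'a) pro \<Rightarrow> nat \<times> ('a \<Rightarrow> 'b) \<Rightarrow> nat \<times> ('a \<Rightarrow> 'b) \<Rightarrow> bool" where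
  "same_germ A \<equiv> \<lambda>(l, f) (l', f'). \<exists>k\<in>pro_index A. pro_le A l k \<and> pro_le A l' k \<and>
    (\<forall>x\<in>carrier (pro_obj A k). f (pro_map A l k x) = f' (pro_map A l' k x))"

definition pro_eq :: "('v, 'a) pro \<Rightarrow> ('v, 'b) pro \<Rightarrow> ('a, 'b) pro_family \<Rightarrow> ('a, 'b) pro_family \<Rightarrow> bool" where
  "pro_eq A B \<phi> \<psi> \<longleftrightarrow> (\<forall>n\<in>pro_index B. same_germ A (\<phi> n) (\<psi> n))"

definition pro_compatible :: "('v, 'a) pro \<Rightarrow> ('v, 'b) pro \<Rightarrow> ('a, 'b) pro_family \<Rightarrow> bool" where
  "pro_compatible A B \<phi> \<longleftrightarrow>
    (\<forall>m\<in>pro_index B. \<forall>n\<in>pro_index B. pro_le B m n \<longrightarrow>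
      same_germ A (\<phi> m) (fst (\<phi> n), pro_map B m n \<circ> snd (\<phi> n)))"

definition pro_linear :: "('v, 'k) ring_scheme \<Rightarrow> ('v, 'a) pro \<Rightarrow> ('v, 'b) pro \<Rightarrow> ('a, 'b) pro_family \<Rightarrow> bool" where
  "pro_linear V A B \<phi> \<longleftrightarrow>
    (\<forall>n\<in>pro_index B. fst (\<phi> n) \<in> pro_index A \<and>
      bdd_linear_map V (pro_obj A (fst (\<phi> n))) (pro_obj B n) (snd (\<phi> n))) \<and>
    pro_compatible A B \<phi>"

definition pro_alg_hom :: "('v, 'k) ring_scheme \<Rightarrow> ('v, 'a) pro \<Rightarrow> ('v, 'b) pro \<Rightarrow> ('a, 'b) pro_family \<Rightarrow> bool" where
  "pro_alg_hom V A B \<phi> \<longleftrightarrow>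
    (\<forall>n\<in>pro_index B. fst (\<phi> n) \<in> pro_index A \<and>
      bdd_alg_hom V (pro_obj A (fst (\<phi> n))) (pro_obj B n) (snd (\<phi> n))) \<and>
    pro_compatible A B \<phi>"

definition pro_id :: "('a, 'a) pro_family" where
  "pro_id n = (n, \<lambda>x. x)"

definition pro_comp :: "('b, 'c) pro_family \<Rightarrow> ('a, 'b) pro_family \<Rightarrow> ('a, 'c) pro_family" where
  "pro_comp \<psi> \<phi> n = (fst (\<phi> (fst (\<psi> n))), snd (\<psi> n) \<circ> snd (\<phi> (fst (\<psi> n))))"

definition pro_is_zero :: "('v, 'a) pro \<Rightarrow> ('v, 'b) pro \<Rightarrow> ('a, 'b) pro_family \<Rightarrow> bool" where
  "pro_is_zero A B \<phi> \<longleftrightarrow>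
    (\<forall>n\<in>pro_index B. same_germ A (\<phi> n) (fst (\<phi> n), \<lambda>x. \<zero>\<^bsub>pro_obj B n\<^esub>))"

section \<open>Extensions and analytic quasi-freeness\<close>

text \<open>
  Kernels and cokernels in the category of projective systems of bornological modules. Universal
  properties cannot quantify over all types, so they are tested on objects whose elements have a
  prescribed type \<open>'t\<close>.
\<close>

definition pro_kernel :: "'t itself \<Rightarrow> ('v, 'k) ring_scheme \<Rightarrow>
    ('v, 'j) pro \<Rightarrow> ('v, 'e) pro \<Rightarrow> ('v, 'a) pro \<Rightarrow> ('j, 'e) pro_family \<Rightarrow> ('e, 'a) pro_family \<Rightarrow> bool" where
  "pro_kernel T V J E A \<iota> p \<longleftrightarrow>
    pro_linear V J E \<iota> \<and> pro_is_zero J A (pro_comp p \<iota>) \<and>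
    (\<forall>(P :: ('v, 't) pro) g. pro_module V P \<and> pro_linear V P E g \<and> pro_is_zero P A (pro_comp p g) \<longrightarrow>
      (\<exists>h. pro_linear V P J h \<and> pro_eq P E (pro_comp \<iota> h) g \<and>
        (\<forall>h'. pro_linear V P J h' \<and> pro_eq P E (pro_comp \<iota> h') g \<longrightarrow> pro_eq P J h' h)))"

definition pro_cokernel :: "'t itself \<Rightarrow> ('v, 'k) ring_scheme \<Rightarrow>
    ('v, 'j) pro \<Rightarrow> ('v, 'e) pro \<Rightarrow> ('v, 'a) pro \<Rightarrow> ('j, 'e) pro_family \<Rightarrow> ('e, 'a) pro_family \<Rightarrow> bool" where
  "pro_cokernel T V J E A \<iota> p \<longleftrightarrow>
    pro_linear V E A p \<and> pro_is_zero J A (pro_comp p \<iota>) \<and>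
    (\<forall>(P :: ('v, 't) pro) g. pro_module V P \<and> pro_linear V E P g \<and> pro_is_zero J P (pro_comp g \<iota>) \<longrightarrow>
      (\<exists>h. pro_linear V A P h \<and> pro_eq E P (pro_comp h p) g \<and>
        (\<forall>h'. pro_linear V A P h' \<and> pro_eq E P (pro_comp h' p) g \<longrightarrow> pro_eq A P h' h)))"

text \<open>
  The test type \<open>'j + 'e + 'a\<close> is as good as all types together. The kernel of \<open>p\<close> is represented by
  a system of submodules of the \<open>pro_obj E n\<close>, and the cokernel of \<open>\<iota>\<close> by a system of quotients of
  the \<open>pro_obj E n\<close>, whose carriers inject into \<open>'e\<close>. So copies of both, and of \<open>J\<close> and \<open>A\<close>, occur
  among the test objects, and comparing \<open>J\<close> and \<open>A\<close> with them by the universal properties shows that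
  \<open>\<iota>\<close> is the kernel and \<open>p\<close> the cokernel.
\<close>

definition pro_extension :: "('v, 'k) ring_scheme \<Rightarrow> 'v \<Rightarrow>
    ('v, 'j) pro \<Rightarrow> ('v, 'e) pro \<Rightarrow> ('v, 'a) pro \<Rightarrow> ('j, 'e) pro_family \<Rightarrow> ('e, 'a) pro_family \<Rightarrow> bool" where
  "pro_extension V \<pi> J E A \<iota> p \<longleftrightarrow>
    pro_algebra V \<pi> J \<and> pro_algebra V \<pi> E \<and> pro_algebra V \<pi> A \<and>
    pro_alg_hom V J E \<iota> \<and> pro_alg_hom V E A p \<and>
    pro_kernel TYPE('j + 'e + 'a) V J E A \<iota> p \<and>
    pro_cokernel TYPE('j + 'e + 'a) V J E A \<iota> p"

definition semi_split :: "('v, 'k) ring_scheme \<Rightarrow> ('v, 'e) pro \<Rightarrow> ('v, 'a) pro \<Rightarrow> ('e, 'a) pro_family \<Rightarrow> bool" where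
  "semi_split V E A p \<longleftrightarrow>
    (\<exists>s. pro_linear V A E s \<and> pro_eq A A (pro_comp p s) pro_id)"

definition splits :: "('v, 'k) ring_scheme \<Rightarrow> ('v, 'e) pro \<Rightarrow> ('v, 'a) pro \<Rightarrow> ('e, 'a) pro_family \<Rightarrow> bool" where
  "splits V E A p \<longleftrightarrow>
    (\<exists>s. pro_alg_hom V A E s \<and> pro_eq A A (pro_comp p s) pro_id)"

definition pro_alg_iso :: "('v, 'k) ring_scheme \<Rightarrow> ('v, 'a) pro \<Rightarrow> ('v, 'b) pro \<Rightarrow> bool" where
  "pro_alg_iso V A B \<longleftrightarrow>
    (\<exists>\<phi> \<psi>. pro_alg_hom V A B \<phi> \<and> pro_alg_hom V B A \<psi> \<and>
      pro_eq A A (pro_comp \<psi> \<phi>) pro_id \<and> pro_eq B B (pro_comp \<phi> \<psi>) pro_id)"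

definition nilpotent_mod :: "('v, 'k) ring_scheme \<Rightarrow> 'v \<Rightarrow> ('v, 'a) pro \<Rightarrow> bool" where
  "nilpotent_mod V \<pi> A \<longleftrightarrow>
    (\<forall>m\<in>pro_index A. \<exists>n\<in>pro_index A. pro_le A m n \<and> (\<exists>l\<ge>1.
      pro_map A m n ` sub_power V (pro_obj A n) (carrier (pro_obj A n)) l
        \<subseteq> scaled (pro_obj A m) \<pi> (carrier (pro_obj A m))))"

definition analytically_nilpotent :: "'u itself \<Rightarrow> ('v, 'k) ring_scheme \<Rightarrow> 'v \<Rightarrow> ('v, 'a) pro \<Rightarrow> bool" where
  "analytically_nilpotent U V \<pi> A \<longleftrightarrow>
    nilpotent_mod V \<pi> A \<and>
    (\<exists>B :: ('v, 'u) pro. pro_algebra V \<pi> B \<and>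
      (\<forall>n\<in>pro_index B. dagger_algebra V \<pi> (pro_obj B n)) \<and> pro_alg_iso V A B)"

text \<open>
  The type argument bounds the elements of the pro-algebras that occur in the hypotheses on an
  extension. A statement in which \<open>'u\<close> is a free type variable therefore covers all extensions:
  finitely many types embed into a common sum type.
\<close>

definition analytically_quasi_free :: "'u itself \<Rightarrow> ('v, 'k) ring_scheme \<Rightarrow> 'v \<Rightarrow> ('v, 'a) pro \<Rightarrow> bool" where
  "analytically_quasi_free U V \<pi> A \<longleftrightarrow>
    pro_algebra V \<pi> A \<and>
    (\<forall>(J :: ('v, 'u) pro) (E :: ('v, 'u) pro) \<iota> p.
      pro_extension V \<pi> J E A \<iota> p \<and> semi_split V E A p \<and> analytically_nilpotent U V \<pi> J
      \<longrightarrow> splits V E A p)"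

section \<open>The universal property of the completion\<close>

lemma (in module) scaled_submodule:
  assumes c: "c \<in> carrier R" and S: "submodule S R M"
  shows "submodule (scaled M c S) R M" "scaled M c S \<subseteq> S"
proof -
  note E = submoduleE[OF S]
  have Z: "\<zero>\<^bsub>M\<^esub> \<in> S" using S
    by (metis monoid.simps(2) subgroup.one_closed submodule.axioms(1))
  show sub: "scaled M c S \<subseteq> S" using E(4) c by (auto simp: scaled_def)
  show "submodule (scaled M c S) R M"
  proof (rule submoduleI)
    show "scaled M c S \<subseteq> carrier M" using sub E(1) by blast
    have "c \<odot>\<^bsub>M\<^esub> \<zero>\<^bsub>M\<^esub> = \<zero>\<^bsub>M\<^esub>" using c by simp
    then show "\<zero>\<^bsub>M\<^esub> \<in> scaled M c S" using Z unfolding scaled_def by force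
  next
    fix a assume "a \<in> scaled M c S"
    then obtain s where s: "s \<in> S" "a = c \<odot>\<^bsub>M\<^esub> s" by (auto simp: scaled_def)
    have "\<ominus>\<^bsub>M\<^esub> a = c \<odot>\<^bsub>M\<^esub> (\<ominus>\<^bsub>M\<^esub> s)" using s c E(1) by (simp add: smult_r_minus subsetD)
    then show "\<ominus>\<^bsub>M\<^esub> a \<in> scaled M c S" using E(3)[OF s(1)] unfolding scaled_def by blast
  next
    fix a b assume "a \<in> scaled M c S" "b \<in> scaled M c S"
    then obtain s t where s: "s \<in> S" "a = c \<odot>\<^bsub>M\<^esub> s" and t: "t \<in> S" "b = c \<odot>\<^bsub>M\<^esub> t"
      by (auto simp: scaled_def)
    have "a \<oplus>\<^bsub>M\<^esub> b = c \<odot>\<^bsub>M\<^esub> (s \<oplus>\<^bsub>M\<^esub> t)" using s t c E(1) by (simp add: smult_r_distr subsetD)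
    then show "a \<oplus>\<^bsub>M\<^esub> b \<in> scaled M c S" using E(5) s t unfolding scaled_def by blast
  next
    fix d a assume d: "d \<in> carrier R" and "a \<in> scaled M c S"
    then obtain s where s: "s \<in> S" "a = c \<odot>\<^bsub>M\<^esub> s" by (auto simp: scaled_def)
    have "d \<odot>\<^bsub>M\<^esub> a = c \<odot>\<^bsub>M\<^esub> (d \<odot>\<^bsub>M\<^esub> s)" using s c d E(1)
      by (metis R.m_comm smult_assoc1 subsetD)
    then show "d \<odot>\<^bsub>M\<^esub> a \<in> scaled M c S" using E(4)[OF d s(1)] unfolding scaled_def by blast
  qed
qed

lemma (in module) submodule_zero: "submodule S R M \<Longrightarrow> \<zero>\<^bsub>M\<^esub> \<in> S"
  by (metis monoid.simps(2) subgroup.one_closed submodule.axioms(1))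

lemma (in module) submodule_minus:
  "submodule S R M \<Longrightarrow> x \<in> S \<Longrightarrow> y \<in> S \<Longrightarrow> x \<ominus>\<^bsub>M\<^esub> y \<in> S"
  using submoduleE(3,5) unfolding a_minus_def by blast

lemma (in module) scaled_pow_antimono:
  assumes p: "p \<in> carrier R" and S: "submodule S R M" and "m \<le> n"
  shows "scaled M (p [^]\<^bsub>R\<^esub> n) S \<subseteq> scaled M (p [^]\<^bsub>R\<^esub> (m::nat)) S"
proof
  fix x assume "x \<in> scaled M (p [^]\<^bsub>R\<^esub> n) S"
  then obtain s where s: "s \<in> S" "x = (p [^]\<^bsub>R\<^esub> n) \<odot>\<^bsub>M\<^esub> s" by (auto simp: scaled_def)
  obtain k where n: "n = m + k" using \<open>m \<le> n\<close> le_Suc_ex by blast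
  have "x = (p [^]\<^bsub>R\<^esub> m) \<odot>\<^bsub>M\<^esub> ((p [^]\<^bsub>R\<^esub> k) \<odot>\<^bsub>M\<^esub> s)"
    using s p submoduleE(1)[OF S] by (simp add: n R.nat_pow_mult[symmetric] smult_assoc1 subsetD)
  then show "x \<in> scaled M (p [^]\<^bsub>R\<^esub> m) S"
    using submoduleE(4)[OF S _ s(1)] p unfolding scaled_def by blast
qed


lemma quot_simps:
  "carrier (quot_module N K) = a_rcosets\<^bsub>N\<^esub> K" "\<zero>\<^bsub>quot_module N K\<^esub> = K"
  "X \<oplus>\<^bsub>quot_module N K\<^esub> Y = X <+>\<^bsub>N\<^esub> Y"
  "c \<odot>\<^bsub>quot_module N K\<^esub> X = (\<Union>x\<in>X. K +>\<^bsub>N\<^esub> (c \<odot>\<^bsub>N\<^esub> x))"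
  "bounded (quot_module N K) = {(\<lambda>x. K +>\<^bsub>N\<^esub> x) ` B | B. B \<in> bounded N}"
  by (simp_all add: quot_module_def)

locale quot_ctx =
  fixes V :: "('v, 'k) ring_scheme" and N :: "('v, 'a) bmod" and K :: "'a set"
  assumes born: "born_module V N" and sub: "submodule K V N"
begin

sublocale module V N using born by (simp add: born_module_def)

abbreviation "Q \<equiv> quot_module N K"
abbreviation "cls x \<equiv> K +>\<^bsub>N\<^esub> x"

lemma K_sub: "K \<subseteq> carrier N" by (rule submoduleE(1)[OF sub])

sublocale asub: abelian_subgroup K N
  by (rule abelian_subgroupI3)
     (use sub in \<open>auto simp: additive_subgroup_def submodule_def M.abelian_group_axioms\<close>)

lemma cls_mem: "x \<in> cls y \<longleftrightarrow> (\<exists>k\<in>K. x = k \<oplus>\<^bsub>N\<^esub> y)" by (auto simp: a_r_coset_def' )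

lemma cls_eq_mem: assumes "y \<in> carrier N" "x \<in> cls y" shows "cls x = cls y"
  using M.a_repr_independence[OF assms(2,1)] sub by (simp add: submodule_def)

lemma cls_eq: assumes "x \<in> carrier N" "y \<in> carrier N"
  shows "cls x = cls y \<longleftrightarrow> x \<ominus>\<^bsub>N\<^esub> y \<in> K"
proof
  assume "cls x = cls y"
  then have "x \<in> cls y" using asub.a_rcos_self[OF assms(1)] by simp
  then obtain k where k: "k \<in> K" "x = k \<oplus>\<^bsub>N\<^esub> y" using cls_mem by blast
  then have "x \<ominus>\<^bsub>N\<^esub> y = k" using assms K_sub
    by (metis M.add.inv_solve_right' a_minus_def subsetD)
  then show "x \<ominus>\<^bsub>N\<^esub> y \<in> K" using k by simp
next
  assume k: "x \<ominus>\<^bsub>N\<^esub> y \<in> K"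
  have "x = (x \<ominus>\<^bsub>N\<^esub> y) \<oplus>\<^bsub>N\<^esub> y" using assms by (simp add: a_minus_def M.a_assoc M.l_neg)
  then have "x \<in> cls y" using k cls_mem by blast
  then show "cls x = cls y" using cls_eq_mem assms by blast
qed

lemma Q_carrier: "carrier Q = cls ` carrier N" by (auto simp: quot_simps A_RCOSETS_def')

lemma Q_add: "x \<in> carrier N \<Longrightarrow> y \<in> carrier N \<Longrightarrow> cls x \<oplus>\<^bsub>Q\<^esub> cls y = cls (x \<oplus>\<^bsub>N\<^esub> y)"
  by (simp add: quot_simps asub.a_rcos_sum)

lemma Q_zero: "\<zero>\<^bsub>Q\<^esub> = cls \<zero>\<^bsub>N\<^esub>"
  using M.a_coset_add_zero[OF K_sub] by (simp add: quot_simps)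

lemma Q_smult: assumes c: "c \<in> carrier V" and x: "x \<in> carrier N"
  shows "c \<odot>\<^bsub>Q\<^esub> cls x = cls (c \<odot>\<^bsub>N\<^esub> x)"
proof -
  have "cls (c \<odot>\<^bsub>N\<^esub> y) = cls (c \<odot>\<^bsub>N\<^esub> x)" if "y \<in> cls x" for y
  proof -
    obtain k where k: "k \<in> K" "y = k \<oplus>\<^bsub>N\<^esub> x" using \<open>y \<in> cls x\<close> cls_mem by blast
    then have "c \<odot>\<^bsub>N\<^esub> y = c \<odot>\<^bsub>N\<^esub> k \<oplus>\<^bsub>N\<^esub> c \<odot>\<^bsub>N\<^esub> x"
      using c x K_sub by (simp add: smult_r_distr subsetD)
    moreover have "c \<odot>\<^bsub>N\<^esub> k \<in> K" using submoduleE(4)[OF sub c k(1)] .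
    ultimately have "c \<odot>\<^bsub>N\<^esub> y \<in> cls (c \<odot>\<^bsub>N\<^esub> x)" using cls_mem by blast
    then show ?thesis using cls_eq_mem c x by simp
  qed
  then have "(\<Union>y\<in>cls x. cls (c \<odot>\<^bsub>N\<^esub> y)) = (\<Union>y\<in>cls x. cls (c \<odot>\<^bsub>N\<^esub> x))" by simp
  also have "\<dots> = cls (c \<odot>\<^bsub>N\<^esub> x)" using asub.a_rcos_self[OF x] by blast
  finally show ?thesis by (simp add: quot_simps)
qed

lemma Q_module: "module V Q"
proof (rule moduleI)
  show "cring V" by (rule R.is_cring)
  show "abelian_group Q"
  proof (rule abelian_groupI)
    show "X \<oplus>\<^bsub>Q\<^esub> Y \<in> carrier Q" if "X \<in> carrier Q" "Y \<in> carrier Q" for X Y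
      using that by (auto simp: Q_carrier Q_add)
    show "\<zero>\<^bsub>Q\<^esub> \<in> carrier Q" by (simp add: Q_zero Q_carrier)
    show "X \<oplus>\<^bsub>Q\<^esub> Y \<oplus>\<^bsub>Q\<^esub> W = X \<oplus>\<^bsub>Q\<^esub> (Y \<oplus>\<^bsub>Q\<^esub> W)"
      if "X \<in> carrier Q" "Y \<in> carrier Q" "W \<in> carrier Q" for X Y W
      using that by (auto simp: Q_carrier Q_add M.a_assoc)
    show "X \<oplus>\<^bsub>Q\<^esub> Y = Y \<oplus>\<^bsub>Q\<^esub> X" if "X \<in> carrier Q" "Y \<in> carrier Q" for X Y
      using that by (auto simp: Q_carrier Q_add M.a_comm)
    show "\<zero>\<^bsub>Q\<^esub> \<oplus>\<^bsub>Q\<^esub> X = X" if "X \<in> carrier Q" for X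
      using that by (auto simp: Q_carrier Q_add Q_zero)
    show "\<exists>Y\<in>carrier Q. Y \<oplus>\<^bsub>Q\<^esub> X = \<zero>\<^bsub>Q\<^esub>" if X: "X \<in> carrier Q" for X
    proof -
      obtain x where x: "x \<in> carrier N" "X = cls x" using X by (auto simp: Q_carrier)
      then have "cls (\<ominus>\<^bsub>N\<^esub> x) \<oplus>\<^bsub>Q\<^esub> X = \<zero>\<^bsub>Q\<^esub>" by (simp add: Q_add Q_zero M.l_neg)
      then show ?thesis using x by (auto simp: Q_carrier)
    qed
  qed
  show "a \<odot>\<^bsub>Q\<^esub> X \<in> carrier Q" if "a \<in> carrier V" "X \<in> carrier Q" for a X
    using that by (auto simp: Q_carrier Q_smult)
  show "(a \<oplus>\<^bsub>V\<^esub> b) \<odot>\<^bsub>Q\<^esub> X = a \<odot>\<^bsub>Q\<^esub> X \<oplus>\<^bsub>Q\<^esub> b \<odot>\<^bsub>Q\<^esub> X"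
    if "a \<in> carrier V" "b \<in> carrier V" "X \<in> carrier Q" for a b X
    using that by (auto simp: Q_carrier Q_smult Q_add smult_l_distr)
  show "a \<odot>\<^bsub>Q\<^esub> (X \<oplus>\<^bsub>Q\<^esub> Y) = a \<odot>\<^bsub>Q\<^esub> X \<oplus>\<^bsub>Q\<^esub> a \<odot>\<^bsub>Q\<^esub> Y"
    if "a \<in> carrier V" "X \<in> carrier Q" "Y \<in> carrier Q" for a X Y
    using that by (auto simp: Q_carrier Q_smult Q_add smult_r_distr)
  show "(a \<otimes>\<^bsub>V\<^esub> b) \<odot>\<^bsub>Q\<^esub> X = a \<odot>\<^bsub>Q\<^esub> (b \<odot>\<^bsub>Q\<^esub> X)"
    if "a \<in> carrier V" "b \<in> carrier V" "X \<in> carrier Q" for a b X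
    using that by (auto simp: Q_carrier Q_smult smult_assoc1)
  show "\<one>\<^bsub>V\<^esub> \<odot>\<^bsub>Q\<^esub> X = X" if "X \<in> carrier Q" for X
    using that by (auto simp: Q_carrier Q_smult)
qed

sublocale Qm: module V Q by (rule Q_module)

lemma Q_uminus: "x \<in> carrier N \<Longrightarrow> \<ominus>\<^bsub>Q\<^esub> cls x = cls (\<ominus>\<^bsub>N\<^esub> x)"
  by (rule Qm.M.minus_equality) (auto simp: Q_add Q_zero Q_carrier M.l_neg)

lemma Q_minus: "x \<in> carrier N \<Longrightarrow> y \<in> carrier N \<Longrightarrow> cls x \<ominus>\<^bsub>Q\<^esub> cls y = cls (x \<ominus>\<^bsub>N\<^esub> y)"
  by (simp add: a_minus_def Q_uminus Q_add)

lemma Q_submodule: assumes S: "submodule S V N" shows "submodule (cls ` S) V Q"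
proof (rule Qm.submoduleI)
  note E = submoduleE[OF S]
  show "cls ` S \<subseteq> carrier Q" using E(1) by (auto simp: Q_carrier)
  show "\<zero>\<^bsub>Q\<^esub> \<in> cls ` S" using submodule_zero[OF S] by (simp add: Q_zero)
  show "\<ominus>\<^bsub>Q\<^esub> X \<in> cls ` S" if "X \<in> cls ` S" for X
    using that E(1,3) by (auto simp: Q_uminus subsetD)
  show "X \<oplus>\<^bsub>Q\<^esub> Y \<in> cls ` S" if "X \<in> cls ` S" "Y \<in> cls ` S" for X Y
    using that E(1,5) by (auto simp: Q_add subsetD)
  show "c \<odot>\<^bsub>Q\<^esub> X \<in> cls ` S" if "c \<in> carrier V" "X \<in> cls ` S" for c X
    using that E(1,4) by (auto simp: Q_smult subsetD)
qed

lemma Q_born: "born_module V Q"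
proof -
  have N: "bornology_on (carrier N) (bounded N)" "\<And>B. B \<in> bounded N \<Longrightarrow> \<exists>S\<in>bdd_submodules V N. B \<subseteq> S"
    using born by (auto simp: born_module_def)
  note N1 = N(1)[unfolded bornology_on_def]
  have N_sub: "B \<in> bounded N \<Longrightarrow> B \<subseteq> carrier N" for B using N1 by (meson PowD subsetD)
  have N_un: "A \<in> bounded N \<Longrightarrow> B \<in> bounded N \<Longrightarrow> A \<union> B \<in> bounded N" for A B using N1 by meson
  have N_down: "B \<in> bounded N \<Longrightarrow> A \<subseteq> B \<Longrightarrow> A \<in> bounded N" for A B using N1 by meson
  have N_fin: "A \<subseteq> carrier N \<Longrightarrow> finite A \<Longrightarrow> A \<in> bounded N" for A using N1 by meson
  have bQ: "X \<in> bounded Q \<longleftrightarrow> (\<exists>B\<in>bounded N. X = cls ` B)" for X unfolding quot_simps(5) by blast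
  have "bornology_on (carrier Q) (bounded Q)"
    unfolding bornology_on_def
  proof (intro conjI ballI allI impI)
    show "bounded Q \<subseteq> Pow (carrier Q)"
    proof
      fix X assume "X \<in> bounded Q"
      then obtain B where B: "B \<in> bounded N" "X = cls ` B" unfolding bQ ..
      have "B \<subseteq> carrier N" using N_sub[OF B(1)] .
      then show "X \<in> Pow (carrier Q)" unfolding Q_carrier B(2) by blast
    qed
    show "X \<union> Y \<in> bounded Q" if XY: "X \<in> bounded Q" "Y \<in> bounded Q" for X Y
    proof -
      obtain A B where AB: "A \<in> bounded N" "B \<in> bounded N" "X = cls ` A" "Y = cls ` B"
        using XY unfolding bQ by meson
      have "A \<union> B \<in> bounded N" using N_un[OF AB(1,2)] .
      then show ?thesis using bQ[of "X \<union> Y"] AB(3,4) image_Un[of cls A B] by metis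
    qed
    show "X \<in> bounded Q" if XY: "Y \<in> bounded Q" "X \<subseteq> Y" for X Y
    proof -
      obtain B where B: "B \<in> bounded N" "Y = cls ` B" using XY(1) unfolding bQ ..
      obtain A where A: "A \<subseteq> B" "X = cls ` A" using XY(2) B(2) by (metis subset_imageE)
      have "A \<in> bounded N" using N_down[OF B(1) A(1)] .
      then show ?thesis using bQ[of X] A(2) by metis
    qed
    show "X \<in> bounded Q" if X: "X \<subseteq> carrier Q" "finite X" for X
    proof -
      obtain A where A: "A \<subseteq> carrier N" "finite A" "X = cls ` A"
        using X unfolding Q_carrier by (metis finite_subset_image)
      have "A \<in> bounded N" using N_fin[OF A(1,2)] .
      then show ?thesis using bQ[of X] A(3) by metis
    qed
  qed
  moreover have "\<exists>S\<in>bdd_submodules V Q. X \<subseteq> S" if X: "X \<in> bounded Q" for X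
  proof -
    obtain B where B: "B \<in> bounded N" "X = cls ` B" using X unfolding bQ ..
    obtain S where S: "S \<in> bdd_submodules V N" "B \<subseteq> S" using N(2)[OF B(1)] by blast
    have "cls ` S \<in> bdd_submodules V Q"
      using S(1) Q_submodule[of S] bQ[of "cls ` S"] by (simp add: bdd_submodules_def) (metis)
    then show ?thesis using S(2) B(2) by blast
  qed
  ultimately show ?thesis using Q_module by (simp add: born_module_def)
qed

lemma cls_linear: "bdd_linear_map V N Q cls"
  by (auto simp: bdd_linear_map_def linear_map_def Q_carrier Q_add Q_smult quot_simps(5))

end

locale bmod_ctx =
  fixes V :: "('v, 'k) ring_scheme" and \<pi> :: 'v and M :: "('v, 'a) bmod"
  assumes born: "born_module V M" and pi: "\<pi> \<in> carrier V"
begin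

sublocale module V M using born by (simp add: born_module_def)

abbreviation "P n S \<equiv> scaled M (\<pi> [^]\<^bsub>V\<^esub> (n::nat)) S"
abbreviation "Z \<equiv> adic_cauchy V \<pi> M"
abbreviation "C \<equiv> cauchy_module V \<pi> M"
abbreviation "K \<equiv> null_module V \<pi> M"
abbreviation "Q \<equiv> completion V \<pi> M"

lemma pin [simp]: "\<pi> [^]\<^bsub>V\<^esub> (n::nat) \<in> carrier V" using pi by simp

lemma bddD: assumes "S \<in> bdd_submodules V M"
  shows "submodule S V M" "S \<in> bounded M" "S \<subseteq> carrier M" "x \<in> S \<Longrightarrow> x \<in> carrier M"
  using assms submoduleE(1) by (auto simp: bdd_submodules_def)

lemma P_sub: "submodule S V M \<Longrightarrow> submodule (P n S) V M" using scaled_submodule pin by blast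
lemma P_le: "submodule S V M \<Longrightarrow> P n S \<subseteq> S" using scaled_submodule pin by blast
lemma P_mono: "S \<subseteq> T \<Longrightarrow> P n S \<subseteq> P n T" by (auto simp: scaled_def)
lemma Z_mono: "S \<subseteq> T \<Longrightarrow> Z S \<subseteq> Z T" using P_mono unfolding adic_cauchy_def by blast

lemma cover: "B \<in> bounded M \<Longrightarrow> \<exists>S\<in>bdd_submodules V M. B \<subseteq> S"
  using born by (simp add: born_module_def)

lemma bdd_join:
  assumes "S \<in> bdd_submodules V M" "T \<in> bdd_submodules V M"
  obtains U where "U \<in> bdd_submodules V M" "S \<subseteq> U" "T \<subseteq> U"
proof -
  have "S \<union> T \<in> bounded M" using assms born
    by (auto simp: bdd_submodules_def born_module_def bornology_on_def)
  from cover[OF this] show thesis using that by blast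
qed

lemma in_bdd:
  assumes "x \<in> carrier M" obtains S where "S \<in> bdd_submodules V M" "x \<in> S"
proof -
  have "{x} \<in> bounded M" using assms born by (auto simp: born_module_def bornology_on_def)
  from cover[OF this] show thesis using that by blast
qed

lemma Z_D: "x \<in> Z S \<Longrightarrow> x n \<in> S" "x \<in> Z S \<Longrightarrow> x (Suc n) \<ominus>\<^bsub>M\<^esub> x n \<in> P n S"
  by (auto simp: adic_cauchy_def)

lemma diff_add: "a \<in> carrier M \<Longrightarrow> b \<in> carrier M \<Longrightarrow> c \<in> carrier M \<Longrightarrow> d \<in> carrier M \<Longrightarrow>
  (a \<oplus>\<^bsub>M\<^esub> b) \<ominus>\<^bsub>M\<^esub> (c \<oplus>\<^bsub>M\<^esub> d) = (a \<ominus>\<^bsub>M\<^esub> c) \<oplus>\<^bsub>M\<^esub> (b \<ominus>\<^bsub>M\<^esub> d)"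
  by (simp add: a_minus_def M.minus_add M.a_ac)

lemma diff_trans: "a \<in> carrier M \<Longrightarrow> b \<in> carrier M \<Longrightarrow> c \<in> carrier M \<Longrightarrow>
  a \<ominus>\<^bsub>M\<^esub> c = (a \<ominus>\<^bsub>M\<^esub> b) \<oplus>\<^bsub>M\<^esub> (b \<ominus>\<^bsub>M\<^esub> c)"
proof -
  assume abc: "a \<in> carrier M" "b \<in> carrier M" "c \<in> carrier M"
  have "(a \<ominus>\<^bsub>M\<^esub> b) \<oplus>\<^bsub>M\<^esub> (b \<ominus>\<^bsub>M\<^esub> c) = a \<oplus>\<^bsub>M\<^esub> ((\<ominus>\<^bsub>M\<^esub> b \<oplus>\<^bsub>M\<^esub> b) \<oplus>\<^bsub>M\<^esub> \<ominus>\<^bsub>M\<^esub> c)"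
    using abc by (simp add: a_minus_def M.a_assoc)
  then show ?thesis using abc by (simp add: M.l_neg a_minus_def)
qed

lemma smult_diff: "c \<in> carrier V \<Longrightarrow> a \<in> carrier M \<Longrightarrow> b \<in> carrier M \<Longrightarrow>
  c \<odot>\<^bsub>M\<^esub> (a \<ominus>\<^bsub>M\<^esub> b) = c \<odot>\<^bsub>M\<^esub> a \<ominus>\<^bsub>M\<^esub> c \<odot>\<^bsub>M\<^esub> b"
  by (simp add: a_minus_def smult_r_distr smult_r_minus)

lemma diff_zero_iff: "a \<in> carrier M \<Longrightarrow> b \<in> carrier M \<Longrightarrow> a \<ominus>\<^bsub>M\<^esub> b = \<zero>\<^bsub>M\<^esub> \<longleftrightarrow> a = b"
  by (metis M.add.inv_solve_right' M.l_zero M.zero_closed a_minus_def M.r_neg)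

lemma diff_zero: "a \<in> carrier M \<Longrightarrow> a \<ominus>\<^bsub>M\<^esub> \<zero>\<^bsub>M\<^esub> = a"
  by (metis M.add.inv_solve_right' M.r_zero M.zero_closed a_minus_def)

lemma diff_identity:
  assumes "u \<in> carrier M" "v \<in> carrier M" "x \<in> carrier M" "a \<in> carrier M" "b \<in> carrier M"
  shows "(u \<ominus>\<^bsub>M\<^esub> v) \<ominus>\<^bsub>M\<^esub> (((u \<ominus>\<^bsub>M\<^esub> x) \<ominus>\<^bsub>M\<^esub> a) \<ominus>\<^bsub>M\<^esub> ((v \<ominus>\<^bsub>M\<^esub> x) \<ominus>\<^bsub>M\<^esub> b)) = a \<ominus>\<^bsub>M\<^esub> b"
proof -
  have "v \<oplus>\<^bsub>M\<^esub> (\<ominus>\<^bsub>M\<^esub> b \<oplus>\<^bsub>M\<^esub> \<ominus>\<^bsub>M\<^esub> v) = \<ominus>\<^bsub>M\<^esub> b"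
    using assms M.r_neg2[of v "\<ominus>\<^bsub>M\<^esub> b"] M.a_comm[of "\<ominus>\<^bsub>M\<^esub> b" "\<ominus>\<^bsub>M\<^esub> v"] by simp
  then show ?thesis
    using assms by (simp add: a_minus_def M.minus_add M.a_ac M.r_neg M.r_neg1 M.r_neg2)
qed

lemma Z_add: assumes "S \<in> bdd_submodules V M" "x \<in> Z S" "y \<in> Z S"
  shows "(\<lambda>n. x n \<oplus>\<^bsub>M\<^esub> y n) \<in> Z S"
  unfolding adic_cauchy_def
proof (intro CollectI allI conjI)
  fix n
  note S = bddD[OF assms(1)]
  show "x n \<oplus>\<^bsub>M\<^esub> y n \<in> S" using Z_D assms submoduleE(5)[OF S(1)] by blast
  show "(x (Suc n) \<oplus>\<^bsub>M\<^esub> y (Suc n)) \<ominus>\<^bsub>M\<^esub> (x n \<oplus>\<^bsub>M\<^esub> y n) \<in> P n S"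
    using Z_D[OF assms(2)] Z_D[OF assms(3)] submoduleE(5)[OF P_sub[OF S(1)]] S(4)
    by (simp add: diff_add)
qed

lemma Z_smult: assumes "S \<in> bdd_submodules V M" "x \<in> Z S" "c \<in> carrier V"
  shows "(\<lambda>n. c \<odot>\<^bsub>M\<^esub> x n) \<in> Z S"
  unfolding adic_cauchy_def
proof (intro CollectI allI conjI)
  fix n
  note S = bddD[OF assms(1)]
  show "c \<odot>\<^bsub>M\<^esub> x n \<in> S" using Z_D assms submoduleE(4)[OF S(1)] by blast
  show "c \<odot>\<^bsub>M\<^esub> x (Suc n) \<ominus>\<^bsub>M\<^esub> c \<odot>\<^bsub>M\<^esub> x n \<in> P n S"
    using Z_D[OF assms(2)] submoduleE(4)[OF P_sub[OF S(1)] assms(3)] S(4) assms(3)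
    by (simp add: smult_diff[symmetric])
qed

lemma Z_const: assumes "S \<in> bdd_submodules V M" "x \<in> S" shows "(\<lambda>n. x) \<in> Z S"
  using assms submodule_zero[OF P_sub[OF bddD(1)[OF assms(1)]]] bddD(4)[OF assms(1)]
  unfolding adic_cauchy_def by (simp add: a_minus_def M.r_neg)

lemma ex_bdd: obtains S where "S \<in> bdd_submodules V M" using in_bdd[OF M.zero_closed] by blast

lemma C_simps [simp]: "x \<oplus>\<^bsub>C\<^esub> y = (\<lambda>n. x n \<oplus>\<^bsub>M\<^esub> y n)" "\<zero>\<^bsub>C\<^esub> = (\<lambda>n. \<zero>\<^bsub>M\<^esub>)"
  "c \<odot>\<^bsub>C\<^esub> x = (\<lambda>n. c \<odot>\<^bsub>M\<^esub> x n)" by (simp_all add: cauchy_module_def)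

lemma C_carrier: "x \<in> carrier C \<longleftrightarrow> (\<exists>S\<in>bdd_submodules V M. x \<in> Z S)"
  by (simp add: cauchy_module_def)

lemma C_val: "x \<in> carrier C \<Longrightarrow> x n \<in> carrier M" using C_carrier Z_D bddD by blast

lemma C_common: assumes "x \<in> carrier C" "y \<in> carrier C"
  obtains S where "S \<in> bdd_submodules V M" "x \<in> Z S" "y \<in> Z S"
proof -
  obtain S T where "S \<in> bdd_submodules V M" "x \<in> Z S" "T \<in> bdd_submodules V M" "y \<in> Z T"
    using assms unfolding C_carrier by blast
  moreover from this obtain U where "U \<in> bdd_submodules V M" "S \<subseteq> U" "T \<subseteq> U" using bdd_join by blast
  ultimately show thesis using that Z_mono by blast
qed

lemma C_module: "module V C"
proof (rule moduleI)
  show "cring V" by (rule R.is_cring)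
  have neg: "(\<lambda>n. \<ominus>\<^bsub>M\<^esub> x n) \<in> carrier C" if x: "x \<in> carrier C" for x
  proof -
    obtain S where S: "S \<in> bdd_submodules V M" "x \<in> Z S" using x C_carrier by blast
    have "(\<lambda>n. (\<ominus>\<^bsub>V\<^esub> \<one>\<^bsub>V\<^esub>) \<odot>\<^bsub>M\<^esub> x n) \<in> Z S" using Z_smult[OF S] by simp
    moreover have "(\<lambda>n. (\<ominus>\<^bsub>V\<^esub> \<one>\<^bsub>V\<^esub>) \<odot>\<^bsub>M\<^esub> x n) = (\<lambda>n. \<ominus>\<^bsub>M\<^esub> x n)"
      using C_val[OF x] by (simp add: smult_l_minus)
    ultimately show ?thesis using S C_carrier by auto
  qed
  show "abelian_group C"
  proof (rule abelian_groupI)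
    show "x \<oplus>\<^bsub>C\<^esub> y \<in> carrier C" if "x \<in> carrier C" "y \<in> carrier C" for x y
    proof -
      obtain S where "S \<in> bdd_submodules V M" "x \<in> Z S" "y \<in> Z S" using C_common[OF \<open>x \<in> carrier C\<close> \<open>y \<in> carrier C\<close>] by blast
      then show ?thesis using Z_add[of S x y] by (auto simp: C_carrier)
    qed
    show "\<zero>\<^bsub>C\<^esub> \<in> carrier C"
    proof -
      obtain S where "S \<in> bdd_submodules V M" using ex_bdd .
      then show ?thesis using Z_const[of S "\<zero>\<^bsub>M\<^esub>"] submodule_zero[OF bddD(1)] by (auto simp: C_carrier)
    qed
    show "x \<oplus>\<^bsub>C\<^esub> y \<oplus>\<^bsub>C\<^esub> z = x \<oplus>\<^bsub>C\<^esub> (y \<oplus>\<^bsub>C\<^esub> z)"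
      if "x \<in> carrier C" "y \<in> carrier C" "z \<in> carrier C" for x y z
      using that C_val by (simp add: M.a_assoc)
    show "x \<oplus>\<^bsub>C\<^esub> y = y \<oplus>\<^bsub>C\<^esub> x" if "x \<in> carrier C" "y \<in> carrier C" for x y
      using that C_val by (simp add: M.a_comm)
    show "\<zero>\<^bsub>C\<^esub> \<oplus>\<^bsub>C\<^esub> x = x" if "x \<in> carrier C" for x using that C_val by simp
    show "\<exists>y\<in>carrier C. y \<oplus>\<^bsub>C\<^esub> x = \<zero>\<^bsub>C\<^esub>" if "x \<in> carrier C" for x
      using that C_val neg[OF that] by (intro bexI[OF _ neg[OF that]]) (simp add: M.l_neg)
  qed
  show "a \<odot>\<^bsub>C\<^esub> x \<in> carrier C" if "a \<in> carrier V" "x \<in> carrier C" for a x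
    using that Z_smult[OF _ _ that(1)] by (auto simp: C_carrier)
  show "(a \<oplus>\<^bsub>V\<^esub> b) \<odot>\<^bsub>C\<^esub> x = a \<odot>\<^bsub>C\<^esub> x \<oplus>\<^bsub>C\<^esub> b \<odot>\<^bsub>C\<^esub> x"
    if "a \<in> carrier V" "b \<in> carrier V" "x \<in> carrier C" for a b x
    using that C_val[OF that(3)] by (simp add: smult_l_distr)
  show "a \<odot>\<^bsub>C\<^esub> (x \<oplus>\<^bsub>C\<^esub> y) = a \<odot>\<^bsub>C\<^esub> x \<oplus>\<^bsub>C\<^esub> a \<odot>\<^bsub>C\<^esub> y"
    if "a \<in> carrier V" "x \<in> carrier C" "y \<in> carrier C" for a x y
    using that C_val[OF that(2)] C_val[OF that(3)] by (simp add: smult_r_distr)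
  show "(a \<otimes>\<^bsub>V\<^esub> b) \<odot>\<^bsub>C\<^esub> x = a \<odot>\<^bsub>C\<^esub> (b \<odot>\<^bsub>C\<^esub> x)"
    if "a \<in> carrier V" "b \<in> carrier V" "x \<in> carrier C" for a b x
    using that C_val[OF that(3)] by (simp add: smult_assoc1)
  show "\<one>\<^bsub>V\<^esub> \<odot>\<^bsub>C\<^esub> x = x" if "x \<in> carrier C" for x
    using C_val[OF that] by simp
qed

sublocale Cm: module V C by (rule C_module)

lemma C_neg: "x \<in> carrier C \<Longrightarrow> \<ominus>\<^bsub>C\<^esub> x = (\<ominus>\<^bsub>V\<^esub> \<one>\<^bsub>V\<^esub>) \<odot>\<^bsub>C\<^esub> x"
  by (metis Cm.smult_l_minus Cm.smult_one R.one_closed)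

lemma C_uminus: assumes "x \<in> carrier C" shows "\<ominus>\<^bsub>C\<^esub> x = (\<lambda>n. \<ominus>\<^bsub>M\<^esub> x n)"
proof
  fix n
  show "(\<ominus>\<^bsub>C\<^esub> x) n = \<ominus>\<^bsub>M\<^esub> x n" using C_val[OF assms] C_neg[OF assms] by (simp add: smult_l_minus)
qed

lemma C_minus: "x \<in> carrier C \<Longrightarrow> y \<in> carrier C \<Longrightarrow> x \<ominus>\<^bsub>C\<^esub> y = (\<lambda>n. x n \<ominus>\<^bsub>M\<^esub> y n)"
  using C_uminus by (simp add: a_minus_def)

lemma Z_submodule: "S \<in> bdd_submodules V M \<Longrightarrow> submodule (Z S) V C"
proof (rule Cm.submoduleI)
  assume S: "S \<in> bdd_submodules V M"
  show sub: "Z S \<subseteq> carrier C" using S C_carrier by blast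
  show "\<zero>\<^bsub>C\<^esub> \<in> Z S" using Z_const[OF S] submodule_zero bddD(1)[OF S] by simp
  show "x \<oplus>\<^bsub>C\<^esub> y \<in> Z S" if "x \<in> Z S" "y \<in> Z S" for x y using Z_add[OF S that] by simp
  show sm: "c \<odot>\<^bsub>C\<^esub> x \<in> Z S" if "c \<in> carrier V" "x \<in> Z S" for c x using Z_smult[OF S] that by simp
  show "\<ominus>\<^bsub>C\<^esub> x \<in> Z S" if "x \<in> Z S" for x
    using sm[OF R.a_inv_closed[OF R.one_closed] that] C_neg[of x] that sub
    by (auto simp del: C_simps)
qed

lemma C_born: "born_module V C"
  unfolding born_module_def
proof (intro conjI)
  show "module V C" by (rule C_module)
  have b: "bounded C = {B. \<exists>S\<in>bdd_submodules V M. B \<subseteq> Z S}" by (simp add: cauchy_module_def)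
  have fin: "A \<in> bounded C" if "finite A" "A \<subseteq> carrier C" for A
    using that
  proof (induction A)
    case empty then show ?case using ex_bdd unfolding b by (metis (mono_tags) empty_subsetI mem_Collect_eq)
  next
    case (insert x A)
    then obtain S T where "S \<in> bdd_submodules V M" "A \<subseteq> Z S" "T \<in> bdd_submodules V M" "x \<in> Z T"
      using C_carrier unfolding b by auto
    then obtain U where U: "U \<in> bdd_submodules V M" "S \<subseteq> U" "T \<subseteq> U" by (metis bdd_join)
    then have "insert x A \<subseteq> Z U" using Z_mono[OF U(2)] Z_mono[OF U(3)] \<open>A \<subseteq> Z S\<close> \<open>x \<in> Z T\<close> by blast
    then show ?case using U(1) unfolding b by blast
  qed
  show "bornology_on (carrier C) (bounded C)"
    unfolding bornology_on_def
  proof (intro conjI ballI allI impI)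
    show "bounded C \<subseteq> Pow (carrier C)" unfolding b using C_carrier by blast
    show "A \<union> B \<in> bounded C" if AB: "A \<in> bounded C" "B \<in> bounded C" for A B
    proof -
      obtain S T where "S \<in> bdd_submodules V M" "A \<subseteq> Z S" "T \<in> bdd_submodules V M" "B \<subseteq> Z T"
        using AB unfolding b by blast
      then obtain U where U: "U \<in> bdd_submodules V M" "S \<subseteq> U" "T \<subseteq> U" by (metis bdd_join)
      then have "A \<union> B \<subseteq> Z U" using Z_mono[OF U(2)] Z_mono[OF U(3)] \<open>A \<subseteq> Z S\<close> \<open>B \<subseteq> Z T\<close> by blast
      then show ?thesis using U(1) unfolding b by blast
    qed
    show "A \<in> bounded C" if "B \<in> bounded C" "A \<subseteq> B" for A B using that unfolding b by blast
    show "A \<in> bounded C" if "A \<subseteq> carrier C" "finite A" for A using fin that by blast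
  qed
  show "\<forall>B\<in>bounded C. \<exists>S\<in>bdd_submodules V C. B \<subseteq> S"
    unfolding b using Z_submodule by (auto simp: bdd_submodules_def b)
qed

lemma K_submodule: "submodule K V C" and K_closed: "limit_closed V \<pi> M K"
proof -
  let ?F = "{K. submodule K V C \<and> limit_closed V \<pi> M K}"
  have top: "carrier C \<in> ?F" using Cm.carrier_is_submodule C_carrier by (auto simp: limit_closed_def)
  show "submodule K V C"
  proof (rule Cm.submoduleI)
    show "K \<subseteq> carrier C" using top unfolding null_module_def by blast
    show "\<zero>\<^bsub>C\<^esub> \<in> K" unfolding null_module_def using Cm.submodule_zero by blast
    show "\<ominus>\<^bsub>C\<^esub> x \<in> K" if "x \<in> K" for x
      using that unfolding null_module_def using Cm.submoduleE(3) by blast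
    show "x \<oplus>\<^bsub>C\<^esub> y \<in> K" if "x \<in> K" "y \<in> K" for x y
      using that unfolding null_module_def using Cm.submoduleE(5) by blast
    show "c \<odot>\<^bsub>C\<^esub> x \<in> K" if "c \<in> carrier V" "x \<in> K" for c x
      using that unfolding null_module_def using Cm.submoduleE(4) by blast
  qed
  show "limit_closed V \<pi> M K"
    unfolding limit_closed_def
  proof (intro ballI impI)
    fix S x assume S: "S \<in> bdd_submodules V M" "x \<in> Z S"
      and h: "\<forall>n. \<exists>k\<in>K \<inter> Z S. x n \<ominus>\<^bsub>M\<^esub> k n \<in> P n S"
    have "x \<in> L" if L: "submodule L V C" "limit_closed V \<pi> M L" for L
    proof -
      have "K \<subseteq> L" using L unfolding null_module_def by blast
      then have "\<forall>n. \<exists>k\<in>L \<inter> Z S. x n \<ominus>\<^bsub>M\<^esub> k n \<in> P n S" using h by blast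
      then show ?thesis using L(2) S unfolding limit_closed_def by blast
    qed
    then show "x \<in> K" unfolding null_module_def by blast
  qed
qed

lemma null_in_K:
  assumes S: "S \<in> bdd_submodules V M" and x: "x \<in> Z S" and n: "\<And>n. x n \<in> P n S"
  shows "x \<in> K"
proof -
  have 0: "(\<lambda>n. \<zero>\<^bsub>M\<^esub>) \<in> K \<inter> Z S"
    using Cm.submodule_zero[OF K_submodule] Cm.submodule_zero[OF Z_submodule[OF S]] by simp
  have "x n \<ominus>\<^bsub>M\<^esub> \<zero>\<^bsub>M\<^esub> \<in> P n S" for n
    using n[of n] diff_zero[OF bddD(4)[OF S Z_D(1)[OF x]], of n] by simp
  then have "\<forall>n. \<exists>k\<in>K \<inter> Z S. x n \<ominus>\<^bsub>M\<^esub> k n \<in> P n S" using 0 by (intro allI bexI[OF _ 0]) simp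
  then show ?thesis using K_closed S x unfolding limit_closed_def by blast
qed

lemma Z_tail:
  assumes S: "S \<in> bdd_submodules V M" and x: "x \<in> Z S"
  shows "x (m + k) \<ominus>\<^bsub>M\<^esub> x m \<in> P m S"
proof (induction k)
  case 0 then show ?case
    using submodule_zero[OF P_sub[OF bddD(1)[OF S]]] Z_D(1)[OF x] bddD(4)[OF S]
    by (simp add: a_minus_def M.r_neg)
next
  case (Suc k)
  have c: "x i \<in> carrier M" for i using Z_D(1)[OF x] bddD(4)[OF S] by blast
  have "x (Suc (m + k)) \<ominus>\<^bsub>M\<^esub> x (m + k) \<in> P m S"
    using Z_D(2)[OF x, of "m + k"] scaled_pow_antimono[OF pi bddD(1)[OF S], of m "m + k"] by auto
  then have "(x (Suc (m + k)) \<ominus>\<^bsub>M\<^esub> x (m + k)) \<oplus>\<^bsub>M\<^esub> (x (m + k) \<ominus>\<^bsub>M\<^esub> x m) \<in> P m S"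
    using Suc submoduleE(5)[OF P_sub[OF bddD(1)[OF S]]] by blast
  then show ?case using diff_trans[OF c c c] by simp
qed

lemma divide:
  assumes S: "S \<in> bdd_submodules V M" and x: "x \<in> Z S" and n: "x n \<in> P n S"
  shows "\<exists>w\<in>Z S. x \<ominus>\<^bsub>C\<^esub> (\<pi> [^]\<^bsub>V\<^esub> n) \<odot>\<^bsub>C\<^esub> w \<in> K"
proof -
  note sS = bddD(1)[OF S]
  have c: "x i \<in> carrier M" for i using Z_D(1)[OF x] bddD(4)[OF S] by blast
  obtain w0 where w0: "w0 \<in> S" "x n = (\<pi> [^]\<^bsub>V\<^esub> n) \<odot>\<^bsub>M\<^esub> w0" using n by (auto simp: scaled_def)
  have "\<exists>s\<in>S. x (Suc m) \<ominus>\<^bsub>M\<^esub> x m = (\<pi> [^]\<^bsub>V\<^esub> m) \<odot>\<^bsub>M\<^esub> s" for m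
    using Z_D(2)[OF x, of m] by (auto simp: scaled_def)
  then obtain s where s: "\<And>m. s m \<in> S" "\<And>m. x (Suc m) \<ominus>\<^bsub>M\<^esub> x m = (\<pi> [^]\<^bsub>V\<^esub> m) \<odot>\<^bsub>M\<^esub> s m"
    by metis
  define w where "w = rec_nat w0 (\<lambda>k u. u \<oplus>\<^bsub>M\<^esub> (\<pi> [^]\<^bsub>V\<^esub> k) \<odot>\<^bsub>M\<^esub> s (n + k))"
  have w_0: "w 0 = w0" and w_S: "w (Suc k) = w k \<oplus>\<^bsub>M\<^esub> (\<pi> [^]\<^bsub>V\<^esub> k) \<odot>\<^bsub>M\<^esub> s (n + k)" for k
    by (simp_all add: w_def)
  have wS: "w k \<in> S" for k
    by (induction k) (auto simp: w_0 w_S w0 s submoduleE(4,5)[OF sS])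
  have wc: "w k \<in> carrier M" "s k \<in> carrier M" for k using wS s bddD(4)[OF S] by blast+
  have wZ: "w \<in> Z S" unfolding adic_cauchy_def
  proof (intro CollectI allI conjI wS)
    fix k
    have "w (Suc k) \<ominus>\<^bsub>M\<^esub> w k = (\<pi> [^]\<^bsub>V\<^esub> k) \<odot>\<^bsub>M\<^esub> s (n + k)"
      unfolding w_S using wc by (metis M.add.inv_solve_right M.a_comm a_minus_def pin smult_closed M.a_closed)
    then show "w (Suc k) \<ominus>\<^bsub>M\<^esub> w k \<in> P k S" using s by (auto simp: scaled_def)
  qed
  have xw: "x (n + k) = (\<pi> [^]\<^bsub>V\<^esub> n) \<odot>\<^bsub>M\<^esub> w k" for k
  proof (induction k)
    case 0 then show ?case by (simp add: w_0 w0)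
  next
    case (Suc k)
    have "x (Suc (n + k)) = (\<pi> [^]\<^bsub>V\<^esub> (n + k)) \<odot>\<^bsub>M\<^esub> s (n + k) \<oplus>\<^bsub>M\<^esub> x (n + k)"
      using s(2)[of "n + k"] c by (metis M.add.inv_solve_right' a_minus_def pin smult_closed wc(2))
    also have "\<dots> = (\<pi> [^]\<^bsub>V\<^esub> n) \<odot>\<^bsub>M\<^esub> w (Suc k)"
      using wc Suc pi by (simp add: w_S smult_r_distr R.nat_pow_mult[symmetric] smult_assoc1 M.a_comm)
    finally show ?case by simp
  qed
  have wC: "w \<in> carrier C" "x \<in> carrier C" using wZ x S C_carrier by blast+
  have "x \<ominus>\<^bsub>C\<^esub> (\<pi> [^]\<^bsub>V\<^esub> n) \<odot>\<^bsub>C\<^esub> w = (\<lambda>m. x m \<ominus>\<^bsub>M\<^esub> x (n + m))"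
    using C_minus[OF wC(2) Cm.smult_closed[OF pin wC(1)]] by (simp add: xw)
  moreover have "\<dots> \<in> K"
  proof (rule null_in_K[OF S])
    have "x \<ominus>\<^bsub>C\<^esub> (\<pi> [^]\<^bsub>V\<^esub> n) \<odot>\<^bsub>C\<^esub> w \<in> Z S"
      using Cm.submodule_minus[OF Z_submodule[OF S] x] Cm.submoduleE(4)[OF Z_submodule[OF S] pin wZ] by blast
    then show "(\<lambda>m. x m \<ominus>\<^bsub>M\<^esub> x (n + m)) \<in> Z S" using calculation by simp
    fix m
    have "\<ominus>\<^bsub>M\<^esub> (x (m + n) \<ominus>\<^bsub>M\<^esub> x m) \<in> P m S"
      using submoduleE(3)[OF P_sub[OF sS] Z_tail[OF S x]] .
    moreover have "\<ominus>\<^bsub>M\<^esub> (x (m + n) \<ominus>\<^bsub>M\<^esub> x m) = x m \<ominus>\<^bsub>M\<^esub> x (n + m)"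
      using c by (simp add: a_minus_def M.minus_add M.a_comm add.commute)
    ultimately show "x m \<ominus>\<^bsub>M\<^esub> x (n + m) \<in> P m S" by simp
  qed
  ultimately show ?thesis by (intro bexI[OF _ wZ]) simp
qed

end

lemma adic_cauchyD:
  assumes "x \<in> adic_cauchy V \<pi> M S"
  shows "x n \<in> S" "x (Suc n) \<ominus>\<^bsub>M\<^esub> x n \<in> scaled M (\<pi> [^]\<^bsub>V\<^esub> n) S"
  using assms by (auto simp: adic_cauchy_def)
context bmod_ctx
begin

sublocale Qc: quot_ctx V C K
  by (rule quot_ctx.intro[OF C_born K_submodule])

abbreviation "cls x \<equiv> K +>\<^bsub>C\<^esub> x"
abbreviation "QC \<equiv> quot_module C K"

lemma scaled_cls:
  assumes S: "S \<in> bdd_submodules V M" and c: "c \<in> carrier V"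
  shows "X \<in> scaled QC c (cls ` Z S) \<longleftrightarrow> (\<exists>w\<in>Z S. X = cls (c \<odot>\<^bsub>C\<^esub> w))"
proof -
  have "c \<odot>\<^bsub>QC\<^esub> cls w = cls (c \<odot>\<^bsub>C\<^esub> w)" if "w \<in> Z S" for w
  proof (rule Qc.Q_smult[OF c])
    show "w \<in> carrier C" using C_carrier[of w] that S by blast
  qed
  then have "scaled QC c (cls ` Z S) = (\<lambda>w. cls (c \<odot>\<^bsub>C\<^esub> w)) ` Z S"
    unfolding scaled_def image_image by (intro image_cong refl) simp
  then show ?thesis by (simp add: image_iff)
qed

lemma cls_complete:
  assumes S: "S \<in> bdd_submodules V M"
  shows "adic_complete V \<pi> QC (cls ` Z S)"
  unfolding adic_complete_def
proof
  fix X assume X: "X \<in> adic_cauchy V \<pi> QC (cls ` Z S)"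
  note ZS = Z_submodule[OF S]
  have ZC: "x \<in> carrier C" if "x \<in> Z S" for x using that S C_carrier by blast
  have "\<exists>x\<in>Z S. X n = cls x" for n using adic_cauchyD(1)[OF X, of n] by blast
  then obtain x0 where x0: "x0 \<in> Z S" "X 0 = cls x0" by blast
  have "\<exists>w\<in>Z S. X (Suc n) \<ominus>\<^bsub>QC\<^esub> X n = cls ((\<pi> [^]\<^bsub>V\<^esub> n) \<odot>\<^bsub>C\<^esub> w)" for n
    using adic_cauchyD(2)[OF X, of n] unfolding scaled_cls[OF S pin] .
  then obtain w where w: "\<And>n. w n \<in> Z S"
    "\<And>n. X (Suc n) \<ominus>\<^bsub>QC\<^esub> X n = cls ((\<pi> [^]\<^bsub>V\<^esub> n) \<odot>\<^bsub>C\<^esub> w n)" by metis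
  define x where "x = rec_nat x0 (\<lambda>n u. u \<oplus>\<^bsub>C\<^esub> (\<pi> [^]\<^bsub>V\<^esub> n) \<odot>\<^bsub>C\<^esub> w n)"
  have x_0: "x 0 = x0" and x_S: "x (Suc n) = x n \<oplus>\<^bsub>C\<^esub> (\<pi> [^]\<^bsub>V\<^esub> n) \<odot>\<^bsub>C\<^esub> w n" for n
    by (simp_all add: x_def)
  have pw: "(\<pi> [^]\<^bsub>V\<^esub> n) \<odot>\<^bsub>C\<^esub> w m \<in> Z S" for n m :: nat using Cm.submoduleE(4)[OF ZS pin w(1)] .
  have xZ: "x n \<in> Z S" for n
  proof (induction n)
    case 0 then show ?case using x0 by (simp add: x_0)
  next
    case (Suc n) then show ?case unfolding x_S using Cm.submoduleE(5)[OF ZS _ pw] by blast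
  qed
  have Xx: "X n = cls (x n)" for n
  proof (induction n)
    case 0 then show ?case using x0 by (simp add: x_0)
  next
    case (Suc n)
    have "X m \<in> carrier QC" for m
      using adic_cauchyD(1)[OF X, of m] ZC unfolding Qc.Q_carrier by blast
    then have "X (Suc n) = X n \<oplus>\<^bsub>QC\<^esub> (X (Suc n) \<ominus>\<^bsub>QC\<^esub> X n)"
      by (metis Qc.Qm.M.a_comm Qc.Qm.M.add.inv_solve_right Qc.Qm.M.minus_closed a_minus_def)
    also have "\<dots> = cls (x n) \<oplus>\<^bsub>QC\<^esub> cls ((\<pi> [^]\<^bsub>V\<^esub> n) \<odot>\<^bsub>C\<^esub> w n)" using Suc w(2) by metis
    also have "\<dots> = cls (x (Suc n))" unfolding x_S by (rule Qc.Q_add[OF ZC[OF xZ] ZC[OF pw]])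
    finally show ?case .
  qed
  have c: "x m i \<in> carrier M" for m i using Z_D(1)[OF xZ] bddD(4)[OF S] by blast
  define y where "y = (\<lambda>m. x m m)"
  have yZ: "y \<in> Z S" unfolding adic_cauchy_def
  proof (intro CollectI allI conjI)
    fix m
    show "y m \<in> S" unfolding y_def using Z_D(1)[OF xZ] .
    have "x (Suc m) (Suc m) = x m (Suc m) \<oplus>\<^bsub>M\<^esub> (\<pi> [^]\<^bsub>V\<^esub> m) \<odot>\<^bsub>M\<^esub> w m (Suc m)" by (simp add: x_S)
    then have "x (Suc m) (Suc m) \<ominus>\<^bsub>M\<^esub> x m (Suc m) = (\<pi> [^]\<^bsub>V\<^esub> m) \<odot>\<^bsub>M\<^esub> w m (Suc m)"
      using c bddD(4)[OF S Z_D(1)[OF w(1)]]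
      by (metis M.add.inv_solve_right M.a_comm a_minus_def pin smult_closed)
    then have "x (Suc m) (Suc m) \<ominus>\<^bsub>M\<^esub> x m (Suc m) \<in> P m S"
      using Z_D(1)[OF w(1)] unfolding scaled_def by blast
    moreover have "x m (Suc m) \<ominus>\<^bsub>M\<^esub> x m m \<in> P m S" using Z_D(2)[OF xZ] .
    ultimately have "(x (Suc m) (Suc m) \<ominus>\<^bsub>M\<^esub> x m (Suc m)) \<oplus>\<^bsub>M\<^esub> (x m (Suc m) \<ominus>\<^bsub>M\<^esub> x m m) \<in> P m S"
      using submoduleE(5)[OF P_sub[OF bddD(1)[OF S]]] by blast
    then show "y (Suc m) \<ominus>\<^bsub>M\<^esub> y m \<in> P m S" unfolding y_def using diff_trans[OF c c c] by simp
  qed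
  have step: "cls u \<in> scaled QC (\<pi> [^]\<^bsub>V\<^esub> n) (cls ` Z S)" if u: "u \<in> Z S" "u n \<in> P n S" for u and n :: nat
  proof -
    obtain v where v: "v \<in> Z S" "u \<ominus>\<^bsub>C\<^esub> (\<pi> [^]\<^bsub>V\<^esub> n) \<odot>\<^bsub>C\<^esub> v \<in> K" using divide[OF S u] by blast
    have "(\<pi> [^]\<^bsub>V\<^esub> n) \<odot>\<^bsub>C\<^esub> v \<in> carrier C" by (rule Cm.smult_closed[OF pin ZC[OF v(1)]])
    then have "cls u = cls ((\<pi> [^]\<^bsub>V\<^esub> n) \<odot>\<^bsub>C\<^esub> v)" using Qc.cls_eq[OF ZC[OF u(1)]] v(2) by blast
    then show ?thesis using scaled_cls[OF S pin] v(1) by blast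
  qed
  show "\<exists>!Y. Y \<in> cls ` Z S \<and> (\<forall>n. Y \<ominus>\<^bsub>QC\<^esub> X n \<in> scaled QC (\<pi> [^]\<^bsub>V\<^esub> n) (cls ` Z S))"
  proof (rule ex_ex1I)
    have "cls y \<ominus>\<^bsub>QC\<^esub> X n \<in> scaled QC (\<pi> [^]\<^bsub>V\<^esub> n) (cls ` Z S)" for n
    proof -
      have "(y \<ominus>\<^bsub>C\<^esub> x n) n = \<zero>\<^bsub>M\<^esub>"
        using C_minus[OF ZC[OF yZ] ZC[OF xZ]] c by (simp add: y_def a_minus_def M.r_neg)
      then have "(y \<ominus>\<^bsub>C\<^esub> x n) n \<in> P n S" using submodule_zero[OF P_sub[OF bddD(1)[OF S]]] by metis
      then have "cls (y \<ominus>\<^bsub>C\<^esub> x n) \<in> scaled QC (\<pi> [^]\<^bsub>V\<^esub> n) (cls ` Z S)"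
        using step Cm.submodule_minus[OF ZS yZ xZ] by blast
      then show ?thesis using Qc.Q_minus[OF ZC[OF yZ] ZC[OF xZ]] Xx by metis
    qed
    then show "\<exists>Y. Y \<in> cls ` Z S \<and> (\<forall>n. Y \<ominus>\<^bsub>QC\<^esub> X n \<in> scaled QC (\<pi> [^]\<^bsub>V\<^esub> n) (cls ` Z S))"
      using yZ by blast
  next
    fix Y Y'
    assume Y: "Y \<in> cls ` Z S \<and> (\<forall>n. Y \<ominus>\<^bsub>QC\<^esub> X n \<in> scaled QC (\<pi> [^]\<^bsub>V\<^esub> n) (cls ` Z S))"
      and Y': "Y' \<in> cls ` Z S \<and> (\<forall>n. Y' \<ominus>\<^bsub>QC\<^esub> X n \<in> scaled QC (\<pi> [^]\<^bsub>V\<^esub> n) (cls ` Z S))"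
    obtain u where u: "u \<in> Z S" "Y = cls u" using Y by blast
    obtain u' where u': "u' \<in> Z S" "Y' = cls u'" using Y' by blast
    have d: "u \<ominus>\<^bsub>C\<^esub> u' \<in> Z S" using Cm.submodule_minus[OF ZS u(1) u'(1)] .
    have "\<exists>k\<in>K \<inter> Z S. (u \<ominus>\<^bsub>C\<^esub> u') n \<ominus>\<^bsub>M\<^esub> k n \<in> P n S" for n
    proof -
      obtain a where a: "a \<in> Z S" "Y \<ominus>\<^bsub>QC\<^esub> X n = cls ((\<pi> [^]\<^bsub>V\<^esub> n) \<odot>\<^bsub>C\<^esub> a)"
        using Y scaled_cls[OF S pin] by blast
      obtain b where b: "b \<in> Z S" "Y' \<ominus>\<^bsub>QC\<^esub> X n = cls ((\<pi> [^]\<^bsub>V\<^esub> n) \<odot>\<^bsub>C\<^esub> b)"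
        using Y' scaled_cls[OF S pin] by blast
      define A where "A = (\<pi> [^]\<^bsub>V\<^esub> n) \<odot>\<^bsub>C\<^esub> a"
      define B where "B = (\<pi> [^]\<^bsub>V\<^esub> n) \<odot>\<^bsub>C\<^esub> b"
      have AB: "A \<in> Z S" "B \<in> Z S" unfolding A_def B_def using Cm.submoduleE(4)[OF ZS pin] a b by blast+
      have uxC: "u \<ominus>\<^bsub>C\<^esub> x n \<in> carrier C" "u' \<ominus>\<^bsub>C\<^esub> x n \<in> carrier C"
        by (rule ZC[OF Cm.submodule_minus[OF ZS u(1) xZ]], rule ZC[OF Cm.submodule_minus[OF ZS u'(1) xZ]])
      have "cls (u \<ominus>\<^bsub>C\<^esub> x n) = cls A"
        using a(2) unfolding u(2) Xx Qc.Q_minus[OF ZC[OF u(1)] ZC[OF xZ]] A_def .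
      then have K1: "(u \<ominus>\<^bsub>C\<^esub> x n) \<ominus>\<^bsub>C\<^esub> A \<in> K"
        by (rule iffD1[OF Qc.cls_eq[OF uxC(1) ZC[OF AB(1)]]])
      have "cls (u' \<ominus>\<^bsub>C\<^esub> x n) = cls B"
        using b(2) unfolding u'(2) Xx Qc.Q_minus[OF ZC[OF u'(1)] ZC[OF xZ]] B_def .
      then have K2: "(u' \<ominus>\<^bsub>C\<^esub> x n) \<ominus>\<^bsub>C\<^esub> B \<in> K"
        by (rule iffD1[OF Qc.cls_eq[OF uxC(2) ZC[OF AB(2)]]])
      define k where "k = ((u \<ominus>\<^bsub>C\<^esub> x n) \<ominus>\<^bsub>C\<^esub> A) \<ominus>\<^bsub>C\<^esub> ((u' \<ominus>\<^bsub>C\<^esub> x n) \<ominus>\<^bsub>C\<^esub> B)"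
      have kK: "k \<in> K" unfolding k_def by (rule Cm.submodule_minus[OF K_submodule K1 K2])
      have kZ: "k \<in> Z S" unfolding k_def 
        by (intro Cm.submodule_minus[OF ZS] u(1) u'(1) xZ AB)
      have uc: "u i \<in> carrier M" "u' i \<in> carrier M" "A i \<in> carrier M" "B i \<in> carrier M" for i
        by (intro C_val ZC u(1) u'(1) AB)+
      have e: "(p \<ominus>\<^bsub>C\<^esub> q) n = p n \<ominus>\<^bsub>M\<^esub> q n" if "p \<in> Z S" "q \<in> Z S" for p q
        by (rule fun_cong[OF C_minus[OF ZC[OF that(1)] ZC[OF that(2)]]])
      have "k n = ((u n \<ominus>\<^bsub>M\<^esub> x n n) \<ominus>\<^bsub>M\<^esub> A n) \<ominus>\<^bsub>M\<^esub> ((u' n \<ominus>\<^bsub>M\<^esub> x n n) \<ominus>\<^bsub>M\<^esub> B n)"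
        unfolding k_def using e Cm.submodule_minus[OF ZS] u(1) u'(1) xZ AB by simp
      then have "(u \<ominus>\<^bsub>C\<^esub> u') n \<ominus>\<^bsub>M\<^esub> k n = A n \<ominus>\<^bsub>M\<^esub> B n"
        using C_minus[OF ZC[OF u(1)] ZC[OF u'(1)]] uc[of n] c[of n n]
          diff_identity[of "u n" "u' n" "x n n" "A n" "B n"] by simp
      moreover have "A n \<ominus>\<^bsub>M\<^esub> B n \<in> P n S"
      proof (rule submodule_minus[OF P_sub[OF bddD(1)[OF S]]])
        show "A n \<in> P n S" "B n \<in> P n S"
          unfolding A_def B_def scaled_def using Z_D(1) a b by auto
      qed
      ultimately show ?thesis using kK kZ by (metis IntI)
    qed
    then have "u \<ominus>\<^bsub>C\<^esub> u' \<in> K" using K_closed d S unfolding limit_closed_def by blast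
    then show "Y = Y'" using Qc.cls_eq[OF ZC[OF u(1)] ZC[OF u'(1)]] u u' by blast
  qed
qed

lemma completion_complete: "complete_born_module V \<pi> (completion V \<pi> M)"
  unfolding complete_born_module_def completion_def
proof (intro conjI ballI)
  show "born_module V QC" by (rule Qc.Q_born)
  fix X assume "X \<in> bounded QC"
  then obtain B where B: "X = cls ` B" "B \<in> bounded C" unfolding quot_simps(5) by blast
  obtain S where S: "S \<in> bdd_submodules V M" "B \<subseteq> Z S" using B(2) by (auto simp: cauchy_module_def)
  have "Z S \<in> bounded C" using S(1) by (auto simp: cauchy_module_def)
  then have "cls ` Z S \<in> bounded QC" unfolding quot_simps(5) by blast
  then have "cls ` Z S \<in> bdd_submodules V QC"
    using Qc.Q_submodule[OF Z_submodule[OF S(1)]] by (simp add: bdd_submodules_def)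
  then show "\<exists>S\<in>bdd_submodules V QC. adic_complete V \<pi> QC S \<and> X \<subseteq> S"
    using cls_complete[OF S(1)] B(1) S(2) by blast
qed

lemma const_C: "x \<in> carrier M \<Longrightarrow> (\<lambda>n. x) \<in> carrier C"
  using in_bdd[of x] Z_const C_carrier by metis

lemma to_completion_linear: "bdd_linear_map V M (completion V \<pi> M) (to_completion V \<pi> M)"
  unfolding bdd_linear_map_def linear_map_def completion_def to_completion_def
proof (intro conjI ballI funcsetI)
  show "cls (\<lambda>n. x) \<in> carrier QC" if "x \<in> carrier M" for x
    using const_C[OF that] unfolding Qc.Q_carrier by blast
  show "cls (\<lambda>n. x \<oplus>\<^bsub>M\<^esub> y) = cls (\<lambda>n. x) \<oplus>\<^bsub>QC\<^esub> cls (\<lambda>n. y)" if "x \<in> carrier M" "y \<in> carrier M" for x y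
    using Qc.Q_add[OF const_C[OF that(1)] const_C[OF that(2)]] by simp
  show "cls (\<lambda>n. c \<odot>\<^bsub>M\<^esub> x) = c \<odot>\<^bsub>QC\<^esub> cls (\<lambda>n. x)" if "c \<in> carrier V" "x \<in> carrier M" for c x
    using Qc.Q_smult[OF that(1) const_C[OF that(2)]] by simp
  fix B assume "B \<in> bounded M"
  then obtain S where S: "S \<in> bdd_submodules V M" "B \<subseteq> S" using cover by blast
  have "(\<lambda>x n. x) ` B \<subseteq> Z S" using Z_const[OF S(1)] S(2) by blast
  then have "(\<lambda>x n. x) ` B \<in> bounded C" using S(1) by (auto simp: cauchy_module_def)
  then have "cls ` ((\<lambda>x n. x) ` B) \<in> bounded QC" unfolding quot_simps(5) by blast
  then show "(\<lambda>x. cls (\<lambda>n. x)) ` B \<in> bounded QC" by (simp add: image_image)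
qed

end

locale complete_target = N: bmod_ctx V \<pi> N for V :: "('v, 'k) ring_scheme" and \<pi> :: 'v and N :: "('v, 'b) bmod" +
  assumes complete: "complete_born_module V \<pi> N"
begin

definition islim :: "(nat \<Rightarrow> 'b) \<Rightarrow> 'b \<Rightarrow> bool" where
  "islim z y \<longleftrightarrow> (\<exists>T\<in>bdd_submodules V N. y \<in> T \<and> (\<forall>n. y \<ominus>\<^bsub>N\<^esub> z n \<in> scaled N (\<pi> [^]\<^bsub>V\<^esub> n) T))"

lemma complete_cover:
  assumes "B \<in> bounded N"
  obtains U where "U \<in> bdd_submodules V N" "adic_complete V \<pi> N U" "B \<subseteq> U"
  using complete assms unfolding complete_born_module_def by blast

lemma complete_join:
  assumes "S \<in> bdd_submodules V N" "T \<in> bdd_submodules V N"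
  obtains U where "U \<in> bdd_submodules V N" "adic_complete V \<pi> N U" "S \<subseteq> U" "T \<subseteq> U"
proof -
  obtain W where W: "W \<in> bdd_submodules V N" "S \<subseteq> W" "T \<subseteq> W" using N.bdd_join[OF assms] by blast
  obtain U where U: "U \<in> bdd_submodules V N" "adic_complete V \<pi> N U" "W \<subseteq> U"
    using complete_cover[OF N.bddD(2)[OF W(1)]] by blast
  show thesis by (rule that[OF U(1,2)]) (use W U in blast)+
qed

lemma separated:
  assumes U: "U \<in> bdd_submodules V N" "adic_complete V \<pi> N U" and w: "\<And>n. w \<in> N.P n U"
  shows "w = \<zero>\<^bsub>N\<^esub>"
proof -
  note z = N.submodule_zero[OF N.bddD(1)[OF U(1)]]
  have wU: "w \<in> U" using w[of 0] N.P_le[OF N.bddD(1)[OF U(1)]] by blast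
  have "(\<lambda>n. \<zero>\<^bsub>N\<^esub>) \<in> N.Z U" by (rule N.Z_const[OF U(1) z])
  then have ex: "\<exists>!y. y \<in> U \<and> (\<forall>n. y \<ominus>\<^bsub>N\<^esub> \<zero>\<^bsub>N\<^esub> \<in> N.P n U)"
    by (rule bspec[OF U(2)[unfolded adic_complete_def]])
  have 1: "w \<in> U \<and> (\<forall>n. w \<ominus>\<^bsub>N\<^esub> \<zero>\<^bsub>N\<^esub> \<in> N.P n U)"
    using wU w N.diff_zero[OF N.bddD(4)[OF U(1) wU]] by simp
  have 2: "\<zero>\<^bsub>N\<^esub> \<in> U \<and> (\<forall>n. \<zero>\<^bsub>N\<^esub> \<ominus>\<^bsub>N\<^esub> \<zero>\<^bsub>N\<^esub> \<in> N.P n U)"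
    using z N.diff_zero[OF N.M.zero_closed] N.submodule_zero[OF N.P_sub[OF N.bddD(1)[OF U(1)]]] by simp
  show ?thesis by (rule ex1E[OF ex]) (use 1 2 in metis)
qed

lemma islim_unique:
  assumes z: "\<And>n. z n \<in> carrier N" and y: "islim z y" and y': "islim z y'"
  shows "y = y'"
proof -
  obtain T where T: "T \<in> bdd_submodules V N" "y \<in> T" "\<And>n. y \<ominus>\<^bsub>N\<^esub> z n \<in> N.P n T"
    using y unfolding islim_def by blast
  obtain T' where T': "T' \<in> bdd_submodules V N" "y' \<in> T'" "\<And>n. y' \<ominus>\<^bsub>N\<^esub> z n \<in> N.P n T'"
    using y' unfolding islim_def by blast
  obtain U where U: "U \<in> bdd_submodules V N" "adic_complete V \<pi> N U" "T \<subseteq> U" "T' \<subseteq> U"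
    using complete_join[OF T(1) T'(1)] by blast
  have c: "y \<in> carrier N" "y' \<in> carrier N" using N.bddD(4) T T' by blast+
  have "y \<ominus>\<^bsub>N\<^esub> y' \<in> N.P n U" for n
  proof -
    have "(y \<ominus>\<^bsub>N\<^esub> z n) \<ominus>\<^bsub>N\<^esub> (y' \<ominus>\<^bsub>N\<^esub> z n) \<in> N.P n U"
    proof (rule N.submodule_minus[OF N.P_sub[OF N.bddD(1)[OF U(1)]]])
      show "y \<ominus>\<^bsub>N\<^esub> z n \<in> N.P n U" using T(3) N.P_mono[OF U(3)] by blast
      show "y' \<ominus>\<^bsub>N\<^esub> z n \<in> N.P n U" using T'(3) N.P_mono[OF U(4)] by blast
    qed
    moreover have "(y \<ominus>\<^bsub>N\<^esub> z n) \<ominus>\<^bsub>N\<^esub> (y' \<ominus>\<^bsub>N\<^esub> z n) = y \<ominus>\<^bsub>N\<^esub> y'"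
    proof -
      have "y \<ominus>\<^bsub>N\<^esub> z n = (y \<ominus>\<^bsub>N\<^esub> y') \<oplus>\<^bsub>N\<^esub> (y' \<ominus>\<^bsub>N\<^esub> z n)" by (rule N.diff_trans[OF c z])
      then show ?thesis using c z
        by (metis N.M.add.inv_solve_right' N.M.minus_closed a_minus_def)
    qed
    ultimately show ?thesis by simp
  qed
  then have "y \<ominus>\<^bsub>N\<^esub> y' = \<zero>\<^bsub>N\<^esub>" by (rule separated[OF U(1,2)])
  then show ?thesis using N.diff_zero_iff[OF c] by simp
qed

end

locale complete_ext = M: bmod_ctx V \<pi> M + complete_target V \<pi> N
  for V :: "('v, 'k) ring_scheme" and \<pi> :: 'v and M :: "('v, 'a) bmod" and N :: "('v, 'b) bmod" +
  fixes f :: "'a \<Rightarrow> 'b"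
  assumes f: "bdd_linear_map V M N f"
begin

lemma f_c: "x \<in> carrier M \<Longrightarrow> f x \<in> carrier N"
  and f_add: "x \<in> carrier M \<Longrightarrow> y \<in> carrier M \<Longrightarrow> f (x \<oplus>\<^bsub>M\<^esub> y) = f x \<oplus>\<^bsub>N\<^esub> f y"
  and f_sm: "c \<in> carrier V \<Longrightarrow> x \<in> carrier M \<Longrightarrow> f (c \<odot>\<^bsub>M\<^esub> x) = c \<odot>\<^bsub>N\<^esub> f x"
  and f_bdd: "B \<in> bounded M \<Longrightarrow> f ` B \<in> bounded N"
  using f by (auto simp: bdd_linear_map_def linear_map_def)

lemma f_minus: assumes x: "x \<in> carrier M" and y: "y \<in> carrier M"
  shows "f (x \<ominus>\<^bsub>M\<^esub> y) = f x \<ominus>\<^bsub>N\<^esub> f y"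
proof -
  have "f x = f ((x \<ominus>\<^bsub>M\<^esub> y) \<oplus>\<^bsub>M\<^esub> y)" using x y by (simp add: a_minus_def M.M.a_assoc M.M.l_neg)
  also have "\<dots> = f (x \<ominus>\<^bsub>M\<^esub> y) \<oplus>\<^bsub>N\<^esub> f y" using x y by (simp add: f_add)
  finally show ?thesis using x y f_c
    by (metis M.M.minus_closed N.M.add.inv_solve_right a_minus_def)
qed

lemma f_P: assumes "S \<subseteq> carrier M" "f ` S \<subseteq> U" "x \<in> M.P n S" shows "f x \<in> N.P n U"
proof -
  obtain s where s: "s \<in> S" "x = (\<pi> [^]\<^bsub>V\<^esub> n) \<odot>\<^bsub>M\<^esub> s" using assms(3) unfolding scaled_def by blast
  have "f x = (\<pi> [^]\<^bsub>V\<^esub> n) \<odot>\<^bsub>N\<^esub> f s" unfolding s(2) using f_sm[OF M.pin] s(1) assms(1) by blast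
  moreover have "f s \<in> U" using s(1) assms(2) by blast
  ultimately show ?thesis unfolding scaled_def by blast
qed

definition F :: "(nat \<Rightarrow> 'a) \<Rightarrow> 'b" where
  "F x = (THE y. islim (\<lambda>n. f (x n)) y)"

lemma F_eq: assumes "x \<in> carrier M.C" "islim (\<lambda>n. f (x n)) y" shows "F x = y"
  unfolding F_def
proof (rule the_equality)
  show "islim (\<lambda>n. f (x n)) y" by fact
  show "y' = y" if "islim (\<lambda>n. f (x n)) y'" for y'
    by (rule islim_unique[OF f_c[OF M.C_val[OF assms(1)]] that assms(2)])
qed

lemma F_in:
  assumes S: "S \<in> bdd_submodules V M" and U: "U \<in> bdd_submodules V N" "adic_complete V \<pi> N U"
    and SU: "f ` S \<subseteq> U" and x: "x \<in> M.Z S"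
  shows "F x \<in> U" "F x \<ominus>\<^bsub>N\<^esub> f (x n) \<in> N.P n U"
proof -
  have xS: "x n \<in> S" "x n \<in> carrier M" for n using adic_cauchyD(1)[OF x] M.bddD(4)[OF S] by blast+
  have "(\<lambda>n. f (x n)) \<in> N.Z U"
    unfolding adic_cauchy_def
  proof (intro CollectI allI conjI)
    fix n
    show "f (x n) \<in> U" using xS(1) SU by blast
    have "f (x (Suc n) \<ominus>\<^bsub>M\<^esub> x n) \<in> N.P n U"
      by (rule f_P[OF M.bddD(3)[OF S] SU adic_cauchyD(2)[OF x]])
    then show "f (x (Suc n)) \<ominus>\<^bsub>N\<^esub> f (x n) \<in> N.P n U" by (simp only: f_minus[OF xS(2) xS(2)])
  qed
  then obtain y where y: "y \<in> U" "\<And>n. y \<ominus>\<^bsub>N\<^esub> f (x n) \<in> N.P n U"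
    using ex1_implies_ex[OF bspec[OF U(2)[unfolded adic_complete_def]]] by blast
  have "islim (\<lambda>n. f (x n)) y" unfolding islim_def using U(1) y by blast
  moreover have "x \<in> carrier M.C" using M.C_carrier[of x] S x by blast
  ultimately have "F x = y" using F_eq by blast
  then show "F x \<in> U" "F x \<ominus>\<^bsub>N\<^esub> f (x n) \<in> N.P n U" using y by auto
qed

lemma target: assumes S: "S \<in> bdd_submodules V M"
  obtains U where "U \<in> bdd_submodules V N" "adic_complete V \<pi> N U" "f ` S \<subseteq> U"
  using complete_cover[OF f_bdd[OF M.bddD(2)[OF S]]] by blast

lemma F_c: assumes "x \<in> carrier M.C" shows "F x \<in> carrier N"
proof -
  obtain S where S: "S \<in> bdd_submodules V M" "x \<in> M.Z S" using assms M.C_carrier[of x] by blast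
  obtain U where U: "U \<in> bdd_submodules V N" "adic_complete V \<pi> N U" "f ` S \<subseteq> U" using target[OF S(1)] .
  show ?thesis by (rule N.bddD(4)[OF U(1) F_in(1)[OF S(1) U S(2)]])
qed

lemma F_add: assumes x: "x \<in> carrier M.C" and y: "y \<in> carrier M.C"
  shows "F (x \<oplus>\<^bsub>M.C\<^esub> y) = F x \<oplus>\<^bsub>N\<^esub> F y"
proof (rule F_eq[OF M.Cm.M.a_closed[OF x y]])
  obtain S where S: "S \<in> bdd_submodules V M" "x \<in> M.Z S" "y \<in> M.Z S" using M.C_common[OF x y] .
  obtain U where U: "U \<in> bdd_submodules V N" "adic_complete V \<pi> N U" "f ` S \<subseteq> U" using target[OF S(1)] .
  note X = F_in[OF S(1) U S(2)] and Y = F_in[OF S(1) U S(3)]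
  have "(F x \<oplus>\<^bsub>N\<^esub> F y) \<ominus>\<^bsub>N\<^esub> f (x n \<oplus>\<^bsub>M\<^esub> y n) \<in> N.P n U" for n
  proof -
    have c: "x n \<in> carrier M" "y n \<in> carrier M" using M.C_val x y by blast+
    have "(F x \<ominus>\<^bsub>N\<^esub> f (x n)) \<oplus>\<^bsub>N\<^esub> (F y \<ominus>\<^bsub>N\<^esub> f (y n)) \<in> N.P n U"
      by (rule N.submoduleE(5)[OF N.P_sub[OF N.bddD(1)[OF U(1)]] X(2) Y(2)])
    then show ?thesis
      by (simp only: f_add[OF c] N.diff_add[OF F_c[OF x] F_c[OF y] f_c[OF c(1)] f_c[OF c(2)]])
  qed
  moreover have "F x \<oplus>\<^bsub>N\<^esub> F y \<in> U" by (rule N.submoduleE(5)[OF N.bddD(1)[OF U(1)] X(1) Y(1)])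
  ultimately show "islim (\<lambda>n. f ((x \<oplus>\<^bsub>M.C\<^esub> y) n)) (F x \<oplus>\<^bsub>N\<^esub> F y)"
    unfolding islim_def M.C_simps using U(1) by blast
qed

lemma F_sm: assumes c: "c \<in> carrier V" and x: "x \<in> carrier M.C"
  shows "F (c \<odot>\<^bsub>M.C\<^esub> x) = c \<odot>\<^bsub>N\<^esub> F x"
proof (rule F_eq[OF M.Cm.smult_closed[OF c x]])
  obtain S where S: "S \<in> bdd_submodules V M" "x \<in> M.Z S" using x M.C_carrier[of x] by blast
  obtain U where U: "U \<in> bdd_submodules V N" "adic_complete V \<pi> N U" "f ` S \<subseteq> U" using target[OF S(1)] .
  note X = F_in[OF S(1) U S(2)]
  have "c \<odot>\<^bsub>N\<^esub> F x \<ominus>\<^bsub>N\<^esub> f (c \<odot>\<^bsub>M\<^esub> x n) \<in> N.P n U" for n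
  proof -
    have xn: "x n \<in> carrier M" using M.C_val x by blast
    have "c \<odot>\<^bsub>N\<^esub> (F x \<ominus>\<^bsub>N\<^esub> f (x n)) \<in> N.P n U"
      by (rule N.submoduleE(4)[OF N.P_sub[OF N.bddD(1)[OF U(1)]] c X(2)])
    then show ?thesis by (simp only: f_sm[OF c xn] N.smult_diff[OF c F_c[OF x] f_c[OF xn]])
  qed
  moreover have "c \<odot>\<^bsub>N\<^esub> F x \<in> U" by (rule N.submoduleE(4)[OF N.bddD(1)[OF U(1)] c X(1)])
  ultimately show "islim (\<lambda>n. f ((c \<odot>\<^bsub>M.C\<^esub> x) n)) (c \<odot>\<^bsub>N\<^esub> F x)"
    unfolding islim_def M.C_simps using U(1) by blast
qed

lemma F_zero: "F \<zero>\<^bsub>M.C\<^esub> = \<zero>\<^bsub>N\<^esub>"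
proof -
  have z: "\<zero>\<^bsub>M.C\<^esub> \<in> carrier M.C" by (rule M.Cm.M.zero_closed)
  have "F (\<zero>\<^bsub>V\<^esub> \<odot>\<^bsub>M.C\<^esub> \<zero>\<^bsub>M.C\<^esub>) = \<zero>\<^bsub>V\<^esub> \<odot>\<^bsub>N\<^esub> F \<zero>\<^bsub>M.C\<^esub>" by (rule F_sm[OF M.R.zero_closed z])
  then show ?thesis using N.smult_l_null[OF F_c[OF z]] M.Cm.smult_l_null[OF z] by metis
qed

lemma F_minus: assumes x: "x \<in> carrier M.C" and y: "y \<in> carrier M.C"
  shows "F (x \<ominus>\<^bsub>M.C\<^esub> y) = F x \<ominus>\<^bsub>N\<^esub> F y"
proof -
  have d: "x \<ominus>\<^bsub>M.C\<^esub> y \<in> carrier M.C" by (rule M.Cm.M.minus_closed[OF x y])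
  have "x = (x \<ominus>\<^bsub>M.C\<^esub> y) \<oplus>\<^bsub>M.C\<^esub> y"
    using x y by (simp only: a_minus_def M.Cm.M.a_assoc M.Cm.M.l_neg M.Cm.M.a_inv_closed M.Cm.M.r_zero)
  then have "F x = F (x \<ominus>\<^bsub>M.C\<^esub> y) \<oplus>\<^bsub>N\<^esub> F y" using F_add[OF d y] by metis
  then show ?thesis using F_c[OF x] F_c[OF y] F_c[OF d]
    by (metis N.M.add.inv_solve_right a_minus_def)
qed

lemma F_const: assumes x: "x \<in> carrier M" shows "F (\<lambda>n. x) = f x"
proof (rule F_eq[OF M.const_C[OF x]])
  obtain T where T: "T \<in> bdd_submodules V N" "f x \<in> T" using N.in_bdd[OF f_c[OF x]] .
  have "f x \<ominus>\<^bsub>N\<^esub> f x = \<zero>\<^bsub>N\<^esub>" using N.diff_zero_iff f_c[OF x] by blast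
  then have "f x \<ominus>\<^bsub>N\<^esub> f x \<in> N.P n T" for n
    using N.submodule_zero[OF N.P_sub[OF N.bddD(1)[OF T(1)]], of n] by simp
  then show "islim (\<lambda>n. f x) (f x)" unfolding islim_def using T by blast
qed

lemma F_null: assumes "x \<in> M.K" shows "F x = \<zero>\<^bsub>N\<^esub>"
proof -
  let ?L = "{x \<in> carrier M.C. F x = \<zero>\<^bsub>N\<^esub>}"
  have "submodule ?L V M.C"
  proof (rule M.Cm.submoduleI)
    show "?L \<subseteq> carrier M.C" by blast
    show "\<zero>\<^bsub>M.C\<^esub> \<in> ?L" using F_zero M.Cm.M.zero_closed by blast
    show "x \<oplus>\<^bsub>M.C\<^esub> y \<in> ?L" if "x \<in> ?L" "y \<in> ?L" for x y
    proof -
      have xy: "x \<in> carrier M.C" "y \<in> carrier M.C" "F x = \<zero>\<^bsub>N\<^esub>" "F y = \<zero>\<^bsub>N\<^esub>" using that by blast+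
      have "F (x \<oplus>\<^bsub>M.C\<^esub> y) = \<zero>\<^bsub>N\<^esub>" unfolding F_add[OF xy(1,2)] xy(3,4) by (rule N.M.r_zero[OF N.M.zero_closed])
      then show ?thesis using M.Cm.M.a_closed[OF xy(1,2)] by blast
    qed
    show sm: "c \<odot>\<^bsub>M.C\<^esub> x \<in> ?L" if c: "c \<in> carrier V" and "x \<in> ?L" for c x
    proof -
      have x: "x \<in> carrier M.C" "F x = \<zero>\<^bsub>N\<^esub>" using that by blast+
      have "F (c \<odot>\<^bsub>M.C\<^esub> x) = \<zero>\<^bsub>N\<^esub>" unfolding F_sm[OF c x(1)] x(2) by (rule N.smult_r_null[OF c])
      then show ?thesis using M.Cm.smult_closed[OF c x(1)] by blast
    qed
    show "\<ominus>\<^bsub>M.C\<^esub> x \<in> ?L" if "x \<in> ?L" for x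
    proof -
      have x: "x \<in> carrier M.C" using that by blast
      show ?thesis unfolding M.C_neg[OF x] by (rule sm[OF M.R.a_inv_closed[OF M.R.one_closed] that])
    qed
  qed
  moreover have "limit_closed V \<pi> M ?L"
    unfolding limit_closed_def
  proof (intro ballI impI)
    fix S x assume S: "S \<in> bdd_submodules V M" and x: "x \<in> M.Z S"
      and h: "\<forall>n. \<exists>k\<in>?L \<inter> M.Z S. x n \<ominus>\<^bsub>M\<^esub> k n \<in> M.P n S"
    obtain U where U: "U \<in> bdd_submodules V N" "adic_complete V \<pi> N U" "f ` S \<subseteq> U" using target[OF S] .
    note sub = N.P_sub[OF N.bddD(1)[OF U(1)]]
    have xC: "x \<in> carrier M.C" using M.C_carrier[of x] S x by blast
    have "F x \<in> N.P n U" for n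
    proof -
      obtain k where k: "k \<in> carrier M.C" "F k = \<zero>\<^bsub>N\<^esub>" "k \<in> M.Z S" "x n \<ominus>\<^bsub>M\<^esub> k n \<in> M.P n S"
        using h by blast
      have c: "x n \<in> carrier M" "k n \<in> carrier M" using M.C_val xC k(1) by blast+
      have "f (x n) \<ominus>\<^bsub>N\<^esub> f (k n) \<in> N.P n U"
        using f_P[OF M.bddD(3)[OF S] U(3) k(4)] by (simp only: f_minus[OF c])
      then have "(F x \<ominus>\<^bsub>N\<^esub> f (x n)) \<oplus>\<^bsub>N\<^esub> (f (x n) \<ominus>\<^bsub>N\<^esub> f (k n)) \<in> N.P n U"
        by (rule N.submoduleE(5)[OF sub F_in(2)[OF S U x]])
      then have 1: "F x \<ominus>\<^bsub>N\<^esub> f (k n) \<in> N.P n U"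
        by (simp only: N.diff_trans[OF F_c[OF xC] f_c[OF c(1)] f_c[OF c(2)], symmetric])
      have "(F x \<ominus>\<^bsub>N\<^esub> f (k n)) \<ominus>\<^bsub>N\<^esub> (F k \<ominus>\<^bsub>N\<^esub> f (k n)) \<in> N.P n U"
        by (rule N.submodule_minus[OF sub 1 F_in(2)[OF S U k(3)]])
      moreover have "(F x \<ominus>\<^bsub>N\<^esub> f (k n)) \<ominus>\<^bsub>N\<^esub> (F k \<ominus>\<^bsub>N\<^esub> f (k n)) = F x \<ominus>\<^bsub>N\<^esub> F k"
        using N.diff_trans[OF F_c[OF xC] F_c[OF k(1)] f_c[OF c(2)]] F_c[OF xC] F_c[OF k(1)] f_c[OF c(2)]
        by (metis N.M.add.inv_solve_right' N.M.minus_closed a_minus_def)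
      moreover have "F x \<ominus>\<^bsub>N\<^esub> F k = F x" unfolding k(2) by (rule N.diff_zero[OF F_c[OF xC]])
      ultimately show ?thesis by simp
    qed
    then have "F x = \<zero>\<^bsub>N\<^esub>" by (rule separated[OF U(1,2)])
    then show "x \<in> ?L" using xC by blast
  qed
  ultimately have "M.K \<subseteq> ?L" unfolding null_module_def by blast
  then show ?thesis using assms by blast
qed

definition G :: "(nat \<Rightarrow> 'a) set \<Rightarrow> 'b" where
  "G X = F (SOME x. x \<in> carrier M.C \<and> X = M.cls x)"

lemma G_cls: assumes x: "x \<in> carrier M.C" shows "G (M.cls x) = F x"
proof -
  define y where "y = (SOME y. y \<in> carrier M.C \<and> M.cls x = M.cls y)"
  have y: "y \<in> carrier M.C" "M.cls x = M.cls y" unfolding y_def by (rule someI2[of _ x]; use x in blast)+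
  have "F (x \<ominus>\<^bsub>M.C\<^esub> y) = \<zero>\<^bsub>N\<^esub>" using F_null M.Qc.cls_eq[OF x y(1)] y(2) by blast
  then have "F x = F y" using F_minus[OF x y(1)] N.diff_zero_iff[OF F_c[OF x] F_c[OF y(1)]] by simp
  then show ?thesis unfolding G_def y_def by simp
qed

lemma G_linear: "bdd_linear_map V M.QC N G"
  unfolding bdd_linear_map_def linear_map_def
proof (intro conjI ballI funcsetI)
  have car: "\<exists>x\<in>carrier M.C. X = M.cls x" if "X \<in> carrier M.QC" for X
    using that unfolding M.Qc.Q_carrier by blast
  show "G X \<in> carrier N" if "X \<in> carrier M.QC" for X
    using car[OF that] G_cls F_c by metis
  show "G (X \<oplus>\<^bsub>M.QC\<^esub> Y) = G X \<oplus>\<^bsub>N\<^esub> G Y" if XY: "X \<in> carrier M.QC" "Y \<in> carrier M.QC" for X Y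
  proof -
    obtain x where x: "x \<in> carrier M.C" "X = M.cls x" using car[OF XY(1)] by blast
    obtain y where y: "y \<in> carrier M.C" "Y = M.cls y" using car[OF XY(2)] by blast
    show ?thesis unfolding x(2) y(2) M.Qc.Q_add[OF x(1) y(1)] G_cls[OF M.Cm.M.a_closed[OF x(1) y(1)]]
        G_cls[OF x(1)] G_cls[OF y(1)] by (rule F_add[OF x(1) y(1)])
  qed
  show "G (c \<odot>\<^bsub>M.QC\<^esub> X) = c \<odot>\<^bsub>N\<^esub> G X" if c: "c \<in> carrier V" and X: "X \<in> carrier M.QC" for c X
  proof -
    obtain x where x: "x \<in> carrier M.C" "X = M.cls x" using car[OF X] by blast
    show ?thesis unfolding x(2) M.Qc.Q_smult[OF c x(1)] G_cls[OF M.Cm.smult_closed[OF c x(1)]]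
        G_cls[OF x(1)] by (rule F_sm[OF c x(1)])
  qed
  fix B assume "B \<in> bounded M.QC"
  then obtain A where A: "B = M.cls ` A" "A \<in> bounded M.C" unfolding quot_simps(5) by blast
  obtain S where S: "S \<in> bdd_submodules V M" "A \<subseteq> M.Z S" using A(2) by (auto simp: cauchy_module_def)
  obtain U where U: "U \<in> bdd_submodules V N" "adic_complete V \<pi> N U" "f ` S \<subseteq> U" using target[OF S(1)] .
  have "G (M.cls x) \<in> U" if "x \<in> A" for x
  proof -
    have x: "x \<in> M.Z S" using that S(2) by blast
    then have "x \<in> carrier M.C" using M.C_carrier[of x] S(1) by blast
    then show ?thesis using G_cls F_in(1)[OF S(1) U x] by simp
  qed
  then have "G ` B \<subseteq> U" unfolding A(1) by blast
  moreover have "\<forall>B\<in>bounded N. \<forall>A\<subseteq>B. A \<in> bounded N"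
    using N.born unfolding born_module_def bornology_on_def by meson
  ultimately show "G ` B \<in> bounded N" using N.bddD(2)[OF U(1)] by blast
qed

lemma G_ext: "x \<in> carrier M \<Longrightarrow> G (to_completion V \<pi> M x) = f x"
  unfolding to_completion_def using G_cls[OF M.const_C] F_const by simp

lemma ext_unique:
  assumes g: "bdd_linear_map V M.QC N g" and h: "bdd_linear_map V M.QC N h"
    and eq: "\<And>x. x \<in> carrier M \<Longrightarrow> g (to_completion V \<pi> M x) = h (to_completion V \<pi> M x)"
    and X: "X \<in> carrier M.QC"
  shows "g X = h X"
proof -
  obtain x where x: "x \<in> carrier M.C" "X = M.cls x" using X unfolding M.Qc.Q_carrier by blast
  obtain S where S: "S \<in> bdd_submodules V M" "x \<in> M.Z S" using x M.C_carrier[of x] by blast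
  have ZC: "z \<in> carrier M.C" if "z \<in> M.Z S" for z using M.C_carrier[of z] S(1) that by blast
  have "M.Z S \<in> bounded M.C" using S(1) by (auto simp: cauchy_module_def)
  then have bS: "M.cls ` M.Z S \<in> bounded M.QC" unfolding quot_simps(5) by blast
  have "g ` (M.cls ` M.Z S) \<in> bounded N" "h ` (M.cls ` M.Z S) \<in> bounded N"
    using g h bS unfolding bdd_linear_map_def by blast+
  moreover have "\<forall>A\<in>bounded N. \<forall>B\<in>bounded N. A \<union> B \<in> bounded N"
    using N.born unfolding born_module_def bornology_on_def by meson
  ultimately have "g ` (M.cls ` M.Z S) \<union> h ` (M.cls ` M.Z S) \<in> bounded N" by blast
  then obtain U where U: "U \<in> bdd_submodules V N" "adic_complete V \<pi> N U"
    "g ` (M.cls ` M.Z S) \<union> h ` (M.cls ` M.Z S) \<subseteq> U" using complete_cover by blast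
  have Qc: "M.cls z \<in> carrier M.QC" if "z \<in> carrier M.C" for z using that unfolding M.Qc.Q_carrier by blast
  have cN: "g Y \<in> carrier N" "h Y \<in> carrier N" if "Y \<in> carrier M.QC" for Y
    using g h that unfolding bdd_linear_map_def linear_map_def by blast+
  have "g X \<ominus>\<^bsub>N\<^esub> h X \<in> N.P n U" for n
  proof -
    have xn: "x n \<in> S" "x n \<in> carrier M" using adic_cauchyD(1)[OF S(2)] M.bddD(4)[OF S(1)] by blast+
    define c where "c = (\<lambda>i::nat. x n)"
    have c: "c \<in> M.Z S" unfolding c_def by (rule M.Z_const[OF S(1) xn(1)])
    have d: "x \<ominus>\<^bsub>M.C\<^esub> c \<in> M.Z S" by (rule M.Cm.submodule_minus[OF M.Z_submodule[OF S(1)] S(2) c])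
    have "(x \<ominus>\<^bsub>M.C\<^esub> c) n = x n \<ominus>\<^bsub>M\<^esub> x n"
      using fun_cong[OF M.C_minus[OF x(1) ZC[OF c]], of n] by (simp add: c_def)
    then have "(x \<ominus>\<^bsub>M.C\<^esub> c) n = \<zero>\<^bsub>M\<^esub>" using M.diff_zero_iff[OF xn(2) xn(2)] by simp
    then have "(x \<ominus>\<^bsub>M.C\<^esub> c) n \<in> M.P n S"
      using M.submodule_zero[OF M.P_sub[OF M.bddD(1)[OF S(1)]]] by simp
    then obtain w where w: "w \<in> M.Z S" "(x \<ominus>\<^bsub>M.C\<^esub> c) \<ominus>\<^bsub>M.C\<^esub> (\<pi> [^]\<^bsub>V\<^esub> n) \<odot>\<^bsub>M.C\<^esub> w \<in> M.K"
      using M.divide[OF S(1) d] by blast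
    note wC = M.Cm.smult_closed[OF M.pin ZC[OF w(1)], of n]
    have "M.cls (x \<ominus>\<^bsub>M.C\<^esub> c) = M.cls ((\<pi> [^]\<^bsub>V\<^esub> n) \<odot>\<^bsub>M.C\<^esub> w)"
      by (rule iffD2[OF M.Qc.cls_eq[OF ZC[OF d] wC] w(2)])
    moreover have "x = (x \<ominus>\<^bsub>M.C\<^esub> c) \<oplus>\<^bsub>M.C\<^esub> c"
      using x(1) ZC[OF c]
      by (simp only: a_minus_def M.Cm.M.a_assoc M.Cm.M.l_neg M.Cm.M.a_inv_closed M.Cm.M.r_zero)
    ultimately have Xeq: "X = ((\<pi> [^]\<^bsub>V\<^esub> n) \<odot>\<^bsub>M.QC\<^esub> M.cls w) \<oplus>\<^bsub>M.QC\<^esub> M.cls c"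
      using M.Qc.Q_add[OF ZC[OF d] ZC[OF c]] M.Qc.Q_smult[OF M.pin ZC[OF w(1)], of n] x(2) by metis
    have lin: "k X = (\<pi> [^]\<^bsub>V\<^esub> n) \<odot>\<^bsub>N\<^esub> k (M.cls w) \<oplus>\<^bsub>N\<^esub> k (M.cls c)" if "linear_map V M.QC N k" for k
    proof -
      have "k X = k ((\<pi> [^]\<^bsub>V\<^esub> n) \<odot>\<^bsub>M.QC\<^esub> M.cls w) \<oplus>\<^bsub>N\<^esub> k (M.cls c)"
        unfolding Xeq using that Qc[OF ZC[OF c]] M.Qc.Qm.smult_closed[OF M.pin Qc[OF ZC[OF w(1)]]]
        unfolding linear_map_def by blast
      moreover have "k ((\<pi> [^]\<^bsub>V\<^esub> n) \<odot>\<^bsub>M.QC\<^esub> M.cls w) = (\<pi> [^]\<^bsub>V\<^esub> n) \<odot>\<^bsub>N\<^esub> k (M.cls w)"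
        using that Qc[OF ZC[OF w(1)]] M.pin[of n] unfolding linear_map_def by blast
      ultimately show ?thesis by simp
    qed
    have gc: "g (M.cls c) = h (M.cls c)" using eq[OF xn(2)] by (simp add: to_completion_def c_def)
    have W: "g (M.cls w) \<in> U" "h (M.cls w) \<in> U" using U(3) w(1) by blast+
    have "g X \<ominus>\<^bsub>N\<^esub> h X = (\<pi> [^]\<^bsub>V\<^esub> n) \<odot>\<^bsub>N\<^esub> g (M.cls w) \<ominus>\<^bsub>N\<^esub> (\<pi> [^]\<^bsub>V\<^esub> n) \<odot>\<^bsub>N\<^esub> h (M.cls w)"
    proof -
      have gl: "g X = (\<pi> [^]\<^bsub>V\<^esub> n) \<odot>\<^bsub>N\<^esub> g (M.cls w) \<oplus>\<^bsub>N\<^esub> h (M.cls c)"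
        and hl: "h X = (\<pi> [^]\<^bsub>V\<^esub> n) \<odot>\<^bsub>N\<^esub> h (M.cls w) \<oplus>\<^bsub>N\<^esub> h (M.cls c)"
        using lin[of g] lin[of h] g h gc unfolding bdd_linear_map_def by simp_all
      have in1: "(\<pi> [^]\<^bsub>V\<^esub> n) \<odot>\<^bsub>N\<^esub> g (M.cls w) \<in> carrier N" "(\<pi> [^]\<^bsub>V\<^esub> n) \<odot>\<^bsub>N\<^esub> h (M.cls w) \<in> carrier N"
        using N.smult_closed[OF N.pin] cN[OF Qc[OF ZC[OF w(1)]]] by blast+
      have in2: "h (M.cls c) \<in> carrier N" using cN(2)[OF Qc[OF ZC[OF c]]] .
      have z: "h (M.cls c) \<ominus>\<^bsub>N\<^esub> h (M.cls c) = \<zero>\<^bsub>N\<^esub>" using N.diff_zero_iff[OF in2 in2] by simp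
      show ?thesis unfolding gl hl N.diff_add[OF in1(1) in2 in1(2) in2] z
        by (rule N.M.r_zero[OF N.M.minus_closed[OF in1]])
    qed
    moreover have "\<dots> \<in> N.P n U"
      by (rule N.submodule_minus[OF N.P_sub[OF N.bddD(1)[OF U(1)]]]) (use W in \<open>auto simp: scaled_def\<close>)
    ultimately show ?thesis by simp
  qed
  then have "g X \<ominus>\<^bsub>N\<^esub> h X = \<zero>\<^bsub>N\<^esub>" by (rule separated[OF U(1,2)])
  then show ?thesis using N.diff_zero_iff[OF cN[OF X]] by simp
qed

end

theorem completion_universal:
  fixes V :: "('v, 'k) ring_scheme" and M :: "('v, 'a) bmod" and N :: "('v, 'b) bmod"
  assumes M: "born_module V M" and \<pi>: "\<pi> \<in> carrier V"
  shows "complete_born_module V \<pi> (completion V \<pi> M)"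
    and "bdd_linear_map V M (completion V \<pi> M) (to_completion V \<pi> M)"
    and "complete_born_module V \<pi> N \<Longrightarrow> bdd_linear_map V M N f \<Longrightarrow>
      \<exists>g. bdd_linear_map V (completion V \<pi> M) N g \<and>
        (\<forall>x\<in>carrier M. g (to_completion V \<pi> M x) = f x) \<and>
        (\<forall>h. bdd_linear_map V (completion V \<pi> M) N h \<and>
          (\<forall>x\<in>carrier M. h (to_completion V \<pi> M x) = f x) \<longrightarrow>
          (\<forall>X\<in>carrier (completion V \<pi> M). h X = g X))"
proof -
  interpret bmod_ctx V \<pi> M by (rule bmod_ctx.intro[OF M \<pi>])
  show "complete_born_module V \<pi> (completion V \<pi> M)" by (rule completion_complete)
  show "bdd_linear_map V M (completion V \<pi> M) (to_completion V \<pi> M)" by (rule to_completion_linear)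
  assume N: "complete_born_module V \<pi> N" and f: "bdd_linear_map V M N f"
  then have bN: "born_module V N" by (simp add: complete_born_module_def)
  interpret E: complete_ext V \<pi> M N f
    by (intro complete_ext.intro complete_target.intro complete_ext_axioms.intro
        complete_target_axioms.intro bmod_ctx.intro M bN \<pi> N f)
  have G: "bdd_linear_map V (completion V \<pi> M) N E.G"
    unfolding completion_def by (rule E.G_linear)
  show "\<exists>g. bdd_linear_map V (completion V \<pi> M) N g \<and>
        (\<forall>x\<in>carrier M. g (to_completion V \<pi> M x) = f x) \<and>
        (\<forall>h. bdd_linear_map V (completion V \<pi> M) N h \<and>
          (\<forall>x\<in>carrier M. h (to_completion V \<pi> M x) = f x) \<longrightarrow>
          (\<forall>X\<in>carrier (completion V \<pi> M). h X = g X))"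
  proof (intro exI[of _ E.G] conjI ballI allI impI)
    show "bdd_linear_map V (completion V \<pi> M) N E.G" by (rule G)
    show "E.G (to_completion V \<pi> M x) = f x" if "x \<in> carrier M" for x by (rule E.G_ext[OF that])
    fix h X
    assume h: "bdd_linear_map V (completion V \<pi> M) N h \<and>
        (\<forall>x\<in>carrier M. h (to_completion V \<pi> M x) = f x)"
      and X: "X \<in> carrier (completion V \<pi> M)"
    show "h X = E.G X"
    proof (rule E.ext_unique)
      show "bdd_linear_map V QC N h" using h unfolding completion_def by blast
      show "bdd_linear_map V QC N E.G" by (rule E.G_linear)
      show "h (to_completion V \<pi> M x) = E.G (to_completion V \<pi> M x)" if "x \<in> carrier M" for x
        using h E.G_ext[OF that] that by simp
      show "X \<in> carrier QC" using X unfolding completion_def .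
    qed
  qed
qed

end

theory Submission
  imports Defs
begin

text \<open>
  Let \<open>s\<close> be a bounded linear map from \<open>R\<close> to a complete algebra, with curvature
  \<open>w(x, y) = s(x) s(y) - s(xy)\<close>, and let \<open>\<psi>\<close> be the map \<open>x\<^sub>0 dx\<^sub>1 dx\<^sub>2 \<mapsto> s(x\<^sub>0) w(x\<^sub>1, x\<^sub>2)\<close> on \<open>2\<close>-forms. A
  connection \<open>\<nabla>\<close> gives a map \<open>\<phi> = \<nabla> \<circ> d\<close> with \<open>\<phi>(xy) = x \<phi>(y) + \<phi>(x) y + dx dy\<close>, and therefore the
  curvature of the Newton step \<open>s + \<psi> \<circ> \<phi>\<close> is quadratic in \<open>w\<close>: it is a sum of products of two
  curvature factors. So the \<open>k\<close>-th iterate has curvature of order \<open>2\<^sup>k\<close>, and finite degree of \<open>\<nabla>\<close> makes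
  the degree of a term with \<open>N\<close> curvature factors, measured by the powers of a bounded submodule, grow
  only linearly in \<open>N\<close>. When the curvature takes values in an analytically nilpotent kernel, products of
  \<open>N\<close> factors are divisible by \<open>\<pi>\<close> to a power proportional to \<open>N\<close>. This beats the growth in degree, so the
  iterates converge to a homomorphism that is bounded for the linear growth bornology, and it extends to
  the dagger completion. The construction is natural in the target and does not move multiplicative maps;
  hence the limits at the levels of \<open>E\<close> form a morphism of pro-algebras and still split \<open>p\<close>.
\<close>

section \<open>Linear and bilinear maps\<close>

text \<open>The arguments of the curvature run through all powers of a bounded submodule
  \<open>M\<close>, so the curvature factors of an iterate do not lie in one bounded set, and
  nilpotency of the kernel does not apply to them directly. Each factor is therefore granted a
  credit \<open>b\<close> in degree. If the connection has degree \<open>a\<close> on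
  \<open>M\<close>, then \<open>b = 2a\<close> makes the estimate reproduce itself:
  \<psi>(\<phi>(x)) and \<psi>(\<phi>(y)) may each raise the degree by \<open>a\<close>, and their
  product occurs in the next curvature. A fixed credit per factor is harmless, because passing from
  \<open>M\<close> to \<open>M + ... + M^c\<close> divides its cost in powers of \<pi> by
  \<open>c\<close>, and \<open>c\<close> is chosen after \<open>b\<close> and the rate of nilpotency
  are known. The second obstacle is that the kernel is only a projective system: curvature at level
  \<open>n\<close> of \<open>E\<close> becomes small only under a structure map to level
  \<open>m\<close>. The estimates are made at level \<open>n\<close>, pushed forward, and divided by
  powers of \<pi> at level \<open>m\<close>, where torsion-freeness permits this. Naturality
  identifies the result with the iteration at level \<open>m\<close>, where the limit is
  taken.\<close>

context module
begin

lemma subI: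
  assumes "H \<subseteq> carrier M" "\<zero>\<^bsub>M\<^esub> \<in> H" "\<And>a b. a \<in> H \<Longrightarrow> b \<in> H \<Longrightarrow> a \<oplus>\<^bsub>M\<^esub> b \<in> H"
    and sm: "\<And>c a. c \<in> carrier R \<Longrightarrow> a \<in> H \<Longrightarrow> c \<odot>\<^bsub>M\<^esub> a \<in> H"
  shows "submodule H R M"
proof (rule submoduleI[OF assms(1,2) _ assms(3) sm])
  fix a assume a: "a \<in> H"
  have "\<ominus>\<^bsub>M\<^esub> a = (\<ominus> \<one>) \<odot>\<^bsub>M\<^esub> a" using a assms(1) by (simp add: smult_l_minus subsetD)
  then show "\<ominus>\<^bsub>M\<^esub> a \<in> H" using sm[OF _ a] by simp
qed

lemma span_least: "submodule S R M \<Longrightarrow> X \<subseteq> S \<Longrightarrow> span_in R M X \<subseteq> S"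
  by (auto simp: span_in_def)

lemma span_sup: "X \<subseteq> span_in R M X" by (auto simp: span_in_def)

lemma span_sub: assumes X: "X \<subseteq> carrier M" shows "submodule (span_in R M X) R M"
proof (rule subI)
  show "span_in R M X \<subseteq> carrier M" by (rule span_least[OF carrier_is_submodule X])
  show "\<zero>\<^bsub>M\<^esub> \<in> span_in R M X" by (auto simp: span_in_def submodule_zero)
  show "a \<oplus>\<^bsub>M\<^esub> b \<in> span_in R M X" if "a \<in> span_in R M X" "b \<in> span_in R M X" for a b
    using that submoduleE(5) by (auto simp: span_in_def)
  show "c \<odot>\<^bsub>M\<^esub> a \<in> span_in R M X" if "c \<in> carrier R" "a \<in> span_in R M X" for c a
    using that submoduleE(4) by (auto simp: span_in_def)
qed

lemma span_carrier: "X \<subseteq> carrier M \<Longrightarrow> span_in R M X \<subseteq> carrier M"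
  by (rule span_least[OF carrier_is_submodule])

lemma span_mono: "X \<subseteq> Y \<Longrightarrow> span_in R M X \<subseteq> span_in R M Y"
  by (auto simp: span_in_def)

lemma span_Un_decomp:
  assumes S: "submodule S R M" and T: "submodule T R M" and x: "x \<in> span_in R M (S \<union> T)"
  shows "\<exists>s\<in>S. \<exists>t\<in>T. x = s \<oplus>\<^bsub>M\<^esub> t"
proof -
  let ?U = "{s \<oplus>\<^bsub>M\<^esub> t |s t. s \<in> S \<and> t \<in> T}"
  note C = submoduleE(1)[OF S, THEN subsetD] submoduleE(1)[OF T, THEN subsetD]
  have "submodule ?U R M"
  proof (rule subI)
    show "?U \<subseteq> carrier M" using C M.a_closed by blast
    show "\<zero>\<^bsub>M\<^esub> \<in> ?U" using submodule_zero[OF S] submodule_zero[OF T] M.l_zero[OF M.zero_closed, symmetric] by blast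
    show "a \<oplus>\<^bsub>M\<^esub> b \<in> ?U" if ab: "a \<in> ?U" "b \<in> ?U" for a b
    proof -
      obtain s t s' t' where h: "s \<in> S" "t \<in> T" "s' \<in> S" "t' \<in> T" "a = s \<oplus>\<^bsub>M\<^esub> t" "b = s' \<oplus>\<^bsub>M\<^esub> t'"
        using ab by auto
      have "a \<oplus>\<^bsub>M\<^esub> b = (s \<oplus>\<^bsub>M\<^esub> s') \<oplus>\<^bsub>M\<^esub> (t \<oplus>\<^bsub>M\<^esub> t')" using h C by (simp add: M.a_ac)
      then show ?thesis using submoduleE(5)[OF S h(1,3)] submoduleE(5)[OF T h(2,4)] by blast
    qed
    show "c \<odot>\<^bsub>M\<^esub> a \<in> ?U" if c: "c \<in> carrier R" "a \<in> ?U" for c a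
    proof -
      obtain s t where h: "s \<in> S" "t \<in> T" "a = s \<oplus>\<^bsub>M\<^esub> t" using c by auto
      have "c \<odot>\<^bsub>M\<^esub> a = c \<odot>\<^bsub>M\<^esub> s \<oplus>\<^bsub>M\<^esub> c \<odot>\<^bsub>M\<^esub> t" using h C c(1) by (simp add: smult_r_distr)
      then show ?thesis using submoduleE(4)[OF S c(1) h(1)] submoduleE(4)[OF T c(1) h(2)] by blast
    qed
  qed
  moreover have "S \<union> T \<subseteq> ?U"
  proof
    fix y assume "y \<in> S \<union> T"
    then show "y \<in> ?U"
    proof
      assume y: "y \<in> S"
      then have "y = y \<oplus>\<^bsub>M\<^esub> \<zero>\<^bsub>M\<^esub>" using C(1) by simp
      then show ?thesis using y submodule_zero[OF T] by blast
    next
      assume y: "y \<in> T"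
      then have "y = \<zero>\<^bsub>M\<^esub> \<oplus>\<^bsub>M\<^esub> y" using C(2) by simp
      then show ?thesis using y submodule_zero[OF S] by blast
    qed
  qed
  ultimately show ?thesis using span_least x by blast
qed

text \<open>Two elements of the union lie in a common member. The application is to the spans of
  bounded rectangles of pure tensors, whose union turns out to be the whole tensor product.\<close>

lemma directed_Union_sub:
  assumes "\<F> \<noteq> {}" "\<And>S. S \<in> \<F> \<Longrightarrow> submodule S R M"
    and dir: "\<And>S T. S \<in> \<F> \<Longrightarrow> T \<in> \<F> \<Longrightarrow> \<exists>U\<in>\<F>. S \<subseteq> U \<and> T \<subseteq> U"
  shows "submodule (\<Union>\<F>) R M"
proof (rule subI)
  show "\<Union>\<F> \<subseteq> carrier M" using assms(2) submoduleE(1) by blast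
  show "\<zero>\<^bsub>M\<^esub> \<in> \<Union>\<F>" using assms(1,2) submodule_zero by blast
  show "a \<oplus>\<^bsub>M\<^esub> b \<in> \<Union>\<F>" if ab: "a \<in> \<Union>\<F>" "b \<in> \<Union>\<F>" for a b
  proof -
    obtain S T where ST: "S \<in> \<F>" "a \<in> S" "T \<in> \<F>" "b \<in> T" using ab by blast
    obtain U where "U \<in> \<F>" "S \<subseteq> U" "T \<subseteq> U" using dir[OF ST(1,3)] by blast
    then show ?thesis using submoduleE(5)[OF assms(2)[OF \<open>U \<in> \<F>\<close>]] ST by blast
  qed
  show "c \<odot>\<^bsub>M\<^esub> a \<in> \<Union>\<F>" if "c \<in> carrier R" "a \<in> \<Union>\<F>" for c a
    using that assms(2) submoduleE(4) by blast
qed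

lemma smult_pow_add:
  assumes "c \<in> carrier R" "x \<in> carrier M"
  shows "(c [^] (m + n :: nat)) \<odot>\<^bsub>M\<^esub> x = (c [^] m) \<odot>\<^bsub>M\<^esub> ((c [^] n) \<odot>\<^bsub>M\<^esub> x)"
  using assms by (simp add: R.nat_pow_mult[symmetric] smult_assoc1)

end

text \<open>Tensor products and the linear growth bornology arise by overwriting the field
  \<open>bounded\<close> of an existing record. Module theory does not read that field, so the
  algebraic facts carry over.\<close>

lemma module_bounded_update:
  "module V M \<Longrightarrow> module V (M\<lparr>bounded := b\<rparr>)"
  "submodule S V (M\<lparr>bounded := b\<rparr>) = submodule S V M"
  "span_in V (M\<lparr>bounded := b\<rparr>) X = span_in V M X"
proof -
  show *: "submodule S V (M\<lparr>bounded := b\<rparr>) = submodule S V M" for S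
    by (simp add: submodule_def submodule_axioms_def subgroup_def a_inv_def[symmetric] m_inv_def)
  show "span_in V (M\<lparr>bounded := b\<rparr>) X = span_in V M X" by (simp add: span_in_def *)
  show "module V M \<Longrightarrow> module V (M\<lparr>bounded := b\<rparr>)"
    by (simp add: module_def abelian_group_def abelian_monoid_def abelian_group_axioms_def module_axioms_def)
qed

section \<open>Linear and bounded linear maps\<close>

lemma linear_mapD:
  assumes "linear_map V M N f"
  shows "x \<in> carrier M \<Longrightarrow> f x \<in> carrier N"
    and "x \<in> carrier M \<Longrightarrow> y \<in> carrier M \<Longrightarrow> f (x \<oplus>\<^bsub>M\<^esub> y) = f x \<oplus>\<^bsub>N\<^esub> f y"
    and "c \<in> carrier V \<Longrightarrow> x \<in> carrier M \<Longrightarrow> f (c \<odot>\<^bsub>M\<^esub> x) = c \<odot>\<^bsub>N\<^esub> f x"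
  using assms by (auto simp: linear_map_def)

lemma linear_mapI:
  assumes "\<And>x. x \<in> carrier M \<Longrightarrow> f x \<in> carrier N"
    and "\<And>x y. x \<in> carrier M \<Longrightarrow> y \<in> carrier M \<Longrightarrow> f (x \<oplus>\<^bsub>M\<^esub> y) = f x \<oplus>\<^bsub>N\<^esub> f y"
    and "\<And>c x. c \<in> carrier V \<Longrightarrow> x \<in> carrier M \<Longrightarrow> f (c \<odot>\<^bsub>M\<^esub> x) = c \<odot>\<^bsub>N\<^esub> f x"
  shows "linear_map V M N f"
  using assms by (auto simp: linear_map_def)

lemma bdd_linear_mapD:
  assumes "bdd_linear_map V M N f"
  shows "linear_map V M N f" "B \<in> bounded M \<Longrightarrow> f ` B \<in> bounded N"
  using assms by (auto simp: bdd_linear_map_def)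

lemma bdd_linear_mapI:
  "linear_map V M N f \<Longrightarrow> (\<And>B. B \<in> bounded M \<Longrightarrow> f ` B \<in> bounded N) \<Longrightarrow> bdd_linear_map V M N f"
  by (auto simp: bdd_linear_map_def)

lemma linear_map_comp:
  "linear_map V M N f \<Longrightarrow> linear_map V N P g \<Longrightarrow> linear_map V M P (\<lambda>x. g (f x))"
  by (auto simp: linear_map_def Pi_def)

lemma bdd_linear_map_comp:
  "bdd_linear_map V M N f \<Longrightarrow> bdd_linear_map V N P g \<Longrightarrow> bdd_linear_map V M P (\<lambda>x. g (f x))"
  unfolding bdd_linear_map_def using linear_map_comp[of V M N f P g] by (auto simp: image_image[symmetric, of g f])

lemma linear_map_cong:
  "(\<And>x. x \<in> carrier M \<Longrightarrow> f x = g x) \<Longrightarrow> module V M \<Longrightarrow> linear_map V M N f \<Longrightarrow> linear_map V M N g"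
  unfolding linear_map_def module_def abelian_group_def module_axioms_def
  by (auto simp: Pi_def abelian_monoid.a_closed)

lemma linear_zero:
  assumes "module V M" "module V N" "linear_map V M N f"
  shows "f \<zero>\<^bsub>M\<^esub> = \<zero>\<^bsub>N\<^esub>"
proof -
  interpret M: module V M by fact
  interpret N: module V N by fact
  show ?thesis using linear_mapD(3)[OF assms(3) M.R.zero_closed M.M.zero_closed]
    linear_mapD(1)[OF assms(3) M.M.zero_closed] by simp
qed

lemma linear_neg:
  assumes "module V M" "module V N" "linear_map V M N f" "x \<in> carrier M"
  shows "f (\<ominus>\<^bsub>M\<^esub> x) = \<ominus>\<^bsub>N\<^esub> f x"
proof -
  interpret M: module V M by fact
  interpret N: module V N by fact
  show ?thesis using linear_mapD(3)[OF assms(3) M.R.a_inv_closed[OF M.R.one_closed] assms(4)]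
    linear_mapD(1)[OF assms(3,4)] assms(4) by (simp add: M.smult_l_minus N.smult_l_minus)
qed

lemma linear_diff:
  assumes "module V M" "module V N" "linear_map V M N f" "x \<in> carrier M" "y \<in> carrier M"
  shows "f (x \<ominus>\<^bsub>M\<^esub> y) = f x \<ominus>\<^bsub>N\<^esub> f y"
proof -
  interpret M: module V M by fact
  show ?thesis using linear_neg[OF assms(1-3,5)] linear_mapD(2)[OF assms(3,4)] assms(5)
    by (simp add: a_minus_def)
qed

lemma linear_preimage:
  assumes "module V M" "module V N" "linear_map V M N f" "submodule T V N"
  shows "submodule {x \<in> carrier M. f x \<in> T} V M"
proof -
  interpret M: module V M by fact
  interpret N: module V N by fact
  show ?thesis using linear_mapD[OF assms(3)] linear_zero[OF assms(1-3)] N.submodule_zero[OF assms(4)]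
      N.submoduleE(4,5)[OF assms(4)]
    by (intro M.subI) auto
qed

lemma linear_image:
  assumes "module V M" "module V N" "linear_map V M N f" "submodule S V M"
  shows "submodule (f ` S) V N"
proof -
  interpret M: module V M by fact
  interpret N: module V N by fact
  note S = M.submoduleE[OF assms(4)]
  have c: "x \<in> S \<Longrightarrow> x \<in> carrier M" for x using S(1) by blast
  show ?thesis
  proof (rule N.subI)
    show "f ` S \<subseteq> carrier N" using linear_mapD(1)[OF assms(3)] c by blast
    show "\<zero>\<^bsub>N\<^esub> \<in> f ` S"
      using linear_zero[OF assms(1-3)] M.submodule_zero[OF assms(4)] by force
    fix a b assume "a \<in> f ` S" "b \<in> f ` S"
    then obtain x y where "x \<in> S" "y \<in> S" "a = f x" "b = f y" by blast
    then show "a \<oplus>\<^bsub>N\<^esub> b \<in> f ` S"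
      by (intro image_eqI[of _ _ "x \<oplus>\<^bsub>M\<^esub> y"]) (simp_all add: linear_mapD(2)[OF assms(3)] c S(5))
  next
    fix k a assume "k \<in> carrier V" "a \<in> f ` S"
    then obtain x where "x \<in> S" "a = f x" by blast
    then show "k \<odot>\<^bsub>N\<^esub> a \<in> f ` S" using \<open>k \<in> carrier V\<close>
      by (intro image_eqI[of _ _ "k \<odot>\<^bsub>M\<^esub> x"]) (simp_all add: linear_mapD(3)[OF assms(3)] c S(4))
  qed
qed

lemma linear_span_in:
  assumes "module V M" "module V N" "linear_map V M N f" "submodule T V N" "X \<subseteq> carrier M"
    "\<And>x. x \<in> X \<Longrightarrow> f x \<in> T" "x \<in> span_in V M X"
  shows "f x \<in> T"
  using module.span_least[OF assms(1) linear_preimage[OF assms(1-4)], of X] assms(5-7) by blast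

lemma linear_span_eq:
  assumes "module V M" "module V N" "linear_map V M N f" "linear_map V M N g" "X \<subseteq> carrier M"
    "\<And>x. x \<in> X \<Longrightarrow> f x = g x" "x \<in> span_in V M X"
  shows "f x = g x"
proof -
  interpret M: module V M by fact
  interpret N: module V N by fact
  have "submodule {x \<in> carrier M. f x = g x} V M"
    using linear_mapD[OF assms(3)] linear_mapD[OF assms(4)] linear_zero[OF assms(1-3)] linear_zero[OF assms(1,2,4)]
    by (intro M.subI) auto
  then show ?thesis using M.span_least[of _ X] assms(5-7) by blast
qed

lemma linear_map_add:
  assumes "module V N" "linear_map V M N f" "linear_map V M N g"
  shows "linear_map V M N (\<lambda>x. f x \<oplus>\<^bsub>N\<^esub> g x)"
proof -
  interpret N: module V N by fact
  show ?thesis using linear_mapD[OF assms(2)] linear_mapD[OF assms(3)]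
    by (intro linear_mapI) (simp_all add: N.M.a_ac N.smult_r_distr)
qed

lemma linear_map_diff:
  assumes "module V N" "linear_map V M N f" "linear_map V M N g"
  shows "linear_map V M N (\<lambda>x. f x \<ominus>\<^bsub>N\<^esub> g x)"
proof -
  interpret N: module V N by fact
  show ?thesis using linear_mapD[OF assms(2)] linear_mapD[OF assms(3)]
    by (intro linear_mapI) (simp_all add: N.M.a_ac N.smult_r_distr a_minus_def N.M.minus_add N.smult_r_minus)
qed

lemma linear_map_zero: "module V N \<Longrightarrow> linear_map V M N (\<lambda>x. \<zero>\<^bsub>N\<^esub>)"
proof -
  assume "module V N"
  then interpret N: module V N .
  show ?thesis by (intro linear_mapI) auto
qed

lemma linear_map_smult:
  assumes "module V N" "linear_map V M N f" "c \<in> carrier V"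
  shows "linear_map V M N (\<lambda>x. c \<odot>\<^bsub>N\<^esub> f x)"
proof -
  interpret N: module V N by fact
  show ?thesis using linear_mapD[OF assms(2)] assms(3)
    by (intro linear_mapI) (simp_all add: N.smult_r_distr N.smult_assoc1[symmetric] N.R.m_comm)
qed

section \<open>Bornological modules\<close>

lemma born_moduleD:
  assumes "born_module V M"
  shows "module V M" "A \<in> bounded M \<Longrightarrow> B \<in> bounded M \<Longrightarrow> A \<union> B \<in> bounded M"
    "B \<in> bounded M \<Longrightarrow> A \<subseteq> B \<Longrightarrow> A \<in> bounded M" "B \<in> bounded M \<Longrightarrow> B \<subseteq> carrier M"
    "A \<subseteq> carrier M \<Longrightarrow> finite A \<Longrightarrow> A \<in> bounded M"
    "B \<in> bounded M \<Longrightarrow> \<exists>S\<in>bdd_submodules V M. B \<subseteq> S"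
proof -
  note n = assms[unfolded born_module_def bornology_on_def]
  show "module V M" using n by blast
  show "A \<in> bounded M \<Longrightarrow> B \<in> bounded M \<Longrightarrow> A \<union> B \<in> bounded M" using n by meson
  show "B \<in> bounded M \<Longrightarrow> A \<subseteq> B \<Longrightarrow> A \<in> bounded M" using n by meson
  show "B \<in> bounded M \<Longrightarrow> B \<subseteq> carrier M" using n by (meson PowD subsetD)
  show "A \<subseteq> carrier M \<Longrightarrow> finite A \<Longrightarrow> A \<in> bounded M" using n by meson
  show "B \<in> bounded M \<Longrightarrow> \<exists>S\<in>bdd_submodules V M. B \<subseteq> S" using n by meson
qed

lemma bdd_submodulesD:
  "S \<in> bdd_submodules V M \<Longrightarrow> S \<in> bounded M" "S \<in> bdd_submodules V M \<Longrightarrow> submodule S V M"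
  by (auto simp: bdd_submodules_def)

text \<open>Every bounded set lies in a bounded submodule, so unions have to be tested on submodules
  only, and boundedness of finite sets follows from that of points by induction. In this form the
  axioms are easy to check for bornologies given by generating submodules.\<close>

lemma born_moduleI:
  assumes M: "module V M"
    and up: "\<And>B. B \<in> bounded M \<Longrightarrow> \<exists>S\<in>bounded M. submodule S V M \<and> B \<subseteq> S"
    and down: "\<And>A B. B \<in> bounded M \<Longrightarrow> A \<subseteq> B \<Longrightarrow> A \<in> bounded M"
    and un: "\<And>A B. A \<in> bounded M \<Longrightarrow> B \<in> bounded M \<Longrightarrow> submodule A V M \<Longrightarrow> submodule B V M \<Longrightarrow> A \<union> B \<in> bounded M"
    and pt: "\<And>x. x \<in> carrier M \<Longrightarrow> \<exists>B\<in>bounded M. x \<in> B"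
  shows "born_module V M"
  unfolding born_module_def bornology_on_def bdd_submodules_def
proof (intro conjI ballI allI impI M)
  interpret module V M by fact
  show "bounded M \<subseteq> Pow (carrier M)" using up submoduleE(1) by blast
  have Un: "A \<union> B \<in> bounded M" if AB: "A \<in> bounded M" "B \<in> bounded M" for A B
  proof -
    obtain S T where "S \<in> bounded M" "submodule S V M" "A \<subseteq> S" "T \<in> bounded M" "submodule T V M" "B \<subseteq> T"
      using up[OF AB(1)] up[OF AB(2)] by blast
    then show ?thesis using un[of S T] down[of "S \<union> T" "A \<union> B"] by blast
  qed
  then show "A \<union> B \<in> bounded M" if "A \<in> bounded M" "B \<in> bounded M" for A B using that .
  show "A \<in> bounded M" if "B \<in> bounded M" "A \<subseteq> B" for A B using that down by blast
  show "A \<in> bounded M" if "A \<subseteq> carrier M" "finite A" for A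
    using that(2,1)
  proof (induction A rule: finite_induct)
    case empty then show ?case using pt[OF M.zero_closed] down by blast
  next
    case (insert x A)
    obtain B where "B \<in> bounded M" "x \<in> B" using pt[of x] insert by blast
    then have "{x} \<in> bounded M" using down by blast
    then show ?case using Un[of "{x}" A] insert by simp
  qed
  show "\<exists>S\<in>{S \<in> bounded M. submodule S V M}. B \<subseteq> S" if "B \<in> bounded M" for B
    using up[OF that] by blast
qed

context bmod_ctx
begin

lemmas bd = born_moduleD[OF born]

lemma bdd_span: assumes "B \<in> bounded M" shows "span_in V M B \<in> bdd_submodules V M"
proof -
  obtain S where S: "S \<in> bdd_submodules V M" "B \<subseteq> S" using bd(6)[OF assms] by blast
  have "span_in V M B \<subseteq> S" by (rule span_least[OF bddD(1)[OF S(1)] S(2)])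
  then show ?thesis using bd(3)[OF bddD(2)[OF S(1)]] span_sub[OF bd(4)[OF assms]]
    by (simp add: bdd_submodules_def)
qed

lemma bdd_add:
  assumes "A \<in> bounded M" "B \<in> bounded M" shows "{a \<oplus>\<^bsub>M\<^esub> b |a b. a \<in> A \<and> b \<in> B} \<in> bounded M"
proof -
  obtain S where S: "S \<in> bdd_submodules V M" "A \<union> B \<subseteq> S" using bd(6)[OF bd(2)[OF assms]] by blast
  have "{a \<oplus>\<^bsub>M\<^esub> b |a b. a \<in> A \<and> b \<in> B} \<subseteq> S" using S(2) submoduleE(5)[OF bddD(1)[OF S(1)]] by blast
  then show ?thesis using bd(3)[OF bddD(2)[OF S(1)]] by blast
qed

lemma P_antimono: "submodule S V M \<Longrightarrow> m \<le> n \<Longrightarrow> P n S \<subseteq> P m S"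
  using scaled_pow_antimono[OF pi] by blast

lemma P_D: "x \<in> P n S \<longleftrightarrow> (\<exists>s\<in>S. x = (\<pi> [^]\<^bsub>V\<^esub> n) \<odot>\<^bsub>M\<^esub> s)"
  by (auto simp: scaled_def)

lemma P_0: "S \<subseteq> carrier M \<Longrightarrow> P 0 S = S"
  unfolding scaled_def by (auto simp: image_iff subset_iff)

lemma scaled_bdd:
  assumes "B \<in> bounded M" "c \<in> carrier V" shows "scaled M c B \<in> bounded M"
proof -
  obtain S where S: "S \<in> bdd_submodules V M" "B \<subseteq> S" using bd(6)[OF assms(1)] by blast
  have "scaled M c B \<subseteq> S" using S(2) submoduleE(4)[OF bddD(1)[OF S(1)] assms(2)] by (auto simp: scaled_def)
  then show ?thesis using bd(3)[OF bddD(2)[OF S(1)]] by blast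
qed

end

lemma bdd_linear_map_add:
  assumes N: "born_module V N" and f: "bdd_linear_map V M N f" and g: "bdd_linear_map V M N g" and pi: "\<pi> \<in> carrier V"
  shows "bdd_linear_map V M N (\<lambda>x. f x \<oplus>\<^bsub>N\<^esub> g x)"
proof (rule bdd_linear_mapI)
  interpret N: bmod_ctx V \<pi> N by (rule bmod_ctx.intro[OF N pi])
  show "linear_map V M N (\<lambda>x. f x \<oplus>\<^bsub>N\<^esub> g x)"
    by (rule linear_map_add[OF N.bd(1) bdd_linear_mapD(1)[OF f] bdd_linear_mapD(1)[OF g]])
  fix B assume "B \<in> bounded M"
  then have "{a \<oplus>\<^bsub>N\<^esub> b |a b. a \<in> f ` B \<and> b \<in> g ` B} \<in> bounded N"
    using N.bdd_add bdd_linear_mapD(2)[OF f] bdd_linear_mapD(2)[OF g] by blast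
  then show "(\<lambda>x. f x \<oplus>\<^bsub>N\<^esub> g x) ` B \<in> bounded N" by (rule N.bd(3)) blast
qed

lemma bdd_linear_map_smult:
  assumes N: "born_module V N" and f: "bdd_linear_map V M N f" and c: "c \<in> carrier V"
  shows "bdd_linear_map V M N (\<lambda>x. c \<odot>\<^bsub>N\<^esub> f x)"
proof (rule bdd_linear_mapI)
  interpret N: bmod_ctx V c N by (rule bmod_ctx.intro[OF N c])
  show "linear_map V M N (\<lambda>x. c \<odot>\<^bsub>N\<^esub> f x)"
    by (rule linear_map_smult[OF N.bd(1) bdd_linear_mapD(1)[OF f] c])
  fix B assume "B \<in> bounded M"
  then have "scaled N c (f ` B) \<in> bounded N" using N.scaled_bdd[OF _ c] bdd_linear_mapD(2)[OF f] by blast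
  then show "(\<lambda>x. c \<odot>\<^bsub>N\<^esub> f x) ` B \<in> bounded N" by (simp add: scaled_def image_image)
qed

lemma bdd_linear_map_diff:
  assumes N: "born_module V N" and f: "bdd_linear_map V M N f" and g: "bdd_linear_map V M N g"
    and M: "born_module V M"
  shows "bdd_linear_map V M N (\<lambda>x. f x \<ominus>\<^bsub>N\<^esub> g x)"
proof -
  interpret N: module V N by (rule born_moduleD(1)[OF N])
  note gc = linear_mapD(1)[OF bdd_linear_mapD(1)[OF g]]
  \<comment> \<open>Subtraction is addition of a multiple by -1. The scalar 1 fills the parameter
    \<open>\<pi>\<close> of \<open>bdd_linear_map_add\<close>.\<close>
  have "bdd_linear_map V M N (\<lambda>x. f x \<oplus>\<^bsub>N\<^esub> (\<ominus>\<^bsub>V\<^esub> \<one>\<^bsub>V\<^esub>) \<odot>\<^bsub>N\<^esub> g x)"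
    by (rule bdd_linear_map_add[OF N f bdd_linear_map_smult[OF N g] N.R.one_closed]) simp
  moreover have "f x \<oplus>\<^bsub>N\<^esub> (\<ominus>\<^bsub>V\<^esub> \<one>\<^bsub>V\<^esub>) \<odot>\<^bsub>N\<^esub> g x = f x \<ominus>\<^bsub>N\<^esub> g x" if "x \<in> carrier M" for x
    using gc[OF that] by (simp add: N.smult_l_minus a_minus_def)
  ultimately show ?thesis
    using linear_map_cong[OF _ born_moduleD(1)[OF M]] born_moduleD(4)[OF M]
    unfolding bdd_linear_map_def by (smt (verit, best) image_cong subsetD)
qed

section \<open>Bounded bilinear maps\<close>

definition bdd_bilinear ::
  "('v, 'k) ring_scheme \<Rightarrow> ('v, 'a) bmod \<Rightarrow> ('v, 'b) bmod \<Rightarrow> ('v, 'c) bmod \<Rightarrow> ('a \<Rightarrow> 'b \<Rightarrow> 'c) \<Rightarrow> bool" where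
  "bdd_bilinear V M N P \<beta> \<longleftrightarrow>
    (\<forall>x\<in>carrier M. linear_map V N P (\<beta> x)) \<and> (\<forall>y\<in>carrier N. linear_map V M P (\<lambda>x. \<beta> x y)) \<and>
    (\<forall>A\<in>bounded M. \<forall>B\<in>bounded N. {\<beta> x y |x y. x \<in> A \<and> y \<in> B} \<in> bounded P)"

lemma bdd_bilinearD:
  assumes "bdd_bilinear V M N P \<beta>"
  shows "x \<in> carrier M \<Longrightarrow> linear_map V N P (\<beta> x)" "y \<in> carrier N \<Longrightarrow> linear_map V M P (\<lambda>x. \<beta> x y)"
    "A \<in> bounded M \<Longrightarrow> B \<in> bounded N \<Longrightarrow> {\<beta> x y |x y. x \<in> A \<and> y \<in> B} \<in> bounded P"
  using assms by (auto simp: bdd_bilinear_def)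

lemma bdd_bilinearI:
  assumes "\<And>x. x \<in> carrier M \<Longrightarrow> linear_map V N P (\<beta> x)" "\<And>y. y \<in> carrier N \<Longrightarrow> linear_map V M P (\<lambda>x. \<beta> x y)"
    "\<And>A B. A \<in> bounded M \<Longrightarrow> B \<in> bounded N \<Longrightarrow> {\<beta> x y |x y. x \<in> A \<and> y \<in> B} \<in> bounded P"
  shows "bdd_bilinear V M N P \<beta>"
  using assms by (simp add: bdd_bilinear_def)

lemma bdd_bilinear_right:
  assumes "bdd_bilinear V M N P \<beta>" "born_module V M" "born_module V P" "x \<in> carrier M"
  shows "bdd_linear_map V N P (\<beta> x)"
proof (rule bdd_linear_mapI)
  show "linear_map V N P (\<beta> x)" by (rule bdd_bilinearD(1)[OF assms(1,4)])
  fix B assume B: "B \<in> bounded N"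
  have "{\<beta> x' y |x' y. x' \<in> {x} \<and> y \<in> B} \<in> bounded P"
    by (rule bdd_bilinearD(3)[OF assms(1) born_moduleD(5)[OF assms(2)] B]) (use assms(4) in auto)
  then show "\<beta> x ` B \<in> bounded P" by (rule born_moduleD(3)[OF assms(3)]) blast
qed

lemma bdd_bilinear_left:
  assumes "bdd_bilinear V M N P \<beta>" "born_module V N" "born_module V P" "y \<in> carrier N"
  shows "bdd_linear_map V M P (\<lambda>x. \<beta> x y)"
proof (rule bdd_linear_mapI)
  show "linear_map V M P (\<lambda>x. \<beta> x y)" by (rule bdd_bilinearD(2)[OF assms(1,4)])
  fix B assume B: "B \<in> bounded M"
  have "{\<beta> x y' |x y'. x \<in> B \<and> y' \<in> {y}} \<in> bounded P"
    by (rule bdd_bilinearD(3)[OF assms(1) B born_moduleD(5)[OF assms(2)]]) (use assms(4) in auto)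
  then show "(\<lambda>x. \<beta> x y) ` B \<in> bounded P" by (rule born_moduleD(3)[OF assms(3)]) blast
qed

lemma bdd_bilinear_comp:
  assumes \<beta>: "bdd_bilinear V M N P \<beta>" and f: "bdd_linear_map V M' M f" and g: "bdd_linear_map V N' N g"
    and h: "bdd_linear_map V P P' h"
  shows "bdd_bilinear V M' N' P' (\<lambda>x y. h (\<beta> (f x) (g y)))"
proof (rule bdd_bilinearI)
  note hl = bdd_linear_mapD(1)[OF h] and fl = bdd_linear_mapD(1)[OF f] and gl = bdd_linear_mapD(1)[OF g]
  show "linear_map V N' P' (\<lambda>y. h (\<beta> (f x) (g y)))" if "x \<in> carrier M'" for x
    by (rule linear_map_comp[OF linear_map_comp[OF gl bdd_bilinearD(1)[OF \<beta> linear_mapD(1)[OF fl that]]] hl])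
  show "linear_map V M' P' (\<lambda>x. h (\<beta> (f x) (g y)))" if "y \<in> carrier N'" for y
    by (rule linear_map_comp[OF linear_map_comp[OF fl bdd_bilinearD(2)[OF \<beta> linear_mapD(1)[OF gl that]]] hl])
  fix A B assume "A \<in> bounded M'" "B \<in> bounded N'"
  then have "h ` {\<beta> x y |x y. x \<in> f ` A \<and> y \<in> g ` B} \<in> bounded P'"
    using bdd_linear_mapD(2)[OF h bdd_bilinearD(3)[OF \<beta>]] bdd_linear_mapD(2)[OF f] bdd_linear_mapD(2)[OF g] by blast
  moreover have "h ` {\<beta> x y |x y. x \<in> f ` A \<and> y \<in> g ` B} = {h (\<beta> (f x) (g y)) |x y. x \<in> A \<and> y \<in> B}"
    by blast
  ultimately show "{h (\<beta> (f x) (g y)) |x y. x \<in> A \<and> y \<in> B} \<in> bounded P'" by simp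
qed

lemma bdd_linear_map_id: "module V M \<Longrightarrow> bdd_linear_map V M M (\<lambda>x. x)"
  by (auto simp: bdd_linear_map_def linear_map_def)

section \<open>Completed tensor products\<close>

lemma (in module) diff_self: "x \<in> carrier M \<Longrightarrow> x \<ominus>\<^bsub>M\<^esub> x = \<zero>\<^bsub>M\<^esub>"
  by (simp add: a_minus_def M.r_neg)

section \<open>Free modules\<close>

lemma free_simps:
  "f \<in> carrier (free_module V X) \<longleftrightarrow> (\<forall>p\<in>X. f p \<in> carrier V) \<and> (\<forall>p. p \<notin> X \<longrightarrow> f p = \<zero>\<^bsub>V\<^esub>) \<and> finite {p. f p \<noteq> \<zero>\<^bsub>V\<^esub>}"
  "\<zero>\<^bsub>free_module V X\<^esub> = (\<lambda>p. \<zero>\<^bsub>V\<^esub>)" "f \<oplus>\<^bsub>free_module V X\<^esub> g = (\<lambda>p. f p \<oplus>\<^bsub>V\<^esub> g p)"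
  "c \<odot>\<^bsub>free_module V X\<^esub> f = (\<lambda>p. c \<otimes>\<^bsub>V\<^esub> f p)" "bounded (free_module V X) = Pow (carrier (free_module V X))"
  by (simp_all add: free_module_def Let_def)

lemma (in cring) free_module_module: "module R (free_module R X)"
proof -
  let ?F = "free_module R X"
  have val: "f p \<in> carrier R" if "f \<in> carrier ?F" for f p using that by (cases "p \<in> X") (auto simp: free_simps)
  have supp: "finite {p. h p \<noteq> \<zero>}"
    if "f \<in> carrier ?F" "g \<in> carrier ?F" "\<And>p. f p = \<zero> \<Longrightarrow> g p = \<zero> \<Longrightarrow> h p = \<zero>" for f g h
    by (rule finite_subset[of _ "{p. f p \<noteq> \<zero>} \<union> {p. g p \<noteq> \<zero>}"]) (use that in \<open>auto simp: free_simps\<close>)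
  have cl: "h \<in> carrier ?F" if "f \<in> carrier ?F" "g \<in> carrier ?F" "\<And>p. f p = \<zero> \<Longrightarrow> g p = \<zero> \<Longrightarrow> h p = \<zero>"
    "\<And>p. h p \<in> carrier R" for f g h
    using supp[OF that(1-3)] that by (auto simp: free_simps)
  note ev = free_simps(2-4)
  show ?thesis
  proof (rule moduleI)
    show "cring R" by (rule is_cring)
    show "abelian_group ?F"
    proof (rule abelian_groupI)
      show "f \<oplus>\<^bsub>?F\<^esub> g \<in> carrier ?F" if "f \<in> carrier ?F" "g \<in> carrier ?F" for f g
        by (rule cl[OF that]) (use val[OF that(1)] val[OF that(2)] in \<open>simp_all add: ev\<close>)
      show "\<zero>\<^bsub>?F\<^esub> \<in> carrier ?F" by (auto simp: free_simps)
      show "f \<oplus>\<^bsub>?F\<^esub> g \<oplus>\<^bsub>?F\<^esub> h = f \<oplus>\<^bsub>?F\<^esub> (g \<oplus>\<^bsub>?F\<^esub> h)" if "f \<in> carrier ?F" "g \<in> carrier ?F" "h \<in> carrier ?F" for f g h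
        using val[OF that(1)] val[OF that(2)] val[OF that(3)] by (simp add: ev a_assoc)
      show "f \<oplus>\<^bsub>?F\<^esub> g = g \<oplus>\<^bsub>?F\<^esub> f" if "f \<in> carrier ?F" "g \<in> carrier ?F" for f g
        using val[OF that(1)] val[OF that(2)] by (simp add: ev a_comm)
      show "\<zero>\<^bsub>?F\<^esub> \<oplus>\<^bsub>?F\<^esub> f = f" if "f \<in> carrier ?F" for f
        using val[OF that(1)] by (simp add: ev)
      show "\<exists>g\<in>carrier ?F. g \<oplus>\<^bsub>?F\<^esub> f = \<zero>\<^bsub>?F\<^esub>" if "f \<in> carrier ?F" for f
      proof
        show "(\<lambda>p. \<ominus> f p) \<in> carrier ?F" by (rule cl[OF that that]) (use val[OF that] in simp_all)
        show "(\<lambda>p. \<ominus> f p) \<oplus>\<^bsub>?F\<^esub> f = \<zero>\<^bsub>?F\<^esub>" using val[OF that] by (simp add: ev l_neg)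
      qed
    qed
    show "c \<odot>\<^bsub>?F\<^esub> f \<in> carrier ?F" if "c \<in> carrier R" "f \<in> carrier ?F" for c f
      by (rule cl[OF that(2,2)]) (use val[OF that(2)] that(1) in \<open>simp_all add: ev\<close>)
    show "(a \<oplus> b) \<odot>\<^bsub>?F\<^esub> f = a \<odot>\<^bsub>?F\<^esub> f \<oplus>\<^bsub>?F\<^esub> b \<odot>\<^bsub>?F\<^esub> f" if "a \<in> carrier R" "b \<in> carrier R" "f \<in> carrier ?F" for a b f
      using that val[OF that(3)] by (simp add: ev l_distr)
    show "a \<odot>\<^bsub>?F\<^esub> (f \<oplus>\<^bsub>?F\<^esub> g) = a \<odot>\<^bsub>?F\<^esub> f \<oplus>\<^bsub>?F\<^esub> a \<odot>\<^bsub>?F\<^esub> g" if "a \<in> carrier R" "f \<in> carrier ?F" "g \<in> carrier ?F" for a f g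
      using that val[OF that(2)] val[OF that(3)] by (simp add: ev r_distr)
    show "(a \<otimes> b) \<odot>\<^bsub>?F\<^esub> f = a \<odot>\<^bsub>?F\<^esub> (b \<odot>\<^bsub>?F\<^esub> f)" if "a \<in> carrier R" "b \<in> carrier R" "f \<in> carrier ?F" for a b f
      using that val[OF that(3)] by (simp add: ev m_assoc)
    show "\<one> \<odot>\<^bsub>?F\<^esub> f = f" if "f \<in> carrier ?F" for f using val[OF that] by (simp add: ev)
  qed
qed

lemma (in cring) free_module_born: "born_module R (free_module R X)"
proof -
  interpret F: module R "free_module R X" by (rule free_module_module)
  show ?thesis
    by (rule born_moduleI[OF free_module_module])
       (use F.carrier_is_submodule in \<open>auto simp: free_simps(5)\<close>)
qed

lemma (in cring) basis_elt_carrier: "p \<in> X \<Longrightarrow> basis_elt R p \<in> carrier (free_module R X)"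
proof -
  assume p: "p \<in> X"
  have "finite {q. basis_elt R p q \<noteq> \<zero>}" by (rule finite_subset[of _ "{p}"]) (simp_all add: basis_elt_def subset_iff)
  then show ?thesis unfolding free_simps(1) using p by (simp add: basis_elt_def)
qed

lemma (in cring) free_span: "carrier (free_module R X) = span_in R (free_module R X) (basis_elt R ` X)"
proof
  let ?F = "free_module R X"
  interpret F: module R ?F by (rule free_module_module)
  have e: "basis_elt R ` X \<subseteq> carrier ?F" by (rule image_subsetI) (rule basis_elt_carrier)
  note sp = F.span_sub[OF e]
  show "span_in R ?F (basis_elt R ` X) \<subseteq> carrier ?F" by (rule F.span_carrier[OF e])
  \<comment> \<open>Induction on a finite set that contains the support: setting one coordinate to
    zero shrinks the set, and what is removed is a multiple of a basis element.\<close>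
  have "f \<in> span_in R ?F (basis_elt R ` X)" if "finite A" "f \<in> carrier ?F" "{p. f p \<noteq> \<zero>} \<subseteq> A" for f A
    using that
  proof (induction A arbitrary: f rule: finite_induct)
    case empty
    then have "f = \<zero>\<^bsub>?F\<^esub>" by (auto simp: free_simps)
    then show ?case using F.submodule_zero[OF sp] by simp
  next
    case (insert q A)
    let ?g = "f(q := \<zero>)"
    have "finite {p. ?g p \<noteq> \<zero>}"
      by (rule finite_subset[of _ "{p. f p \<noteq> \<zero>}"]) (use insert.prems(1) in \<open>auto simp: free_simps(1)\<close>)
    then have g: "?g \<in> carrier ?F" using insert.prems(1) by (simp add: free_simps(1))
    have gs: "?g \<in> span_in R ?F (basis_elt R ` X)" by (rule insert.IH[OF g]) (use insert.prems in auto)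
    show ?case
    proof (cases "q \<in> X")
      case False
      then have "f = ?g" using insert.prems(1) by (auto simp: free_simps)
      then show ?thesis using gs by simp
    next
      case True
      have v: "f p \<in> carrier R" for p using insert.prems(1) by (cases "p \<in> X") (auto simp: free_simps)
      have "f = ?g \<oplus>\<^bsub>?F\<^esub> f q \<odot>\<^bsub>?F\<^esub> basis_elt R q" using v by (auto simp: free_simps basis_elt_def)
      moreover have "basis_elt R q \<in> span_in R ?F (basis_elt R ` X)" using F.span_sup True by blast
      ultimately show ?thesis using F.submoduleE(4)[OF sp v] F.submoduleE(5)[OF sp gs] by metis
    qed
  qed
  then show "carrier ?F \<subseteq> span_in R ?F (basis_elt R ` X)" by (auto simp: free_simps(1))
qed

definition free_lift :: "('v, 'a) bmod \<Rightarrow> ('v, 'l) ring_scheme \<Rightarrow> ('x \<Rightarrow> 'a) \<Rightarrow> ('x \<Rightarrow> 'v) \<Rightarrow> 'a" where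
  "free_lift N V b f = finsum N (\<lambda>p. f p \<odot>\<^bsub>N\<^esub> b p) {p. f p \<noteq> \<zero>\<^bsub>V\<^esub>}"

lemma free_lift:
  fixes M :: "('v, 'a) bmod" and R (structure)
  assumes "module R M" and b: "\<And>p. p \<in> X \<Longrightarrow> b p \<in> carrier M"
  shows "linear_map R (free_module R X) M (free_lift M R b)"
    and "p \<in> X \<Longrightarrow> free_lift M R b (basis_elt R p) = b p"
proof -
  interpret module R M by fact
  let ?F = "free_module R X"
  \<comment> \<open>The index set in \<open>free_lift\<close> is the support and changes with the
    function. Enlarging it to any finite superset adds only zero terms and allows two functions to
    be summed over a common set.\<close>
  have sup: "free_lift M R b f = finsum M (\<lambda>p. f p \<odot>\<^bsub>M\<^esub> b p) A"
    if "f \<in> carrier ?F" "finite A" "{p. f p \<noteq> \<zero>} \<subseteq> A" "A \<subseteq> X" for f A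
    unfolding free_lift_def
  proof (rule M.add.finprod_mono_neutral_cong_left[OF that(2,3)])
    show "f i \<odot>\<^bsub>M\<^esub> b i = \<zero>\<^bsub>M\<^esub>" if "i \<in> A - {p. f p \<noteq> \<zero>}" for i using that \<open>A \<subseteq> X\<close> b by auto
    show "(\<lambda>p. f p \<odot>\<^bsub>M\<^esub> b p) \<in> A \<rightarrow> carrier M" using that(1,4) b by (auto simp: free_simps)
  qed simp
  have supp: "finite {p. f p \<noteq> \<zero>}" "{p. f p \<noteq> \<zero>} \<subseteq> X" if "f \<in> carrier ?F" for f
    using that by (auto simp: free_simps)
  have fb: "(\<lambda>p. f p \<odot>\<^bsub>M\<^esub> b p) \<in> A \<rightarrow> carrier M" if "f \<in> carrier ?F" "A \<subseteq> X" for f A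
    using that b by (auto simp: free_simps)
  interpret F: module R ?F by (rule R.free_module_module)
  show "linear_map R ?F M (free_lift M R b)"
  proof (rule linear_mapI)
    show "free_lift M R b f \<in> carrier M" if "f \<in> carrier ?F" for f
      using sup[OF that supp(1)[OF that] order_refl supp(2)[OF that]] fb[OF that supp(2)[OF that]] by simp
    show "free_lift M R b (f \<oplus>\<^bsub>?F\<^esub> g) = free_lift M R b f \<oplus>\<^bsub>M\<^esub> free_lift M R b g" if f: "f \<in> carrier ?F" and g: "g \<in> carrier ?F" for f g
    proof -
      let ?A = "{p. f p \<noteq> \<zero>} \<union> {p. g p \<noteq> \<zero>}"
      have A: "finite ?A" "?A \<subseteq> X" using supp f g by auto
      have "free_lift M R b (f \<oplus>\<^bsub>?F\<^esub> g) = finsum M (\<lambda>p. (f p \<oplus> g p) \<odot>\<^bsub>M\<^esub> b p) ?A"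
        by (subst sup[OF F.M.a_closed[OF f g] A(1) _ A(2)]) (auto simp: free_simps(3))
      also have "\<dots> = finsum M (\<lambda>p. f p \<odot>\<^bsub>M\<^esub> b p \<oplus>\<^bsub>M\<^esub> g p \<odot>\<^bsub>M\<^esub> b p) ?A"
      proof (rule M.finsum_cong'[OF refl])
        have v: "f p \<in> carrier R" "g p \<in> carrier R" "b p \<in> carrier M" if "p \<in> ?A" for p
          using subsetD[OF A(2) that] f g b by (simp_all only: free_simps(1))
        show "(\<lambda>p. f p \<odot>\<^bsub>M\<^esub> b p \<oplus>\<^bsub>M\<^esub> g p \<odot>\<^bsub>M\<^esub> b p) \<in> ?A \<rightarrow> carrier M"
          by (intro funcsetI M.a_closed smult_closed v)
        show "(f p \<oplus> g p) \<odot>\<^bsub>M\<^esub> b p = f p \<odot>\<^bsub>M\<^esub> b p \<oplus>\<^bsub>M\<^esub> g p \<odot>\<^bsub>M\<^esub> b p" if "p \<in> ?A" for p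
          by (rule smult_l_distr[OF v[OF that]])
      qed
      also have "\<dots> = free_lift M R b f \<oplus>\<^bsub>M\<^esub> free_lift M R b g"
        using M.finsum_addf[OF fb[OF f A(2)] fb[OF g A(2)]] sup[OF f A(1) _ A(2)] sup[OF g A(1) _ A(2)] by simp
      finally show ?thesis .
    qed
    show "free_lift M R b (c \<odot>\<^bsub>?F\<^esub> f) = c \<odot>\<^bsub>M\<^esub> free_lift M R b f" if c: "c \<in> carrier R" and f: "f \<in> carrier ?F" for c f
    proof -
      let ?A = "{p. f p \<noteq> \<zero>}"
      note A = supp[OF f]
      have "free_lift M R b (c \<odot>\<^bsub>?F\<^esub> f) = finsum M (\<lambda>p. (c \<otimes> f p) \<odot>\<^bsub>M\<^esub> b p) ?A"
        by (subst sup[OF F.smult_closed[OF c f] A(1) _ A(2)]) (use c in \<open>auto simp: free_simps(4)\<close>)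
      also have "\<dots> = finsum M (\<lambda>p. c \<odot>\<^bsub>M\<^esub> (f p \<odot>\<^bsub>M\<^esub> b p)) ?A"
        by (rule M.finsum_cong') (use f c A(2) b in \<open>auto simp: free_simps smult_assoc1 subset_iff\<close>)
      also have "\<dots> = c \<odot>\<^bsub>M\<^esub> free_lift M R b f"
        using finsum_smult_ldistr[OF A(1) c fb[OF f A(2)]] by (simp add: free_lift_def)
      finally show ?thesis .
    qed
  qed
  assume p: "p \<in> X"
  show "free_lift M R b (basis_elt R p) = b p"
  proof -
    have "free_lift M R b (basis_elt R p) = finsum M (\<lambda>q. basis_elt R p q \<odot>\<^bsub>M\<^esub> b q) {p}"
      by (rule sup[OF R.basis_elt_carrier[OF p]]) (use p in \<open>auto simp: basis_elt_def\<close>)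
    also have "\<dots> = b p" using b[OF p] by (simp add: basis_elt_def)
    finally show ?thesis .
  qed
qed

text \<open>The map is evaluated on a chosen representative; two representatives differ by an
  element of \<open>K\<close>, which the map kills. Boundedness is left out because the tensor
  product does not carry the quotient bornology.\<close>

lemma (in quot_ctx) factor:
  assumes P: "module V P" and f: "linear_map V N P f" and K: "\<And>k. k \<in> K \<Longrightarrow> f k = \<zero>\<^bsub>P\<^esub>"
  shows "\<exists>g. linear_map V Q P g \<and> (\<forall>x\<in>carrier N. g (cls x) = f x)"
proof -
  interpret P: module V P by fact
  define g where "g X = f (SOME x. x \<in> carrier N \<and> X = cls x)" for X
  have g: "g (cls x) = f x" if x: "x \<in> carrier N" for x
  proof -
    define y where "y = (SOME y. y \<in> carrier N \<and> cls x = cls y)"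
    have y: "y \<in> carrier N" "cls x = cls y" unfolding y_def by (rule someI2[of _ x]; use x in blast)+
    have "f x \<ominus>\<^bsub>P\<^esub> f y = \<zero>\<^bsub>P\<^esub>"
      using K cls_eq[OF x y(1)] y(2) linear_diff[OF module_axioms P f x y(1)] by simp
    then have "f x = f y"
      using linear_mapD(1)[OF f] x y(1) by (metis P.M.add.inv_solve_right' P.M.l_zero P.M.zero_closed a_minus_def)
    then show ?thesis by (simp add: g_def y_def)
  qed
  have "linear_map V Q P g"
  proof (rule linear_mapI)
    show "g X \<in> carrier P" if "X \<in> carrier Q" for X using that g linear_mapD(1)[OF f] by (auto simp: Q_carrier)
    show "g (X \<oplus>\<^bsub>Q\<^esub> Y) = g X \<oplus>\<^bsub>P\<^esub> g Y" if "X \<in> carrier Q" "Y \<in> carrier Q" for X Y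
      using that g linear_mapD(2)[OF f] by (auto simp: Q_carrier Q_add)
    show "g (c \<odot>\<^bsub>Q\<^esub> X) = c \<odot>\<^bsub>P\<^esub> g X" if "c \<in> carrier V" "X \<in> carrier Q" for c X
      using that g linear_mapD(3)[OF f] by (auto simp: Q_carrier Q_smult)
  qed
  then show ?thesis using g by blast
qed

section \<open>The tensor product and its bornology\<close>

locale tensor_ctx =
  fixes V :: "('v, 'k) ring_scheme" and M :: "('v, 'a) bmod" and N :: "('v, 'b) bmod"
  assumes Mb: "born_module V M" and Nb: "born_module V N"
begin

sublocale M: module V M by (rule born_moduleD(1)[OF Mb])
sublocale N: module V N by (rule born_moduleD(1)[OF Nb])

abbreviation "F \<equiv> free_module V (carrier M \<times> carrier N)"
abbreviation "K \<equiv> tensor_relations V M N"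
abbreviation "T \<equiv> tensor V M N"
abbreviation "pure \<equiv> pure_tensor V M N"
abbreviation "pures S U \<equiv> {pure x y |x y. x \<in> S \<and> y \<in> U}"

sublocale F: module V F by (rule M.R.free_module_module)

lemma e_carrier: "x \<in> carrier M \<Longrightarrow> y \<in> carrier N \<Longrightarrow> basis_elt V (x, y) \<in> carrier F"
  by (rule M.R.basis_elt_carrier) simp

text \<open>The generators inside \<open>tensor_relations\<close>, named so that a linear map can be
  tested on them.\<close>

definition "rels =
     {basis_elt V (x \<oplus>\<^bsub>M\<^esub> x', y) \<ominus>\<^bsub>F\<^esub> (basis_elt V (x, y) \<oplus>\<^bsub>F\<^esub> basis_elt V (x', y)) | x x' y.
         x \<in> carrier M \<and> x' \<in> carrier M \<and> y \<in> carrier N} \<union>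
      {basis_elt V (x, y \<oplus>\<^bsub>N\<^esub> y') \<ominus>\<^bsub>F\<^esub> (basis_elt V (x, y) \<oplus>\<^bsub>F\<^esub> basis_elt V (x, y')) | x y y'.
         x \<in> carrier M \<and> y \<in> carrier N \<and> y' \<in> carrier N} \<union>
      {basis_elt V (c \<odot>\<^bsub>M\<^esub> x, y) \<ominus>\<^bsub>F\<^esub> c \<odot>\<^bsub>F\<^esub> basis_elt V (x, y) | c x y.
         c \<in> carrier V \<and> x \<in> carrier M \<and> y \<in> carrier N} \<union>
      {basis_elt V (x, c \<odot>\<^bsub>N\<^esub> y) \<ominus>\<^bsub>F\<^esub> c \<odot>\<^bsub>F\<^esub> basis_elt V (x, y) | c x y.
         c \<in> carrier V \<and> x \<in> carrier M \<and> y \<in> carrier N}"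

lemma K_rels: "K = span_in V F rels"
  by (simp add: tensor_relations_def rels_def Let_def)

lemma rels_carrier: "rels \<subseteq> carrier F"
  unfolding rels_def by (auto intro!: F.M.minus_closed F.M.a_closed F.smult_closed e_carrier)

sublocale Qt: quot_ctx V F K
  by (rule quot_ctx.intro[OF M.R.free_module_born]) (simp add: K_rels F.span_sub[OF rels_carrier])

lemma T_def': "T = Qt.Q\<lparr>bounded := {B. \<exists>S\<in>bdd_submodules V M. \<exists>U\<in>bdd_submodules V N.
        B \<subseteq> span_in V Qt.Q (pures S U)}\<rparr>"
  by (simp add: tensor_def Let_def)

lemma T_simps: "carrier T = carrier Qt.Q" "add T = add Qt.Q" "smult T = smult Qt.Q" "\<zero>\<^bsub>T\<^esub> = \<zero>\<^bsub>Qt.Q\<^esub>"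
  "span_in V Qt.Q X = span_in V T X"
  "B \<in> bounded T \<longleftrightarrow> (\<exists>S\<in>bdd_submodules V M. \<exists>U\<in>bdd_submodules V N. B \<subseteq> span_in V T (pures S U))"
  using module_bounded_update(3)[where V = V and M = Qt.Q] unfolding T_def' by simp_all

sublocale T: module V T unfolding T_def' by (rule module_bounded_update(1)[OF Qt.Q_module])

lemma pure_carrier: "x \<in> carrier M \<Longrightarrow> y \<in> carrier N \<Longrightarrow> pure x y \<in> carrier T"
  unfolding T_simps(1) Qt.Q_carrier pure_tensor_def using e_carrier by blast

lemma rel_cls: "a \<in> carrier F \<Longrightarrow> b \<in> carrier F \<Longrightarrow> a \<ominus>\<^bsub>F\<^esub> b \<in> rels \<Longrightarrow> Qt.cls a = Qt.cls b"
  using Qt.cls_eq F.span_sup[of rels] unfolding K_rels by blast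

lemma pure_linear: "x \<in> carrier M \<Longrightarrow> linear_map V N T (pure x)"
  "y \<in> carrier N \<Longrightarrow> linear_map V M T (\<lambda>x. pure x y)"
proof -
  note ec = e_carrier
  show "linear_map V N T (pure x)" if x: "x \<in> carrier M" for x
  proof (rule linear_mapI)
    show "pure x y \<in> carrier T" if "y \<in> carrier N" for y by (rule pure_carrier[OF x that])
    fix y y' assume y: "y \<in> carrier N" "y' \<in> carrier N"
    have "Qt.cls (basis_elt V (x, y \<oplus>\<^bsub>N\<^esub> y')) = Qt.cls (basis_elt V (x, y) \<oplus>\<^bsub>F\<^esub> basis_elt V (x, y'))"
      by (rule rel_cls) (simp_all only: F.M.a_closed N.M.a_closed M.M.a_closed ec x y, use x y in \<open>unfold rels_def, blast\<close>)
    then show "pure x (y \<oplus>\<^bsub>N\<^esub> y') = pure x y \<oplus>\<^bsub>T\<^esub> pure x y'"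
      by (simp add: pure_tensor_def T_simps Qt.Q_add ec x y)
  next
    fix c y assume c: "c \<in> carrier V" and y: "y \<in> carrier N"
    have "Qt.cls (basis_elt V (x, c \<odot>\<^bsub>N\<^esub> y)) = Qt.cls (c \<odot>\<^bsub>F\<^esub> basis_elt V (x, y))"
      by (rule rel_cls) (simp_all only: F.smult_closed N.smult_closed M.smult_closed ec x y c, use x y c in \<open>unfold rels_def, blast\<close>)
    then show "pure x (c \<odot>\<^bsub>N\<^esub> y) = c \<odot>\<^bsub>T\<^esub> pure x y"
      by (simp add: pure_tensor_def T_simps Qt.Q_smult ec x y c)
  qed
  show "linear_map V M T (\<lambda>x. pure x y)" if y: "y \<in> carrier N" for y
  proof (rule linear_mapI)
    show "pure x y \<in> carrier T" if "x \<in> carrier M" for x by (rule pure_carrier[OF that y])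
    fix x x' assume x: "x \<in> carrier M" "x' \<in> carrier M"
    have "Qt.cls (basis_elt V (x \<oplus>\<^bsub>M\<^esub> x', y)) = Qt.cls (basis_elt V (x, y) \<oplus>\<^bsub>F\<^esub> basis_elt V (x', y))"
      by (rule rel_cls) (simp_all only: F.M.a_closed N.M.a_closed M.M.a_closed ec x y, use x y in \<open>unfold rels_def, blast\<close>)
    then show "pure (x \<oplus>\<^bsub>M\<^esub> x') y = pure x y \<oplus>\<^bsub>T\<^esub> pure x' y"
      by (simp add: pure_tensor_def T_simps Qt.Q_add ec x y)
  next
    fix c x assume c: "c \<in> carrier V" and x: "x \<in> carrier M"
    have "Qt.cls (basis_elt V (c \<odot>\<^bsub>M\<^esub> x, y)) = Qt.cls (c \<odot>\<^bsub>F\<^esub> basis_elt V (x, y))"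
      by (rule rel_cls) (simp_all only: F.smult_closed N.smult_closed M.smult_closed ec x y c, use x y c in \<open>unfold rels_def, blast\<close>)
    then show "pure (c \<odot>\<^bsub>M\<^esub> x) y = c \<odot>\<^bsub>T\<^esub> pure x y"
      by (simp add: pure_tensor_def T_simps Qt.Q_smult ec x y c)
  qed
qed

lemma pures_carrier: "S \<subseteq> carrier M \<Longrightarrow> U \<subseteq> carrier N \<Longrightarrow> pures S U \<subseteq> carrier T"
  using pure_carrier by blast

lemma T_span: "carrier T = span_in V T (pures (carrier M) (carrier N))"
proof
  show "span_in V T (pures (carrier M) (carrier N)) \<subseteq> carrier T"
    by (rule T.span_carrier[OF pures_carrier[OF order_refl order_refl]])
  have cls: "linear_map V F T Qt.cls"
    using bdd_linear_mapD(1)[OF Qt.cls_linear] by (simp add: linear_map_def T_simps)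
  have "Qt.cls f \<in> span_in V T (pures (carrier M) (carrier N))" if "f \<in> carrier F" for f
  proof (rule linear_span_in[OF F.module_axioms T.module_axioms cls T.span_sub[OF pures_carrier[OF order_refl order_refl]], of "basis_elt V ` (carrier M \<times> carrier N)"])
    show "basis_elt V ` (carrier M \<times> carrier N) \<subseteq> carrier F" using e_carrier by auto
    show "f \<in> span_in V F (basis_elt V ` (carrier M \<times> carrier N))" using that M.R.free_span by blast
    show "Qt.cls x \<in> span_in V T (pures (carrier M) (carrier N))" if "x \<in> basis_elt V ` (carrier M \<times> carrier N)" for x
      by (rule subsetD[OF T.span_sup]) (use that in \<open>auto simp: pure_tensor_def\<close>)
  qed
  then show "carrier T \<subseteq> span_in V T (pures (carrier M) (carrier N))"
    unfolding T_simps(1) Qt.Q_carrier by blast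
qed

lemma sub_c: "S \<in> bdd_submodules V M \<Longrightarrow> S \<subseteq> carrier M" "U \<in> bdd_submodules V N \<Longrightarrow> U \<subseteq> carrier N"
  using M.submoduleE(1) N.submoduleE(1) by (auto simp: bdd_submodules_def)

lemma span_bdd: "S \<in> bdd_submodules V M \<Longrightarrow> U \<in> bdd_submodules V N \<Longrightarrow> span_in V T (pures S U) \<in> bdd_submodules V T"
  unfolding bdd_submodules_def[of V T] using T_simps(6) T.span_sub[OF pures_carrier[OF sub_c]] by blast

lemma cover2: "A \<in> bounded M \<Longrightarrow> B \<in> bounded M \<Longrightarrow> \<exists>S\<in>bdd_submodules V M. A \<union> B \<subseteq> S"
  "A' \<in> bounded N \<Longrightarrow> B' \<in> bounded N \<Longrightarrow> \<exists>S\<in>bdd_submodules V N. A' \<union> B' \<subseteq> S"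
  using born_moduleD(2,6)[OF Mb] born_moduleD(2,6)[OF Nb] by meson+

lemma span_join:
  assumes "S \<in> bdd_submodules V M" "U \<in> bdd_submodules V N" "S' \<in> bdd_submodules V M" "U' \<in> bdd_submodules V N"
  obtains S'' U'' where "S'' \<in> bdd_submodules V M" "U'' \<in> bdd_submodules V N"
    "span_in V T (pures S U) \<subseteq> span_in V T (pures S'' U'')" "span_in V T (pures S' U') \<subseteq> span_in V T (pures S'' U'')"
proof -
  obtain S'' where S: "S'' \<in> bdd_submodules V M" "S \<union> S' \<subseteq> S''" using cover2(1)[OF assms(1,3)[THEN bdd_submodulesD(1)]] by blast
  obtain U'' where U: "U'' \<in> bdd_submodules V N" "U \<union> U' \<subseteq> U''" using cover2(2)[OF assms(2,4)[THEN bdd_submodulesD(1)]] by blast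
  have "pures S U \<subseteq> pures S'' U''" "pures S' U' \<subseteq> pures S'' U''" using S(2) U(2) by blast+
  then show thesis by (intro that[OF S(1) U(1)] T.span_mono)
qed

lemma single_bdd: "x \<in> carrier M \<Longrightarrow> \<exists>S\<in>bdd_submodules V M. x \<in> S" "y \<in> carrier N \<Longrightarrow> \<exists>S\<in>bdd_submodules V N. y \<in> S"
  using born_moduleD(5,6)[OF Mb, of "{x}"] born_moduleD(5,6)[OF Nb, of "{y}"] by blast+

lemma T_born: "born_module V T"
proof (rule born_moduleI[OF T.module_axioms])
  show "\<exists>S\<in>bounded T. submodule S V T \<and> B \<subseteq> S" if B: "B \<in> bounded T" for B
  proof -
    obtain S U where SU: "S \<in> bdd_submodules V M" "U \<in> bdd_submodules V N" "B \<subseteq> span_in V T (pures S U)"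
      using B unfolding T_simps(6) by blast
    then show ?thesis using bdd_submodulesD[OF span_bdd[OF SU(1,2)]] by blast
  qed
  show "A \<in> bounded T" if "B \<in> bounded T" "A \<subseteq> B" for A B using that unfolding T_simps(6) by blast
  show "A \<union> B \<in> bounded T" if AB: "A \<in> bounded T" "B \<in> bounded T" for A B
  proof -
    obtain S U where SU: "S \<in> bdd_submodules V M" "U \<in> bdd_submodules V N" "A \<subseteq> span_in V T (pures S U)"
      using AB(1) unfolding T_simps(6) by blast
    obtain S' U' where SU': "S' \<in> bdd_submodules V M" "U' \<in> bdd_submodules V N" "B \<subseteq> span_in V T (pures S' U')"
      using AB(2) unfolding T_simps(6) by blast
    obtain S'' U'' where "S'' \<in> bdd_submodules V M" "U'' \<in> bdd_submodules V N"
      "span_in V T (pures S U) \<subseteq> span_in V T (pures S'' U'')" "span_in V T (pures S' U') \<subseteq> span_in V T (pures S'' U'')"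
      using span_join[OF SU(1,2) SU'(1,2)] by blast
    then show ?thesis unfolding T_simps(6) using SU(3) SU'(3) by blast
  qed
  \<comment> \<open>The spans of bounded rectangles form a directed family. Its union is a submodule
    containing all pure tensors, hence everything, and so each point is bounded.\<close>
  let ?\<F> = "{span_in V T (pures S U) |S U. S \<in> bdd_submodules V M \<and> U \<in> bdd_submodules V N}"
  have "submodule (\<Union>?\<F>) V T"
  proof (rule T.directed_Union_sub)
    show "?\<F> \<noteq> {}" using single_bdd(1)[OF M.M.zero_closed] single_bdd(2)[OF N.M.zero_closed] by blast
    show "submodule S V T" if "S \<in> ?\<F>" for S using that span_bdd bdd_submodulesD(2) by blast
    fix X Y assume "X \<in> ?\<F>" "Y \<in> ?\<F>"
    then obtain S U S' U' where SU: "S \<in> bdd_submodules V M" "U \<in> bdd_submodules V N" "S' \<in> bdd_submodules V M"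
      "U' \<in> bdd_submodules V N" "X = span_in V T (pures S U)" "Y = span_in V T (pures S' U')" by blast
    show "\<exists>U\<in>?\<F>. X \<subseteq> U \<and> Y \<subseteq> U" by (rule span_join[OF SU(1-4)]) (use SU(5,6) in blast)
  qed
  moreover have "pures (carrier M) (carrier N) \<subseteq> \<Union>?\<F>"
  proof
    fix t assume "t \<in> pures (carrier M) (carrier N)"
    then obtain x y where t: "t = pure x y" "x \<in> carrier M" "y \<in> carrier N" by blast
    obtain S U where "S \<in> bdd_submodules V M" "x \<in> S" "U \<in> bdd_submodules V N" "y \<in> U"
      using single_bdd(1)[OF t(2)] single_bdd(2)[OF t(3)] by blast
    moreover from this have "t \<in> span_in V T (pures S U)" by (intro subsetD[OF T.span_sup]) (use t in blast)
    ultimately show "t \<in> \<Union>?\<F>" by blast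
  qed
  ultimately have "carrier T \<subseteq> \<Union>?\<F>" unfolding T_span by (rule T.span_least)
  then show "\<exists>B\<in>bounded T. x \<in> B" if x: "x \<in> carrier T" for x
  proof -
    obtain S U where SU: "S \<in> bdd_submodules V M" "U \<in> bdd_submodules V N" "x \<in> span_in V T (pures S U)"
      using x \<open>carrier T \<subseteq> \<Union>?\<F>\<close> by blast
    show ?thesis using SU(3) bdd_submodulesD(1)[OF span_bdd[OF SU(1,2)]] by blast
  qed
qed

lemma pure_bilinear: "bdd_bilinear V M N T pure"
proof (rule bdd_bilinearI[OF pure_linear])
  fix A B assume "A \<in> bounded M" "B \<in> bounded N"
  then obtain S U where SU: "S \<in> bdd_submodules V M" "A \<subseteq> S" "U \<in> bdd_submodules V N" "B \<subseteq> U"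
    using born_moduleD(6)[OF Mb] born_moduleD(6)[OF Nb] by meson
  have "pures A B \<subseteq> span_in V T (pures S U)" by (rule order_trans[OF _ T.span_sup]) (use SU in blast)
  then show "pures A B \<in> bounded T" unfolding T_simps(6) using SU(1,3) by blast
qed

text \<open>Extend \<beta> linearly to the free module; bilinearity says exactly that the relations
  go to zero. Boundedness needs no extra estimate: a bounded submodule that contains the values on a
  rectangle contains the image of its span.\<close>

lemma tensor_lift:
  assumes P: "born_module V P" and \<beta>: "bdd_bilinear V M N P \<beta>"
  shows "\<exists>g. bdd_linear_map V T P g \<and> (\<forall>x\<in>carrier M. \<forall>y\<in>carrier N. g (pure x y) = \<beta> x y)"
proof -
  interpret P: module V P by (rule born_moduleD(1)[OF P])
  let ?f = "free_lift P V (\<lambda>(x, y). \<beta> x y)"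
  note l1 = linear_mapD[OF bdd_bilinearD(1)[OF \<beta>]] and l2 = linear_mapD[OF bdd_bilinearD(2)[OF \<beta>]]
  have c: "p \<in> carrier M \<times> carrier N \<Longrightarrow> (\<lambda>(x, y). \<beta> x y) p \<in> carrier P" for p
    using l1(1) by auto
  note f = free_lift(1)[where X = "carrier M \<times> carrier N" and b = "\<lambda>(x, y). \<beta> x y", OF P.module_axioms c]
  have fe: "?f (basis_elt V (x, y)) = \<beta> x y" if "x \<in> carrier M" "y \<in> carrier N" for x y
    using free_lift(2)[where X = "carrier M \<times> carrier N" and b = "\<lambda>(x, y). \<beta> x y" and p = "(x, y)", OF P.module_axioms c] that by simp
  have z: "?f k = \<zero>\<^bsub>P\<^esub>" if k: "k \<in> K" for k
  proof -
    have "?f r = \<zero>\<^bsub>P\<^esub>" if "r \<in> rels" for r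
      using that unfolding rels_def
      by (auto simp: linear_diff[OF F.module_axioms P.module_axioms f] linear_mapD(2,3)[OF f] e_carrier fe l1 l2 P.diff_self)
    then show ?thesis
      by (intro linear_span_eq[OF F.module_axioms P.module_axioms f linear_map_zero[OF P.module_axioms] rels_carrier _ k[unfolded K_rels]])
  qed
  obtain g where g: "linear_map V Qt.Q P g" "\<And>x. x \<in> carrier F \<Longrightarrow> g (Qt.cls x) = ?f x"
    using Qt.factor[OF P.module_axioms f z] by blast
  have gT: "linear_map V T P g" using g(1) by (simp add: linear_map_def T_simps)
  have gp: "g (pure x y) = \<beta> x y" if "x \<in> carrier M" "y \<in> carrier N" for x y
    using g(2)[OF e_carrier[OF that]] fe[OF that] by (simp add: pure_tensor_def)
  have "bdd_linear_map V T P g"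
  proof (rule bdd_linear_mapI[OF gT])
    fix B assume "B \<in> bounded T"
    then obtain S U where SU: "S \<in> bdd_submodules V M" "U \<in> bdd_submodules V N" "B \<subseteq> span_in V T (pures S U)"
      unfolding T_simps(6) by blast
    obtain W where W: "W \<in> bdd_submodules V P" "{\<beta> x y |x y. x \<in> S \<and> y \<in> U} \<subseteq> W"
      using born_moduleD(6)[OF P bdd_bilinearD(3)[OF \<beta> SU(1,2)[THEN bdd_submodulesD(1)]]] by blast
    have "g b \<in> W" if "b \<in> B" for b
    proof (rule linear_span_in[OF T.module_axioms P.module_axioms gT bdd_submodulesD(2)[OF W(1)] pures_carrier[OF sub_c(1)[OF SU(1)] sub_c(2)[OF SU(2)]]])
      show "b \<in> span_in V T (pures S U)" using that SU(3) by blast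
      show "g x \<in> W" if "x \<in> pures S U" for x
      proof -
        obtain a b where x: "x = pure a b" "a \<in> S" "b \<in> U" using \<open>x \<in> pures S U\<close> by blast
        moreover from this have "a \<in> carrier M" "b \<in> carrier N" using sub_c(1)[OF SU(1)] sub_c(2)[OF SU(2)] by blast+
        ultimately show ?thesis using gp[of a b] W(2) by auto
      qed
    qed
    then show "g ` B \<in> bounded P" using born_moduleD(3)[OF P bdd_submodulesD(1)[OF W(1)]] by blast
  qed
  then show ?thesis using gp by blast
qed

end

section \<open>The universal property of the completed tensor product\<close>

locale ctensor_ctx = tensor_ctx V M N for V :: "('v, 'k) ring_scheme" and M :: "('v, 'a) bmod" and N :: "('v, 'b) bmod" +
  fixes \<pi> :: 'v
  assumes pi: "\<pi> \<in> carrier V"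
begin

sublocale Tc: bmod_ctx V \<pi> T by (rule bmod_ctx.intro[OF T_born pi])

abbreviation "CT \<equiv> ctensor V \<pi> M N"
abbreviation "cpure \<equiv> pure_ctensor V \<pi> M N"
text \<open>The image of the \<open>\<pi>\<close>-adic completion of the span of a bounded
  rectangle. By \<open>ct_cover\<close> these sets are cofinal among the bounded subsets of the
  completed tensor product.\<close>

definition "ctset S U = Tc.cls ` Tc.Z (span_in V T (pures S U))"

lemma CT_complete: "complete_born_module V \<pi> CT"
  unfolding ctensor_def by (rule Tc.completion_complete)

lemma CT_born: "born_module V CT" using CT_complete by (simp add: complete_born_module_def)

lemma cpure_bilinear: "bdd_bilinear V M N CT cpure"
  unfolding pure_ctensor_def ctensor_def
  using bdd_bilinear_comp[OF pure_bilinear bdd_linear_map_id[OF M.module_axioms] bdd_linear_map_id[OF N.module_axioms] Tc.to_completion_linear] .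

lemma cpure_carrier: "x \<in> carrier M \<Longrightarrow> y \<in> carrier N \<Longrightarrow> cpure x y \<in> carrier CT"
  using linear_mapD(1)[OF bdd_bilinearD(1)[OF cpure_bilinear]] .

lemma ct_lift:
  assumes P: "complete_born_module V \<pi> P" and \<beta>: "bdd_bilinear V M N P \<beta>"
  shows "\<exists>g. bdd_linear_map V CT P g \<and> (\<forall>x\<in>carrier M. \<forall>y\<in>carrier N. g (cpure x y) = \<beta> x y)"
proof -
  have bP: "born_module V P" using P by (simp add: complete_born_module_def)
  obtain f where f: "bdd_linear_map V T P f" "\<And>x y. x \<in> carrier M \<Longrightarrow> y \<in> carrier N \<Longrightarrow> f (pure x y) = \<beta> x y"
    using tensor_lift[OF bP \<beta>] by blast
  then obtain g where "bdd_linear_map V CT P g" "\<And>x. x \<in> carrier T \<Longrightarrow> g (to_completion V \<pi> T x) = f x"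
    using completion_universal(3)[OF T_born pi P f(1)] unfolding ctensor_def by blast
  then show ?thesis using f(2) pure_carrier unfolding pure_ctensor_def by metis
qed

text \<open>Density in two stages: pure tensors span the tensor product, and a bounded linear map
  from the completion to a complete module is determined on the image of the tensor product.\<close>

lemma ct_unique:
  assumes P: "complete_born_module V \<pi> P" and g: "bdd_linear_map V CT P g" and h: "bdd_linear_map V CT P h"
    and eq: "\<And>x y. x \<in> carrier M \<Longrightarrow> y \<in> carrier N \<Longrightarrow> g (cpure x y) = h (cpure x y)"
    and X: "X \<in> carrier CT"
  shows "g X = h X"
proof -
  note g' = g[unfolded ctensor_def] and h' = h[unfolded ctensor_def]
  have bP: "born_module V P" using P by (simp add: complete_born_module_def)
  note gt = bdd_linear_map_comp[OF Tc.to_completion_linear g'] and ht = bdd_linear_map_comp[OF Tc.to_completion_linear h']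
  interpret E: complete_ext V \<pi> T P "\<lambda>x. g (to_completion V \<pi> T x)"
    by (intro complete_ext.intro complete_target.intro complete_ext_axioms.intro
        complete_target_axioms.intro bmod_ctx.intro T_born bP pi P gt)
  have "g (to_completion V \<pi> T t) = h (to_completion V \<pi> T t)" if "t \<in> carrier T" for t
    by (rule linear_span_eq[OF T.module_axioms born_moduleD(1)[OF bP] bdd_linear_mapD(1)[OF gt] bdd_linear_mapD(1)[OF ht]
        pures_carrier[OF order_refl order_refl] _ that[unfolded T_span]])
       (use eq in \<open>auto simp: pure_ctensor_def\<close>)
  then show ?thesis using E.ext_unique g' h' X unfolding ctensor_def completion_def by blast
qed

lemma ct_cover:
  assumes "B \<in> bounded CT"
  shows "\<exists>S\<in>bdd_submodules V M. \<exists>U\<in>bdd_submodules V N. B \<subseteq> ctset S U"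
proof -
  obtain A where A: "B = Tc.cls ` A" "A \<in> bounded Tc.C"
    using assms unfolding ctensor_def completion_def quot_simps(5) by blast
  then obtain W where W: "W \<in> bdd_submodules V T" "A \<subseteq> Tc.Z W" by (auto simp: cauchy_module_def)
  obtain S U where SU: "S \<in> bdd_submodules V M" "U \<in> bdd_submodules V N" "W \<subseteq> span_in V T (pures S U)"
    using bdd_submodulesD(1)[OF W(1)] unfolding T_simps(6) by blast
  have "B \<subseteq> ctset S U" unfolding ctset_def A(1) using W(2) Tc.Z_mono[OF SU(3)] by blast
  then show ?thesis using SU by blast
qed

text \<open>A complete submodule that contains the values on pure tensors also contains their
  limits. The bound \<open>W\<close> does not depend on \<open>g\<close>, which is what makes a
  whole family of lifts jointly bounded in \<open>ct_lift_right\<close>.\<close>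

lemma ct_bound:
  assumes P: "complete_born_module V \<pi> P" and g: "bdd_linear_map V CT P g"
    and SU: "S \<in> bdd_submodules V M" "U \<in> bdd_submodules V N"
    and W: "W \<in> bdd_submodules V P" "adic_complete V \<pi> P W"
    and gW: "\<And>x y. x \<in> S \<Longrightarrow> y \<in> U \<Longrightarrow> g (cpure x y) \<in> W"
  shows "g ` ctset S U \<subseteq> W"
proof -
  note g' = g[unfolded ctensor_def]
  have bP: "born_module V P" using P by (simp add: complete_born_module_def)
  note gt = bdd_linear_map_comp[OF Tc.to_completion_linear g']
  interpret E: complete_ext V \<pi> T P "\<lambda>x. g (to_completion V \<pi> T x)"
    by (intro complete_ext.intro complete_target.intro complete_ext_axioms.intro
        complete_target_axioms.intro bmod_ctx.intro T_born bP pi P gt)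
  note sb = span_bdd[OF SU]
  have im: "(\<lambda>x. g (to_completion V \<pi> T x)) ` span_in V T (pures S U) \<subseteq> W"
  proof (intro image_subsetI)
    fix t assume t: "t \<in> span_in V T (pures S U)"
    show "g (to_completion V \<pi> T t) \<in> W"
      by (rule linear_span_in[OF T.module_axioms born_moduleD(1)[OF bP] bdd_linear_mapD(1)[OF gt] bdd_submodulesD(2)[OF W(1)]
          pures_carrier[OF sub_c(1)[OF SU(1)] sub_c(2)[OF SU(2)]] _ t])
         (use gW in \<open>auto simp: pure_ctensor_def\<close>)
  qed
  have "g (Tc.cls z) \<in> W" if z: "z \<in> Tc.Z (span_in V T (pures S U))" for z
  proof -
    have zC: "z \<in> carrier Tc.C" using Tc.C_carrier[of z] sb z by blast
    then have "Tc.cls z \<in> carrier Tc.QC" unfolding Tc.Qc.Q_carrier by blast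
    then have "g (Tc.cls z) = E.G (Tc.cls z)"
      using E.ext_unique[OF g'[unfolded completion_def] E.G_linear] E.G_ext by simp
    also have "\<dots> = E.F z" by (rule E.G_cls[OF zC])
    also have "\<dots> \<in> W" by (rule E.F_in(1)[OF sb W im z])
    finally show ?thesis .
  qed
  then show ?thesis unfolding ctset_def by blast
qed

end

section \<open>Bornological algebras and differential forms\<close>

locale balg =
  fixes V :: "('v, 'k) ring_scheme" and \<pi> :: 'v and A :: "('v, 'a) bmod"
  assumes alg: "born_algebra V A" and pi: "\<pi> \<in> carrier V"
begin

lemma born: "born_module V A" using alg by (simp add: born_algebra_def)

sublocale bmod_ctx V \<pi> A by (rule bmod_ctx.intro[OF born pi])

lemma mul_closed [simp]: "x \<in> carrier A \<Longrightarrow> y \<in> carrier A \<Longrightarrow> x \<otimes>\<^bsub>A\<^esub> y \<in> carrier A"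
  and mul_assoc: "x \<in> carrier A \<Longrightarrow> y \<in> carrier A \<Longrightarrow> z \<in> carrier A \<Longrightarrow> (x \<otimes>\<^bsub>A\<^esub> y) \<otimes>\<^bsub>A\<^esub> z = x \<otimes>\<^bsub>A\<^esub> (y \<otimes>\<^bsub>A\<^esub> z)"
  and mul_l_distr: "x \<in> carrier A \<Longrightarrow> y \<in> carrier A \<Longrightarrow> z \<in> carrier A \<Longrightarrow> (x \<oplus>\<^bsub>A\<^esub> y) \<otimes>\<^bsub>A\<^esub> z = (x \<otimes>\<^bsub>A\<^esub> z) \<oplus>\<^bsub>A\<^esub> (y \<otimes>\<^bsub>A\<^esub> z)"
  and mul_r_distr: "x \<in> carrier A \<Longrightarrow> y \<in> carrier A \<Longrightarrow> z \<in> carrier A \<Longrightarrow> x \<otimes>\<^bsub>A\<^esub> (y \<oplus>\<^bsub>A\<^esub> z) = (x \<otimes>\<^bsub>A\<^esub> y) \<oplus>\<^bsub>A\<^esub> (x \<otimes>\<^bsub>A\<^esub> z)"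
  and mul_smult_l: "c \<in> carrier V \<Longrightarrow> x \<in> carrier A \<Longrightarrow> y \<in> carrier A \<Longrightarrow> (c \<odot>\<^bsub>A\<^esub> x) \<otimes>\<^bsub>A\<^esub> y = c \<odot>\<^bsub>A\<^esub> (x \<otimes>\<^bsub>A\<^esub> y)"
  and mul_smult_r: "c \<in> carrier V \<Longrightarrow> x \<in> carrier A \<Longrightarrow> y \<in> carrier A \<Longrightarrow> x \<otimes>\<^bsub>A\<^esub> (c \<odot>\<^bsub>A\<^esub> y) = c \<odot>\<^bsub>A\<^esub> (x \<otimes>\<^bsub>A\<^esub> y)"
  and mul_bdd: "B \<in> bounded A \<Longrightarrow> B' \<in> bounded A \<Longrightarrow> set_prod A B B' \<in> bounded A"
  using alg unfolding born_algebra_def by blast+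

lemma mul_linear: "x \<in> carrier A \<Longrightarrow> linear_map V A A (\<lambda>y. x \<otimes>\<^bsub>A\<^esub> y)" "y \<in> carrier A \<Longrightarrow> linear_map V A A (\<lambda>x. x \<otimes>\<^bsub>A\<^esub> y)"
  by (rule linear_mapI; simp add: mul_r_distr mul_l_distr mul_smult_l mul_smult_r)+

lemma mul_bilinear: "bdd_bilinear V A A A (\<lambda>x y. x \<otimes>\<^bsub>A\<^esub> y)"
  using mul_linear mul_bdd by (auto simp: bdd_bilinear_def set_prod_def)

lemma mul_zero [simp]: "x \<in> carrier A \<Longrightarrow> x \<otimes>\<^bsub>A\<^esub> \<zero>\<^bsub>A\<^esub> = \<zero>\<^bsub>A\<^esub>" "x \<in> carrier A \<Longrightarrow> \<zero>\<^bsub>A\<^esub> \<otimes>\<^bsub>A\<^esub> x = \<zero>\<^bsub>A\<^esub>"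
  using linear_zero[OF module_axioms module_axioms] mul_linear by blast+

lemma mul_neg: "x \<in> carrier A \<Longrightarrow> y \<in> carrier A \<Longrightarrow> x \<otimes>\<^bsub>A\<^esub> (\<ominus>\<^bsub>A\<^esub> y) = \<ominus>\<^bsub>A\<^esub> (x \<otimes>\<^bsub>A\<^esub> y)"
  "x \<in> carrier A \<Longrightarrow> y \<in> carrier A \<Longrightarrow> (\<ominus>\<^bsub>A\<^esub> x) \<otimes>\<^bsub>A\<^esub> y = \<ominus>\<^bsub>A\<^esub> (x \<otimes>\<^bsub>A\<^esub> y)"
  using linear_neg[OF module_axioms module_axioms mul_linear(1)] linear_neg[OF module_axioms module_axioms mul_linear(2)] by blast+

text \<open>These rules set up the method \<open>algebra\<close> for non-unital algebras; its setup
  for rings would presuppose a unit.\<close>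

lemmas alg_simprules [algebra nonunital "zero A" "add A" "a_inv A" "a_minus A" "mult A"] =
  M.a_closed M.zero_closed M.a_inv_closed M.minus_closed mul_closed
  M.a_assoc M.l_zero M.l_neg M.a_comm mul_assoc mul_l_distr mul_r_distr
  a_minus_def M.r_zero M.r_neg M.r_neg2 M.r_neg1 M.minus_add M.minus_minus M.add.inv_one
  M.a_lcomm mul_zero mul_neg


end

text \<open>For fixed \<open>x\<close> the last two variables are lifted by the universal property.
  Linearity in \<open>x\<close> follows from uniqueness of these lifts, and joint boundedness from
  \<open>ct_bound\<close> with one \<open>W\<close> for all \<open>x\<close> in a bounded set. This
  serves \<open>omega2\<close>, which is an iterated completed tensor product.\<close>

lemma (in ctensor_ctx) ct_lift_right:
  assumes X: "born_module V X" and P: "complete_born_module V \<pi> P"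
    and bil: "\<And>x. x \<in> carrier X \<Longrightarrow> bdd_bilinear V M N P (\<tau> x)"
    and lin: "\<And>y z. y \<in> carrier M \<Longrightarrow> z \<in> carrier N \<Longrightarrow> linear_map V X P (\<lambda>x. \<tau> x y z)"
    and bdd: "\<And>A S T. A \<in> bounded X \<Longrightarrow> S \<in> bounded M \<Longrightarrow> T \<in> bounded N \<Longrightarrow>
      {\<tau> x y z |x y z. x \<in> A \<and> y \<in> S \<and> z \<in> T} \<in> bounded P"
  shows "\<exists>\<gamma>. bdd_bilinear V X CT P \<gamma> \<and>
    (\<forall>x\<in>carrier X. \<forall>y\<in>carrier M. \<forall>z\<in>carrier N. \<gamma> x (cpure y z) = \<tau> x y z)"
proof -
  have bP: "born_module V P" using P by (simp add: complete_born_module_def)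
  interpret P: bmod_ctx V \<pi> P by (rule bmod_ctx.intro[OF bP pi])
  interpret X: module V X by (rule born_moduleD(1)[OF X])
  have "\<forall>x\<in>carrier X. \<exists>g. bdd_linear_map V CT P g \<and> (\<forall>y\<in>carrier M. \<forall>z\<in>carrier N. g (cpure y z) = \<tau> x y z)"
    using ct_lift[OF P bil] by blast
  then obtain \<gamma> where \<gamma>: "\<And>x. x \<in> carrier X \<Longrightarrow> bdd_linear_map V CT P (\<gamma> x)"
    "\<And>x y z. x \<in> carrier X \<Longrightarrow> y \<in> carrier M \<Longrightarrow> z \<in> carrier N \<Longrightarrow> \<gamma> x (cpure y z) = \<tau> x y z"
    by metis
  have "bdd_bilinear V X CT P \<gamma>"
  proof (rule bdd_bilinearI)
    show "linear_map V CT P (\<gamma> x)" if "x \<in> carrier X" for x by (rule bdd_linear_mapD(1)[OF \<gamma>(1)[OF that]])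
    show "linear_map V X P (\<lambda>x. \<gamma> x w)" if w: "w \<in> carrier CT" for w
    proof (rule linear_mapI)
      show "\<gamma> x w \<in> carrier P" if "x \<in> carrier X" for x
        by (rule linear_mapD(1)[OF bdd_linear_mapD(1)[OF \<gamma>(1)[OF that]] w])
      show "\<gamma> (x \<oplus>\<^bsub>X\<^esub> x') w = \<gamma> x w \<oplus>\<^bsub>P\<^esub> \<gamma> x' w" if x: "x \<in> carrier X" "x' \<in> carrier X" for x x'
        by (rule ct_unique[OF P \<gamma>(1)[OF X.M.a_closed[OF x]] bdd_linear_map_add[OF bP \<gamma>(1)[OF x(1)] \<gamma>(1)[OF x(2)] pi] _ w])
           (simp add: \<gamma>(2) x linear_mapD(2)[OF lin])
      show "\<gamma> (c \<odot>\<^bsub>X\<^esub> x) w = c \<odot>\<^bsub>P\<^esub> \<gamma> x w" if c: "c \<in> carrier V" and x: "x \<in> carrier X" for c x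
        by (rule ct_unique[OF P \<gamma>(1)[OF X.smult_closed[OF c x]] bdd_linear_map_smult[OF bP \<gamma>(1)[OF x] c] _ w])
           (simp add: \<gamma>(2) x c linear_mapD(3)[OF lin])
    qed
    fix A B assume A: "A \<in> bounded X" and B: "B \<in> bounded CT"
    obtain S T where ST: "S \<in> bdd_submodules V M" "T \<in> bdd_submodules V N" "B \<subseteq> ctset S T"
      using ct_cover[OF B] by blast
    have "{\<tau> x y z |x y z. x \<in> A \<and> y \<in> S \<and> z \<in> T} \<in> bounded P"
      by (rule bdd[OF A bdd_submodulesD(1)[OF ST(1)] bdd_submodulesD(1)[OF ST(2)]])
    then obtain W where W: "W \<in> bdd_submodules V P" "adic_complete V \<pi> P W"
      "{\<tau> x y z |x y z. x \<in> A \<and> y \<in> S \<and> z \<in> T} \<subseteq> W"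
      using P unfolding complete_born_module_def by blast
    have "\<gamma> x ` ctset S T \<subseteq> W" if x: "x \<in> A" for x
    proof -
      have xc: "x \<in> carrier X" using born_moduleD(4)[OF X A] x by blast
      show ?thesis
      proof (rule ct_bound[OF P \<gamma>(1)[OF xc] ST(1,2) W(1,2)])
        fix y z assume yz: "y \<in> S" "z \<in> T"
        then have "y \<in> carrier M" "z \<in> carrier N" using sub_c(1)[OF ST(1)] sub_c(2)[OF ST(2)] by blast+
        then show "\<gamma> x (cpure y z) \<in> W" using W(3) x yz \<gamma>(2)[OF xc] by auto
      qed
    qed
    then have "{\<gamma> x y |x y. x \<in> A \<and> y \<in> B} \<subseteq> W" using ST(3) by blast
    then show "{\<gamma> x y |x y. x \<in> A \<and> y \<in> B} \<in> bounded P" by (rule P.bd(3)[OF bdd_submodulesD(1)[OF W(1)]])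
  qed
  then show ?thesis using \<gamma>(2) by blast
qed

text \<open>The operations on forms are defined by \<open>THE\<close> among extensional maps. A map
  from the universal property becomes extensional by restriction, so \<Phi> has to survive
  restriction; two candidates agree on the carrier by density.\<close>

lemma the_bdd_linear_map:
  fixes M :: "('v, 'a) bmod" and N :: "('v, 'b) bmod"
  assumes ex: "\<exists>g. bdd_linear_map V M N g \<and> \<Phi> g" and restr: "\<And>g. \<Phi> g \<Longrightarrow> \<Phi> (restrict g (carrier M))"
    and uniq: "\<And>g h x. bdd_linear_map V M N g \<Longrightarrow> bdd_linear_map V M N h \<Longrightarrow> \<Phi> g \<Longrightarrow> \<Phi> h \<Longrightarrow> x \<in> carrier M \<Longrightarrow> g x = h x"
    and M: "born_module V M"
  shows "bdd_linear_map V M N (THE g. g \<in> extensional (carrier M) \<and> bdd_linear_map V M N g \<and> \<Phi> g)"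
    and "\<Phi> (THE g. g \<in> extensional (carrier M) \<and> bdd_linear_map V M N g \<and> \<Phi> g)"
proof -
  obtain g where g: "bdd_linear_map V M N g" "\<Phi> g" using ex by blast
  let ?g = "restrict g (carrier M)"
  have im: "?g ` B = g ` B" if "B \<in> bounded M" for B
    using born_moduleD(4)[OF M that] by (intro image_cong) auto
  have l: "bdd_linear_map V M N ?g"
  proof (rule bdd_linear_mapI)
    show "linear_map V M N ?g"
      by (rule linear_map_cong[OF _ born_moduleD(1)[OF M] bdd_linear_mapD(1)[OF g(1)]]) simp
    show "?g ` B \<in> bounded N" if "B \<in> bounded M" for B
      using bdd_linear_mapD(2)[OF g(1) that] im[OF that] by simp
  qed
  have "\<exists>!g. g \<in> extensional (carrier M) \<and> bdd_linear_map V M N g \<and> \<Phi> g"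
  proof (rule ex1I[of _ ?g])
    show "?g \<in> extensional (carrier M) \<and> bdd_linear_map V M N ?g \<and> \<Phi> ?g" using l restr[OF g(2)] by simp
    fix h assume h: "h \<in> extensional (carrier M) \<and> bdd_linear_map V M N h \<and> \<Phi> h"
    show "h = ?g"
    proof (rule extensionalityI[of _ "carrier M"])
      show "h x = ?g x" if "x \<in> carrier M" for x using uniq[OF _ l _ restr[OF g(2)] that] h by blast
    qed (use h in simp_all)
  qed
  from theI'[OF this] show "bdd_linear_map V M N (THE g. g \<in> extensional (carrier M) \<and> bdd_linear_map V M N g \<and> \<Phi> g)"
    and "\<Phi> (THE g. g \<in> extensional (carrier M) \<and> bdd_linear_map V M N g \<and> \<Phi> g)" by simp_all
qed

section \<open>The unitalisation and differential forms of degree one and two\<close>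

locale forms = A: balg V \<pi> R
  for V :: "('v, 'k) ring_scheme" and \<pi> :: 'v and R :: "('v, 'r) bmod"
begin

abbreviation "U \<equiv> unitalisation V R"
abbreviation "io \<equiv> in_unital V"

lemma U_simps [simp]: "carrier U = carrier R \<times> carrier V"
  "(x, a) \<oplus>\<^bsub>U\<^esub> (y, b) = (x \<oplus>\<^bsub>R\<^esub> y, a \<oplus>\<^bsub>V\<^esub> b)" "\<zero>\<^bsub>U\<^esub> = (\<zero>\<^bsub>R\<^esub>, \<zero>\<^bsub>V\<^esub>)"
  "c \<odot>\<^bsub>U\<^esub> (x, a) = (c \<odot>\<^bsub>R\<^esub> x, c \<otimes>\<^bsub>V\<^esub> a)" "\<one>\<^bsub>U\<^esub> = (\<zero>\<^bsub>R\<^esub>, \<one>\<^bsub>V\<^esub>)"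
  "(x, a) \<otimes>\<^bsub>U\<^esub> (y, b) = ((x \<otimes>\<^bsub>R\<^esub> y) \<oplus>\<^bsub>R\<^esub> (b \<odot>\<^bsub>R\<^esub> x) \<oplus>\<^bsub>R\<^esub> (a \<odot>\<^bsub>R\<^esub> y), a \<otimes>\<^bsub>V\<^esub> b)"
  "B \<in> bounded U \<longleftrightarrow> B \<subseteq> carrier R \<times> carrier V \<and> fst ` B \<in> bounded R"
  by (simp_all add: unitalisation_def)

lemma U_module: "module V U"
proof (rule moduleI)
  show "cring V" by (rule A.R.is_cring)
  show "abelian_group U"
  proof (rule abelian_groupI)
    show "\<exists>y\<in>carrier U. y \<oplus>\<^bsub>U\<^esub> x = \<zero>\<^bsub>U\<^esub>" if "x \<in> carrier U" for x
      using that by (intro bexI[of _ "(\<ominus>\<^bsub>R\<^esub> fst x, \<ominus>\<^bsub>V\<^esub> snd x)"]) (auto simp: A.M.l_neg A.R.l_neg)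
  qed (auto simp: A.M.a_ac A.R.a_ac)
qed (auto simp: A.smult_l_distr A.smult_r_distr A.smult_assoc1 A.R.l_distr A.R.r_distr A.R.m_assoc)

sublocale U: module V U by (rule U_module)

lemma U_born: "born_module V U"
proof (rule born_moduleI[OF U_module])
  show "\<exists>S\<in>bounded U. submodule S V U \<and> B \<subseteq> S" if B: "B \<in> bounded U" for B
  proof -
    have "fst ` B \<in> bounded R" using B by simp
    then obtain S where S: "S \<in> bdd_submodules V R" "fst ` B \<subseteq> S" using A.bd(6) by blast
    have "submodule (S \<times> carrier V) V U"
      using A.submoduleE[OF A.bddD(1)[OF S(1)]] A.submodule_zero[OF A.bddD(1)[OF S(1)]]
      by (intro U.subI) auto
    moreover have "S \<times> carrier V \<in> bounded U"
      using A.bddD(3)[OF S(1)] A.bd(3)[OF A.bddD(2)[OF S(1)], of "fst ` (S \<times> carrier V)"] by auto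
    moreover have "B \<subseteq> S \<times> carrier V" using S(2) B by force
    ultimately show ?thesis by blast
  qed
  show "X \<in> bounded U" if B: "B \<in> bounded U" "X \<subseteq> B" for X B
    using B A.bd(3)[of "fst ` B" "fst ` X"] by (simp add: image_mono subset_trans)
  show "A \<union> B \<in> bounded U" if "A \<in> bounded U" "B \<in> bounded U" for A B
    using that A.bd(2)[of "fst ` A" "fst ` B"] by (simp add: image_Un)
  show "\<exists>B\<in>bounded U. x \<in> B" if "x \<in> carrier U" for x
    using that A.bd(5)[of "{fst x}"] by (intro bexI[of _ "{x}"]) auto
qed

lemma io_linear: "bdd_linear_map V R U io"
proof (rule bdd_linear_mapI)
  show "linear_map V R U io" by (rule linear_mapI) (auto simp: in_unital_def)
  show "io ` B \<in> bounded U" if "B \<in> bounded R" for B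
    using that A.bd(4)[OF that] by (auto simp: in_unital_def image_image)
qed

lemma io_carrier [simp]: "x \<in> carrier R \<Longrightarrow> io x \<in> carrier U" by (simp add: in_unital_def)

lemma io_mult: "x \<in> carrier R \<Longrightarrow> y \<in> carrier R \<Longrightarrow> io x \<otimes>\<^bsub>U\<^esub> io y = io (x \<otimes>\<^bsub>R\<^esub> y)"
  "x \<in> carrier R \<Longrightarrow> \<one>\<^bsub>U\<^esub> \<otimes>\<^bsub>U\<^esub> io x = io x" "x \<in> carrier R \<Longrightarrow> io x \<otimes>\<^bsub>U\<^esub> \<one>\<^bsub>U\<^esub> = io x"
  by (simp_all add: in_unital_def)

lemma U_one [simp]: "\<one>\<^bsub>U\<^esub> \<in> carrier U" by simp

lemma U_left: "a \<in> carrier R \<Longrightarrow> bdd_linear_map V U U (\<lambda>x. io a \<otimes>\<^bsub>U\<^esub> x)"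
proof (rule bdd_linear_mapI)
  assume a: "a \<in> carrier R"
  show "linear_map V U U (\<lambda>x. io a \<otimes>\<^bsub>U\<^esub> x)"
    by (rule linear_mapI)
       (use a in \<open>auto simp: in_unital_def A.mul_r_distr A.smult_l_distr A.M.a_ac A.mul_smult_r A.smult_r_distr A.smult_assoc1\<close>)
  fix B assume B: "B \<in> bounded U"
  obtain S where S: "S \<in> bdd_submodules V R" "set_prod R {a} (fst ` B) \<union> {a} \<subseteq> S"
    using A.bd(6)[OF A.bd(2)[OF A.mul_bdd[OF A.bd(5) _] A.bd(5)], of "{a}" "fst ` B" "{a}"] a B by auto
  have "fst (io a \<otimes>\<^bsub>U\<^esub> b) \<in> S" if b: "b \<in> B" for b
  proof -
    obtain x k where xk: "b = (x, k)" "x \<in> carrier R" "k \<in> carrier V" using B b by force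
    have "x \<in> fst ` B" using b xk(1) by force
    then have "a \<otimes>\<^bsub>R\<^esub> x \<in> S" "k \<odot>\<^bsub>R\<^esub> a \<in> S"
      using S A.submoduleE(4)[OF A.bddD(1)[OF S(1)] xk(3)] by (auto simp: set_prod_def)
    moreover have "fst (io a \<otimes>\<^bsub>U\<^esub> b) = (a \<otimes>\<^bsub>R\<^esub> x) \<oplus>\<^bsub>R\<^esub> k \<odot>\<^bsub>R\<^esub> a"
      using xk a by (simp add: in_unital_def)
    ultimately show ?thesis using A.submoduleE(5)[OF A.bddD(1)[OF S(1)]] by simp
  qed
  then have "fst ` (\<lambda>x. io a \<otimes>\<^bsub>U\<^esub> x) ` B \<subseteq> S" by blast
  moreover have "(\<lambda>x. io a \<otimes>\<^bsub>U\<^esub> x) ` B \<subseteq> carrier U" using B a by (auto simp: in_unital_def)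
  ultimately show "(\<lambda>x. io a \<otimes>\<^bsub>U\<^esub> x) ` B \<in> bounded U" using A.bd(3)[OF A.bddD(2)[OF S(1)]] by simp
qed

text \<open>Right multiplication of forms contains products of the coefficient with the first
  differentiated element. Both vary, so boundedness is needed jointly and not only for a fixed
  element of \<open>R\<close>.\<close>

lemma U_right: "bdd_bilinear V U R U (\<lambda>x y. x \<otimes>\<^bsub>U\<^esub> io y)"
proof (rule bdd_bilinearI)
  show "linear_map V R U (\<lambda>y. x \<otimes>\<^bsub>U\<^esub> io y)" if "x \<in> carrier U" for x
    by (rule linear_mapI)
       (use that in \<open>auto simp: in_unital_def A.mul_r_distr A.M.a_ac A.mul_smult_r A.smult_r_distr A.smult_assoc1[symmetric] A.R.m_comm\<close>)
  show "linear_map V U U (\<lambda>x. x \<otimes>\<^bsub>U\<^esub> io y)" if "y \<in> carrier R" for y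
    by (rule linear_mapI)
       (use that in \<open>auto simp: in_unital_def A.mul_l_distr A.M.a_ac A.mul_smult_l A.smult_l_distr A.smult_r_distr A.smult_assoc1\<close>)
  fix A B assume A: "A \<in> bounded U" and B: "B \<in> bounded R"
  obtain S where S: "S \<in> bdd_submodules V R" "set_prod R (fst ` A) B \<union> B \<subseteq> S"
    using A.bd(6)[OF A.bd(2)[OF A.mul_bdd[OF _ B] B], of "fst ` A"] A by auto
  have "fst (x \<otimes>\<^bsub>U\<^esub> io y) \<in> S \<and> x \<otimes>\<^bsub>U\<^esub> io y \<in> carrier U" if xy: "x \<in> A" "y \<in> B" for x y
  proof -
    obtain z k where xk: "x = (z, k)" "z \<in> carrier R" "k \<in> carrier V" using A xy by force
    have y: "y \<in> carrier R" using A.bd(4)[OF B] xy by blast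
    have "z \<in> fst ` A" using xy xk(1) by force
    then have "z \<otimes>\<^bsub>R\<^esub> y \<in> set_prod R (fst ` A) B" using xy(2) unfolding set_prod_def by blast
    moreover have "y \<in> S" using S(2) xy(2) by blast
    ultimately have "z \<otimes>\<^bsub>R\<^esub> y \<in> S" "k \<odot>\<^bsub>R\<^esub> y \<in> S"
      using S(2) A.submoduleE(4)[OF A.bddD(1)[OF S(1)] xk(3)] by blast+
    moreover have "x \<otimes>\<^bsub>U\<^esub> io y = ((z \<otimes>\<^bsub>R\<^esub> y) \<oplus>\<^bsub>R\<^esub> k \<odot>\<^bsub>R\<^esub> y, \<zero>\<^bsub>V\<^esub>)"
      using xk y by (simp add: in_unital_def)
    ultimately show ?thesis using A.submoduleE(5)[OF A.bddD(1)[OF S(1)]] xk y by simp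
  qed
  then have "fst ` {x \<otimes>\<^bsub>U\<^esub> io y |x y. x \<in> A \<and> y \<in> B} \<subseteq> S" "{x \<otimes>\<^bsub>U\<^esub> io y |x y. x \<in> A \<and> y \<in> B} \<subseteq> carrier U" by blast+
  then show "{x \<otimes>\<^bsub>U\<^esub> io y |x y. x \<in> A \<and> y \<in> B} \<in> bounded U" using A.bd(3)[OF A.bddD(2)[OF S(1)]] by simp
qed

declare U_simps [simp del]

sublocale RR: ctensor_ctx V R R \<pi>
  by (intro ctensor_ctx.intro tensor_ctx.intro ctensor_ctx_axioms.intro A.born A.pi)
sublocale O1: ctensor_ctx V U R \<pi>
  by (intro ctensor_ctx.intro tensor_ctx.intro ctensor_ctx_axioms.intro A.born A.pi U_born)
sublocale O2: ctensor_ctx V U "ctensor V \<pi> R R" \<pi>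
  by (intro ctensor_ctx.intro tensor_ctx.intro ctensor_ctx_axioms.intro A.pi U_born RR.CT_born)

abbreviation "\<Omega>\<^sub>1 \<equiv> omega1 V \<pi> R"
abbreviation "\<Omega>\<^sub>2 \<equiv> omega2 V \<pi> R"
abbreviation "f1 \<equiv> form1 V \<pi> R"
abbreviation "f2 \<equiv> form2 V \<pi> R"

lemmas O_defs = omega1_def omega2_def form1_def form2_def

lemma O_complete: "complete_born_module V \<pi> \<Omega>\<^sub>1" "complete_born_module V \<pi> \<Omega>\<^sub>2"
  unfolding O_defs by (rule O1.CT_complete O2.CT_complete)+

lemma O_born: "born_module V \<Omega>\<^sub>1" "born_module V \<Omega>\<^sub>2"
  using O_complete by (simp_all add: complete_born_module_def)

lemma f1_bilinear: "bdd_bilinear V U R \<Omega>\<^sub>1 f1"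
  using O1.cpure_bilinear by (simp add: O_defs form1_def[abs_def])

lemma f2_bilinear: "x \<in> carrier U \<Longrightarrow> bdd_bilinear V R R \<Omega>\<^sub>2 (f2 x)"
  using bdd_bilinear_comp[OF RR.cpure_bilinear bdd_linear_map_id[OF A.module_axioms] bdd_linear_map_id[OF A.module_axioms]
      bdd_bilinear_right[OF O2.cpure_bilinear U_born O_born(2)[unfolded O_defs], of x]]
  by (simp add: O_defs form2_def[abs_def])

lemma f2_linear: "y \<in> carrier R \<Longrightarrow> z \<in> carrier R \<Longrightarrow> linear_map V U \<Omega>\<^sub>2 (\<lambda>x. f2 x y z)"
  using bdd_bilinearD(2)[OF O2.cpure_bilinear RR.cpure_carrier] by (simp add: O_defs form2_def[abs_def])

lemma f_carrier: "x \<in> carrier U \<Longrightarrow> y \<in> carrier R \<Longrightarrow> f1 x y \<in> carrier \<Omega>\<^sub>1"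
  "x \<in> carrier U \<Longrightarrow> y \<in> carrier R \<Longrightarrow> z \<in> carrier R \<Longrightarrow> f2 x y z \<in> carrier \<Omega>\<^sub>2"
  using linear_mapD(1)[OF bdd_bilinearD(1)[OF f1_bilinear]] linear_mapD(1)[OF bdd_bilinearD(1)[OF f2_bilinear]] by blast+

lemma O1_lift:
  assumes "complete_born_module V \<pi> P" "bdd_bilinear V U R P \<beta>"
  shows "\<exists>g. bdd_linear_map V \<Omega>\<^sub>1 P g \<and> (\<forall>x\<in>carrier U. \<forall>y\<in>carrier R. g (f1 x y) = \<beta> x y)"
  using O1.ct_lift[OF assms] unfolding O_defs .

lemma O1_unique:
  assumes "complete_born_module V \<pi> P" "bdd_linear_map V \<Omega>\<^sub>1 P g" "bdd_linear_map V \<Omega>\<^sub>1 P h"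
    "\<And>x y. x \<in> carrier U \<Longrightarrow> y \<in> carrier R \<Longrightarrow> g (f1 x y) = h (f1 x y)" "X \<in> carrier \<Omega>\<^sub>1"
  shows "g X = h X"
  using O1.ct_unique[of P g h X] assms unfolding O_defs by blast

text \<open>The lift is made one tensor product at a time: \<open>ct_lift_right\<close> produces a
  bounded bilinear map on the unitalisation and the inner tensor product, to which the outer
  universal property applies.\<close>

lemma O2_lift:
  assumes P: "complete_born_module V \<pi> P"
    and bil: "\<And>x. x \<in> carrier U \<Longrightarrow> bdd_bilinear V R R P (\<tau> x)"
    and lin: "\<And>y z. y \<in> carrier R \<Longrightarrow> z \<in> carrier R \<Longrightarrow> linear_map V U P (\<lambda>x. \<tau> x y z)"
    and bdd: "\<And>A S T. A \<in> bounded U \<Longrightarrow> S \<in> bounded R \<Longrightarrow> T \<in> bounded R \<Longrightarrow>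
      {\<tau> x y z |x y z. x \<in> A \<and> y \<in> S \<and> z \<in> T} \<in> bounded P"
  shows "\<exists>g. bdd_linear_map V \<Omega>\<^sub>2 P g \<and> (\<forall>x\<in>carrier U. \<forall>y\<in>carrier R. \<forall>z\<in>carrier R. g (f2 x y z) = \<tau> x y z)"
proof -
  obtain \<gamma> where \<gamma>: "bdd_bilinear V U (ctensor V \<pi> R R) P \<gamma>"
    "\<And>x y z. x \<in> carrier U \<Longrightarrow> y \<in> carrier R \<Longrightarrow> z \<in> carrier R \<Longrightarrow> \<gamma> x (pure_ctensor V \<pi> R R y z) = \<tau> x y z"
    using RR.ct_lift_right[OF U_born P bil lin bdd] by blast
  obtain g where g: "bdd_linear_map V \<Omega>\<^sub>2 P g"
    "\<And>x w. x \<in> carrier U \<Longrightarrow> w \<in> carrier (ctensor V \<pi> R R) \<Longrightarrow> g (pure_ctensor V \<pi> U (ctensor V \<pi> R R) x w) = \<gamma> x w"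
    using O2.ct_lift[OF P \<gamma>(1)] unfolding O_defs by blast
  have "g (f2 x y z) = \<tau> x y z" if "x \<in> carrier U" "y \<in> carrier R" "z \<in> carrier R" for x y z
    using g(2)[OF that(1) RR.cpure_carrier[OF that(2,3)]] \<gamma>(2)[OF that] by (simp add: form2_def)
  then show ?thesis using g(1) by blast
qed

lemma O2_unique:
  assumes P: "complete_born_module V \<pi> P" and g: "bdd_linear_map V \<Omega>\<^sub>2 P g" and h: "bdd_linear_map V \<Omega>\<^sub>2 P h"
    and eq: "\<And>x y z. x \<in> carrier U \<Longrightarrow> y \<in> carrier R \<Longrightarrow> z \<in> carrier R \<Longrightarrow> g (f2 x y z) = h (f2 x y z)"
    and X: "X \<in> carrier \<Omega>\<^sub>2"
  shows "g X = h X"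
proof -
  let ?p = "pure_ctensor V \<pi> U (ctensor V \<pi> R R)"
  have "g (?p x w) = h (?p x w)" if x: "x \<in> carrier U" and w: "w \<in> carrier (ctensor V \<pi> R R)" for x w
  proof -
    note px = bdd_bilinear_right[OF O2.cpure_bilinear U_born O_born(2)[unfolded O_defs] x]
    show ?thesis
      by (rule RR.ct_unique[OF P bdd_linear_map_comp[OF px g[unfolded O_defs]] bdd_linear_map_comp[OF px h[unfolded O_defs]] _ w])
         (use eq[OF x] in \<open>simp add: form2_def\<close>)
  qed
  then show ?thesis using O2.ct_unique[of P g h X] P g h X unfolding O_defs by blast
qed

lemma f2_bdd:
  assumes "A \<in> bounded U" "S \<in> bounded R" "T \<in> bounded R"
  shows "{f2 x y z |x y z. x \<in> A \<and> y \<in> S \<and> z \<in> T} \<in> bounded \<Omega>\<^sub>2"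
proof -
  have "{pure_ctensor V \<pi> U (ctensor V \<pi> R R) x w |x w. x \<in> A \<and> w \<in> {pure_ctensor V \<pi> R R y z |y z. y \<in> S \<and> z \<in> T}} \<in> bounded \<Omega>\<^sub>2"
    unfolding O_defs by (rule bdd_bilinearD(3)[OF O2.cpure_bilinear assms(1) bdd_bilinearD(3)[OF RR.cpure_bilinear assms(2,3)]])
  then show ?thesis by (rule born_moduleD(3)[OF O_born(2)]) (unfold form2_def, blast)
qed

section \<open>The operations on forms\<close>

lemma left_mult1:
  assumes a: "a \<in> carrier R"
  shows "bdd_linear_map V \<Omega>\<^sub>1 \<Omega>\<^sub>1 (left_mult1 V \<pi> R a)"
    and "x \<in> carrier U \<Longrightarrow> y \<in> carrier R \<Longrightarrow> left_mult1 V \<pi> R a (f1 x y) = f1 (io a \<otimes>\<^bsub>U\<^esub> x) y"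
proof -
  let ?\<Phi> = "\<lambda>g. \<forall>x\<in>carrier U. \<forall>y\<in>carrier R. g (f1 x y) = f1 (io a \<otimes>\<^bsub>U\<^esub> x) y"
  have ex: "\<exists>g. bdd_linear_map V \<Omega>\<^sub>1 \<Omega>\<^sub>1 g \<and> ?\<Phi> g"
    by (rule O1_lift[OF O_complete(1) bdd_bilinear_comp[OF f1_bilinear U_left[OF a] bdd_linear_map_id[OF A.module_axioms]
        bdd_linear_map_id[OF born_moduleD(1)[OF O_born(1)]]]])
  have r: "?\<Phi> (restrict g (carrier \<Omega>\<^sub>1))" if "?\<Phi> g" for g using that f_carrier(1) by simp
  have u: "g x = h x" if "bdd_linear_map V \<Omega>\<^sub>1 \<Omega>\<^sub>1 g" "bdd_linear_map V \<Omega>\<^sub>1 \<Omega>\<^sub>1 h" "?\<Phi> g" "?\<Phi> h" "x \<in> carrier \<Omega>\<^sub>1" for g h x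
    by (rule O1_unique[OF O_complete(1) that(1,2) _ that(5)]) (use that(3,4) in simp)
  have T: "bdd_linear_map V \<Omega>\<^sub>1 \<Omega>\<^sub>1 (left_mult1 V \<pi> R a)" "?\<Phi> (left_mult1 V \<pi> R a)"
    unfolding left_mult1_def
    by (rule the_bdd_linear_map[of V \<Omega>\<^sub>1 \<Omega>\<^sub>1 ?\<Phi>], rule ex, erule r, erule (4) u, rule O_born(1))+
  show "bdd_linear_map V \<Omega>\<^sub>1 \<Omega>\<^sub>1 (left_mult1 V \<pi> R a)" by (rule T(1))
  show "x \<in> carrier U \<Longrightarrow> y \<in> carrier R \<Longrightarrow> left_mult1 V \<pi> R a (f1 x y) = f1 (io a \<otimes>\<^bsub>U\<^esub> x) y" using T(2) by blast
qed

lemma right_mult1: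
  assumes a: "a \<in> carrier R"
  shows "bdd_linear_map V \<Omega>\<^sub>1 \<Omega>\<^sub>1 (right_mult1 V \<pi> R a)"
    and "x \<in> carrier U \<Longrightarrow> y \<in> carrier R \<Longrightarrow>
      right_mult1 V \<pi> R a (f1 x y) = f1 x (y \<otimes>\<^bsub>R\<^esub> a) \<ominus>\<^bsub>\<Omega>\<^sub>1\<^esub> f1 (x \<otimes>\<^bsub>U\<^esub> io y) a"
proof -
  let ?\<Phi> = "\<lambda>g. \<forall>x\<in>carrier U. \<forall>y\<in>carrier R. g (f1 x y) = f1 x (y \<otimes>\<^bsub>R\<^esub> a) \<ominus>\<^bsub>\<Omega>\<^sub>1\<^esub> f1 (x \<otimes>\<^bsub>U\<^esub> io y) a"
  note idU = bdd_linear_map_id[OF U.module_axioms] and idR = bdd_linear_map_id[OF A.module_axioms]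
  note ra = bdd_bilinear_left[OF A.mul_bilinear A.born A.born a]
  obtain g where g: "bdd_linear_map V \<Omega>\<^sub>1 \<Omega>\<^sub>1 g" "\<And>x y. x \<in> carrier U \<Longrightarrow> y \<in> carrier R \<Longrightarrow> g (f1 x y) = f1 x (y \<otimes>\<^bsub>R\<^esub> a)"
    using O1_lift[OF O_complete(1) bdd_bilinear_comp[OF f1_bilinear idU ra bdd_linear_map_id[OF born_moduleD(1)[OF O_born(1)]]]] by blast
  obtain h where h: "bdd_linear_map V \<Omega>\<^sub>1 \<Omega>\<^sub>1 h" "\<And>x y. x \<in> carrier U \<Longrightarrow> y \<in> carrier R \<Longrightarrow> h (f1 x y) = f1 (x \<otimes>\<^bsub>U\<^esub> io y) a"
    using O1_lift[OF O_complete(1) bdd_bilinear_comp[OF U_right idU idR bdd_bilinear_left[OF f1_bilinear A.born O_born(1) a]]] by blast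
  have "bdd_linear_map V \<Omega>\<^sub>1 \<Omega>\<^sub>1 (\<lambda>x. g x \<ominus>\<^bsub>\<Omega>\<^sub>1\<^esub> h x)" by (rule bdd_linear_map_diff[OF O_born(1) g(1) h(1) O_born(1)])
  moreover have "?\<Phi> (\<lambda>x. g x \<ominus>\<^bsub>\<Omega>\<^sub>1\<^esub> h x)" by (intro ballI) (simp only: g(2) h(2))
  ultimately have ex: "\<exists>g. bdd_linear_map V \<Omega>\<^sub>1 \<Omega>\<^sub>1 g \<and> ?\<Phi> g" by blast
  have r: "?\<Phi> (restrict g (carrier \<Omega>\<^sub>1))" if "?\<Phi> g" for g using that f_carrier(1) by simp
  have u: "g x = h x" if "bdd_linear_map V \<Omega>\<^sub>1 \<Omega>\<^sub>1 g" "bdd_linear_map V \<Omega>\<^sub>1 \<Omega>\<^sub>1 h" "?\<Phi> g" "?\<Phi> h" "x \<in> carrier \<Omega>\<^sub>1" for g h x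
    by (rule O1_unique[OF O_complete(1) that(1,2) _ that(5)]) (use that(3,4) in simp)
  have T: "bdd_linear_map V \<Omega>\<^sub>1 \<Omega>\<^sub>1 (right_mult1 V \<pi> R a)" "?\<Phi> (right_mult1 V \<pi> R a)"
    unfolding right_mult1_def
    by (rule the_bdd_linear_map[of V \<Omega>\<^sub>1 \<Omega>\<^sub>1 ?\<Phi>], rule ex, erule r, erule (4) u, rule O_born(1))+
  show "bdd_linear_map V \<Omega>\<^sub>1 \<Omega>\<^sub>1 (right_mult1 V \<pi> R a)" by (rule T(1))
  show "x \<in> carrier U \<Longrightarrow> y \<in> carrier R \<Longrightarrow>
      right_mult1 V \<pi> R a (f1 x y) = f1 x (y \<otimes>\<^bsub>R\<^esub> a) \<ominus>\<^bsub>\<Omega>\<^sub>1\<^esub> f1 (x \<otimes>\<^bsub>U\<^esub> io y) a" using T(2) by blast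
qed

lemma times_d:
  assumes a: "a \<in> carrier R"
  shows "bdd_linear_map V \<Omega>\<^sub>1 \<Omega>\<^sub>2 (times_d V \<pi> R a)"
    and "x \<in> carrier U \<Longrightarrow> y \<in> carrier R \<Longrightarrow> times_d V \<pi> R a (f1 x y) = f2 x y a"
proof -
  let ?\<Phi> = "\<lambda>g. \<forall>x\<in>carrier U. \<forall>y\<in>carrier R. g (f1 x y) = f2 x y a"
  have "bdd_bilinear V U R \<Omega>\<^sub>2 (\<lambda>x y. f2 x y a)"
    using bdd_bilinear_comp[OF O2.cpure_bilinear bdd_linear_map_id[OF U.module_axioms]
        bdd_bilinear_left[OF RR.cpure_bilinear A.born RR.CT_born a] bdd_linear_map_id[OF born_moduleD(1)[OF O_born(2)[unfolded O_defs]]]]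
    by (simp add: O_defs)
  then have ex: "\<exists>g. bdd_linear_map V \<Omega>\<^sub>1 \<Omega>\<^sub>2 g \<and> ?\<Phi> g" by (rule O1_lift[OF O_complete(2)])
  have r: "?\<Phi> (restrict g (carrier \<Omega>\<^sub>1))" if "?\<Phi> g" for g using that f_carrier(1) by simp
  have u: "g x = h x" if "bdd_linear_map V \<Omega>\<^sub>1 \<Omega>\<^sub>2 g" "bdd_linear_map V \<Omega>\<^sub>1 \<Omega>\<^sub>2 h" "?\<Phi> g" "?\<Phi> h" "x \<in> carrier \<Omega>\<^sub>1" for g h x
    by (rule O1_unique[OF O_complete(2) that(1,2) _ that(5)]) (use that(3,4) in simp)
  have T: "bdd_linear_map V \<Omega>\<^sub>1 \<Omega>\<^sub>2 (times_d V \<pi> R a)" "?\<Phi> (times_d V \<pi> R a)"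
    unfolding times_d_def
    by (rule the_bdd_linear_map[of V \<Omega>\<^sub>1 \<Omega>\<^sub>2 ?\<Phi>], rule ex, erule r, erule (4) u, rule O_born(1))+
  show "bdd_linear_map V \<Omega>\<^sub>1 \<Omega>\<^sub>2 (times_d V \<pi> R a)" by (rule T(1))
  show "x \<in> carrier U \<Longrightarrow> y \<in> carrier R \<Longrightarrow> times_d V \<pi> R a (f1 x y) = f2 x y a" using T(2) by blast
qed

lemma left_mult2:
  assumes a: "a \<in> carrier R"
  shows "bdd_linear_map V \<Omega>\<^sub>2 \<Omega>\<^sub>2 (left_mult2 V \<pi> R a)"
    and "x \<in> carrier U \<Longrightarrow> y \<in> carrier R \<Longrightarrow> z \<in> carrier R \<Longrightarrow> left_mult2 V \<pi> R a (f2 x y z) = f2 (io a \<otimes>\<^bsub>U\<^esub> x) y z"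
proof -
  let ?\<Phi> = "\<lambda>g. \<forall>x\<in>carrier U. \<forall>y\<in>carrier R. \<forall>z\<in>carrier R. g (f2 x y z) = f2 (io a \<otimes>\<^bsub>U\<^esub> x) y z"
  note lc = linear_mapD(1)[OF bdd_linear_mapD(1)[OF U_left[OF a]]]
  have ex: "\<exists>g. bdd_linear_map V \<Omega>\<^sub>2 \<Omega>\<^sub>2 g \<and> ?\<Phi> g"
  proof (rule O2_lift[OF O_complete(2)])
    show "bdd_bilinear V R R \<Omega>\<^sub>2 (f2 (io a \<otimes>\<^bsub>U\<^esub> x))" if "x \<in> carrier U" for x by (rule f2_bilinear[OF lc[OF that]])
    show "linear_map V U \<Omega>\<^sub>2 (\<lambda>x. f2 (io a \<otimes>\<^bsub>U\<^esub> x) y z)" if "y \<in> carrier R" "z \<in> carrier R" for y z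
      by (rule linear_map_comp[OF bdd_linear_mapD(1)[OF U_left[OF a]] f2_linear[OF that]])
    fix A S T assume AST: "A \<in> bounded U" "S \<in> bounded R" "T \<in> bounded R"
    show "{f2 (io a \<otimes>\<^bsub>U\<^esub> x) y z |x y z. x \<in> A \<and> y \<in> S \<and> z \<in> T} \<in> bounded \<Omega>\<^sub>2"
      by (rule born_moduleD(3)[OF O_born(2) f2_bdd[OF bdd_linear_mapD(2)[OF U_left[OF a] AST(1)] AST(2,3)]]) blast
  qed
  have r: "?\<Phi> (restrict g (carrier \<Omega>\<^sub>2))" if "?\<Phi> g" for g using that f_carrier(2) by simp
  have u: "g x = h x" if "bdd_linear_map V \<Omega>\<^sub>2 \<Omega>\<^sub>2 g" "bdd_linear_map V \<Omega>\<^sub>2 \<Omega>\<^sub>2 h" "?\<Phi> g" "?\<Phi> h" "x \<in> carrier \<Omega>\<^sub>2" for g h x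
    by (rule O2_unique[OF O_complete(2) that(1,2) _ that(5)]) (use that(3,4) in simp)
  have T: "bdd_linear_map V \<Omega>\<^sub>2 \<Omega>\<^sub>2 (left_mult2 V \<pi> R a)" "?\<Phi> (left_mult2 V \<pi> R a)"
    unfolding left_mult2_def
    by (rule the_bdd_linear_map[of V \<Omega>\<^sub>2 \<Omega>\<^sub>2 ?\<Phi>], rule ex, erule r, erule (4) u, rule O_born(2))+
  show "bdd_linear_map V \<Omega>\<^sub>2 \<Omega>\<^sub>2 (left_mult2 V \<pi> R a)" by (rule T(1))
  show "x \<in> carrier U \<Longrightarrow> y \<in> carrier R \<Longrightarrow> z \<in> carrier R \<Longrightarrow> left_mult2 V \<pi> R a (f2 x y z) = f2 (io a \<otimes>\<^bsub>U\<^esub> x) y z"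
    using T(2) by blast
qed

text \<open>Each of the three summands of the formula is a bounded trilinear expression, so each
  lifts to 2-forms by itself. The sum of the lifts is the required map.\<close>

lemma right_mult2:
  assumes a: "a \<in> carrier R"
  shows "bdd_linear_map V \<Omega>\<^sub>2 \<Omega>\<^sub>2 (right_mult2 V \<pi> R a)"
    and "x \<in> carrier U \<Longrightarrow> y \<in> carrier R \<Longrightarrow> z \<in> carrier R \<Longrightarrow> right_mult2 V \<pi> R a (f2 x y z) =
      (f2 x y (z \<otimes>\<^bsub>R\<^esub> a) \<ominus>\<^bsub>\<Omega>\<^sub>2\<^esub> f2 x (y \<otimes>\<^bsub>R\<^esub> z) a) \<oplus>\<^bsub>\<Omega>\<^sub>2\<^esub> f2 (x \<otimes>\<^bsub>U\<^esub> io y) z a"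
proof -
  let ?\<Phi> = "\<lambda>g. \<forall>x\<in>carrier U. \<forall>y\<in>carrier R. \<forall>z\<in>carrier R. g (f2 x y z) =
    (f2 x y (z \<otimes>\<^bsub>R\<^esub> a) \<ominus>\<^bsub>\<Omega>\<^sub>2\<^esub> f2 x (y \<otimes>\<^bsub>R\<^esub> z) a) \<oplus>\<^bsub>\<Omega>\<^sub>2\<^esub> f2 (x \<otimes>\<^bsub>U\<^esub> io y) z a"
  note ra = bdd_bilinear_left[OF A.mul_bilinear A.born A.born a]
  note idR = bdd_linear_map_id[OF A.module_axioms] and idO = bdd_linear_map_id[OF born_moduleD(1)[OF O_born(2)]]
  note bc = born_moduleD(3)[OF O_born(2)]
  note rac = linear_mapD(1)[OF bdd_linear_mapD(1)[OF ra]]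
  have sa: "{a} \<in> bounded R" using A.bd(5) a by simp
  have "\<exists>g. bdd_linear_map V \<Omega>\<^sub>2 \<Omega>\<^sub>2 g \<and> (\<forall>x\<in>carrier U. \<forall>y\<in>carrier R. \<forall>z\<in>carrier R. g (f2 x y z) = f2 x y (z \<otimes>\<^bsub>R\<^esub> a))"
  proof (rule O2_lift[OF O_complete(2)])
    show "bdd_bilinear V R R \<Omega>\<^sub>2 (\<lambda>y z. f2 x y (z \<otimes>\<^bsub>R\<^esub> a))" if "x \<in> carrier U" for x
      by (rule bdd_bilinear_comp[OF f2_bilinear[OF that] idR ra idO])
    show "linear_map V U \<Omega>\<^sub>2 (\<lambda>x. f2 x y (z \<otimes>\<^bsub>R\<^esub> a))" if "y \<in> carrier R" "z \<in> carrier R" for y z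
      by (rule f2_linear[OF that(1) rac[OF that(2)]])
    fix A S T assume AST: "A \<in> bounded U" "S \<in> bounded R" "T \<in> bounded R"
    show "{f2 x y (z \<otimes>\<^bsub>R\<^esub> a) |x y z. x \<in> A \<and> y \<in> S \<and> z \<in> T} \<in> bounded \<Omega>\<^sub>2"
      by (rule bc[OF f2_bdd[OF AST(1,2) bdd_linear_mapD(2)[OF ra AST(3)]]]) blast
  qed
  then obtain g1 where g1: "bdd_linear_map V \<Omega>\<^sub>2 \<Omega>\<^sub>2 g1" "\<And>x y z. x \<in> carrier U \<Longrightarrow> y \<in> carrier R \<Longrightarrow> z \<in> carrier R \<Longrightarrow> g1 (f2 x y z) = f2 x y (z \<otimes>\<^bsub>R\<^esub> a)" by blast
  have "\<exists>g. bdd_linear_map V \<Omega>\<^sub>2 \<Omega>\<^sub>2 g \<and> (\<forall>x\<in>carrier U. \<forall>y\<in>carrier R. \<forall>z\<in>carrier R. g (f2 x y z) = f2 x (y \<otimes>\<^bsub>R\<^esub> z) a)"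
  proof (rule O2_lift[OF O_complete(2)])
    show "bdd_bilinear V R R \<Omega>\<^sub>2 (\<lambda>y z. f2 x (y \<otimes>\<^bsub>R\<^esub> z) a)" if "x \<in> carrier U" for x
      by (rule bdd_bilinear_comp[OF A.mul_bilinear idR idR bdd_bilinear_left[OF f2_bilinear[OF that] A.born O_born(2) a]])
    show "linear_map V U \<Omega>\<^sub>2 (\<lambda>x. f2 x (y \<otimes>\<^bsub>R\<^esub> z) a)" if "y \<in> carrier R" "z \<in> carrier R" for y z
      by (rule f2_linear[OF A.mul_closed[OF that] a])
    fix A S T assume AST: "A \<in> bounded U" "S \<in> bounded R" "T \<in> bounded R"
    show "{f2 x (y \<otimes>\<^bsub>R\<^esub> z) a |x y z. x \<in> A \<and> y \<in> S \<and> z \<in> T} \<in> bounded \<Omega>\<^sub>2"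
      by (rule bc[OF f2_bdd[OF AST(1) A.mul_bdd[OF AST(2,3)] sa]]) (unfold set_prod_def, blast)
  qed
  then obtain g2 where g2: "bdd_linear_map V \<Omega>\<^sub>2 \<Omega>\<^sub>2 g2" "\<And>x y z. x \<in> carrier U \<Longrightarrow> y \<in> carrier R \<Longrightarrow> z \<in> carrier R \<Longrightarrow> g2 (f2 x y z) = f2 x (y \<otimes>\<^bsub>R\<^esub> z) a" by blast
  have "\<exists>g. bdd_linear_map V \<Omega>\<^sub>2 \<Omega>\<^sub>2 g \<and> (\<forall>x\<in>carrier U. \<forall>y\<in>carrier R. \<forall>z\<in>carrier R. g (f2 x y z) = f2 (x \<otimes>\<^bsub>U\<^esub> io y) z a)"
  proof (rule O2_lift[OF O_complete(2)])
    show "bdd_bilinear V R R \<Omega>\<^sub>2 (\<lambda>y z. f2 (x \<otimes>\<^bsub>U\<^esub> io y) z a)" if x: "x \<in> carrier U" for x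
      using bdd_bilinear_comp[OF O2.cpure_bilinear bdd_bilinear_right[OF U_right U_born U_born x]
        bdd_bilinear_left[OF RR.cpure_bilinear A.born RR.CT_born a] idO[unfolded O_defs]]
      by (simp add: O_defs)
    show "linear_map V U \<Omega>\<^sub>2 (\<lambda>x. f2 (x \<otimes>\<^bsub>U\<^esub> io y) z a)" if "y \<in> carrier R" "z \<in> carrier R" for y z
      by (rule linear_map_comp[OF bdd_bilinearD(2)[OF U_right that(1)] f2_linear[OF that(2) a]])
    fix A S T assume AST: "A \<in> bounded U" "S \<in> bounded R" "T \<in> bounded R"
    show "{f2 (x \<otimes>\<^bsub>U\<^esub> io y) z a |x y z. x \<in> A \<and> y \<in> S \<and> z \<in> T} \<in> bounded \<Omega>\<^sub>2"
      by (rule bc[OF f2_bdd[OF bdd_bilinearD(3)[OF U_right AST(1,2)] AST(3) sa]]) blast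
  qed
  then obtain g3 where g3: "bdd_linear_map V \<Omega>\<^sub>2 \<Omega>\<^sub>2 g3" "\<And>x y z. x \<in> carrier U \<Longrightarrow> y \<in> carrier R \<Longrightarrow> z \<in> carrier R \<Longrightarrow> g3 (f2 x y z) = f2 (x \<otimes>\<^bsub>U\<^esub> io y) z a" by blast
  have "bdd_linear_map V \<Omega>\<^sub>2 \<Omega>\<^sub>2 (\<lambda>w. (g1 w \<ominus>\<^bsub>\<Omega>\<^sub>2\<^esub> g2 w) \<oplus>\<^bsub>\<Omega>\<^sub>2\<^esub> g3 w)"
    by (rule bdd_linear_map_add[OF O_born(2) bdd_linear_map_diff[OF O_born(2) g1(1) g2(1) O_born(2)] g3(1) A.pi])
  moreover have "?\<Phi> (\<lambda>w. (g1 w \<ominus>\<^bsub>\<Omega>\<^sub>2\<^esub> g2 w) \<oplus>\<^bsub>\<Omega>\<^sub>2\<^esub> g3 w)" by (intro ballI) (simp only: g1(2) g2(2) g3(2))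
  ultimately have ex: "\<exists>g. bdd_linear_map V \<Omega>\<^sub>2 \<Omega>\<^sub>2 g \<and> ?\<Phi> g" by blast
  have r: "?\<Phi> (restrict g (carrier \<Omega>\<^sub>2))" if "?\<Phi> g" for g using that f_carrier(2) by simp
  have u: "g x = h x" if "bdd_linear_map V \<Omega>\<^sub>2 \<Omega>\<^sub>2 g" "bdd_linear_map V \<Omega>\<^sub>2 \<Omega>\<^sub>2 h" "?\<Phi> g" "?\<Phi> h" "x \<in> carrier \<Omega>\<^sub>2" for g h x
    by (rule O2_unique[OF O_complete(2) that(1,2) _ that(5)]) (use that(3,4) in simp)
  have T: "bdd_linear_map V \<Omega>\<^sub>2 \<Omega>\<^sub>2 (right_mult2 V \<pi> R a)" "?\<Phi> (right_mult2 V \<pi> R a)"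
    unfolding right_mult2_def
    by (rule the_bdd_linear_map[of V \<Omega>\<^sub>2 \<Omega>\<^sub>2 ?\<Phi>], rule ex, erule r, erule (4) u, rule O_born(2))+
  show "bdd_linear_map V \<Omega>\<^sub>2 \<Omega>\<^sub>2 (right_mult2 V \<pi> R a)" by (rule T(1))
  show "x \<in> carrier U \<Longrightarrow> y \<in> carrier R \<Longrightarrow> z \<in> carrier R \<Longrightarrow> right_mult2 V \<pi> R a (f2 x y z) =
      (f2 x y (z \<otimes>\<^bsub>R\<^esub> a) \<ominus>\<^bsub>\<Omega>\<^sub>2\<^esub> f2 x (y \<otimes>\<^bsub>R\<^esub> z) a) \<oplus>\<^bsub>\<Omega>\<^sub>2\<^esub> f2 (x \<otimes>\<^bsub>U\<^esub> io y) z a" using T(2) by blast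
qed

text \<open>Apply the two rules for a connection to \<open>d(xy) = x dy + (dx)y\<close>. The
  right-hand rule contributes the additional summand \<open>dx dy\<close>, and it is this summand
  that later cancels the linear curvature term in a Newton step.\<close>

lemma connection_d:
  assumes D: "connection V \<pi> R D" and x: "x \<in> carrier R" and y: "y \<in> carrier R"
  shows "D (f1 \<one>\<^bsub>U\<^esub> (x \<otimes>\<^bsub>R\<^esub> y)) = left_mult2 V \<pi> R x (D (f1 \<one>\<^bsub>U\<^esub> y)) \<oplus>\<^bsub>\<Omega>\<^sub>2\<^esub>
    (right_mult2 V \<pi> R y (D (f1 \<one>\<^bsub>U\<^esub> x)) \<oplus>\<^bsub>\<Omega>\<^sub>2\<^esub> f2 \<one>\<^bsub>U\<^esub> x y)"
proof -
  interpret P: module V \<Omega>\<^sub>1 by (rule born_moduleD(1)[OF O_born(1)])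
  note d = f_carrier(1)[OF U_one]
  have lin: "linear_map V \<Omega>\<^sub>1 \<Omega>\<^sub>2 D" using D by (simp add: connection_def)
  have l: "left_mult1 V \<pi> R x (f1 \<one>\<^bsub>U\<^esub> y) = f1 (io x) y"
    using left_mult1(2)[OF x U_one y] io_mult(3)[OF x] by simp
  have r: "right_mult1 V \<pi> R y (f1 \<one>\<^bsub>U\<^esub> x) = f1 \<one>\<^bsub>U\<^esub> (x \<otimes>\<^bsub>R\<^esub> y) \<ominus>\<^bsub>\<Omega>\<^sub>1\<^esub> f1 (io x) y"
    using right_mult1(2)[OF y U_one x] io_mult(2)[OF x] by simp
  note c = f_carrier(1)[OF io_carrier[OF x] y] d[OF A.mul_closed[OF x y]]
  have "f1 \<one>\<^bsub>U\<^esub> (x \<otimes>\<^bsub>R\<^esub> y) = left_mult1 V \<pi> R x (f1 \<one>\<^bsub>U\<^esub> y) \<oplus>\<^bsub>\<Omega>\<^sub>1\<^esub> right_mult1 V \<pi> R y (f1 \<one>\<^bsub>U\<^esub> x)"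
    unfolding l r using c by (simp add: a_minus_def P.M.a_lcomm[of _ "f1 \<one>\<^bsub>U\<^esub> (x \<otimes>\<^bsub>R\<^esub> y)"] P.M.r_neg)
  then have "D (f1 \<one>\<^bsub>U\<^esub> (x \<otimes>\<^bsub>R\<^esub> y)) = D (left_mult1 V \<pi> R x (f1 \<one>\<^bsub>U\<^esub> y)) \<oplus>\<^bsub>\<Omega>\<^sub>2\<^esub> D (right_mult1 V \<pi> R y (f1 \<one>\<^bsub>U\<^esub> x))"
    using linear_mapD(2)[OF lin] linear_mapD(1)[OF bdd_linear_mapD(1)[OF left_mult1(1)[OF x]] d[OF y]]
      linear_mapD(1)[OF bdd_linear_mapD(1)[OF right_mult1(1)[OF y]] d[OF x]] by simp
  also have "D (left_mult1 V \<pi> R x (f1 \<one>\<^bsub>U\<^esub> y)) = left_mult2 V \<pi> R x (D (f1 \<one>\<^bsub>U\<^esub> y))"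
    using D x d[OF y] unfolding connection_def by blast
  also have "D (right_mult1 V \<pi> R y (f1 \<one>\<^bsub>U\<^esub> x)) = right_mult2 V \<pi> R y (D (f1 \<one>\<^bsub>U\<^esub> x)) \<oplus>\<^bsub>\<Omega>\<^sub>2\<^esub> times_d V \<pi> R y (f1 \<one>\<^bsub>U\<^esub> x)"
    using D y d[OF x] unfolding connection_def by blast
  also have "times_d V \<pi> R y (f1 \<one>\<^bsub>U\<^esub> x) = f2 \<one>\<^bsub>U\<^esub> x y" by (rule times_d(2)[OF y U_one x])
  finally show ?thesis .
qed

end

section \<open>Newton iteration for almost multiplicative maps\<close>

context balg
begin

lemma span_mult:
  assumes "X \<subseteq> carrier A" "Y \<subseteq> carrier A" "submodule T V A" "\<And>x y. x \<in> X \<Longrightarrow> y \<in> Y \<Longrightarrow> x \<otimes>\<^bsub>A\<^esub> y \<in> T"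
    "x \<in> span_in V A X" "y \<in> span_in V A Y"
  shows "x \<otimes>\<^bsub>A\<^esub> y \<in> T"
proof -
  have y: "y \<in> carrier A" using span_carrier[OF assms(2)] assms(6) by blast
  have "x' \<otimes>\<^bsub>A\<^esub> y \<in> T" if "x' \<in> X" for x'
    by (rule linear_span_in[OF module_axioms module_axioms mul_linear(1) assms(3,2) _ assms(6)])
       (use that assms(1,4) in blast)+
  then show ?thesis
    by (rule linear_span_in[OF module_axioms module_axioms mul_linear(2)[OF y] assms(3,1) _ assms(5)])
qed

lemma set_prod_carrier: "S \<subseteq> carrier A \<Longrightarrow> T \<subseteq> carrier A \<Longrightarrow> set_prod A S T \<subseteq> carrier A"
  unfolding set_prod_def using mul_closed by blast

lemma set_prodI: "x \<in> S \<Longrightarrow> y \<in> T \<Longrightarrow> x \<otimes>\<^bsub>A\<^esub> y \<in> set_prod A S T"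
  unfolding set_prod_def by blast

lemma set_prodE: "z \<in> set_prod A S T \<Longrightarrow> (\<And>x y. z = x \<otimes>\<^bsub>A\<^esub> y \<Longrightarrow> x \<in> S \<Longrightarrow> y \<in> T \<Longrightarrow> thesis) \<Longrightarrow> thesis"
  unfolding set_prod_def by blast

lemma fold_Suc: "i \<ge> 1 \<Longrightarrow> fold_prods A M (Suc i) = set_prod A M (fold_prods A M i)"
  by (cases i) simp_all

lemma fold_carrier: "M \<subseteq> carrier A \<Longrightarrow> fold_prods A M i \<subseteq> carrier A"
proof (induction i)
  case (Suc i) then show ?case using set_prod_carrier[of M "fold_prods A M i"] by (cases "i \<ge> 1") (auto simp: fold_Suc not_le)
qed simp

lemma fold_bdd: "M \<in> bounded A \<Longrightarrow> fold_prods A M i \<in> bounded A"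
proof (induction i)
  case 0 then show ?case using bd(3)[of M "{}"] by simp
next
  case (Suc i) then show ?case using mul_bdd[of M "fold_prods A M i"] by (cases "i \<ge> 1") (auto simp: fold_Suc not_le)
qed

lemma fold_mult:
  assumes M: "M \<subseteq> carrier A" and j: "j \<ge> 1"
  shows "x \<in> fold_prods A M i \<Longrightarrow> y \<in> fold_prods A M j \<Longrightarrow> x \<otimes>\<^bsub>A\<^esub> y \<in> fold_prods A M (i + j)"
proof (induction i arbitrary: x)
  case (Suc i)
  show ?case
  proof (cases "i \<ge> 1")
    case True
    obtain m z where z: "x = m \<otimes>\<^bsub>A\<^esub> z" "m \<in> M" "z \<in> fold_prods A M i"
      using Suc.prems(1) unfolding fold_Suc[OF True] by (rule set_prodE)
    have "x \<otimes>\<^bsub>A\<^esub> y = m \<otimes>\<^bsub>A\<^esub> (z \<otimes>\<^bsub>A\<^esub> y)"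
      unfolding z(1) using z(2,3) Suc.prems(2) fold_carrier[OF M] M by (intro mul_assoc) blast+
    then show ?thesis using set_prodI[OF z(2) Suc.IH[OF z(3) Suc.prems(2)]] True by (simp add: fold_Suc)
  next
    case False
    then have "x \<in> M" using Suc.prems(1) by (simp add: not_le)
    then show ?thesis using False Suc.prems(2) set_prodI j by (simp add: not_le fold_Suc)
  qed
qed simp

text \<open>The recursion of \<open>fold_prods\<close> splits off one factor on the left;
  associativity moves the cut to any place. This is how long products are divided into
  blocks.\<close>

lemma fold_split:
  assumes M: "M \<subseteq> carrier A" and "i \<ge> 1" "j \<ge> 1" "x \<in> fold_prods A M (i + j)"
  shows "\<exists>y\<in>fold_prods A M i. \<exists>z\<in>fold_prods A M j. x = y \<otimes>\<^bsub>A\<^esub> z"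
  using assms(2,4)
proof (induction i arbitrary: x rule: nat_induct_at_least)
  case base then show ?case using fold_Suc[OF assms(3), of M] unfolding set_prod_def by simp blast
next
  case (Suc i)
  have "x \<in> set_prod A M (fold_prods A M (i + j))" using Suc.prems fold_Suc[of "i + j" M] Suc.hyps by simp
  then obtain m w where w: "x = m \<otimes>\<^bsub>A\<^esub> w" "m \<in> M" "w \<in> fold_prods A M (i + j)" by (rule set_prodE)
  obtain y z where yz: "y \<in> fold_prods A M i" "z \<in> fold_prods A M j" "w = y \<otimes>\<^bsub>A\<^esub> z" using Suc.IH[OF w(3)] by blast
  have "x = (m \<otimes>\<^bsub>A\<^esub> y) \<otimes>\<^bsub>A\<^esub> z"
    unfolding w(1) yz(3) by (rule mul_assoc[symmetric]) (use w(2) yz(1,2) fold_carrier[OF M] M in blast)+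
  moreover have "m \<otimes>\<^bsub>A\<^esub> y \<in> fold_prods A M (Suc i)" using set_prodI[OF w(2) yz(1)] fold_Suc[OF Suc.hyps] by simp
  ultimately show ?case using yz(2) by blast
qed

lemma power_bdd: "M \<in> bounded A \<Longrightarrow> sub_power V A M i \<in> bdd_submodules V A"
  unfolding sub_power_def by (rule bdd_span[OF fold_bdd])

lemma power_carrier: "M \<subseteq> carrier A \<Longrightarrow> sub_power V A M i \<subseteq> carrier A"
  unfolding sub_power_def by (rule span_carrier[OF fold_carrier])

lemma power_mult:
  assumes "M \<subseteq> carrier A" "j \<ge> 1" "x \<in> sub_power V A M i" "y \<in> sub_power V A M j"
  shows "x \<otimes>\<^bsub>A\<^esub> y \<in> sub_power V A M (i + j)"
  using assms(3,4) unfolding sub_power_def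
  by (rule span_mult[OF fold_carrier[OF assms(1)] fold_carrier[OF assms(1)] span_sub[OF fold_carrier[OF assms(1)]],
      rotated 1]) (rule subsetD[OF span_sup fold_mult[OF assms(1,2)]])

lemma upto_gen: "M \<subseteq> carrier A \<Longrightarrow> (\<Union>i\<in>{1..n}. sub_power V A M i) \<subseteq> carrier A"
  using power_carrier[of M] by (intro UN_least)

lemma upto_sub: "M \<subseteq> carrier A \<Longrightarrow> submodule (sub_powers_upto V A M n) V A"
  unfolding sub_powers_upto_def by (rule span_sub[OF upto_gen])

lemma upto_carrier: "M \<subseteq> carrier A \<Longrightarrow> sub_powers_upto V A M n \<subseteq> carrier A"
  unfolding sub_powers_upto_def by (rule span_carrier[OF upto_gen])

lemma upto_bdd: assumes M: "M \<in> bounded A" shows "sub_powers_upto V A M n \<in> bdd_submodules V A"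
proof -
  have "(\<Union>i\<in>{1..k}. sub_power V A M i) \<in> bounded A" for k
  proof (induction k)
    case 0 then show ?case using bd(3)[OF M, of "{}"] by simp
  next
    case (Suc k)
    have "(\<Union>i\<in>{1..Suc k}. sub_power V A M i) = (\<Union>i\<in>{1..k}. sub_power V A M i) \<union> sub_power V A M (Suc k)"
      by (simp add: atLeastAtMostSuc_conv Un_commute)
    then show ?case using bd(2)[OF Suc bddD(2)[OF power_bdd[OF M]]] by simp
  qed
  then show ?thesis unfolding sub_powers_upto_def by (rule bdd_span)
qed

lemma upto_mono: "i \<le> j \<Longrightarrow> sub_powers_upto V A M i \<subseteq> sub_powers_upto V A M j"
  unfolding sub_powers_upto_def by (intro span_mono UN_mono) auto

lemma upto_1: "M \<subseteq> sub_powers_upto V A M 1"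
  unfolding sub_powers_upto_def sub_power_def using span_sup by (auto intro!: order_trans[OF _ span_sup])

lemma upto_mult:
  assumes M: "M \<subseteq> carrier A" and x: "x \<in> sub_powers_upto V A M i" and y: "y \<in> sub_powers_upto V A M j"
  shows "x \<otimes>\<^bsub>A\<^esub> y \<in> sub_powers_upto V A M (i + j)"
  using x y unfolding sub_powers_upto_def[of _ _ _ i] sub_powers_upto_def[of _ _ _ j]
proof (rule span_mult[OF upto_gen[OF M] upto_gen[OF M] upto_sub[OF M], rotated 1])
  fix x y assume "x \<in> (\<Union>i\<in>{1..i}. sub_power V A M i)" "y \<in> (\<Union>i\<in>{1..j}. sub_power V A M i)"
  then obtain k l where kl: "k \<in> {1..i}" "l \<in> {1..j}" "x \<in> sub_power V A M k" "y \<in> sub_power V A M l" by blast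
  have "x \<otimes>\<^bsub>A\<^esub> y \<in> sub_power V A M (k + l)" by (rule power_mult[OF M _ kl(3,4)]) (use kl in simp)
  moreover have "k + l \<in> {1..i+j}" using kl by auto
  ultimately show "x \<otimes>\<^bsub>A\<^esub> y \<in> sub_powers_upto V A M (i + j)"
    unfolding sub_powers_upto_def by (intro subsetD[OF span_sup]) blast
qed

end

section \<open>Curvature and the Newton step\<close>

definition curv :: "('v, 'r) bmod \<Rightarrow> ('v, 'e) bmod \<Rightarrow> ('r \<Rightarrow> 'e) \<Rightarrow> 'r \<Rightarrow> 'r \<Rightarrow> 'e" where
  "curv R E s x y = s x \<otimes>\<^bsub>E\<^esub> s y \<ominus>\<^bsub>E\<^esub> s (x \<otimes>\<^bsub>R\<^esub> y)"

text \<open>The coefficient \<open>x\<close> lies in the unitalisation, so \<open>s\<close> has to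
  be extended to it by sending 1 to 1. As \<open>E\<close> may lack a unit, the scalar component
  appears as a separate summand. Such a map exists and is determined by the universal property of
  2-forms.\<close>

definition psi where
  "psi V \<pi> R E s = (SOME g. bdd_linear_map V (omega2 V \<pi> R) E g \<and>
    (\<forall>x\<in>carrier (unitalisation V R). \<forall>y\<in>carrier R. \<forall>z\<in>carrier R. g (form2 V \<pi> R x y z) =
      (s (fst x) \<otimes>\<^bsub>E\<^esub> curv R E s y z) \<oplus>\<^bsub>E\<^esub> snd x \<odot>\<^bsub>E\<^esub> curv R E s y z))"

definition newton where
  "newton V \<pi> R D E s x = s x \<oplus>\<^bsub>E\<^esub> psi V \<pi> R E s (D (form1 V \<pi> R \<one>\<^bsub>unitalisation V R\<^esub> x))"

lemma bdd_bilinear_diff: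
  assumes P: "born_module V P" and f: "bdd_bilinear V M N P f" and g: "bdd_bilinear V M N P g" and pi: "\<pi> \<in> carrier V"
  shows "bdd_bilinear V M N P (\<lambda>x y. f x y \<ominus>\<^bsub>P\<^esub> g x y)"
proof (rule bdd_bilinearI)
  interpret P: bmod_ctx V \<pi> P by (rule bmod_ctx.intro[OF P pi])
  show "linear_map V N P (\<lambda>y. f x y \<ominus>\<^bsub>P\<^esub> g x y)" if "x \<in> carrier M" for x
    by (rule linear_map_diff[OF P.module_axioms bdd_bilinearD(1)[OF f that] bdd_bilinearD(1)[OF g that]])
  show "linear_map V M P (\<lambda>x. f x y \<ominus>\<^bsub>P\<^esub> g x y)" if "y \<in> carrier N" for y
    by (rule linear_map_diff[OF P.module_axioms bdd_bilinearD(2)[OF f that] bdd_bilinearD(2)[OF g that]])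
  fix A B assume AB: "A \<in> bounded M" "B \<in> bounded N"
  obtain S where S: "S \<in> bdd_submodules V P" "{f x y |x y. x \<in> A \<and> y \<in> B} \<union> {g x y |x y. x \<in> A \<and> y \<in> B} \<subseteq> S"
    using P.bd(6)[OF P.bd(2)[OF bdd_bilinearD(3)[OF f AB] bdd_bilinearD(3)[OF g AB]]] by blast
  have "{f x y \<ominus>\<^bsub>P\<^esub> g x y |x y. x \<in> A \<and> y \<in> B} \<subseteq> S"
    using S(2) P.submodule_minus[OF P.bddD(1)[OF S(1)]] by blast
  then show "{f x y \<ominus>\<^bsub>P\<^esub> g x y |x y. x \<in> A \<and> y \<in> B} \<in> bounded P" by (rule P.bd(3)[OF P.bddD(2)[OF S(1)]])
qed

locale calg = balg V \<pi> A for V :: "('v, 'k) ring_scheme" and \<pi> :: 'v and A :: "('v, 'a) bmod" +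
  assumes compl: "complete_born_module V \<pi> A"

locale almost_hom = forms V \<pi> R + E: calg V \<pi> E
  for V :: "('v, 'k) ring_scheme" and \<pi> :: 'v and R :: "('v, 'r) bmod" and E :: "('v, 'e) bmod" +
  fixes s :: "'r \<Rightarrow> 'e"
  assumes s: "bdd_linear_map V R E s"
begin

abbreviation "w \<equiv> curv R E s"
abbreviation "\<psi> \<equiv> psi V \<pi> R E s"

lemmas sl = linear_mapD[OF bdd_linear_mapD(1)[OF s]]

lemma w_carrier [simp]: "x \<in> carrier R \<Longrightarrow> y \<in> carrier R \<Longrightarrow> w x y \<in> carrier E"
  by (simp add: curv_def sl)

lemma w_bilinear: "bdd_bilinear V R R E w"
proof -
  have "bdd_bilinear V R R E (\<lambda>x y. s x \<otimes>\<^bsub>E\<^esub> s y)"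
    by (rule bdd_bilinear_comp[OF E.mul_bilinear s s bdd_linear_map_id[OF E.module_axioms]])
  moreover have "bdd_bilinear V R R E (\<lambda>x y. s (x \<otimes>\<^bsub>R\<^esub> y))"
    by (rule bdd_bilinear_comp[OF A.mul_bilinear bdd_linear_map_id[OF A.module_axioms] bdd_linear_map_id[OF A.module_axioms] s])
  ultimately have "bdd_bilinear V R R E (\<lambda>x y. s x \<otimes>\<^bsub>E\<^esub> s y \<ominus>\<^bsub>E\<^esub> s (x \<otimes>\<^bsub>R\<^esub> y))"
    by (rule bdd_bilinear_diff[OF E.born _ _ E.pi])
  then show ?thesis by (simp add: curv_def[abs_def])
qed

lemma psi: "bdd_linear_map V \<Omega>\<^sub>2 E \<psi>"
  "x \<in> carrier U \<Longrightarrow> y \<in> carrier R \<Longrightarrow> z \<in> carrier R \<Longrightarrow>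
    \<psi> (f2 x y z) = (s (fst x) \<otimes>\<^bsub>E\<^esub> w y z) \<oplus>\<^bsub>E\<^esub> snd x \<odot>\<^bsub>E\<^esub> w y z"
proof -
  have "\<exists>g. bdd_linear_map V \<Omega>\<^sub>2 E g \<and> (\<forall>x\<in>carrier U. \<forall>y\<in>carrier R. \<forall>z\<in>carrier R.
      g (f2 x y z) = (s (fst x) \<otimes>\<^bsub>E\<^esub> w y z) \<oplus>\<^bsub>E\<^esub> snd x \<odot>\<^bsub>E\<^esub> w y z)"
  proof (rule O2_lift[OF E.compl])
    fix x assume "x \<in> carrier U"
    then have x: "fst x \<in> carrier R" "snd x \<in> carrier V" by (auto simp: U_simps)
    have "bdd_linear_map V E E (\<lambda>e. (s (fst x) \<otimes>\<^bsub>E\<^esub> e) \<oplus>\<^bsub>E\<^esub> snd x \<odot>\<^bsub>E\<^esub> e)"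
      by (intro bdd_linear_map_add[OF E.born _ _ E.pi] bdd_bilinear_right[OF E.mul_bilinear E.born E.born]
          bdd_linear_map_smult[OF E.born] bdd_linear_map_id E.module_axioms sl x)
    then show "bdd_bilinear V R R E (\<lambda>y z. (s (fst x) \<otimes>\<^bsub>E\<^esub> w y z) \<oplus>\<^bsub>E\<^esub> snd x \<odot>\<^bsub>E\<^esub> w y z)"
      by (rule bdd_bilinear_comp[OF w_bilinear bdd_linear_map_id[OF A.module_axioms] bdd_linear_map_id[OF A.module_axioms]])
  next
    fix y z assume "y \<in> carrier R" "z \<in> carrier R"
    then have yz: "w y z \<in> carrier E" by simp
    show "linear_map V U E (\<lambda>x. (s (fst x) \<otimes>\<^bsub>E\<^esub> w y z) \<oplus>\<^bsub>E\<^esub> snd x \<odot>\<^bsub>E\<^esub> w y z)"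
      by (rule linear_mapI)
         (use yz in \<open>auto simp: U_simps sl E.mul_l_distr E.smult_l_distr E.smult_r_distr E.mul_smult_l E.smult_assoc1 E.M.a_ac\<close>)
  next
    fix A S T assume AST: "A \<in> bounded U" "S \<in> bounded R" "T \<in> bounded R"
    let ?W = "{w y z |y z. y \<in> S \<and> z \<in> T}"
    have W: "?W \<in> bounded E" by (rule bdd_bilinearD(3)[OF w_bilinear AST(2,3)])
    have A: "s ` (fst ` A) \<in> bounded E" using bdd_linear_mapD(2)[OF s, of "fst ` A"] AST(1) by (simp add: U_simps)
    obtain X where X: "X \<in> bdd_submodules V E" "?W \<union> set_prod E (s ` (fst ` A)) ?W \<subseteq> X"
      using E.bd(6)[OF E.bd(2)[OF W E.mul_bdd[OF A W]]] by blast
    have "{(s (fst x) \<otimes>\<^bsub>E\<^esub> w y z) \<oplus>\<^bsub>E\<^esub> snd x \<odot>\<^bsub>E\<^esub> w y z |x y z. x \<in> A \<and> y \<in> S \<and> z \<in> T} \<subseteq> X"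
    proof clarify
      fix a k y z assume h: "(a, k) \<in> A" "y \<in> S" "z \<in> T"
      have k: "k \<in> carrier V" using h(1) AST(1) by (auto simp: U_simps)
      have 1: "w y z \<in> ?W" using h by blast
      have sa: "s a \<in> s ` (fst ` A)" by (rule imageI, rule image_eqI[OF _ h(1)]) simp
      have 2: "s a \<otimes>\<^bsub>E\<^esub> w y z \<in> X"
        by (rule subsetD[OF X(2)], rule UnI2, rule E.set_prodI[OF sa 1])
      have "k \<odot>\<^bsub>E\<^esub> w y z \<in> X"
        by (rule E.submoduleE(4)[OF E.bddD(1)[OF X(1)] k]) (rule subsetD[OF X(2)], rule UnI1, rule 1)
      then show "(s (fst (a, k)) \<otimes>\<^bsub>E\<^esub> w y z) \<oplus>\<^bsub>E\<^esub> snd (a, k) \<odot>\<^bsub>E\<^esub> w y z \<in> X"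
        using E.submoduleE(5)[OF E.bddD(1)[OF X(1)] 2] by simp
    qed
    then show "{(s (fst x) \<otimes>\<^bsub>E\<^esub> w y z) \<oplus>\<^bsub>E\<^esub> snd x \<odot>\<^bsub>E\<^esub> w y z |x y z. x \<in> A \<and> y \<in> S \<and> z \<in> T} \<in> bounded E"
      by (rule E.bd(3)[OF E.bddD(2)[OF X(1)]])
  qed
  note * = someI_ex[OF this, folded psi_def]
  show "bdd_linear_map V \<Omega>\<^sub>2 E \<psi>" by (rule *[THEN conjunct1])
  show "x \<in> carrier U \<Longrightarrow> y \<in> carrier R \<Longrightarrow> z \<in> carrier R \<Longrightarrow>
      \<psi> (f2 x y z) = (s (fst x) \<otimes>\<^bsub>E\<^esub> w y z) \<oplus>\<^bsub>E\<^esub> snd x \<odot>\<^bsub>E\<^esub> w y z"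
    by (rule *[THEN conjunct2, THEN bspec, THEN bspec, THEN bspec])
qed

lemma psi_io: "x \<in> carrier R \<Longrightarrow> y \<in> carrier R \<Longrightarrow> z \<in> carrier R \<Longrightarrow> \<psi> (f2 (io x) y z) = s x \<otimes>\<^bsub>E\<^esub> w y z"
  "y \<in> carrier R \<Longrightarrow> z \<in> carrier R \<Longrightarrow> \<psi> (f2 \<one>\<^bsub>U\<^esub> y z) = w y z"
  using psi(2)[of "io x" y z] psi(2)[OF U_one, of y z] linear_zero[OF A.module_axioms E.module_axioms bdd_linear_mapD(1)[OF s]]
  by (simp_all add: in_unital_def U_simps sl)

text \<open>The Bianchi identity, a consequence of associativity alone. It moves a factor
  \<open>s x\<close> from the left of a curvature factor to the right, at the price of terms in
  which two arguments are multiplied.\<close>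

lemma w_shift:
  assumes "x \<in> carrier R" "y \<in> carrier R" "z \<in> carrier R"
  shows "s x \<otimes>\<^bsub>E\<^esub> w y z = (w x y \<otimes>\<^bsub>E\<^esub> s z \<ominus>\<^bsub>E\<^esub> w x (y \<otimes>\<^bsub>R\<^esub> z)) \<oplus>\<^bsub>E\<^esub> w (x \<otimes>\<^bsub>R\<^esub> y) z"
proof -
  note c = sl(1)[OF assms(1)] sl(1)[OF assms(2)] sl(1)[OF assms(3)] sl(1)[OF A.mul_closed[OF assms(1,2)]]
    sl(1)[OF A.mul_closed[OF assms(2,3)]] sl(1)[OF A.mul_closed[OF assms(1) A.mul_closed[OF assms(2,3)]]]
  show ?thesis unfolding curv_def A.mul_assoc[OF assms] using c by algebra
qed

end

context almost_hom
begin

text \<open>The failure of \<open>\<psi>\<close> to be a bimodule map is quadratic in the curvature.\<close>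

lemma psi_left:
  assumes x: "x \<in> carrier R" and T: "submodule T V E" and X: "X \<subseteq> carrier \<Omega>\<^sub>2" and \<xi>: "\<xi> \<in> span_in V \<Omega>\<^sub>2 X"
    and gen: "\<And>\<eta>. \<eta> \<in> X \<Longrightarrow> (\<exists>x0\<in>carrier R. \<exists>y\<in>carrier R. \<exists>z\<in>carrier R. \<eta> = f2 (io x0) y z \<and> w x x0 \<otimes>\<^bsub>E\<^esub> w y z \<in> T) \<or>
      (\<exists>y\<in>carrier R. \<exists>z\<in>carrier R. \<eta> = f2 \<one>\<^bsub>U\<^esub> y z)"
  shows "s x \<otimes>\<^bsub>E\<^esub> \<psi> \<xi> \<ominus>\<^bsub>E\<^esub> \<psi> (left_mult2 V \<pi> R x \<xi>) \<in> T"
proof (rule linear_span_in[OF born_moduleD(1)[OF O_born(2)] E.module_axioms _ T X _ \<xi>])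
  note \<psi>l = bdd_linear_mapD(1)[OF psi(1)] and ll = bdd_linear_mapD(1)[OF left_mult2(1)[OF x]]
  show "linear_map V \<Omega>\<^sub>2 E (\<lambda>\<xi>. s x \<otimes>\<^bsub>E\<^esub> \<psi> \<xi> \<ominus>\<^bsub>E\<^esub> \<psi> (left_mult2 V \<pi> R x \<xi>))"
    by (intro linear_map_diff[OF E.module_axioms] linear_map_comp[OF \<psi>l E.mul_linear(1)] linear_map_comp[OF ll \<psi>l] sl x)
  fix \<eta> assume "\<eta> \<in> X"
  then consider (a) x0 y z where "x0 \<in> carrier R" "y \<in> carrier R" "z \<in> carrier R" "\<eta> = f2 (io x0) y z" "w x x0 \<otimes>\<^bsub>E\<^esub> w y z \<in> T"
    | (b) y z where "y \<in> carrier R" "z \<in> carrier R" "\<eta> = f2 \<one>\<^bsub>U\<^esub> y z" using gen by meson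
  then show "s x \<otimes>\<^bsub>E\<^esub> \<psi> \<eta> \<ominus>\<^bsub>E\<^esub> \<psi> (left_mult2 V \<pi> R x \<eta>) \<in> T"
  proof cases
    case a
    note c = sl(1)[OF x] sl(1)[OF a(1)] sl(1)[OF A.mul_closed[OF x a(1)]] w_carrier[OF a(2,3)]
    have "\<psi> (left_mult2 V \<pi> R x \<eta>) = s (x \<otimes>\<^bsub>R\<^esub> x0) \<otimes>\<^bsub>E\<^esub> w y z"
      using left_mult2(2)[OF x io_carrier[OF a(1)] a(2,3)] a(1-4) x by (simp add: io_mult psi_io)
    \<comment> \<open>The coefficients contribute the difference of \<open>s x s x0\<close> and
      \<open>s (x x0)\<close>, which is a curvature, next to the curvature already present.\<close>
    then have "s x \<otimes>\<^bsub>E\<^esub> \<psi> \<eta> \<ominus>\<^bsub>E\<^esub> \<psi> (left_mult2 V \<pi> R x \<eta>) = w x x0 \<otimes>\<^bsub>E\<^esub> w y z"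
      unfolding a(4) psi_io(1)[OF a(1-3)] curv_def[of R E s x x0] using c by algebra
    then show ?thesis using a(5) by simp
  next
    case b
    have "\<psi> (left_mult2 V \<pi> R x \<eta>) = s x \<otimes>\<^bsub>E\<^esub> w y z"
      using left_mult2(2)[OF x U_one b(1,2)] b x by (simp add: io_mult psi_io)
    then have "s x \<otimes>\<^bsub>E\<^esub> \<psi> \<eta> \<ominus>\<^bsub>E\<^esub> \<psi> (left_mult2 V \<pi> R x \<eta>) = \<zero>\<^bsub>E\<^esub>"
      unfolding b(3) psi_io(2)[OF b(1,2)] using E.diff_self[OF E.mul_closed[OF sl(1)[OF x] w_carrier[OF b(1,2)]]] by simp
    then show ?thesis using E.submodule_zero[OF T] by simp
  qed
qed

text \<open>Right multiplication by \<open>a\<close> changes the differentiated elements, so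
  \<open>s a\<close> first has to pass to the left of a curvature by the Bianchi identity. What
  remains is the defect of \<open>s\<close> on the product of the coefficient with the first of
  these elements. For forms with coefficient 1 nothing remains.\<close>

lemma psi_right:
  assumes a: "a \<in> carrier R" and T: "submodule T V E" and X: "X \<subseteq> carrier \<Omega>\<^sub>2" and \<xi>: "\<xi> \<in> span_in V \<Omega>\<^sub>2 X"
    and gen: "\<And>\<eta>. \<eta> \<in> X \<Longrightarrow> (\<exists>x0\<in>carrier R. \<exists>y\<in>carrier R. \<exists>z\<in>carrier R. \<eta> = f2 (io x0) y z \<and> w x0 y \<otimes>\<^bsub>E\<^esub> w z a \<in> T) \<or>
      (\<exists>y\<in>carrier R. \<exists>z\<in>carrier R. \<eta> = f2 \<one>\<^bsub>U\<^esub> y z)"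
  shows "\<psi> \<xi> \<otimes>\<^bsub>E\<^esub> s a \<ominus>\<^bsub>E\<^esub> \<psi> (right_mult2 V \<pi> R a \<xi>) \<in> T"
proof (rule linear_span_in[OF born_moduleD(1)[OF O_born(2)] E.module_axioms _ T X _ \<xi>])
  note \<psi>l = bdd_linear_mapD(1)[OF psi(1)] and rl = bdd_linear_mapD(1)[OF right_mult2(1)[OF a]]
  note m\<Omega> = born_moduleD(1)[OF O_born(2)]
  interpret P: module V \<Omega>\<^sub>2 by (rule m\<Omega>)
  show "linear_map V \<Omega>\<^sub>2 E (\<lambda>\<xi>. \<psi> \<xi> \<otimes>\<^bsub>E\<^esub> s a \<ominus>\<^bsub>E\<^esub> \<psi> (right_mult2 V \<pi> R a \<xi>))"
    by (intro linear_map_diff[OF E.module_axioms] linear_map_comp[OF \<psi>l E.mul_linear(2)] linear_map_comp[OF rl \<psi>l] sl a)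
  have r: "\<psi> (right_mult2 V \<pi> R a (f2 x y z)) = (\<psi> (f2 x y (z \<otimes>\<^bsub>R\<^esub> a)) \<ominus>\<^bsub>E\<^esub> \<psi> (f2 x (y \<otimes>\<^bsub>R\<^esub> z) a)) \<oplus>\<^bsub>E\<^esub> \<psi> (f2 (x \<otimes>\<^bsub>U\<^esub> io y) z a)"
    if "x \<in> carrier U" "y \<in> carrier R" "z \<in> carrier R" for x y z
  proof -
    have "x \<otimes>\<^bsub>U\<^esub> io y \<in> carrier U" using linear_mapD(1)[OF bdd_bilinearD(1)[OF U_right that(1)] that(2)] .
    then show ?thesis using that a
      by (simp add: right_mult2(2) linear_mapD(2)[OF \<psi>l] linear_diff[OF m\<Omega> E.module_axioms \<psi>l] f_carrier)
  qed
  fix \<eta> assume "\<eta> \<in> X"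
  then consider (a) x0 y z where "x0 \<in> carrier R" "y \<in> carrier R" "z \<in> carrier R" "\<eta> = f2 (io x0) y z" "w x0 y \<otimes>\<^bsub>E\<^esub> w z a \<in> T"
    | (b) y z where "y \<in> carrier R" "z \<in> carrier R" "\<eta> = f2 \<one>\<^bsub>U\<^esub> y z" using gen by meson
  then show "\<psi> \<eta> \<otimes>\<^bsub>E\<^esub> s a \<ominus>\<^bsub>E\<^esub> \<psi> (right_mult2 V \<pi> R a \<eta>) \<in> T"
  proof cases
    case (a x0 y z)
    note [simp] = a(1-3) \<open>a \<in> carrier R\<close>
    have p: "\<psi> (right_mult2 V \<pi> R a \<eta>) = (s x0 \<otimes>\<^bsub>E\<^esub> w y (z \<otimes>\<^bsub>R\<^esub> a) \<ominus>\<^bsub>E\<^esub> s x0 \<otimes>\<^bsub>E\<^esub> w (y \<otimes>\<^bsub>R\<^esub> z) a) \<oplus>\<^bsub>E\<^esub> s (x0 \<otimes>\<^bsub>R\<^esub> y) \<otimes>\<^bsub>E\<^esub> w z a"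
      unfolding a(4) r[OF io_carrier[OF a(1)] a(2,3)] by (simp add: psi_io io_mult)
    \<comment> \<open>The Bianchi identity, solved for the term with \<open>s a\<close> on the
      right. It reproduces the three summands of right multiplication.\<close>
    have e: "w y z \<otimes>\<^bsub>E\<^esub> s a = (s y \<otimes>\<^bsub>E\<^esub> w z a \<oplus>\<^bsub>E\<^esub> w y (z \<otimes>\<^bsub>R\<^esub> a)) \<ominus>\<^bsub>E\<^esub> w (y \<otimes>\<^bsub>R\<^esub> z) a"
    proof -
      have "w y z \<otimes>\<^bsub>E\<^esub> s a \<in> carrier E" "w y (z \<otimes>\<^bsub>R\<^esub> a) \<in> carrier E" "w (y \<otimes>\<^bsub>R\<^esub> z) a \<in> carrier E" by (simp_all add: sl)
      then show ?thesis unfolding w_shift[OF a(2,3) \<open>a \<in> carrier R\<close>] by algebra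
    qed
    have c: "s x0 \<in> carrier E" "s y \<in> carrier E" "s a \<in> carrier E" "w y z \<in> carrier E" "w z a \<in> carrier E"
      "w y (z \<otimes>\<^bsub>R\<^esub> a) \<in> carrier E" "w (y \<otimes>\<^bsub>R\<^esub> z) a \<in> carrier E" "s (x0 \<otimes>\<^bsub>R\<^esub> y) \<in> carrier E" by (simp_all add: sl)
    have "\<psi> \<eta> \<otimes>\<^bsub>E\<^esub> s a = s x0 \<otimes>\<^bsub>E\<^esub> (w y z \<otimes>\<^bsub>E\<^esub> s a)"
      unfolding a(4) psi_io(1)[OF a(1-3)] using c by (simp add: E.mul_assoc)
    then have "\<psi> \<eta> \<otimes>\<^bsub>E\<^esub> s a \<ominus>\<^bsub>E\<^esub> \<psi> (right_mult2 V \<pi> R a \<eta>) = w x0 y \<otimes>\<^bsub>E\<^esub> w z a"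
      unfolding p e curv_def[of R E s x0 y] using c by algebra
    then show ?thesis using a(5) by simp
  next
    case (b y z)
    note [simp] = b(1,2) \<open>a \<in> carrier R\<close>
    have p: "\<psi> (right_mult2 V \<pi> R a \<eta>) = (w y (z \<otimes>\<^bsub>R\<^esub> a) \<ominus>\<^bsub>E\<^esub> w (y \<otimes>\<^bsub>R\<^esub> z) a) \<oplus>\<^bsub>E\<^esub> s y \<otimes>\<^bsub>E\<^esub> w z a"
      unfolding b(3) r[OF U_one b(1,2)] by (simp add: psi_io io_mult)
    have c: "s a \<in> carrier E" "w y z \<in> carrier E" "w y (z \<otimes>\<^bsub>R\<^esub> a) \<in> carrier E" "w (y \<otimes>\<^bsub>R\<^esub> z) a \<in> carrier E" by (simp_all add: sl)
    have "\<psi> \<eta> \<otimes>\<^bsub>E\<^esub> s a \<ominus>\<^bsub>E\<^esub> \<psi> (right_mult2 V \<pi> R a \<eta>) = \<zero>\<^bsub>E\<^esub>"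
      unfolding p w_shift[OF b(1,2) \<open>a \<in> carrier R\<close>] unfolding b(3) psi_io(2)[OF b(1,2)] using c by algebra
    then show ?thesis using E.submodule_zero[OF T] by simp
  qed
qed

end

context almost_hom
begin

context
  fixes D
  assumes D: "connection V \<pi> R D"
begin

abbreviation "\<phi> x \<equiv> D (f1 \<one>\<^bsub>U\<^esub> x)"
abbreviation "s' \<equiv> newton V \<pi> R D E s"

lemma phi_linear: "linear_map V R \<Omega>\<^sub>2 \<phi>"
  using linear_map_comp[OF bdd_bilinearD(1)[OF f1_bilinear U_one]] D unfolding connection_def by blast

text \<open>Expanding the product gives the old curvature plus terms linear and quadratic in the
  correction. By \<open>connection_d\<close> the correction at \<open>xy\<close> contains \<psi>(dx
  dy), which equals the old curvature and cancels it. Only the defects of \<psi> as a bimodule map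
  and the product of two corrections survive.\<close>

lemma curv_newton:
  assumes x: "x \<in> carrier R" and y: "y \<in> carrier R"
  shows "curv R E s' x y = ((s x \<otimes>\<^bsub>E\<^esub> \<psi> (\<phi> y) \<ominus>\<^bsub>E\<^esub> \<psi> (left_mult2 V \<pi> R x (\<phi> y))) \<oplus>\<^bsub>E\<^esub>
    (\<psi> (\<phi> x) \<otimes>\<^bsub>E\<^esub> s y \<ominus>\<^bsub>E\<^esub> \<psi> (right_mult2 V \<pi> R y (\<phi> x)))) \<oplus>\<^bsub>E\<^esub> \<psi> (\<phi> x) \<otimes>\<^bsub>E\<^esub> \<psi> (\<phi> y)"
proof -
  note \<psi>l = linear_mapD[OF bdd_linear_mapD(1)[OF psi(1)]]
  interpret P: module V \<Omega>\<^sub>2 by (rule born_moduleD(1)[OF O_born(2)])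
  have \<phi>: "\<phi> x \<in> carrier \<Omega>\<^sub>2" "\<phi> y \<in> carrier \<Omega>\<^sub>2" using linear_mapD(1)[OF phi_linear] x y by blast+
  note lr = linear_mapD(1)[OF bdd_linear_mapD(1)[OF left_mult2(1)[OF x]] \<phi>(2)] linear_mapD(1)[OF bdd_linear_mapD(1)[OF right_mult2(1)[OF y]] \<phi>(1)]
  have p: "\<psi> (\<phi> (x \<otimes>\<^bsub>R\<^esub> y)) = \<psi> (left_mult2 V \<pi> R x (\<phi> y)) \<oplus>\<^bsub>E\<^esub> (\<psi> (right_mult2 V \<pi> R y (\<phi> x)) \<oplus>\<^bsub>E\<^esub> w x y)"
    unfolding connection_d[OF D x y] using lr f_carrier(2)[OF U_one x y] x y by (simp add: \<psi>l psi_io)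
  have c: "s x \<in> carrier E" "s y \<in> carrier E" "s (x \<otimes>\<^bsub>R\<^esub> y) \<in> carrier E" "\<psi> (\<phi> x) \<in> carrier E" "\<psi> (\<phi> y) \<in> carrier E"
    "\<psi> (left_mult2 V \<pi> R x (\<phi> y)) \<in> carrier E" "\<psi> (right_mult2 V \<pi> R y (\<phi> x)) \<in> carrier E"
    using x y \<phi> lr by (simp_all add: sl \<psi>l)
  show ?thesis unfolding curv_def[of R E s' x y] newton_def p curv_def using c by algebra
qed

lemma newton_bdd:
  assumes \<phi>: "bdd_linear_map V R \<Omega>\<^sub>2 \<phi>"
  shows "bdd_linear_map V R E s'"
  unfolding newton_def[abs_def]
  by (rule bdd_linear_map_add[OF E.born s bdd_linear_map_comp[OF \<phi> psi(1)] E.pi])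

text \<open>With zero curvature \<psi> vanishes on elementary forms, hence everywhere by density,
  and so the correction is zero.\<close>

lemma newton_multiplicative:
  assumes "\<And>x y. x \<in> carrier R \<Longrightarrow> y \<in> carrier R \<Longrightarrow> s (x \<otimes>\<^bsub>R\<^esub> y) = s x \<otimes>\<^bsub>E\<^esub> s y" and x: "x \<in> carrier R"
  shows "s' x = s x"
proof -
  have w0: "w y z = \<zero>\<^bsub>E\<^esub>" if "y \<in> carrier R" "z \<in> carrier R" for y z
    using assms(1)[OF that] that by (simp add: curv_def E.diff_self sl)
  have z: "bdd_linear_map V \<Omega>\<^sub>2 E (\<lambda>x. \<zero>\<^bsub>E\<^esub>)"
    by (rule bdd_linear_mapI[OF linear_map_zero[OF E.module_axioms]], rule E.bd(3)[OF E.bd(5)[of "{\<zero>\<^bsub>E\<^esub>}"]]) auto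
  have "\<psi> \<xi> = \<zero>\<^bsub>E\<^esub>" if "\<xi> \<in> carrier \<Omega>\<^sub>2" for \<xi>
  proof (rule O2_unique[OF E.compl psi(1) z _ that])
    fix x y z assume h: "x \<in> carrier U" "y \<in> carrier R" "z \<in> carrier R"
    have "fst x \<in> carrier R" "snd x \<in> carrier V" using h(1) by (auto simp: U_simps)
    then show "\<psi> (f2 x y z) = \<zero>\<^bsub>E\<^esub>" using h by (simp add: psi(2) w0 sl)
  qed
  then show ?thesis using linear_mapD(1)[OF phi_linear x] x by (simp add: newton_def sl)
qed

text \<open>Composing \<psi> with the homomorphism gives a bounded linear map on 2-forms with the
  values prescribed for the \<psi> of \<open>t\<close>; uniqueness identifies the two. This compares
  the iterations at different levels of a projective system.\<close>

lemma newton_natural: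
  assumes h: "bdd_alg_hom V E E' h" and t: "almost_hom V \<pi> R E' t"
    and st: "\<And>x. x \<in> carrier R \<Longrightarrow> h (s x) = t x" and x: "x \<in> carrier R"
  shows "h (s' x) = newton V \<pi> R D E' t x"
proof -
  have hl: "bdd_linear_map V E E' h" and hm: "\<And>a b. a \<in> carrier E \<Longrightarrow> b \<in> carrier E \<Longrightarrow> h (a \<otimes>\<^bsub>E\<^esub> b) = h a \<otimes>\<^bsub>E'\<^esub> h b"
    using h by (auto simp: bdd_alg_hom_def)
  have E': "calg V \<pi> E'" using t by (simp add: almost_hom_def)
  note hD = linear_mapD[OF bdd_linear_mapD(1)[OF hl]]
  have mE': "module V E'" using calg.compl[OF E'] by (simp add: complete_born_module_def born_module_def)
  have hw: "h (w y z) = curv R E' t y z" if "y \<in> carrier R" "z \<in> carrier R" for y z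
    using that by (simp add: curv_def linear_diff[OF E.module_axioms mE' bdd_linear_mapD(1)[OF hl]] hm sl st)
  have "h (\<psi> \<xi>) = psi V \<pi> R E' t \<xi>" if "\<xi> \<in> carrier \<Omega>\<^sub>2" for \<xi>
  proof (rule O2_unique[OF calg.compl[OF E'] bdd_linear_map_comp[OF psi(1) hl] almost_hom.psi(1)[OF t] _ that])
    fix x y z assume q: "x \<in> carrier U" "y \<in> carrier R" "z \<in> carrier R"
    have "fst x \<in> carrier R" "snd x \<in> carrier V" using q(1) by (auto simp: U_simps)
    then show "h (\<psi> (f2 x y z)) = psi V \<pi> R E' t (f2 x y z)"
      using q by (simp add: psi(2) almost_hom.psi(2)[OF t] hD hm hw sl st)
  qed
  then show ?thesis using linear_mapD(1)[OF phi_linear x] linear_mapD(1)[OF bdd_linear_mapD(1)[OF psi(1)]] x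
    by (simp add: newton_def hD sl st)
qed

end

end

section \<open>Degree and boundedness of connections\<close>

context forms
begin

definition "gens2 M r =
    {f2 (io x0) x1 x2 | x0 x1 x2 i0 i1 i2. i0 + i1 + i2 \<le> r \<and>
        x0 \<in> sub_powers_upto V R M i0 \<and> x1 \<in> sub_powers_upto V R M i1 \<and> x2 \<in> sub_powers_upto V R M i2} \<union>
     {f2 \<one>\<^bsub>U\<^esub> x1 x2 | x1 x2 i1 i2. i1 + i2 \<le> r \<and> x1 \<in> sub_powers_upto V R M i1 \<and> x2 \<in> sub_powers_upto V R M i2}"

lemma gens2:
  assumes M: "M \<subseteq> carrier R"
  shows "filtration2 V \<pi> R M r = span_in V \<Omega>\<^sub>2 (gens2 M r)" and "gens2 M r \<subseteq> carrier \<Omega>\<^sub>2"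
proof -
  note u = A.upto_carrier[OF M, THEN subsetD]
  show "gens2 M r \<subseteq> carrier \<Omega>\<^sub>2"
    unfolding gens2_def by clarify (elim UnE CollectE exE conjE, auto intro: f_carrier(2) io_carrier U_one u)
qed (simp add: filtration2_def gens2_def)

lemma phi_degree:
  assumes deg: "\<And>n. D ` filtration1 V \<pi> R M n \<subseteq> filtration2 V \<pi> R M (n + a)" and x: "x \<in> sub_powers_upto V R M i"
  shows "D (f1 \<one>\<^bsub>U\<^esub> x) \<in> filtration2 V \<pi> R M (i + a)"
proof -
  interpret P: module V \<Omega>\<^sub>1 by (rule born_moduleD(1)[OF O_born(1)])
  have "f1 \<one>\<^bsub>U\<^esub> x \<in> filtration1 V \<pi> R M i"
    unfolding filtration1_def by (rule subsetD[OF P.span_sup]) (use x in blast)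
  then show ?thesis using deg by blast
qed

text \<open>A connection is only a linear map by definition; its restriction to exact forms becomes
  bounded through finite degree. On a suitable \<open>M\<close> it maps degree 1 into degree
  \<open>1 + a\<close> of the filtration, and the latter is generated by forms with entries in a
  bounded set.\<close>

lemma phi_bdd:
  assumes D: "connection V \<pi> R D" and fd: "finite_degree V \<pi> R D"
  shows "bdd_linear_map V R \<Omega>\<^sub>2 (\<lambda>x. D (f1 \<one>\<^bsub>U\<^esub> x))"
proof (rule bdd_linear_mapI)
  show "linear_map V R \<Omega>\<^sub>2 (\<lambda>x. D (f1 \<one>\<^bsub>U\<^esub> x))"
    using linear_map_comp[OF bdd_bilinearD(1)[OF f1_bilinear U_one]] D unfolding connection_def by blast
  fix B assume "B \<in> bounded R"
  then obtain M where M0: "M \<in> bdd_submodules V R" "B \<subseteq> M" "finite_degree_on V \<pi> R D M"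
    using fd[unfolded finite_degree_def, THEN bspec] by blast
  obtain a where "\<And>n. D ` filtration1 V \<pi> R M n \<subseteq> filtration2 V \<pi> R M (n + a)"
    using M0(3) unfolding finite_degree_on_def by blast
  note M = M0(1,2) this
  interpret P: bmod_ctx V \<pi> \<Omega>\<^sub>2 by (rule bmod_ctx.intro[OF O_born(2) A.pi])
  \<comment> \<open>Elements of \<open>B\<close> lie in \<open>M\<close> and have degree 1, and the
    connection raises the degree by at most \<open>a\<close>.\<close>
  let ?r = "1 + a"
  let ?S = "sub_powers_upto V R M ?r"
  note S = A.bddD(2)[OF A.upto_bdd[OF A.bddD(2)[OF M(1)]], of ?r]
  have one: "{\<one>\<^bsub>U\<^esub>} \<in> bounded U" using born_moduleD(5)[OF U_born, of "{\<one>\<^bsub>U\<^esub>}"] U_one by blast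
  let ?X = "{f2 x y z |x y z. x \<in> io ` ?S \<union> {\<one>\<^bsub>U\<^esub>} \<and> y \<in> ?S \<and> z \<in> ?S}"
  have "?X \<in> bounded \<Omega>\<^sub>2"
    by (rule f2_bdd[OF born_moduleD(2)[OF U_born bdd_linear_mapD(2)[OF io_linear S] one] S S])
  note W1 = P.bdd_span[OF this]
  define W where "W = span_in V \<Omega>\<^sub>2 ?X"
  have W: "W \<in> bdd_submodules V \<Omega>\<^sub>2" "?X \<subseteq> W" unfolding W_def by (rule W1 P.span_sup)+
  have up: "x \<in> ?S" if "x \<in> sub_powers_upto V R M i" "i \<le> ?r" for x i using A.upto_mono[OF that(2)] that(1) by blast
  have "filtration2 V \<pi> R M ?r \<subseteq> W"
    unfolding gens2(1)[OF A.bddD(3)[OF M(1)]] gens2_def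
  proof (rule P.span_least[OF P.bddD(1)[OF W(1)]], rule Un_least)
    show "{f2 (io x0) x1 x2 | x0 x1 x2 i0 i1 i2. i0 + i1 + i2 \<le> ?r \<and>
        x0 \<in> sub_powers_upto V R M i0 \<and> x1 \<in> sub_powers_upto V R M i1 \<and> x2 \<in> sub_powers_upto V R M i2} \<subseteq> W"
    proof clarify
      fix x0 x1 x2 i0 i1 i2 assume h: "i0 + i1 + i2 \<le> ?r" "x0 \<in> sub_powers_upto V R M i0"
        "x1 \<in> sub_powers_upto V R M i1" "x2 \<in> sub_powers_upto V R M i2"
      have "x0 \<in> ?S" "x1 \<in> ?S" "x2 \<in> ?S" using up[OF h(2)] up[OF h(3)] up[OF h(4)] h(1) by linarith+
      then show "f2 (io x0) x1 x2 \<in> W" by (intro subsetD[OF W(2)]) blast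
    qed
    show "{f2 \<one>\<^bsub>U\<^esub> x1 x2 | x1 x2 i1 i2. i1 + i2 \<le> ?r \<and> x1 \<in> sub_powers_upto V R M i1 \<and> x2 \<in> sub_powers_upto V R M i2} \<subseteq> W"
    proof clarify
      fix x1 x2 i1 i2 assume h: "i1 + i2 \<le> ?r" "x1 \<in> sub_powers_upto V R M i1" "x2 \<in> sub_powers_upto V R M i2"
      have "x1 \<in> ?S" "x2 \<in> ?S" using up[OF h(2)] up[OF h(3)] h(1) by linarith+
      then show "f2 \<one>\<^bsub>U\<^esub> x1 x2 \<in> W" by (intro subsetD[OF W(2)]) blast
    qed
  qed
  moreover have "D (f1 \<one>\<^bsub>U\<^esub> x) \<in> filtration2 V \<pi> R M ?r" if "x \<in> B" for x
    by (rule phi_degree[OF M(3)]) (use that M(2) A.upto_1[of M] in blast)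
  ultimately show "(\<lambda>x. D (f1 \<one>\<^bsub>U\<^esub> x)) ` B \<in> bounded \<Omega>\<^sub>2"
    using P.bd(3)[OF P.bddD(2)[OF W(1)]] by (meson image_subsetI subsetD)
qed

end

section \<open>Growth of the Newton iterates\<close>

text \<open>\<open>grow V R E s M b d N\<close> contains the sums of products of at least \<open>N\<close> curvature factors with at
  most one factor \<open>s x\<close> at the right end, where a product of \<open>k\<close> curvature factors may have total degree
  up to \<open>d + b * k\<close> with respect to the powers of \<open>M\<close>.\<close>

inductive grow for V :: "('v, 'k) ring_scheme" and R :: "('v, 'r) bmod" and E :: "('v, 'e) bmod"
    and s :: "'r \<Rightarrow> 'e" and M :: "'r set" and b :: int where
  grow_s: "x \<in> sub_powers_upto V R M i \<Longrightarrow> int i \<le> d \<Longrightarrow> grow V R E s M b d 0 (s x)"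
| grow_w: "x \<in> sub_powers_upto V R M i \<Longrightarrow> y \<in> sub_powers_upto V R M j \<Longrightarrow> int i + int j \<le> d + b \<Longrightarrow>
    grow V R E s M b d 1 (curv R E s x y)"
| grow_mul: "x \<in> sub_powers_upto V R M i \<Longrightarrow> y \<in> sub_powers_upto V R M j \<Longrightarrow> grow V R E s M b d N e \<Longrightarrow>
    int i + int j + d \<le> d' + b \<Longrightarrow> grow V R E s M b d' (Suc N) (curv R E s x y \<otimes>\<^bsub>E\<^esub> e)"
| grow_mono: "grow V R E s M b d N e \<Longrightarrow> d \<le> d' \<Longrightarrow> N' \<le> N \<Longrightarrow> grow V R E s M b d' N' e"
| grow_zero: "grow V R E s M b d N \<zero>\<^bsub>E\<^esub>"
| grow_add: "grow V R E s M b d N e \<Longrightarrow> grow V R E s M b d N e' \<Longrightarrow> grow V R E s M b d N (e \<oplus>\<^bsub>E\<^esub> e')"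
| grow_smult: "k \<in> carrier V \<Longrightarrow> grow V R E s M b d N e \<Longrightarrow> grow V R E s M b d N (k \<odot>\<^bsub>E\<^esub> e)"

text \<open>The shape of the summands in \<open>grow\<close> once curvatures lie in \<open>W\<close>
  and values of \<open>s\<close> in \<open>S\<close>: products of \<open>k\<close> elements of
  \<open>W\<close>, with or without a last factor from \<open>S\<close>. The extra \<open>W\<close>
  at the first step yields the products without that last factor.\<close>

fun prodset :: "('v, 'e) bmod \<Rightarrow> 'e set \<Rightarrow> 'e set \<Rightarrow> nat \<Rightarrow> 'e set" where
  "prodset E W S 0 = S"
| "prodset E W S (Suc k) = set_prod E W (prodset E W S k) \<union> (if k = 0 then W else {})"

definition newton_iter where
  "newton_iter V \<pi> R D E s k = ((newton V \<pi> R D E) ^^ k) s"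

lemma newton_iter_simps: "newton_iter V \<pi> R D E s 0 = s"
  "newton_iter V \<pi> R D E s (Suc k) = newton V \<pi> R D E (newton_iter V \<pi> R D E s k)"
  by (simp_all add: newton_iter_def)

lemma newton_iter_almost_hom:
  assumes "almost_hom V \<pi> R E s" "connection V \<pi> R D"
    "bdd_linear_map V R (omega2 V \<pi> R) (\<lambda>x. D (form1 V \<pi> R \<one>\<^bsub>unitalisation V R\<^esub> x))"
  shows "almost_hom V \<pi> R E (newton_iter V \<pi> R D E s k)"
proof (induction k)
  case (Suc k)
  have "forms V \<pi> R" "calg V \<pi> E" using assms(1) by (simp_all add: almost_hom_def)
  then show ?case unfolding newton_iter_simps
    by (intro almost_hom.intro almost_hom_axioms.intro almost_hom.newton_bdd[OF Suc assms(2,3)])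
qed (simp add: assms newton_iter_simps)

lemma newton_iter_natural:
  assumes s: "almost_hom V \<pi> R E s" and D: "connection V \<pi> R D"
    "bdd_linear_map V R (omega2 V \<pi> R) (\<lambda>x. D (form1 V \<pi> R \<one>\<^bsub>unitalisation V R\<^esub> x))"
    and t: "almost_hom V \<pi> R E' t" and h: "bdd_alg_hom V E E' h"
    and st: "\<And>x. x \<in> carrier R \<Longrightarrow> h (s x) = t x" and x: "x \<in> carrier R"
  shows "h (newton_iter V \<pi> R D E s k x) = newton_iter V \<pi> R D E' t k x"
  using x
proof (induction k arbitrary: x)
  case (Suc k)
  show ?case unfolding newton_iter_simps
    by (rule almost_hom.newton_natural[OF newton_iter_almost_hom[OF s D] D(1) h newton_iter_almost_hom[OF t D] Suc.IH Suc.prems])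
qed (simp add: st newton_iter_simps)

section \<open>Products of curvature factors and their degrees\<close>

context almost_hom
begin

context
  fixes M :: "'r set" and b :: int
  assumes M: "M \<subseteq> carrier R" and b: "0 \<le> b"
begin

abbreviation "pw \<equiv> sub_powers_upto V R M"
abbreviation "gr \<equiv> grow V R E s M b"

lemma pw_c: "x \<in> pw i \<Longrightarrow> x \<in> carrier R" using A.upto_carrier[OF M] by blast

lemma grow_carrier: "gr d N e \<Longrightarrow> e \<in> carrier E"
  by (induction rule: grow.induct) (simp_all add: pw_c sl)

lemma grow_sub: "submodule {e. gr d N e} V E"
proof (rule E.subI)
  show "{e. gr d N e} \<subseteq> carrier E" using grow_carrier by blast
qed (simp_all add: grow_zero grow_add grow_smult)

lemma grow_minus: "gr d N e \<Longrightarrow> gr d N e' \<Longrightarrow> gr d N (e \<ominus>\<^bsub>E\<^esub> e')"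
  using E.submodule_minus[OF grow_sub, of e d N e'] by simp

text \<open>The Bianchi identity pushes a factor \<open>s x\<close> to the right and preserves both
  the number of curvature factors and the total degree. If it meets a factor \<open>s y\<close> at
  the right end, then \<open>s x s y\<close> is the sum of \<open>w x y\<close> and
  \<open>s (xy)\<close>; here \<open>b \<ge> 0\<close> keeps the first summand within the
  bound.\<close>

lemma grow_s_left: "gr d N e \<Longrightarrow> x \<in> pw i \<Longrightarrow> gr (int i + d) N (s x \<otimes>\<^bsub>E\<^esub> e)"
proof (induction arbitrary: x i rule: grow.induct)
  case (grow_s y j d)
  note xy = pw_c[OF grow_s.prems] pw_c[OF grow_s.hyps(1)]
  have "s x \<otimes>\<^bsub>E\<^esub> s y = w x y \<oplus>\<^bsub>E\<^esub> s (x \<otimes>\<^bsub>R\<^esub> y)"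
    using sl(1)[OF xy(1)] sl(1)[OF xy(2)] sl(1)[OF A.mul_closed[OF xy]] unfolding curv_def by algebra
  moreover have "gr (int i + d) 0 (w x y)"
    by (rule grow_mono[OF grow_w[OF grow_s.prems grow_s.hyps(1), of "int i + d"]]) (use grow_s.hyps b in simp_all)
  moreover have "gr (int i + d) 0 (s (x \<otimes>\<^bsub>R\<^esub> y))"
    by (rule grow.grow_s[OF A.upto_mult[OF M grow_s.prems grow_s.hyps(1)]]) (use grow_s.hyps in simp)
  ultimately show ?case using grow_add by metis
next
  case (grow_w y j z k d)
  note c = pw_c[OF grow_w.prems] pw_c[OF grow_w.hyps(1)] pw_c[OF grow_w.hyps(2)]
  have "gr (int i + d) 1 (w x y \<otimes>\<^bsub>E\<^esub> s z)"
    using grow_mul[OF grow_w.prems grow_w.hyps(1) grow_s[OF grow_w.hyps(2) order_refl], of "int i + d"] grow_w.hyps(3) by simp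
  moreover have "gr (int i + d) 1 (w x (y \<otimes>\<^bsub>R\<^esub> z))"
    by (rule grow.grow_w[OF grow_w.prems A.upto_mult[OF M grow_w.hyps(1,2)]]) (use grow_w.hyps(3) in simp)
  moreover have "gr (int i + d) 1 (w (x \<otimes>\<^bsub>R\<^esub> y) z)"
    by (rule grow.grow_w[OF A.upto_mult[OF M grow_w.prems grow_w.hyps(1)] grow_w.hyps(2)]) (use grow_w.hyps(3) in simp)
  ultimately show ?case unfolding w_shift[OF c] by (intro grow_add grow_minus)
next
  case (grow_mul y j z k d N e d')
  note c = pw_c[OF grow_mul.prems] pw_c[OF grow_mul.hyps(1)] pw_c[OF grow_mul.hyps(2)]
  have e: "e \<in> carrier E" by (rule grow_carrier[OF grow_mul.hyps(3)])
  have 1: "gr (int i + d') (Suc N) (w x y \<otimes>\<^bsub>E\<^esub> (s z \<otimes>\<^bsub>E\<^esub> e))"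
    by (rule grow.grow_mul[OF grow_mul.prems grow_mul.hyps(1) grow_mul.IH[OF grow_mul.hyps(2)]]) (use grow_mul.hyps in simp)
  have 2: "gr (int i + d') (Suc N) (w x (y \<otimes>\<^bsub>R\<^esub> z) \<otimes>\<^bsub>E\<^esub> e)"
    by (rule grow.grow_mul[OF grow_mul.prems A.upto_mult[OF M grow_mul.hyps(1,2)] grow_mul.hyps(3)]) (use grow_mul.hyps in simp)
  have 3: "gr (int i + d') (Suc N) (w (x \<otimes>\<^bsub>R\<^esub> y) z \<otimes>\<^bsub>E\<^esub> e)"
    by (rule grow.grow_mul[OF A.upto_mult[OF M grow_mul.prems grow_mul.hyps(1)] grow_mul.hyps(2,3)]) (use grow_mul.hyps in simp)
  have "s x \<otimes>\<^bsub>E\<^esub> (w y z \<otimes>\<^bsub>E\<^esub> e) = (s x \<otimes>\<^bsub>E\<^esub> w y z) \<otimes>\<^bsub>E\<^esub> e"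
    by (rule E.mul_assoc[symmetric]) (use c e in \<open>simp_all add: sl\<close>)
  also have "\<dots> = (w x y \<otimes>\<^bsub>E\<^esub> (s z \<otimes>\<^bsub>E\<^esub> e) \<ominus>\<^bsub>E\<^esub> w x (y \<otimes>\<^bsub>R\<^esub> z) \<otimes>\<^bsub>E\<^esub> e) \<oplus>\<^bsub>E\<^esub> w (x \<otimes>\<^bsub>R\<^esub> y) z \<otimes>\<^bsub>E\<^esub> e"
    unfolding w_shift[OF c]
    using w_carrier[OF c(1,2)] sl(1)[OF c(3)] e w_carrier[OF c(1) A.mul_closed[OF c(2,3)]] w_carrier[OF A.mul_closed[OF c(1,2)] c(3)]
    by algebra
  finally show ?case using 1 2 3 by (simp add: grow_add grow_minus)
next
  case (grow_mono d N e d' N')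
  show ?case by (rule grow.grow_mono[OF grow_mono.IH[OF grow_mono.prems]]) (use grow_mono.hyps in simp_all)
next
  case (grow_zero d N)
  then show ?case using sl(1)[OF pw_c[OF grow_zero.prems]] by (simp add: grow.grow_zero)
next
  case (grow_add d N e e')
  then show ?case using sl(1)[OF pw_c[OF grow_add.prems]] grow_carrier
    by (simp add: E.mul_r_distr grow.grow_add)
next
  case (grow_smult k d N e)
  then show ?case using sl(1)[OF pw_c[OF grow_smult.prems]] grow_carrier
    by (simp add: E.mul_smult_r grow.grow_smult)
qed

text \<open>The only obstruction to concatenating two such products is a factor \<open>s x\<close>
  at the right end of the first one, and \<open>grow_s_left\<close> absorbs it into the second.
  Orders and degree bounds add because the credit \<open>b\<close> is counted per curvature
  factor.\<close>

lemma grow_mult: "gr d N e \<Longrightarrow> gr d' N' e' \<Longrightarrow> gr (d + d') (N + N') (e \<otimes>\<^bsub>E\<^esub> e')"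
proof (induction rule: grow.induct)
  case (grow_s x i d)
  show ?case using grow_mono[OF grow_s_left[OF grow_s.prems grow_s.hyps(1)], of "d + d'" N'] grow_s.hyps by simp
next
  case (grow_w x i y j d)
  show ?case using grow_mul[OF grow_w.hyps(1,2) grow_w.prems, of "d + d'"] grow_w.hyps(3) by simp
next
  case (grow_mul x i y j d N e d'')
  have "(w x y \<otimes>\<^bsub>E\<^esub> e) \<otimes>\<^bsub>E\<^esub> e' = w x y \<otimes>\<^bsub>E\<^esub> (e \<otimes>\<^bsub>E\<^esub> e')"
    by (rule E.mul_assoc) (use grow_mul grow_carrier in \<open>simp_all add: pw_c\<close>)
  then show ?case using grow.grow_mul[OF grow_mul.hyps(1,2) grow_mul.IH[OF grow_mul.prems], of "d'' + d'"] grow_mul.hyps by simp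
next
  case (grow_mono d N e d1 N1)
  show ?case by (rule grow.grow_mono[OF grow_mono.IH[OF grow_mono.prems]]) (use grow_mono.hyps in simp_all)
next
  case (grow_zero d N)
  then show ?case using grow_carrier[OF grow_zero.prems] by (simp add: grow.grow_zero)
next
  case (grow_add d N e1 e2)
  then show ?case using grow_carrier by (simp add: E.mul_l_distr grow.grow_add)
next
  case (grow_smult k d N e)
  then show ?case using grow_carrier by (simp add: E.mul_smult_l grow.grow_smult)
qed

text \<open>Write the degrees with two credits deducted. The bimodule defects are products of two
  curvatures of degree at most \<open>i + j + a - 2b\<close>, and the product of the two corrections
  has degree at most \<open>i + j + 2a - 2b\<close>. The second is the tight case: for
  \<open>b = 2a\<close> it equals \<open>i + j - b\<close>, the bound required of a single
  curvature.\<close>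

lemma newton_grow:
  assumes D: "connection V \<pi> R D" and a: "b = 2 * int a"
    and deg: "\<And>i x. x \<in> pw i \<Longrightarrow> D (f1 \<one>\<^bsub>U\<^esub> x) \<in> filtration2 V \<pi> R M (i + a)"
    and t: "almost_hom V \<pi> R E t"
    and gt: "\<And>i x. x \<in> pw i \<Longrightarrow> gr (int i) 0 (t x)"
    and gw: "\<And>i j x y. x \<in> pw i \<Longrightarrow> y \<in> pw j \<Longrightarrow> gr (int i + int j - b) r (curv R E t x y)"
  shows "x \<in> pw i \<Longrightarrow> gr (int i) r (psi V \<pi> R E t (D (f1 \<one>\<^bsub>U\<^esub> x)))"
    and "x \<in> pw i \<Longrightarrow> gr (int i) 0 (newton V \<pi> R D E t x)"
    and "x \<in> pw i \<Longrightarrow> y \<in> pw j \<Longrightarrow> gr (int i + int j - b) (2 * r) (curv R E (newton V \<pi> R D E t) x y)"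
proof -
  note T = almost_hom.psi_io[OF t] almost_hom.psi(1)[OF t]
  note tc = linear_mapD(1)[OF bdd_linear_mapD(1)[OF almost_hom.s[OF t]]]
  note m2 = born_moduleD(1)[OF O_born(2)]
  have deg': "D (f1 \<one>\<^bsub>U\<^esub> x) \<in> span_in V \<Omega>\<^sub>2 (gens2 M (i + a))" if "x \<in> pw i" for x i
    using deg[OF that] unfolding gens2(1)[OF M] .
  \<comment> \<open>The conclusion states only the bound \<open>i\<close>; the product of two
    corrections needs the sharper \<open>i + a - b\<close>.\<close>
  have P: "gr (int i + int a - b) r (psi V \<pi> R E t (D (f1 \<one>\<^bsub>U\<^esub> x)))" if x: "x \<in> pw i" for x i
  proof -
    have "psi V \<pi> R E t (D (f1 \<one>\<^bsub>U\<^esub> x)) \<in> {e. gr (int i + int a - b) r e}"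
    proof (rule linear_span_in[OF m2 E.module_axioms bdd_linear_mapD(1)[OF T(3)] grow_sub gens2(2)[OF M] _ deg'[OF x]])
      fix \<eta> assume "\<eta> \<in> gens2 M (i + a)"
      then consider (a) x0 x1 x2 i0 i1 i2 where "\<eta> = f2 (io x0) x1 x2" "i0 + i1 + i2 \<le> i + a" "x0 \<in> pw i0" "x1 \<in> pw i1" "x2 \<in> pw i2"
        | (b) x1 x2 i1 i2 where "\<eta> = f2 \<one>\<^bsub>U\<^esub> x1 x2" "i1 + i2 \<le> i + a" "x1 \<in> pw i1" "x2 \<in> pw i2"
        unfolding gens2_def by blast
      then have "gr (int i + int a - b) r (psi V \<pi> R E t \<eta>)"
      proof cases
        case a
        have "gr (int i0 + (int i1 + int i2 - b)) (0 + r) (t x0 \<otimes>\<^bsub>E\<^esub> curv R E t x1 x2)"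
          by (rule grow_mult[OF gt[OF a(3)] gw[OF a(4,5)]])
        then show ?thesis unfolding a(1) T(1)[OF pw_c[OF a(3)] pw_c[OF a(4)] pw_c[OF a(5)]]
          by (rule grow_mono) (use a(2) in simp_all)
      next
        case b
        show ?thesis unfolding b(1) T(2)[OF pw_c[OF b(3)] pw_c[OF b(4)]]
          by (rule grow_mono[OF gw[OF b(3,4)]]) (use b(2) in simp_all)
      qed
      then show "psi V \<pi> R E t \<eta> \<in> {e. gr (int i + int a - b) r e}" by simp
    qed
    then show ?thesis by simp
  qed
  show psi: "gr (int i) r (psi V \<pi> R E t (D (f1 \<one>\<^bsub>U\<^esub> x)))" if "x \<in> pw i" for x i
    by (rule grow_mono[OF P[OF that]]) (use a in simp_all)
  show "gr (int i) 0 (newton V \<pi> R D E t x)" if "x \<in> pw i" for x i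
    unfolding newton_def by (rule grow_add[OF gt[OF that] grow_mono[OF psi[OF that]]]) simp_all
  show "gr (int i + int j - b) (2 * r) (curv R E (newton V \<pi> R D E t) x y)" if x: "x \<in> pw i" and y: "y \<in> pw j" for x y i j
  proof -
    let ?T = "{e. gr (int i + int j - b) (2 * r) e}"
    \<comment> \<open>One of the arguments \<open>x\<close>, \<open>y\<close> is combined with a
      generator of \<phi> of the other, whence the total degree \<open>i + j + a\<close>.\<close>
    have q: "gr (int i + int j - b) (2 * r) (curv R E t x0 y0 \<otimes>\<^bsub>E\<^esub> curv R E t x1 y1)"
      if "x0 \<in> pw i0" "y0 \<in> pw j0" "x1 \<in> pw i1" "y1 \<in> pw j1" "i0 + j0 + i1 + j1 \<le> i + j + a" for x0 y0 x1 y1 i0 j0 i1 j1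
      by (rule grow_mono[OF grow_mult[OF gw[OF that(1,2)] gw[OF that(3,4)]]]) (use that(5) a in simp_all)
    have 1: "t x \<otimes>\<^bsub>E\<^esub> psi V \<pi> R E t (D (f1 \<one>\<^bsub>U\<^esub> y)) \<ominus>\<^bsub>E\<^esub> psi V \<pi> R E t (left_mult2 V \<pi> R x (D (f1 \<one>\<^bsub>U\<^esub> y))) \<in> ?T"
    proof (rule almost_hom.psi_left[OF t pw_c[OF x] grow_sub gens2(2)[OF M] deg'[OF y]])
      fix \<eta> assume "\<eta> \<in> gens2 M (j + a)"
      then consider (a) x0 x1 x2 i0 i1 i2 where "\<eta> = f2 (io x0) x1 x2" "i0 + i1 + i2 \<le> j + a" "x0 \<in> pw i0" "x1 \<in> pw i1" "x2 \<in> pw i2"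
        | (b) x1 x2 i1 i2 where "\<eta> = f2 \<one>\<^bsub>U\<^esub> x1 x2" "x1 \<in> pw i1" "x2 \<in> pw i2"
        unfolding gens2_def by blast
      then show "(\<exists>x0\<in>carrier R. \<exists>y\<in>carrier R. \<exists>z\<in>carrier R. \<eta> = f2 (io x0) y z \<and> curv R E t x x0 \<otimes>\<^bsub>E\<^esub> curv R E t y z \<in> ?T) \<or>
        (\<exists>y\<in>carrier R. \<exists>z\<in>carrier R. \<eta> = f2 \<one>\<^bsub>U\<^esub> y z)"
      proof cases
        case a
        have "curv R E t x x0 \<otimes>\<^bsub>E\<^esub> curv R E t x1 x2 \<in> ?T" using q[OF x a(3,4,5)] a(2) by simp
        then show ?thesis using a(1) pw_c[OF a(3)] pw_c[OF a(4)] pw_c[OF a(5)] by blast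
      next
        case b then show ?thesis using pw_c[OF b(2)] pw_c[OF b(3)] by blast
      qed
    qed
    have 2: "psi V \<pi> R E t (D (f1 \<one>\<^bsub>U\<^esub> x)) \<otimes>\<^bsub>E\<^esub> t y \<ominus>\<^bsub>E\<^esub> psi V \<pi> R E t (right_mult2 V \<pi> R y (D (f1 \<one>\<^bsub>U\<^esub> x))) \<in> ?T"
    proof (rule almost_hom.psi_right[OF t pw_c[OF y] grow_sub gens2(2)[OF M] deg'[OF x]])
      fix \<eta> assume "\<eta> \<in> gens2 M (i + a)"
      then consider (a) x0 x1 x2 i0 i1 i2 where "\<eta> = f2 (io x0) x1 x2" "i0 + i1 + i2 \<le> i + a" "x0 \<in> pw i0" "x1 \<in> pw i1" "x2 \<in> pw i2"
        | (b) x1 x2 i1 i2 where "\<eta> = f2 \<one>\<^bsub>U\<^esub> x1 x2" "x1 \<in> pw i1" "x2 \<in> pw i2"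
        unfolding gens2_def by blast
      then show "(\<exists>x0\<in>carrier R. \<exists>z\<in>carrier R. \<exists>u\<in>carrier R. \<eta> = f2 (io x0) z u \<and> curv R E t x0 z \<otimes>\<^bsub>E\<^esub> curv R E t u y \<in> ?T) \<or>
        (\<exists>z\<in>carrier R. \<exists>u\<in>carrier R. \<eta> = f2 \<one>\<^bsub>U\<^esub> z u)"
      proof cases
        case a
        have "curv R E t x0 x1 \<otimes>\<^bsub>E\<^esub> curv R E t x2 y \<in> ?T" using q[OF a(3,4,5) y] a(2) by simp
        then show ?thesis using a(1) pw_c[OF a(3)] pw_c[OF a(4)] pw_c[OF a(5)] by blast
      next
        case b then show ?thesis using pw_c[OF b(2)] pw_c[OF b(3)] by blast
      qed
    qed
    have 3: "psi V \<pi> R E t (D (f1 \<one>\<^bsub>U\<^esub> x)) \<otimes>\<^bsub>E\<^esub> psi V \<pi> R E t (D (f1 \<one>\<^bsub>U\<^esub> y)) \<in> ?T"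
      using grow_mono[OF grow_mult[OF P[OF x] P[OF y]], of "int i + int j - b" "2 * r"] a by simp
    show ?thesis
      unfolding almost_hom.curv_newton[OF t D pw_c[OF x] pw_c[OF y]] using 1 2 3 by (simp add: grow_add)
  qed
qed

text \<open>\<open>newton_grow\<close> returns its own hypotheses with the same \<open>b\<close>, so
  degree bounds are stable while the order doubles, starting from order 1 for the curvature of
  \<open>s\<close>. The correction has the order of the curvature before the step, which makes
  consecutive iterates close to each other.\<close>

lemma newton_iter_grow:
  assumes D: "connection V \<pi> R D" and a: "b = 2 * int a"
    and deg: "\<And>i x. x \<in> pw i \<Longrightarrow> D (f1 \<one>\<^bsub>U\<^esub> x) \<in> filtration2 V \<pi> R M (i + a)"
    and \<phi>: "bdd_linear_map V R \<Omega>\<^sub>2 (\<lambda>x. D (f1 \<one>\<^bsub>U\<^esub> x))"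
  shows "x \<in> pw i \<Longrightarrow> gr (int i) 0 (newton_iter V \<pi> R D E s k x)"
    and "x \<in> pw i \<Longrightarrow> y \<in> pw j \<Longrightarrow> gr (int i + int j - b) (2 ^ k) (curv R E (newton_iter V \<pi> R D E s k) x y)"
    and "x \<in> pw i \<Longrightarrow> \<exists>e. gr (int i) (2 ^ k) e \<and> newton_iter V \<pi> R D E s (Suc k) x = newton_iter V \<pi> R D E s k x \<oplus>\<^bsub>E\<^esub> e"
proof -
  have *: "(\<forall>i. \<forall>x\<in>pw i. gr (int i) 0 (newton_iter V \<pi> R D E s k x)) \<and>
    (\<forall>i j. \<forall>x\<in>pw i. \<forall>y\<in>pw j. gr (int i + int j - b) (2 ^ k) (curv R E (newton_iter V \<pi> R D E s k) x y))"
  proof (induction k)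
    case 0
    have "gr (int i + int j - b) 1 (w x y)" if "x \<in> pw i" "y \<in> pw j" for i j x y by (rule grow_w[OF that]) simp
    moreover have "gr (int i) 0 (s x)" if "x \<in> pw i" for i x by (rule grow_s[OF that order_refl])
    ultimately show ?case by (simp add: newton_iter_simps)
  next
    case (Suc k)
    show ?case
      using newton_grow(2,3)[OF D a deg newton_iter_almost_hom[OF almost_hom_axioms D \<phi>], of k "2 ^ k"] Suc
      by (auto simp: newton_iter_simps)
  qed
  have t: "almost_hom V \<pi> R E (newton_iter V \<pi> R D E s k)" by (rule newton_iter_almost_hom[OF almost_hom_axioms D \<phi>])
  show "x \<in> pw i \<Longrightarrow> gr (int i) 0 (newton_iter V \<pi> R D E s k x)" using * by blast
  show "x \<in> pw i \<Longrightarrow> y \<in> pw j \<Longrightarrow> gr (int i + int j - b) (2 ^ k) (curv R E (newton_iter V \<pi> R D E s k) x y)" using * by blast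
  show "\<exists>e. gr (int i) (2 ^ k) e \<and> newton_iter V \<pi> R D E s (Suc k) x = newton_iter V \<pi> R D E s k x \<oplus>\<^bsub>E\<^esub> e" if x: "x \<in> pw i"
    using newton_grow(1)[OF D a deg t _ _ x, of "2 ^ k"] * by (auto simp: newton_iter_simps newton_def)
qed

text \<open>The scalar goes into the leftmost factor. Sums of products need not stay in
  \<open>prodset\<close>, so this closure property does not come from a submodule.\<close>

lemma prodset_smult:
  assumes W: "submodule W V E" and S: "submodule S V E" and c: "c \<in> carrier V"
  shows "z \<in> prodset E W S k \<Longrightarrow> c \<odot>\<^bsub>E\<^esub> z \<in> prodset E W S k"
proof (cases k)
  case 0 then show "z \<in> prodset E W S k \<Longrightarrow> ?thesis" using E.submoduleE(4)[OF S c] by simp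
next
  case (Suc l)
  have pc: "prodset E W S l \<subseteq> carrier E" for l
    using E.set_prod_carrier[OF E.submoduleE(1)[OF W]] E.submoduleE(1)[OF W] E.submoduleE(1)[OF S] by (induction l) auto
  assume "z \<in> prodset E W S k"
  then consider "z \<in> set_prod E W (prodset E W S l)" | "l = 0" "z \<in> W" unfolding Suc by (auto split: if_splits)
  then show ?thesis
  proof cases
    case 1
    then obtain x y where xy: "z = x \<otimes>\<^bsub>E\<^esub> y" "x \<in> W" "y \<in> prodset E W S l" by (rule E.set_prodE)
    have "x \<in> carrier E" "y \<in> carrier E" using xy E.submoduleE(1)[OF W] pc by blast+
    then have "c \<odot>\<^bsub>E\<^esub> z = (c \<odot>\<^bsub>E\<^esub> x) \<otimes>\<^bsub>E\<^esub> y" unfolding xy(1) using c by (simp add: E.mul_smult_l)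
    then show ?thesis unfolding Suc using E.set_prodI[OF E.submoduleE(4)[OF W c xy(2)] xy(3)] by simp
  next
    case 2 then show ?thesis unfolding Suc using E.submoduleE(4)[OF W c] by simp
  qed
qed

text \<open>Multiplying an argument of degree \<open>i\<close> by \<open>\<pi>^(i div c)\<close>
  brings it into the fixed set \<open>B\<close>, and then a curvature factor into \<open>W\<close>
  and a final factor into \<open>S\<close>. One power with exponent \<open>\<delta> div c\<close>
  does this for a whole product of total degree \<delta>. The span is taken because \<open>k\<close>
  and \<delta> differ between the summands.\<close>

lemma grow_prodset:
  assumes W: "submodule W V E" and S: "submodule S V E" and B: "B \<subseteq> carrier R" and c: "c > 0"
    and pB: "\<And>i x. x \<in> pw i \<Longrightarrow> (\<pi> [^]\<^bsub>V\<^esub> (i div c)) \<odot>\<^bsub>R\<^esub> x \<in> B"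
    and sB: "\<And>x. x \<in> B \<Longrightarrow> s x \<in> S" and wB: "\<And>x y. x \<in> B \<Longrightarrow> y \<in> B \<Longrightarrow> w x y \<in> W"
  shows "gr d N e \<Longrightarrow> e \<in> span_in V E {e' \<in> carrier E. \<exists>k\<ge>N. \<exists>\<delta>. int \<delta> \<le> d + b * int k \<and>
    (\<pi> [^]\<^bsub>V\<^esub> (\<delta> div c)) \<odot>\<^bsub>E\<^esub> e' \<in> prodset E W S k}" (is "_ \<Longrightarrow> _ \<in> span_in V E (?X d N)")
proof -
  have Xc: "?X d N \<subseteq> carrier E" for d N by blast
  have sup: "e \<in> ?X d N \<Longrightarrow> e \<in> span_in V E (?X d N)" for e d N by (rule subsetD[OF E.span_sup])
  have ww: "(\<pi> [^]\<^bsub>V\<^esub> (i div c + j div c)) \<odot>\<^bsub>E\<^esub> w x y \<in> W" if xy: "x \<in> pw i" "y \<in> pw j" for x y i j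
  proof -
    note cc = pw_c[OF xy(1)] pw_c[OF xy(2)] and pc = A.pin
    note l1 = linear_mapD(3)[OF bdd_bilinearD(2)[OF w_bilinear]] and l2 = linear_mapD(3)[OF bdd_bilinearD(1)[OF w_bilinear]]
    have "(\<pi> [^]\<^bsub>V\<^esub> (i div c + j div c)) \<odot>\<^bsub>E\<^esub> w x y = w ((\<pi> [^]\<^bsub>V\<^esub> (i div c)) \<odot>\<^bsub>R\<^esub> x) ((\<pi> [^]\<^bsub>V\<^esub> (j div c)) \<odot>\<^bsub>R\<^esub> y)"
      using cc E.smult_pow_add[OF E.pi w_carrier[OF cc], of "j div c" "i div c"] by (simp add: l1 l2 add.commute)
    then show ?thesis using wB[OF pB[OF xy(1)] pB[OF xy(2)]] by simp
  qed
  \<comment> \<open>Rounding down is superadditive. The exponent for the total degree therefore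
    covers the exponents of the single factors, and the surplus is absorbed as a scalar.\<close>
  have dv: "i div c + j div c \<le> (i + j) div c" for i j :: nat
    by (subst div_add1_eq[of i j c]) simp
  show "gr d N e \<Longrightarrow> e \<in> span_in V E (?X d N)"
  proof (induction rule: grow.induct)
    case (grow_s x i d)
    have "(\<pi> [^]\<^bsub>V\<^esub> (i div c)) \<odot>\<^bsub>E\<^esub> s x \<in> S" using sB[OF pB[OF grow_s(1)]] pw_c[OF grow_s(1)] by (simp add: sl)
    then have "s x \<in> ?X d 0" using grow_s pw_c[OF grow_s(1)]
      by (intro CollectI conjI sl exI[of _ 0] exI[of _ i]) simp_all
    then show ?case by (rule sup)
  next
    case (grow_w x i y j d)
    have "(\<pi> [^]\<^bsub>V\<^esub> ((i + j) div c - (i div c + j div c) + (i div c + j div c))) \<odot>\<^bsub>E\<^esub> w x y \<in> W"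
      using E.submoduleE(4)[OF W E.pin ww[OF grow_w(1,2)]] pw_c[OF grow_w(1)] pw_c[OF grow_w(2)]
      by (simp only: E.smult_pow_add[OF E.pi w_carrier])
    then have "(\<pi> [^]\<^bsub>V\<^esub> ((i + j) div c)) \<odot>\<^bsub>E\<^esub> w x y \<in> prodset E W S 1" using dv[of i j] by simp
    then have "w x y \<in> ?X d 1" using grow_w pw_c[OF grow_w(1)] pw_c[OF grow_w(2)]
      by (intro CollectI conjI w_carrier exI[of _ 1] exI[of _ "i + j"]) simp_all
    then show ?case by (rule sup)
  next
    case (grow_mul x i y j d N e d')
    note wc = w_carrier[OF pw_c[OF grow_mul(1)] pw_c[OF grow_mul(2)]]
    show ?case
    proof (rule linear_span_in[OF E.module_axioms E.module_axioms E.mul_linear(1)[OF wc] E.span_sub[OF Xc] Xc _ grow_mul.IH])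
      fix e' assume "e' \<in> ?X d N"
      then obtain k \<delta> where k: "e' \<in> carrier E" "k \<ge> N" "int \<delta> \<le> d + b * int k" "(\<pi> [^]\<^bsub>V\<^esub> (\<delta> div c)) \<odot>\<^bsub>E\<^esub> e' \<in> prodset E W S k" by blast
      let ?m = "i div c + j div c" and ?d = "i + j + \<delta>"
      have le: "?m + \<delta> div c \<le> ?d div c" using dv[of i j] dv[of "i + j" \<delta>] by linarith
      have "((\<pi> [^]\<^bsub>V\<^esub> ?m) \<odot>\<^bsub>E\<^esub> w x y) \<otimes>\<^bsub>E\<^esub> ((\<pi> [^]\<^bsub>V\<^esub> (\<delta> div c)) \<odot>\<^bsub>E\<^esub> e') \<in> prodset E W S (Suc k)"
        using E.set_prodI[OF ww[OF grow_mul(1,2)] k(4)] by simp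
      then have "(\<pi> [^]\<^bsub>V\<^esub> (?m + \<delta> div c)) \<odot>\<^bsub>E\<^esub> (w x y \<otimes>\<^bsub>E\<^esub> e') \<in> prodset E W S (Suc k)"
        by (simp only: E.mul_smult_l[OF E.pin wc E.smult_closed[OF E.pin k(1)]] E.mul_smult_r[OF E.pin wc k(1)]
            E.smult_pow_add[OF E.pi E.mul_closed[OF wc k(1)]])
      then have "(\<pi> [^]\<^bsub>V\<^esub> (?d div c - (?m + \<delta> div c))) \<odot>\<^bsub>E\<^esub> ((\<pi> [^]\<^bsub>V\<^esub> (?m + \<delta> div c)) \<odot>\<^bsub>E\<^esub> (w x y \<otimes>\<^bsub>E\<^esub> e')) \<in> prodset E W S (Suc k)"
        by (rule prodset_smult[OF W S E.pin])
      then have "(\<pi> [^]\<^bsub>V\<^esub> (?d div c)) \<odot>\<^bsub>E\<^esub> (w x y \<otimes>\<^bsub>E\<^esub> e') \<in> prodset E W S (Suc k)"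
        using E.smult_pow_add[OF E.pi E.mul_closed[OF wc k(1)], of "?d div c - (?m + \<delta> div c)" "?m + \<delta> div c"] le by simp
      moreover have "int ?d \<le> d' + b * int (Suc k)" using k(3) grow_mul(4) by (simp add: algebra_simps)
      ultimately have "w x y \<otimes>\<^bsub>E\<^esub> e' \<in> ?X d' (Suc N)"
        using k(2) wc k(1) by (intro CollectI conjI E.mul_closed exI[of _ "Suc k"] exI[of _ ?d]) simp_all
      then show "w x y \<otimes>\<^bsub>E\<^esub> e' \<in> span_in V E (?X d' (Suc N))" by (rule sup)
    qed
  next
    case (grow_mono d N e d' N')
    have "?X d N \<subseteq> ?X d' N'"
    proof clarify
      fix e k \<delta> assume "e \<in> carrier E" "k \<ge> N" "int \<delta> \<le> d + b * int k" "(\<pi> [^]\<^bsub>V\<^esub> (\<delta> div c)) \<odot>\<^bsub>E\<^esub> e \<in> prodset E W S k"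
      then show "\<exists>k\<ge>N'. \<exists>\<delta>. int \<delta> \<le> d' + b * int k \<and> (\<pi> [^]\<^bsub>V\<^esub> (\<delta> div c)) \<odot>\<^bsub>E\<^esub> e \<in> prodset E W S k"
        using grow_mono(2,3) by (intro exI[of _ k] conjI exI[of _ \<delta>]) simp_all
    qed
    then show ?case using grow_mono.IH E.span_mono by blast
  next
    case (grow_zero d N) then show ?case by (rule E.submodule_zero[OF E.span_sub[OF Xc]])
  next
    case (grow_add d N e e') then show ?case by (intro E.submoduleE(5)[OF E.span_sub[OF Xc]])
  next
    case (grow_smult k d N e) then show ?case by (intro E.submoduleE(4)[OF E.span_sub[OF Xc]])
  qed
qed

end

end

section \<open>Limits\<close>

lemma (in balg) power_mono: assumes "M \<subseteq> M'" shows "sub_power V A M i \<subseteq> sub_power V A M' i"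
proof -
  have "fold_prods A M k \<subseteq> fold_prods A M' k" for k
  proof (induction k)
    case (Suc k) then show ?case using assms by (cases k) (auto simp: set_prod_def)
  qed simp
  then show ?thesis unfolding sub_power_def by (rule span_mono)
qed

lemma (in balg) P_I: "x \<in> S \<Longrightarrow> (\<pi> [^]\<^bsub>V\<^esub> n) \<odot>\<^bsub>A\<^esub> x \<in> P n S"
  unfolding scaled_def by (rule imageI)

lemma (in balg) power_upto: "1 \<le> i \<Longrightarrow> i \<le> n \<Longrightarrow> sub_power V A M i \<subseteq> sub_powers_upto V A M n"
  unfolding sub_powers_upto_def by (rule order_trans[OF UN_upper span_sup]) simp

section \<open>Convergent sequences in complete algebras\<close>

context calg
begin

lemma complete_cover: "B \<in> bounded A \<Longrightarrow> \<exists>U\<in>bdd_submodules V A. adic_complete V \<pi> A U \<and> B \<subseteq> U"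
  using compl by (simp add: complete_born_module_def)

lemma separated: "U \<in> bdd_submodules V A \<Longrightarrow> adic_complete V \<pi> A U \<Longrightarrow> (\<And>n. x \<in> P n U) \<Longrightarrow> x = \<zero>\<^bsub>A\<^esub>"
  by (rule complete_target.separated[OF complete_target.intro[OF bmod_ctx_axioms complete_target_axioms.intro[OF compl]]])

text \<open>Bornological convergence: one bounded submodule \<open>T\<close> measures the error for
  all powers of \<pi>. Only the differences lie in \<open>T\<close>, not the sequence
  itself.\<close>

definition "tends (z :: nat \<Rightarrow> 'a) y \<longleftrightarrow> y \<in> carrier A \<and>
  (\<exists>T\<in>bdd_submodules V A. \<forall>n. \<exists>k0. \<forall>k\<ge>k0. z k \<ominus>\<^bsub>A\<^esub> y \<in> P n T)"

lemma tends_unique: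
  assumes z: "\<And>k. z k \<in> carrier A" and y: "tends z y" "tends z y'"
  shows "y = y'"
proof -
  obtain T where T: "T \<in> bdd_submodules V A" "\<And>n. \<exists>k0. \<forall>k\<ge>k0. z k \<ominus>\<^bsub>A\<^esub> y \<in> P n T" using y(1) unfolding tends_def by blast
  obtain T' where T': "T' \<in> bdd_submodules V A" "\<And>n. \<exists>k0. \<forall>k\<ge>k0. z k \<ominus>\<^bsub>A\<^esub> y' \<in> P n T'" using y(2) unfolding tends_def by blast
  have c: "y \<in> carrier A" "y' \<in> carrier A" using y by (simp_all add: tends_def)
  obtain U where U: "U \<in> bdd_submodules V A" "adic_complete V \<pi> A U" "T \<union> T' \<subseteq> U"
    using complete_cover[OF bd(2)[OF bddD(2)[OF T(1)] bddD(2)[OF T'(1)]]] by blast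
  have "y \<ominus>\<^bsub>A\<^esub> y' \<in> P n U" for n
  proof -
    obtain k0 where k0: "\<And>k. k \<ge> k0 \<Longrightarrow> z k \<ominus>\<^bsub>A\<^esub> y \<in> P n T" using T(2)[of n] by blast
    obtain k1 where k1: "\<And>k. k \<ge> k1 \<Longrightarrow> z k \<ominus>\<^bsub>A\<^esub> y' \<in> P n T'" using T'(2)[of n] by blast
    let ?k = "max k0 k1"
    have TU: "T \<subseteq> U" "T' \<subseteq> U" using U(3) by blast+
    have "z ?k \<ominus>\<^bsub>A\<^esub> y \<in> P n U" by (rule subsetD[OF P_mono[OF TU(1)] k0]) simp
    moreover have "z ?k \<ominus>\<^bsub>A\<^esub> y' \<in> P n U" by (rule subsetD[OF P_mono[OF TU(2)] k1]) simp
    ultimately have "(z ?k \<ominus>\<^bsub>A\<^esub> y') \<ominus>\<^bsub>A\<^esub> (z ?k \<ominus>\<^bsub>A\<^esub> y) \<in> P n U"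
      by (rule submodule_minus[OF P_sub[OF bddD(1)[OF U(1)]], rotated])
    moreover have "(z ?k \<ominus>\<^bsub>A\<^esub> y') \<ominus>\<^bsub>A\<^esub> (z ?k \<ominus>\<^bsub>A\<^esub> y) = y \<ominus>\<^bsub>A\<^esub> y'" using z[of ?k] c by algebra
    ultimately show ?thesis by simp
  qed
  then have "y \<ominus>\<^bsub>A\<^esub> y' = \<zero>\<^bsub>A\<^esub>" by (rule separated[OF U(1,2)])
  then show ?thesis using diff_zero_iff[OF c] by simp
qed

text \<open>Forgetting the first \<open>m\<close> terms turns the sequence into an element of
  \<open>Z T\<close>, to which completeness of \<open>T\<close> applies directly.\<close>

lemma tends_cauchy:
  assumes T: "T \<in> bdd_submodules V A" "adic_complete V \<pi> A T" and z: "\<And>k. z k \<in> T"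
    and d: "\<And>n k. k \<ge> n + m \<Longrightarrow> z (Suc k) \<ominus>\<^bsub>A\<^esub> z k \<in> P n T"
  shows "\<exists>y\<in>T. tends z y"
proof -
  have "(\<lambda>n. z (n + m)) \<in> Z T" unfolding adic_cauchy_def using z d by simp
  then obtain y where y: "y \<in> T" "\<And>n. y \<ominus>\<^bsub>A\<^esub> z (n + m) \<in> P n T"
    using ex1_implies_ex[OF bspec[OF T(2)[unfolded adic_complete_def]]] by blast
  have "z k \<ominus>\<^bsub>A\<^esub> y \<in> P n T" if k: "k \<ge> n + m" for n k
  proof -
    have "y \<ominus>\<^bsub>A\<^esub> z k \<in> P (k - m) T" using y(2)[of "k - m"] k by simp
    moreover have "n \<le> k - m" using k by simp
    ultimately have "y \<ominus>\<^bsub>A\<^esub> z k \<in> P n T" using subsetD[OF P_antimono[OF bddD(1)[OF T(1)]]] by blast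
    moreover have "z k \<ominus>\<^bsub>A\<^esub> y = \<ominus>\<^bsub>A\<^esub> (y \<ominus>\<^bsub>A\<^esub> z k)" using z[of k] y(1) bddD(4)[OF T(1)] by algebra
    ultimately show ?thesis using submoduleE(3)[OF P_sub[OF bddD(1)[OF T(1)]]] by simp
  qed
  then have "tends z y" unfolding tends_def using T(1) y(1) bddD(4)[OF T(1)] by blast
  then show ?thesis using y(1) by blast
qed

lemma tends_const: assumes y: "y \<in> carrier A" shows "tends (\<lambda>k. y) y"
proof -
  obtain T where T: "T \<in> bdd_submodules V A" by (rule ex_bdd)
  have "y \<ominus>\<^bsub>A\<^esub> y \<in> P n T" for n
    using diff_self[OF y] submodule_zero[OF P_sub[OF bddD(1)[OF T]], of n] by simp
  then show ?thesis unfolding tends_def using T y by blast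
qed

lemma tends_add:
  assumes z: "\<And>k. z k \<in> carrier A" "\<And>k. z' k \<in> carrier A" and y: "tends z y" "tends z' y'"
  shows "tends (\<lambda>k. z k \<oplus>\<^bsub>A\<^esub> z' k) (y \<oplus>\<^bsub>A\<^esub> y')"
proof -
  obtain T where T: "T \<in> bdd_submodules V A" "\<And>n. \<exists>k0. \<forall>k\<ge>k0. z k \<ominus>\<^bsub>A\<^esub> y \<in> P n T" using y(1) unfolding tends_def by blast
  obtain T' where T': "T' \<in> bdd_submodules V A" "\<And>n. \<exists>k0. \<forall>k\<ge>k0. z' k \<ominus>\<^bsub>A\<^esub> y' \<in> P n T'" using y(2) unfolding tends_def by blast
  have c: "y \<in> carrier A" "y' \<in> carrier A" using y by (simp_all add: tends_def)
  obtain U where U: "U \<in> bdd_submodules V A" "T \<subseteq> U" "T' \<subseteq> U" using bdd_join[OF T(1) T'(1)] .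
  have "\<exists>k0. \<forall>k\<ge>k0. (z k \<oplus>\<^bsub>A\<^esub> z' k) \<ominus>\<^bsub>A\<^esub> (y \<oplus>\<^bsub>A\<^esub> y') \<in> P n U" for n
  proof -
    obtain k0 where k0: "\<And>k. k \<ge> k0 \<Longrightarrow> z k \<ominus>\<^bsub>A\<^esub> y \<in> P n T" using T(2)[of n] by blast
    obtain k1 where k1: "\<And>k. k \<ge> k1 \<Longrightarrow> z' k \<ominus>\<^bsub>A\<^esub> y' \<in> P n T'" using T'(2)[of n] by blast
    have "(z k \<oplus>\<^bsub>A\<^esub> z' k) \<ominus>\<^bsub>A\<^esub> (y \<oplus>\<^bsub>A\<^esub> y') \<in> P n U" if "k \<ge> max k0 k1" for k
      unfolding diff_add[OF z c]
      by (rule submoduleE(5)[OF P_sub[OF bddD(1)[OF U(1)]] subsetD[OF P_mono[OF U(2)] k0] subsetD[OF P_mono[OF U(3)] k1]])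
         (use that in simp_all)
    then show ?thesis by blast
  qed
  then show ?thesis unfolding tends_def using U(1) c by blast
qed

text \<open>The conclusion is convergence of the images, spelled out because \<open>tends\<close>
  belongs to complete algebras while the target is any bornological module.\<close>

lemma tends_linear:
  assumes B: "born_module V B" and f: "bdd_linear_map V A B f" and z: "\<And>k. z k \<in> carrier A" and y: "tends z y"
  shows "f y \<in> carrier B \<and> (\<exists>T\<in>bdd_submodules V B. \<forall>n. \<exists>k0. \<forall>k\<ge>k0. f (z k) \<ominus>\<^bsub>B\<^esub> f y \<in> scaled B (\<pi> [^]\<^bsub>V\<^esub> (n::nat)) T)"
proof -
  note fl = bdd_linear_mapD(1)[OF f]
  obtain T where T: "T \<in> bdd_submodules V A" "\<And>n. \<exists>k0. \<forall>k\<ge>k0. z k \<ominus>\<^bsub>A\<^esub> y \<in> P n T" using y unfolding tends_def by blast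
  have c: "y \<in> carrier A" using y by (simp add: tends_def)
  obtain S where S: "S \<in> bdd_submodules V B" "f ` T \<subseteq> S"
    using born_moduleD(6)[OF B bdd_linear_mapD(2)[OF f bddD(2)[OF T(1)]]] by blast
  have "f (z k) \<ominus>\<^bsub>B\<^esub> f y \<in> scaled B (\<pi> [^]\<^bsub>V\<^esub> (n::nat)) S" if zt: "z k \<ominus>\<^bsub>A\<^esub> y \<in> P n T" for n k
  proof -
    obtain t where t: "t \<in> T" "z k \<ominus>\<^bsub>A\<^esub> y = (\<pi> [^]\<^bsub>V\<^esub> n) \<odot>\<^bsub>A\<^esub> t" using zt unfolding P_D by blast
    have "f (z k) \<ominus>\<^bsub>B\<^esub> f y = (\<pi> [^]\<^bsub>V\<^esub> n) \<odot>\<^bsub>B\<^esub> f t"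
      unfolding linear_diff[OF module_axioms born_moduleD(1)[OF B] fl z c, symmetric] t(2)
      by (rule linear_mapD(3)[OF fl pin bddD(4)[OF T(1) t(1)]])
    then show ?thesis using S(2) t(1) unfolding scaled_def by blast
  qed
  then have "\<forall>n. \<exists>k0. \<forall>k\<ge>k0. f (z k) \<ominus>\<^bsub>B\<^esub> f y \<in> scaled B (\<pi> [^]\<^bsub>V\<^esub> (n::nat)) S" using T(2) by meson
  then show ?thesis using S(1) linear_mapD(1)[OF fl c] by blast
qed

lemma tends_smult:
  assumes "c \<in> carrier V" "\<And>k. z k \<in> carrier A" "tends z y"
  shows "tends (\<lambda>k. c \<odot>\<^bsub>A\<^esub> z k) (c \<odot>\<^bsub>A\<^esub> y)"
  using tends_linear[OF born bdd_linear_map_smult[OF born bdd_linear_map_id[OF module_axioms] assms(1)] assms(2,3)]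
  unfolding tends_def .

lemma tends_mul:
  assumes z: "\<And>k. z k \<in> carrier A" "\<And>k. z' k \<in> carrier A" and y: "tends z y" "tends z' y'"
  shows "tends (\<lambda>k. z k \<otimes>\<^bsub>A\<^esub> z' k) (y \<otimes>\<^bsub>A\<^esub> y')"
proof -
  obtain T where T: "T \<in> bdd_submodules V A" "\<And>n. \<exists>k0. \<forall>k\<ge>k0. z k \<ominus>\<^bsub>A\<^esub> y \<in> P n T" using y(1) unfolding tends_def by blast
  obtain T' where T': "T' \<in> bdd_submodules V A" "\<And>n. \<exists>k0. \<forall>k\<ge>k0. z' k \<ominus>\<^bsub>A\<^esub> y' \<in> P n T'" using y(2) unfolding tends_def by blast
  have c: "y \<in> carrier A" "y' \<in> carrier A" using y by (simp_all add: tends_def)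
  have s: "{y} \<in> bounded A" "{y'} \<in> bounded A" using bd(5) c by auto
  note b = bddD(2)[OF T(1)] bddD(2)[OF T'(1)]
  \<comment> \<open>\<open>U\<close> has to contain the products in the expansion of
    \<open>z z' - y y'\<close> into \<open>(z - y)(z' - y')\<close>, \<open>(z - y) y'\<close> and
    \<open>y (z' - y')\<close>.\<close>
  obtain U where U: "U \<in> bdd_submodules V A" "(set_prod A T T' \<union> set_prod A T {y'}) \<union> set_prod A {y} T' \<subseteq> U"
    using bd(6)[OF bd(2)[OF bd(2)[OF mul_bdd[OF b] mul_bdd[OF b(1) s(2)]] mul_bdd[OF s(1) b(2)]]] by blast
  have pr: "a \<otimes>\<^bsub>A\<^esub> d \<in> U" if "a \<in> T \<and> (d \<in> T' \<or> d = y') \<or> a = y \<and> d \<in> T'" for a d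
    using that U(2) unfolding set_prod_def by blast
  have "\<exists>k0. \<forall>k\<ge>k0. (z k \<otimes>\<^bsub>A\<^esub> z' k) \<ominus>\<^bsub>A\<^esub> (y \<otimes>\<^bsub>A\<^esub> y') \<in> P n U" for n
  proof -
    obtain k0 where k0: "\<And>k. k \<ge> k0 \<Longrightarrow> z k \<ominus>\<^bsub>A\<^esub> y \<in> P n T" using T(2)[of n] by blast
    obtain k1 where k1: "\<And>k. k \<ge> k1 \<Longrightarrow> z' k \<ominus>\<^bsub>A\<^esub> y' \<in> P n T'" using T'(2)[of n] by blast
    have "(z k \<otimes>\<^bsub>A\<^esub> z' k) \<ominus>\<^bsub>A\<^esub> (y \<otimes>\<^bsub>A\<^esub> y') \<in> P n U" if k: "k \<ge> max k0 k1" for k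
    proof -
      obtain t where t: "t \<in> T" "z k \<ominus>\<^bsub>A\<^esub> y = (\<pi> [^]\<^bsub>V\<^esub> n) \<odot>\<^bsub>A\<^esub> t" using k0[of k] k unfolding P_D by auto
      obtain t' where t': "t' \<in> T'" "z' k \<ominus>\<^bsub>A\<^esub> y' = (\<pi> [^]\<^bsub>V\<^esub> n) \<odot>\<^bsub>A\<^esub> t'" using k1[of k] k unfolding P_D by auto
      have p0: "(\<pi> [^]\<^bsub>V\<^esub> n) \<odot>\<^bsub>A\<^esub> t' \<in> T'" using submoduleE(4)[OF bddD(1)[OF T'(1)] pin t'(1)] .
      note tc = bddD(4)[OF T(1) t(1)] bddD(4)[OF T'(1) t'(1)] bddD(4)[OF T'(1) p0]
      have "(z k \<otimes>\<^bsub>A\<^esub> z' k) \<ominus>\<^bsub>A\<^esub> (y \<otimes>\<^bsub>A\<^esub> y') =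
          ((z k \<ominus>\<^bsub>A\<^esub> y) \<otimes>\<^bsub>A\<^esub> (z' k \<ominus>\<^bsub>A\<^esub> y') \<oplus>\<^bsub>A\<^esub> (z k \<ominus>\<^bsub>A\<^esub> y) \<otimes>\<^bsub>A\<^esub> y') \<oplus>\<^bsub>A\<^esub> y \<otimes>\<^bsub>A\<^esub> (z' k \<ominus>\<^bsub>A\<^esub> y')"
        using z[of k] c by algebra
      also have "\<dots> = ((\<pi> [^]\<^bsub>V\<^esub> n) \<odot>\<^bsub>A\<^esub> (t \<otimes>\<^bsub>A\<^esub> ((\<pi> [^]\<^bsub>V\<^esub> n) \<odot>\<^bsub>A\<^esub> t')) \<oplus>\<^bsub>A\<^esub> (\<pi> [^]\<^bsub>V\<^esub> n) \<odot>\<^bsub>A\<^esub> (t \<otimes>\<^bsub>A\<^esub> y')) \<oplus>\<^bsub>A\<^esub> (\<pi> [^]\<^bsub>V\<^esub> n) \<odot>\<^bsub>A\<^esub> (y \<otimes>\<^bsub>A\<^esub> t')"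
        unfolding t(2) t'(2) mul_smult_l[OF pin tc(1) tc(3)] mul_smult_l[OF pin tc(1) c(2)] mul_smult_r[OF pin c(1) tc(2)] ..
      also have "\<dots> \<in> P n U"
        by (intro submoduleE(5)[OF P_sub[OF bddD(1)[OF U(1)]]] P_I pr) (use t(1) t'(1) p0 in simp_all)
      finally show ?thesis .
    qed
    then show ?thesis by blast
  qed
  then show ?thesis unfolding tends_def using U(1) c by auto
qed

end

section \<open>Torsion-free algebras and limits of almost multiplicative maps\<close>

locale tfalg = balg V \<pi> A for V :: "('v, 'k) ring_scheme" and \<pi> :: 'v and A :: "('v, 'a) bmod" +
  assumes tf: "torsion_free \<pi> A"
begin

lemma pi_inj: "x \<in> carrier A \<Longrightarrow> y \<in> carrier A \<Longrightarrow> \<pi> \<odot>\<^bsub>A\<^esub> x = \<pi> \<odot>\<^bsub>A\<^esub> y \<Longrightarrow> x = y"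
  using tf unfolding torsion_free_def bornological_embedding_def inj_on_def by blast

text \<open>Injectivity of multiplication by \<pi> is only half of torsion-freeness. The other half
  is that dividing a bounded set by \<pi> keeps it bounded.\<close>

lemma pi_bdd: "X \<subseteq> carrier A \<Longrightarrow> scaled A \<pi> X \<in> bounded A \<Longrightarrow> X \<in> bounded A"
  using tf unfolding torsion_free_def bornological_embedding_def scaled_def by blast

lemma pin_inj: "x \<in> carrier A \<Longrightarrow> y \<in> carrier A \<Longrightarrow> (\<pi> [^]\<^bsub>V\<^esub> (n::nat)) \<odot>\<^bsub>A\<^esub> x = (\<pi> [^]\<^bsub>V\<^esub> n) \<odot>\<^bsub>A\<^esub> y \<Longrightarrow> x = y"
proof (induction n)
  case (Suc n)
  have s: "(\<pi> [^]\<^bsub>V\<^esub> Suc n) \<odot>\<^bsub>A\<^esub> w = \<pi> \<odot>\<^bsub>A\<^esub> ((\<pi> [^]\<^bsub>V\<^esub> n) \<odot>\<^bsub>A\<^esub> w)" if "w \<in> carrier A" for w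
    using smult_pow_add[OF pi that, of 1 n] pi by simp
  show ?case by (rule Suc.IH[OF Suc.prems(1,2) pi_inj]) (use Suc.prems s in simp_all)
qed simp

lemma P_cancel:
  assumes "x \<in> carrier A" "S \<subseteq> carrier A" "(\<pi> [^]\<^bsub>V\<^esub> m) \<odot>\<^bsub>A\<^esub> x \<in> P (m + n) S"
  shows "x \<in> P n S"
proof -
  obtain t where t: "t \<in> S" "(\<pi> [^]\<^bsub>V\<^esub> m) \<odot>\<^bsub>A\<^esub> x = (\<pi> [^]\<^bsub>V\<^esub> (m + n)) \<odot>\<^bsub>A\<^esub> t" using assms(3) unfolding P_D by blast
  have tc: "t \<in> carrier A" using t(1) assms(2) by blast
  have "x = (\<pi> [^]\<^bsub>V\<^esub> n) \<odot>\<^bsub>A\<^esub> t"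
    by (rule pin_inj[OF assms(1) smult_closed[OF pin tc], of m]) (simp add: t(2) smult_pow_add[OF pi tc])
  then show ?thesis using t(1) unfolding P_D by blast
qed

end

locale ctf = calg V \<pi> A + tfalg V \<pi> A for V :: "('v, 'k) ring_scheme" and \<pi> :: 'v and A :: "('v, 'a) bmod"
begin

text \<open>These are the bounds of linear growth that make the limit of the maps \<open>q k\<close> extend to the dagger
  completion.\<close>

definition fast where
  "fast R q M T m \<longleftrightarrow>
    (\<forall>j k. \<forall>x\<in>sub_powers_upto V R M (Suc j). (\<pi> [^]\<^bsub>V\<^esub> j) \<odot>\<^bsub>A\<^esub> q k x \<in> T) \<and>
    (\<forall>j n k. \<forall>x\<in>sub_powers_upto V R M (Suc j). k \<ge> n + m \<longrightarrow> (\<pi> [^]\<^bsub>V\<^esub> j) \<odot>\<^bsub>A\<^esub> (q (Suc k) x \<ominus>\<^bsub>A\<^esub> q k x) \<in> P n T) \<and>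
    (\<forall>n k. \<forall>x\<in>M. \<forall>y\<in>M. k \<ge> n + m \<longrightarrow> \<pi> \<odot>\<^bsub>A\<^esub> curv R A (q k) x y \<in> P n T)"

lemma fastD:
  assumes "fast R q M T m"
  shows "x \<in> sub_powers_upto V R M (Suc j) \<Longrightarrow> (\<pi> [^]\<^bsub>V\<^esub> j) \<odot>\<^bsub>A\<^esub> q k x \<in> T"
    and "x \<in> sub_powers_upto V R M (Suc j) \<Longrightarrow> k \<ge> n + m \<Longrightarrow> (\<pi> [^]\<^bsub>V\<^esub> j) \<odot>\<^bsub>A\<^esub> (q (Suc k) x \<ominus>\<^bsub>A\<^esub> q k x) \<in> P n T"
    and "x \<in> M \<Longrightarrow> y \<in> M \<Longrightarrow> k \<ge> n + m \<Longrightarrow> \<pi> \<odot>\<^bsub>A\<^esub> curv R A (q k) x y \<in> P n T"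
  using assms by (simp_all add: fast_def)

text \<open>Pointwise convergence is the case \<open>j = 0\<close> of \<open>fast\<close>. For
  \<open>x\<close> of degree \<open>j + 1\<close> the multiples of \<open>q k x\<close> by
  \<open>\<pi>^j\<close> stay in the complete submodule \<open>T\<close>, and so does their limit;
  since such \<open>\<pi>^j x\<close> generate the sets of linear growth, the limit is bounded on
  them.\<close>

lemma limit_hom:
  assumes R: "balg V \<pi> R" and q: "\<And>k. linear_map V R A (q k)"
    and cond: "\<And>B. B \<in> bounded R \<Longrightarrow> \<exists>M\<in>bdd_submodules V R. \<exists>T\<in>bdd_submodules V A. \<exists>m.
      B \<subseteq> M \<and> adic_complete V \<pi> A T \<and> fast R q M T m"
  shows "\<exists>f. bdd_linear_map V (R\<lparr>bounded := linear_growth V \<pi> R\<rparr>) A f \<and> (\<forall>x\<in>carrier R. tends (\<lambda>k. q k x) (f x)) \<and>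
    (\<forall>x\<in>carrier R. \<forall>y\<in>carrier R. f (x \<otimes>\<^bsub>R\<^esub> y) = f x \<otimes>\<^bsub>A\<^esub> f y)"
proof -
  interpret R: balg V \<pi> R by (rule R)
  note ql = linear_mapD[OF q]
  have "\<exists>y. tends (\<lambda>k. q k x) y" if x: "x \<in> carrier R" for x
  proof -
    have "{x} \<in> bounded R" using R.bd(5) x by simp
    from cond[OF this] obtain M T m where h: "x \<in> M" "T \<in> bdd_submodules V A" "adic_complete V \<pi> A T" "fast R q M T m"
      by blast
    note h = h(1-3) fastD(1,2)[OF h(4)]
    have x1: "x \<in> sub_powers_upto V R M (Suc 0)" using h(1) R.upto_1[of M] by auto
    have "\<exists>y\<in>T. tends (\<lambda>k. q k x) y"
    proof (rule tends_cauchy[OF h(2,3)])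
      show "q k x \<in> T" for k using h(4)[OF x1, of k] ql(1)[OF x] by simp
      show "q (Suc k) x \<ominus>\<^bsub>A\<^esub> q k x \<in> P n T" if "k \<ge> n + m" for n k using h(5)[OF x1 that] ql(1)[OF x] by simp
    qed
    then show ?thesis by blast
  qed
  then obtain f where f: "\<And>x. x \<in> carrier R \<Longrightarrow> tends (\<lambda>k. q k x) (f x)" by metis
  have fc: "f x \<in> carrier A" if "x \<in> carrier R" for x using f[OF that] by (simp add: tends_def)
  have lin: "linear_map V R A f"
  proof (rule linear_mapI[OF fc])
    fix x y assume xy: "x \<in> carrier R" "y \<in> carrier R"
    show "f (x \<oplus>\<^bsub>R\<^esub> y) = f x \<oplus>\<^bsub>A\<^esub> f y"
      by (rule tends_unique[OF _ f[OF R.M.a_closed[OF xy]]])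
         (use tends_add[OF ql(1)[OF xy(1)] ql(1)[OF xy(2)] f[OF xy(1)] f[OF xy(2)]] xy in \<open>simp_all add: ql\<close>)
  next
    fix c x assume c: "c \<in> carrier V" and x: "x \<in> carrier R"
    show "f (c \<odot>\<^bsub>R\<^esub> x) = c \<odot>\<^bsub>A\<^esub> f x"
      by (rule tends_unique[OF _ f[OF R.smult_closed[OF c x]]])
         (use tends_smult[OF c ql(1)[OF x] f[OF x]] c x in \<open>simp_all add: ql\<close>)
  qed
  have mult: "f (x \<otimes>\<^bsub>R\<^esub> y) = f x \<otimes>\<^bsub>A\<^esub> f y" if xy: "x \<in> carrier R" "y \<in> carrier R" for x y
  proof -
    have "{x, y} \<in> bounded R" using R.bd(5) xy by simp
    from cond[OF this] obtain M T m where h: "x \<in> M" "y \<in> M" "T \<in> bdd_submodules V A" "fast R q M T m"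
      by blast
    note h = h(1-3) fastD(3)[OF h(4)]
    let ?c = "\<lambda>k. curv R A (q k) x y"
    note c = ql(1)[OF xy(1)] ql(1)[OF xy(2)] ql(1)[OF R.mul_closed[OF xy]]
    have cc: "?c k \<in> carrier A" for k using c by (simp add: curv_def)
    have eq: "?c k = (q k x \<otimes>\<^bsub>A\<^esub> q k y) \<oplus>\<^bsub>A\<^esub> (\<ominus>\<^bsub>V\<^esub> \<one>\<^bsub>V\<^esub>) \<odot>\<^bsub>A\<^esub> q k (x \<otimes>\<^bsub>R\<^esub> y)" for k
      unfolding curv_def using c by (simp add: a_minus_def smult_l_minus)
    have m1: "\<ominus>\<^bsub>V\<^esub> \<one>\<^bsub>V\<^esub> \<in> carrier V" by simp
    let ?y = "(f x \<otimes>\<^bsub>A\<^esub> f y) \<oplus>\<^bsub>A\<^esub> (\<ominus>\<^bsub>V\<^esub> \<one>\<^bsub>V\<^esub>) \<odot>\<^bsub>A\<^esub> f (x \<otimes>\<^bsub>R\<^esub> y)"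
    have "tends ?c ?y"
      unfolding eq
      by (rule tends_add[OF mul_closed[OF c(1,2)] smult_closed[OF m1 c(3)] tends_mul[OF c(1,2) f[OF xy(1)] f[OF xy(2)]]
          tends_smult[OF m1 c(3) f[OF R.mul_closed[OF xy]]]])
    \<comment> \<open>Only \<pi> times the curvature is known to be small. The limit of this
      multiple is computed in two ways, and \<pi> is cancelled by torsion-freeness.\<close>
    then have 1: "tends (\<lambda>k. \<pi> \<odot>\<^bsub>A\<^esub> ?c k) (\<pi> \<odot>\<^bsub>A\<^esub> ?y)" by (rule tends_smult[OF pi cc])
    have "\<pi> \<odot>\<^bsub>A\<^esub> ?c k \<ominus>\<^bsub>A\<^esub> \<zero>\<^bsub>A\<^esub> \<in> P n T" if "k \<ge> n + m" for n k
      using h(4)[OF h(1,2) that] diff_zero[OF smult_closed[OF pi cc]] by simp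
    then have 2: "tends (\<lambda>k. \<pi> \<odot>\<^bsub>A\<^esub> ?c k) \<zero>\<^bsub>A\<^esub>" unfolding tends_def using h(3) by blast
    have yc: "?y \<in> carrier A" using fc xy by simp
    have "\<pi> \<odot>\<^bsub>A\<^esub> ?y = \<pi> \<odot>\<^bsub>A\<^esub> \<zero>\<^bsub>A\<^esub>" using tends_unique[OF smult_closed[OF pi cc] 1 2] pi by simp
    then have "?y = \<zero>\<^bsub>A\<^esub>" by (rule pi_inj[OF yc M.zero_closed])
    then have "f x \<otimes>\<^bsub>A\<^esub> f y \<ominus>\<^bsub>A\<^esub> f (x \<otimes>\<^bsub>R\<^esub> y) = \<zero>\<^bsub>A\<^esub>"
      using fc xy by (simp add: a_minus_def smult_l_minus)
    then show ?thesis using diff_zero_iff[of "f x \<otimes>\<^bsub>A\<^esub> f y" "f (x \<otimes>\<^bsub>R\<^esub> y)"] fc xy by simp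
  qed
  have "bdd_linear_map V (R\<lparr>bounded := linear_growth V \<pi> R\<rparr>) A f"
  proof (rule bdd_linear_mapI)
    show "linear_map V (R\<lparr>bounded := linear_growth V \<pi> R\<rparr>) A f" using lin by (simp add: linear_map_def)
    fix B assume "B \<in> bounded (R\<lparr>bounded := linear_growth V \<pi> R\<rparr>)"
    then obtain M0 where M0: "M0 \<in> bdd_submodules V R" "B \<subseteq> span_in V R (\<Union>i. scaled R (\<pi> [^]\<^bsub>V\<^esub> i) (sub_power V R M0 (Suc i)))"
      unfolding linear_growth_def by auto
    from cond[OF R.bddD(2)[OF M0(1)]] obtain M T m where h: "M0 \<subseteq> M" "M \<in> bdd_submodules V R" "T \<in> bdd_submodules V A" "adic_complete V \<pi> A T" "fast R q M T m"
      by blast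
    note h = h(1-4) fastD(1,2)[OF h(5)]
    have key: "(\<pi> [^]\<^bsub>V\<^esub> j) \<odot>\<^bsub>A\<^esub> f x \<in> T" if x: "x \<in> sub_powers_upto V R M (Suc j)" for j x
    proof -
      have xc: "x \<in> carrier R" using R.upto_carrier[OF R.bddD(3)[OF h(2)]] x by blast
      have "\<exists>y\<in>T. tends (\<lambda>k. (\<pi> [^]\<^bsub>V\<^esub> j) \<odot>\<^bsub>A\<^esub> q k x) y"
        by (rule tends_cauchy[OF h(3,4) h(5)[OF x]]) (use h(6)[OF x] ql(1)[OF xc] in \<open>simp add: smult_diff[symmetric]\<close>)
      then obtain y where y: "y \<in> T" "tends (\<lambda>k. (\<pi> [^]\<^bsub>V\<^esub> j) \<odot>\<^bsub>A\<^esub> q k x) y" by blast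
      have "y = (\<pi> [^]\<^bsub>V\<^esub> j) \<odot>\<^bsub>A\<^esub> f x"
        by (rule tends_unique[OF smult_closed[OF pin ql(1)[OF xc]] y(2) tends_smult[OF pin ql(1)[OF xc] f[OF xc]]])
      then show ?thesis using y(1) by simp
    qed
    have fT: "f b \<in> T" if b: "b \<in> B" for b
    proof (rule linear_span_in[OF R.module_axioms module_axioms lin bddD(1)[OF h(3)] _ _ subsetD[OF M0(2) b]])
      have c: "x \<in> sub_power V R M0 (Suc i) \<Longrightarrow> x \<in> carrier R" for x i using R.power_carrier[OF R.bddD(3)[OF M0(1)]] by blast
      show "(\<Union>i. scaled R (\<pi> [^]\<^bsub>V\<^esub> i) (sub_power V R M0 (Suc i))) \<subseteq> carrier R"
        unfolding scaled_def by clarify (rule R.smult_closed[OF R.pin c])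
      fix x assume "x \<in> (\<Union>i. scaled R (\<pi> [^]\<^bsub>V\<^esub> i) (sub_power V R M0 (Suc i)))"
      then obtain i y where y: "y \<in> sub_power V R M0 (Suc i)" "x = (\<pi> [^]\<^bsub>V\<^esub> i) \<odot>\<^bsub>R\<^esub> y" unfolding scaled_def by blast
      have "y \<in> sub_powers_upto V R M (Suc i)"
        using R.power_mono[OF h(1)] R.power_upto[of "Suc i" "Suc i" M] y(1) by auto
      from key[OF this] show "f x \<in> T" unfolding y(2) using linear_mapD(3)[OF lin R.pin c[OF y(1)]] by simp
    qed
    show "f ` B \<in> bounded A" by (rule bd(3)[OF bddD(2)[OF h(3)]]) (use fT in blast)
  qed
  then show ?thesis using f mult by blast
qed

end

section \<open>The linear growth bornology\<close>

context balg
begin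

definition "lg M = span_in V A (\<Union>i. scaled A (\<pi> [^]\<^bsub>V\<^esub> i) (sub_power V A M (Suc i)))"

lemma lg_gen: "M \<subseteq> carrier A \<Longrightarrow> (\<Union>i. scaled A (\<pi> [^]\<^bsub>V\<^esub> i) (sub_power V A M (Suc i))) \<subseteq> carrier A"
  unfolding scaled_def by clarify (rule smult_closed[OF pin subsetD[OF power_carrier]])

lemma lg_sub: "M \<subseteq> carrier A \<Longrightarrow> submodule (lg M) V A" "M \<subseteq> carrier A \<Longrightarrow> lg M \<subseteq> carrier A"
  unfolding lg_def by (rule span_sub[OF lg_gen] span_carrier[OF lg_gen], assumption)+

lemma lg_mono: "M \<subseteq> M' \<Longrightarrow> lg M \<subseteq> lg M'"
  unfolding lg_def scaled_def by (intro span_mono UN_mono image_mono power_mono order_refl)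

lemma lg_I: "x \<in> sub_power V A M (Suc i) \<Longrightarrow> (\<pi> [^]\<^bsub>V\<^esub> i) \<odot>\<^bsub>A\<^esub> x \<in> lg M"
  unfolding lg_def scaled_def by (rule subsetD[OF span_sup]) blast

lemma power_1: "M \<subseteq> sub_power V A M 1"
  unfolding sub_power_def using span_sup by simp

lemma lg_incl: assumes M: "M \<subseteq> carrier A" shows "M \<subseteq> lg M"
proof
  fix x assume x: "x \<in> M"
  then have "(\<pi> [^]\<^bsub>V\<^esub> (0::nat)) \<odot>\<^bsub>A\<^esub> x \<in> lg M" using power_1[of M] by (intro lg_I) auto
  then show "x \<in> lg M" using x M by (simp add: subset_iff)
qed

lemma linear_growth_iff: "B \<in> linear_growth V \<pi> A \<longleftrightarrow> (\<exists>M\<in>bdd_submodules V A. B \<subseteq> lg M)"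
  by (simp add: linear_growth_def lg_def)

text \<open>Passing from \<open>M\<close> to \<open>M + M\<^sup>2 + \<dots> + M\<^sup>c\<close> divides the growth rate by \<open>c\<close>.\<close>

lemma fold_block:
  assumes M: "M \<subseteq> carrier A" and c: "c \<ge> 1"
  shows "k \<ge> 1 \<Longrightarrow> x \<in> fold_prods A M k \<Longrightarrow> x \<in> sub_power V A (sub_powers_upto V A M c) (Suc ((k - 1) div c))"
proof (induction k arbitrary: x rule: less_induct)
  case (less k)
  let ?M = "sub_powers_upto V A M c"
  have small: "y \<in> ?M" if "i \<ge> 1" "i \<le> c" "y \<in> fold_prods A M i" for i y
    using power_upto[OF that(1,2), of M] that(3) span_sup[of "fold_prods A M i"] unfolding sub_power_def by blast
  show ?case
  proof (cases "k \<le> c")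
    case True
    then have "(k - 1) div c = 0" using less.prems(1) by simp
    then show ?thesis using small[OF less.prems(1) True less.prems(2)] power_1[of ?M] by auto
  next
    case False
    then have "k - c \<ge> 1" "c + (k - c) = k" by linarith+
    then obtain y z where yz: "y \<in> fold_prods A M c" "z \<in> fold_prods A M (k - c)" "x = y \<otimes>\<^bsub>A\<^esub> z"
      using fold_split[OF M c, of "k - c" x] less.prems(2) by metis
    have z: "z \<in> sub_power V A ?M (Suc ((k - c - 1) div c))" by (rule less.IH[OF _ _ yz(2)]) (use False c in auto)
    have y: "y \<in> sub_power V A ?M 1" using small[OF c order_refl yz(1)] power_1[of ?M] by blast
    \<comment> \<open>\<open>Suc ((k - 1) div c)\<close> is \<open>k / c\<close> rounded up, the
      number of blocks of length at most \<open>c\<close>; removing one full block lowers it by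
      one.\<close>
    have "(k - 1) div c = Suc ((k - c - 1) div c)" using False c le_div_geq[of c "k - 1"] by (simp add: diff_commute)
    then show ?thesis using power_mult[OF upto_carrier[OF M] _ y z] yz(3) by simp
  qed
qed

text \<open>A product of \<open>k\<close> factors needs the exponent \<open>(k - 1) div c\<close> by
  \<open>fold_block\<close>, which is at most \<open>i div c\<close> for \<open>k \<le> i\<close>.
  Spare powers of \<pi> make the exponent uniform for all summands of degree up to
  \<open>i\<close>.\<close>

lemma upto_lg:
  assumes M: "M \<subseteq> carrier A" and c: "c \<ge> 1" and x: "x \<in> sub_powers_upto V A M i"
  shows "(\<pi> [^]\<^bsub>V\<^esub> (i div c)) \<odot>\<^bsub>A\<^esub> x \<in> lg (sub_powers_upto V A M c)"
proof -
  let ?M = "sub_powers_upto V A M c"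
  have lin: "linear_map V A A (\<lambda>x. (\<pi> [^]\<^bsub>V\<^esub> (i div c)) \<odot>\<^bsub>A\<^esub> x)"
    by (rule linear_map_smult[OF module_axioms bdd_linear_mapD(1)[OF bdd_linear_map_id[OF module_axioms]] pin])
  note lgs = lg_sub(1)[OF upto_carrier[OF M, of c]]
  have f: "(\<pi> [^]\<^bsub>V\<^esub> (i div c)) \<odot>\<^bsub>A\<^esub> y \<in> lg ?M" if k: "1 \<le> k" "k \<le> i" and y: "y \<in> fold_prods A M k" for y k
  proof -
    let ?q = "(k - 1) div c"
    have q: "?q \<le> i div c" using k by (intro div_le_mono) simp
    have yc: "y \<in> carrier A" using fold_carrier[OF M] y by blast
    have "(\<pi> [^]\<^bsub>V\<^esub> (i div c - ?q)) \<odot>\<^bsub>A\<^esub> ((\<pi> [^]\<^bsub>V\<^esub> ?q) \<odot>\<^bsub>A\<^esub> y) \<in> lg ?M"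
      by (rule submoduleE(4)[OF lgs pin lg_I[OF fold_block[OF M c k(1) y]]])
    then show ?thesis using smult_pow_add[OF pi yc, of "i div c - ?q" ?q] q by simp
  qed
  have p: "(\<pi> [^]\<^bsub>V\<^esub> (i div c)) \<odot>\<^bsub>A\<^esub> y \<in> lg ?M" if k: "1 \<le> k" "k \<le> i" and y: "y \<in> sub_power V A M k" for y k
    by (rule linear_span_in[OF module_axioms module_axioms lin lgs fold_carrier[OF M] f[OF k] y[unfolded sub_power_def]])
  show ?thesis
  proof (rule linear_span_in[OF module_axioms module_axioms lin lgs upto_gen[OF M] _ x[unfolded sub_powers_upto_def]])
    fix y assume "y \<in> (\<Union>k\<in>{1..i}. sub_power V A M k)"
    then obtain k where "k \<in> {1..i}" "y \<in> sub_power V A M k" by (rule UN_E)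
    then show "(\<pi> [^]\<^bsub>V\<^esub> (i div c)) \<odot>\<^bsub>A\<^esub> y \<in> lg ?M" using p[of k y] by simp
  qed
qed

abbreviation "Alg \<equiv> A\<lparr>bounded := linear_growth V \<pi> A\<rparr>"

lemma lg_born: "born_module V Alg"
proof (rule born_moduleI)
  show "module V Alg" by (rule module_bounded_update(1)[OF module_axioms])
  have iff: "B \<in> bounded Alg \<longleftrightarrow> (\<exists>M\<in>bdd_submodules V A. B \<subseteq> lg M)" for B using linear_growth_iff by simp
  show "\<exists>S\<in>bounded Alg. submodule S V Alg \<and> B \<subseteq> S" if B: "B \<in> bounded Alg" for B
  proof -
    obtain M where M: "M \<in> bdd_submodules V A" "B \<subseteq> lg M" using B unfolding iff by blast
    have "lg M \<in> bounded Alg" unfolding iff using M(1) by blast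
    then show ?thesis using M(2) lg_sub(1)[OF bddD(3)[OF M(1)]] unfolding module_bounded_update(2) by blast
  qed
  show "B \<in> bounded Alg" if "B' \<in> bounded Alg" "B \<subseteq> B'" for B B' using that unfolding iff by blast
  show "B \<union> B' \<in> bounded Alg" if h: "B \<in> bounded Alg" "B' \<in> bounded Alg" for B B'
  proof -
    obtain M M' where M: "M \<in> bdd_submodules V A" "B \<subseteq> lg M" "M' \<in> bdd_submodules V A" "B' \<subseteq> lg M'" using h unfolding iff by blast
    obtain N where N: "N \<in> bdd_submodules V A" "M \<subseteq> N" "M' \<subseteq> N" using bdd_join[OF M(1,3)] .
    have "B \<union> B' \<subseteq> lg N" using M(2,4) lg_mono[OF N(2)] lg_mono[OF N(3)] by blast
    then show ?thesis using N(1) unfolding iff by blast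
  qed
  show "\<exists>B\<in>bounded Alg. x \<in> B" if x: "x \<in> carrier Alg" for x
  proof -
    have "x \<in> carrier A" using x by simp
    then obtain M where M: "M \<in> bdd_submodules V A" "x \<in> M" by (rule in_bdd)
    have "x \<in> lg M" using lg_incl[OF bddD(3)[OF M(1)]] M(2) by blast
    moreover have "lg M \<in> bounded Alg" unfolding iff using M(1) by blast
    ultimately show ?thesis by blast
  qed
qed

text \<open>The product of \<open>\<pi>^i M^(i+1)\<close> and \<open>\<pi>^j M^(j+1)\<close> has
  \<open>i + j + 2\<close> factors but only the power \<open>i + j\<close>. The block length must
  satisfy \<open>(n + 2) div c \<le> n\<close> for all \<open>n\<close>, and 3 is the least such
  value.\<close>

lemma lg_mult:
  assumes M: "M \<subseteq> carrier A" and x: "x \<in> lg M" and y: "y \<in> lg M"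
  shows "x \<otimes>\<^bsub>A\<^esub> y \<in> lg (sub_powers_upto V A M 3)"
  using x y unfolding lg_def[of M]
proof (rule span_mult[OF lg_gen[OF M] lg_gen[OF M] lg_sub(1)[OF upto_carrier[OF M, of 3]], rotated])
  fix x y assume "x \<in> (\<Union>i. scaled A (\<pi> [^]\<^bsub>V\<^esub> i) (sub_power V A M (Suc i)))" "y \<in> (\<Union>i. scaled A (\<pi> [^]\<^bsub>V\<^esub> i) (sub_power V A M (Suc i)))"
  then obtain i j a b where h: "a \<in> sub_power V A M (Suc i)" "x = (\<pi> [^]\<^bsub>V\<^esub> i) \<odot>\<^bsub>A\<^esub> a"
    "b \<in> sub_power V A M (Suc j)" "y = (\<pi> [^]\<^bsub>V\<^esub> j) \<odot>\<^bsub>A\<^esub> b" unfolding scaled_def by blast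
  have c: "a \<in> carrier A" "b \<in> carrier A" using h(1,3) power_carrier[OF M] by blast+
  let ?k = "Suc i + Suc j"
  have "a \<otimes>\<^bsub>A\<^esub> b \<in> sub_power V A M ?k" by (rule power_mult[OF M _ h(1,3)]) simp
  then have "a \<otimes>\<^bsub>A\<^esub> b \<in> sub_powers_upto V A M ?k" using power_upto[of ?k ?k M] by auto
  then have 1: "(\<pi> [^]\<^bsub>V\<^esub> (?k div 3)) \<odot>\<^bsub>A\<^esub> (a \<otimes>\<^bsub>A\<^esub> b) \<in> lg (sub_powers_upto V A M 3)" by (rule upto_lg[OF M, rotated]) simp
  have le: "?k div 3 \<le> i + j" by linarith
  have "x \<otimes>\<^bsub>A\<^esub> y = (\<pi> [^]\<^bsub>V\<^esub> (i + j)) \<odot>\<^bsub>A\<^esub> (a \<otimes>\<^bsub>A\<^esub> b)"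
    unfolding h(2,4) mul_smult_l[OF pin c(1) smult_closed[OF pin c(2)]] mul_smult_r[OF pin c] smult_pow_add[OF pi mul_closed[OF c]] ..
  also have "\<dots> = (\<pi> [^]\<^bsub>V\<^esub> (i + j - ?k div 3)) \<odot>\<^bsub>A\<^esub> ((\<pi> [^]\<^bsub>V\<^esub> (?k div 3)) \<odot>\<^bsub>A\<^esub> (a \<otimes>\<^bsub>A\<^esub> b))"
    using smult_pow_add[OF pi mul_closed[OF c], of "i + j - ?k div 3" "?k div 3"] le by simp
  also have "\<dots> \<in> lg (sub_powers_upto V A M 3)" by (rule submoduleE(4)[OF lg_sub(1)[OF upto_carrier[OF M]] pin 1])
  finally show "x \<otimes>\<^bsub>A\<^esub> y \<in> lg (sub_powers_upto V A M 3)" .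
qed

lemma lg_alg: "balg V \<pi> Alg"
proof
  show "born_algebra V Alg"
    unfolding born_algebra_def
  proof (intro conjI lg_born)
    show "\<forall>B\<in>bounded Alg. \<forall>C\<in>bounded Alg. set_prod Alg B C \<in> bounded Alg"
    proof (intro ballI)
      fix B B' assume h: "B \<in> bounded Alg" "B' \<in> bounded Alg"
      obtain M where M: "M \<in> bdd_submodules V A" "B \<union> B' \<subseteq> lg M"
        using born_moduleD(2)[OF lg_born h] linear_growth_iff by auto
      have "set_prod Alg B B' \<subseteq> lg (sub_powers_upto V A M 3)"
      proof
        fix z assume "z \<in> set_prod Alg B B'"
        then obtain x y where "z = x \<otimes>\<^bsub>A\<^esub> y" "x \<in> B" "y \<in> B'" unfolding set_prod_def by auto
        then show "z \<in> lg (sub_powers_upto V A M 3)" using lg_mult[OF bddD(3)[OF M(1)], of x y] M(2) by blast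
      qed
      then show "set_prod Alg B B' \<in> bounded Alg" using linear_growth_iff upto_bdd[OF bddD(2)[OF M(1)]] by auto
    qed
  qed (use mul_closed mul_assoc mul_l_distr mul_r_distr mul_smult_l mul_smult_r in auto)
qed (rule pi)

end

section \<open>Convergence of the Newton iteration\<close>

text \<open>With \<open>2 * b * L\<close> in \<open>c\<close>, the credits \<open>b * k\<close> cost
  about \<open>k / (2 * L)\<close> powers of \<pi>, which is half of what \<open>k\<close> curvature
  factors will provide. The summand 2 in \<open>c\<close> absorbs the \<open>j + 1\<close> and the
  rounding.\<close>

lemma degree_bound:
  fixes b L c j k \<delta> :: nat
  assumes L: "L \<ge> 1" and c: "c = 2 * b * L + 2" and \<delta>: "\<delta> \<le> j + 1 + b * k"
  shows "\<delta> div c \<le> j + k div (2 * L)"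
proof -
  let ?q = "k div (2 * L)"
  have "k \<le> 2 * L * ?q + 2 * L" using mod_less_divisor[of "2 * L" k] mult_div_mod_eq[of "2 * L" k] L by linarith
  then have "b * k \<le> b * (2 * L * ?q + 2 * L)" by (rule mult_le_mono2)
  then have "\<delta> < (j + ?q + 1) * c" using \<delta> unfolding c by (simp add: algebra_simps)
  then show ?thesis using less_mult_imp_div_less[of \<delta> "j + ?q + 1" c] by simp
qed

context almost_hom
begin

text \<open>The image of a summand, multiplied by \<open>\<pi>^(\<delta> div c)\<close>, is
  divisible by \<open>\<pi>^(k div L)\<close>, and \<open>degree_bound\<close> limits
  \<open>\<delta> div c\<close>. Torsion-freeness of \<open>E'\<close> allows the surplus to be
  cancelled. Degree \<open>j + 1\<close> comes with \<open>\<pi>^j\<close> because this is what the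
  linear growth bornology grants.\<close>

lemma grow_bound:
  fixes b :: nat
  assumes M: "M \<subseteq> carrier R" and E': "ctf V \<pi> E'" and \<alpha>: "bdd_alg_hom V E E' \<alpha>"
    and L: "L \<ge> 1" and c: "c = 2 * b * L + 2"
    and W: "submodule W V E" and S: "submodule S V E" and B: "B \<subseteq> carrier R"
    and pB: "\<And>i x. x \<in> sub_powers_upto V R M i \<Longrightarrow> (\<pi> [^]\<^bsub>V\<^esub> (i div c)) \<odot>\<^bsub>R\<^esub> x \<in> B"
    and sB: "\<And>x. x \<in> B \<Longrightarrow> s x \<in> S" and wB: "\<And>x y. x \<in> B \<Longrightarrow> y \<in> B \<Longrightarrow> w x y \<in> W"
    and T: "submodule T V E'" and \<alpha>T: "\<And>k z. z \<in> prodset E W S k \<Longrightarrow> \<alpha> z \<in> scaled E' (\<pi> [^]\<^bsub>V\<^esub> (k div L)) T"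
    and e: "grow V R E s M (int b) (int j + 1) N e"
  shows "(\<pi> [^]\<^bsub>V\<^esub> j) \<odot>\<^bsub>E'\<^esub> \<alpha> e \<in> scaled E' (\<pi> [^]\<^bsub>V\<^esub> (N div (2 * L))) T"
proof -
  interpret F: ctf V \<pi> E' by (rule E')
  have \<alpha>l: "linear_map V E E' \<alpha>" using \<alpha> by (simp add: bdd_alg_hom_def bdd_linear_map_def)
  note Tc = F.submoduleE(1)[OF T]
  let ?X = "{e' \<in> carrier E. \<exists>k\<ge>N. \<exists>\<delta>. int \<delta> \<le> (int j + 1) + int b * int k \<and>
    (\<pi> [^]\<^bsub>V\<^esub> (\<delta> div c)) \<odot>\<^bsub>E\<^esub> e' \<in> prodset E W S k}"
  have sp: "e \<in> span_in V E ?X"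
    using grow_prodset[OF M _ W S B _ pB sB wB e] c by simp
  have key: "(\<pi> [^]\<^bsub>V\<^esub> j) \<odot>\<^bsub>E'\<^esub> \<alpha> x \<in> F.P (N div (2 * L)) T" if x: "x \<in> ?X" for x
  proof -
    obtain k \<delta> where h: "x \<in> carrier E" "k \<ge> N" "int \<delta> \<le> (int j + 1) + int b * int k" "(\<pi> [^]\<^bsub>V\<^esub> (\<delta> div c)) \<odot>\<^bsub>E\<^esub> x \<in> prodset E W S k"
      using x by blast
    let ?q = "k div (2 * L)"
    have xc: "\<alpha> x \<in> carrier E'" by (rule linear_mapD(1)[OF \<alpha>l h(1)])
    have "int \<delta> \<le> int (j + 1 + b * k)" using h(3) by simp
    then have dl: "\<delta> div c \<le> j + ?q" using degree_bound[OF L c] by (simp only: of_nat_le_iff)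
    \<comment> \<open>One half of the available powers of \<pi> pays for the degree, and the other
      half remains as the rate of convergence.\<close>
    have 2: "?q + ?q \<le> k div L"
    proof -
      have "?q = k div L div 2" by (simp only: div_mult2_eq mult.commute[of 2])
      then show ?thesis by simp
    qed
    have "(\<pi> [^]\<^bsub>V\<^esub> (\<delta> div c)) \<odot>\<^bsub>E'\<^esub> \<alpha> x \<in> F.P (k div L) T"
      using \<alpha>T[OF h(4)] linear_mapD(3)[OF \<alpha>l F.pin h(1)] by simp
    then have "(\<pi> [^]\<^bsub>V\<^esub> (\<delta> div c)) \<odot>\<^bsub>E'\<^esub> \<alpha> x \<in> F.P (?q + ?q) T"
      by (rule subsetD[OF F.P_antimono[OF T 2]])
    then have "(\<pi> [^]\<^bsub>V\<^esub> (?q + j - \<delta> div c)) \<odot>\<^bsub>E'\<^esub> ((\<pi> [^]\<^bsub>V\<^esub> (\<delta> div c)) \<odot>\<^bsub>E'\<^esub> \<alpha> x) \<in> F.P (?q + ?q) T"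
      by (rule F.submoduleE(4)[OF F.P_sub[OF T] F.pin])
    then have "(\<pi> [^]\<^bsub>V\<^esub> (?q + j)) \<odot>\<^bsub>E'\<^esub> \<alpha> x \<in> F.P (?q + ?q) T"
      using F.smult_pow_add[OF F.pi xc, of "?q + j - \<delta> div c" "\<delta> div c"] dl by (simp add: add.commute)
    then have "(\<pi> [^]\<^bsub>V\<^esub> ?q) \<odot>\<^bsub>E'\<^esub> ((\<pi> [^]\<^bsub>V\<^esub> j) \<odot>\<^bsub>E'\<^esub> \<alpha> x) \<in> F.P (?q + ?q) T"
      by (simp only: F.smult_pow_add[OF F.pi xc])
    then have "(\<pi> [^]\<^bsub>V\<^esub> j) \<odot>\<^bsub>E'\<^esub> \<alpha> x \<in> F.P ?q T" by (rule F.P_cancel[OF F.smult_closed[OF F.pin xc] Tc])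
    then show ?thesis by (rule subsetD[OF F.P_antimono[OF T div_le_mono[OF h(2)]]])
  qed
  have Xc: "?X \<subseteq> carrier E" by blast
  show ?thesis
    by (rule linear_span_in[OF E.module_axioms F.module_axioms linear_map_smult[OF F.module_axioms \<alpha>l F.pin] F.P_sub[OF T] Xc key sp])
qed

end

text \<open>Nilpotency gives estimates for products of elements of \<open>W\<close> only, so a last
  factor from \<open>S\<close> has to be set apart.\<close>

lemma (in balg) prodset_split:
  assumes W: "W \<subseteq> carrier A" and S: "S \<subseteq> carrier A"
  shows "z \<in> prodset A W S (Suc k) \<Longrightarrow> z \<in> fold_prods A W (Suc k) \<union> set_prod A (fold_prods A W (Suc k)) S"
proof (induction k arbitrary: z)
  case 0 then show ?case by auto
next
  case (Suc k)
  then obtain x y where z: "z = x \<otimes>\<^bsub>A\<^esub> y" "x \<in> W" "y \<in> prodset A W S (Suc k)" by (auto elim: set_prodE)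
  from Suc.IH[OF z(3)] show ?case
  proof
    assume "y \<in> fold_prods A W (Suc k)"
    then show ?thesis using z(1,2) set_prodI by simp
  next
    assume "y \<in> set_prod A (fold_prods A W (Suc k)) S"
    then obtain u v where y: "y = u \<otimes>\<^bsub>A\<^esub> v" "u \<in> fold_prods A W (Suc k)" "v \<in> S" by (rule set_prodE)
    have "z = (x \<otimes>\<^bsub>A\<^esub> u) \<otimes>\<^bsub>A\<^esub> v"
      unfolding z(1) y(1) by (rule mul_assoc[symmetric]) (use z(2) y(2,3) W S fold_carrier[OF W] in blast)+
    moreover have "x \<otimes>\<^bsub>A\<^esub> u \<in> fold_prods A W (Suc (Suc k))" using set_prodI[OF z(2) y(2)] by simp
    ultimately show ?thesis using set_prodI[OF _ y(3)] by blast
  qed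
qed

text \<open>The iterates of \<open>s\<close> are estimated in \<open>E\<close> and then mapped by
  \<alpha> to the iterates of \<open>t\<close>. Boundedness of \<open>s\<close> for linear growth
  confines all relevant curvatures, after scaling, to one bounded submodule \<open>W\<close> of
  \<open>K\<close>, so that a single rate of nilpotency applies.\<close>

lemma (in almost_hom) newton_fast:
  assumes slg: "bdd_linear_map V A.Alg E s" and D: "connection V \<pi> R D" "finite_degree V \<pi> R D"
    and E': "ctf V \<pi> E'" and \<alpha>: "bdd_alg_hom V E E' \<alpha>" and t: "almost_hom V \<pi> R E' t"
    and st: "\<And>x. x \<in> carrier R \<Longrightarrow> \<alpha> (s x) = t x"
    and K: "submodule K V E" "\<And>x y. x \<in> carrier R \<Longrightarrow> y \<in> carrier R \<Longrightarrow> w x y \<in> K" and L: "L \<ge> 1"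
    and nil: "\<And>W. W \<in> bdd_submodules V E \<Longrightarrow> W \<subseteq> K \<Longrightarrow> \<exists>W'\<in>bdd_submodules V E'. \<forall>k\<ge>1.
      \<alpha> ` fold_prods E W k \<subseteq> scaled E' (\<pi> [^]\<^bsub>V\<^esub> (k div L)) W'"
    and B: "B \<in> bounded R"
  shows "\<exists>M\<in>bdd_submodules V R. \<exists>T\<in>bdd_submodules V E'. \<exists>m. B \<subseteq> M \<and> adic_complete V \<pi> E' T \<and>
    ctf.fast V \<pi> E' R (newton_iter V \<pi> R D E' t) M T m"
proof -
  interpret F: ctf V \<pi> E' by (rule E')
  interpret Rl: balg V \<pi> A.Alg by (rule A.lg_alg)
  note \<phi> = phi_bdd[OF D]
  have \<alpha>bl: "bdd_linear_map V E E' \<alpha>" and \<alpha>m: "\<And>x y. x \<in> carrier E \<Longrightarrow> y \<in> carrier E \<Longrightarrow> \<alpha> (x \<otimes>\<^bsub>E\<^esub> y) = \<alpha> x \<otimes>\<^bsub>E'\<^esub> \<alpha> y"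
    using \<alpha> by (simp_all add: bdd_alg_hom_def)
  note \<alpha>l = bdd_linear_mapD(1)[OF \<alpha>bl]
  obtain M where M0: "M \<in> bdd_submodules V R" "B \<subseteq> M" "finite_degree_on V \<pi> R D M"
    using D(2)[unfolded finite_degree_def, THEN bspec, OF B] by blast
  obtain a where deg: "\<And>n. D ` filtration1 V \<pi> R M n \<subseteq> filtration2 V \<pi> R M (n + a)"
    using M0(3) unfolding finite_degree_on_def by blast
  note Mc = A.bddD(3)[OF M0(1)]
  define b where "b = 2 * a"
  define c where "c = 2 * b * L + 2"
  \<comment> \<open>\<open>Y\<close> contains \<open>\<pi>^(i div c) x\<close> for every
    \<open>x\<close> of degree \<open>i\<close> in \<open>M\<close>, and it is bounded for the
    linear growth bornology.\<close>
  define Y where "Y = A.lg (sub_powers_upto V R M c)"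
  have Y: "Y \<in> bounded A.Alg" "Y \<subseteq> carrier R"
    unfolding Y_def using A.linear_growth_iff A.upto_bdd[OF A.bddD(2)[OF M0(1)]] A.lg_sub(2)[OF A.upto_carrier[OF Mc]] by auto
  \<comment> \<open>The curvature does not see the bornology of \<open>R\<close>. Regarding
    \<open>s\<close> as a map on \<open>R\<close> with linear growth shows that its values on
    \<open>Y\<close> are bounded.\<close>
  have "almost_hom V \<pi> A.Alg E s"
    by (intro almost_hom.intro almost_hom_axioms.intro forms.intro Rl.balg_axioms E.calg_axioms slg)
  from bdd_bilinearD(3)[OF almost_hom.w_bilinear[OF this] Y(1) Y(1)]
  have wY: "{w x y |x y. x \<in> Y \<and> y \<in> Y} \<in> bounded E" by (simp add: curv_def)
  define W where "W = span_in V E {w x y |x y. x \<in> Y \<and> y \<in> Y}"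
  have W: "W \<in> bdd_submodules V E" unfolding W_def by (rule E.bdd_span[OF wY])
  have WK: "W \<subseteq> K" unfolding W_def by (rule E.span_least[OF K(1)]) (use K(2) Y(2) in blast)
  obtain W' where W': "W' \<in> bdd_submodules V E'"
    "\<And>k. k \<ge> 1 \<Longrightarrow> \<alpha> ` fold_prods E W k \<subseteq> scaled E' (\<pi> [^]\<^bsub>V\<^esub> (k div L)) W'" using nil[OF W WK] by blast
  define S where "S = span_in V E (s ` Y)"
  have S: "S \<in> bdd_submodules V E" unfolding S_def by (rule E.bdd_span[OF bdd_linear_mapD(2)[OF slg Y(1)]])
  have \<alpha>S: "\<alpha> ` S \<in> bounded E'" by (rule bdd_linear_mapD(2)[OF \<alpha>bl E.bddD(2)[OF S]])
  \<comment> \<open>\<open>T\<close> must also hold products with the image of \<open>S\<close>, to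
    absorb the possible last factor of a term.\<close>
  obtain T where T: "T \<in> bdd_submodules V E'" "adic_complete V \<pi> E' T" "(W' \<union> \<alpha> ` S) \<union> set_prod E' W' (\<alpha> ` S) \<subseteq> T"
    using F.complete_cover[OF F.bd(2)[OF F.bd(2)[OF F.bddD(2)[OF W'(1)] \<alpha>S] F.mul_bdd[OF F.bddD(2)[OF W'(1)] \<alpha>S]]] by blast
  note Tc = F.bddD(3)[OF T(1)]
  have \<alpha>T: "\<alpha> z \<in> scaled E' (\<pi> [^]\<^bsub>V\<^esub> (k div L)) T" if z: "z \<in> prodset E W S k" for k z
  proof (cases k)
    case 0
    have "\<alpha> z \<in> T" using z 0 T(3) by auto
    then show ?thesis using F.P_0[OF Tc] 0 by simp
  next
    case (Suc l)
    note Wc = E.bddD(3)[OF W] and Sc = E.bddD(3)[OF S]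
    have f: "\<alpha> x \<in> F.P (k div L) W'" if "x \<in> fold_prods E W k" for x using W'(2)[of k] that Suc by auto
    from E.prodset_split[OF Wc Sc z[unfolded Suc]] show ?thesis
    proof
      assume "z \<in> fold_prods E W (Suc l)"
      then have "\<alpha> z \<in> F.P (k div L) W'" using f Suc by simp
      then show ?thesis by (rule subsetD[OF F.P_mono, rotated]) (use T(3) in blast)
    next
      assume "z \<in> set_prod E (fold_prods E W (Suc l)) S"
      then obtain x y where xy: "z = x \<otimes>\<^bsub>E\<^esub> y" "x \<in> fold_prods E W k" "y \<in> S" unfolding Suc by (rule E.set_prodE)
      obtain u where u: "u \<in> W'" "\<alpha> x = (\<pi> [^]\<^bsub>V\<^esub> (k div L)) \<odot>\<^bsub>E'\<^esub> u" using f[OF xy(2)] unfolding F.P_D by blast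
      have xc: "x \<in> carrier E" "y \<in> carrier E" using xy(2,3) E.fold_carrier[OF Wc] Sc by blast+
      have "\<alpha> z = (\<pi> [^]\<^bsub>V\<^esub> (k div L)) \<odot>\<^bsub>E'\<^esub> (u \<otimes>\<^bsub>E'\<^esub> \<alpha> y)"
        unfolding xy(1) \<alpha>m[OF xc] u(2) by (rule F.mul_smult_l[OF F.pin F.bddD(4)[OF W'(1) u(1)] linear_mapD(1)[OF \<alpha>l xc(2)]])
      moreover have "u \<otimes>\<^bsub>E'\<^esub> \<alpha> y \<in> T" by (rule subsetD[OF T(3)], rule UnI2, rule F.set_prodI[OF u(1) imageI[OF xy(3)]])
      ultimately show ?thesis using F.P_I by simp
    qed
  qed
  have c1: "c \<ge> 1" by (simp add: c_def)
  have bound: "(\<pi> [^]\<^bsub>V\<^esub> j) \<odot>\<^bsub>E'\<^esub> \<alpha> e \<in> F.P (N div (2 * L)) T" if "grow V R E s M (int b) (int j + 1) N e" for e j N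
  proof (rule grow_bound[OF Mc E' \<alpha> L c_def E.bddD(1)[OF W] E.bddD(1)[OF S] Y(2) _ _ _ F.bddD(1)[OF T(1)] \<alpha>T that])
    show "(\<pi> [^]\<^bsub>V\<^esub> (i div c)) \<odot>\<^bsub>R\<^esub> x \<in> Y" if "x \<in> sub_powers_upto V R M i" for i x
      unfolding Y_def by (rule A.upto_lg[OF Mc c1 that])
    show "s x \<in> S" if "x \<in> Y" for x unfolding S_def by (rule subsetD[OF E.span_sup imageI[OF that]])
    show "w x y \<in> W" if "x \<in> Y" "y \<in> Y" for x y unfolding W_def by (rule subsetD[OF E.span_sup]) (use that in blast)
  qed
  have b2: "int b = 2 * int a" by (simp add: b_def)
  have b0: "0 \<le> int b" by simp
  have dg: "D (f1 \<one>\<^bsub>U\<^esub> x) \<in> filtration2 V \<pi> R M (i + a)" if "x \<in> sub_powers_upto V R M i" for x i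
    by (rule phi_degree[OF deg that])
  have G: "grow V R E s M (int b) (int i) 0 (newton_iter V \<pi> R D E s k x)"
    "\<exists>e. grow V R E s M (int b) (int i) (2 ^ k) e \<and> newton_iter V \<pi> R D E s (Suc k) x = newton_iter V \<pi> R D E s k x \<oplus>\<^bsub>E\<^esub> e"
    "y \<in> sub_powers_upto V R M j \<Longrightarrow> grow V R E s M (int b) (int i + int j - int b) (2 ^ k) (curv R E (newton_iter V \<pi> R D E s k) x y)"
    if x: "x \<in> sub_powers_upto V R M i" for x y i j k
    by (rule newton_iter_grow[OF Mc b0 D(1) b2 _ \<phi>], erule dg, (rule x | assumption))+
  have q: "\<alpha> (newton_iter V \<pi> R D E s k x) = newton_iter V \<pi> R D E' t k x" if "x \<in> carrier R" for x k
    by (rule newton_iter_natural[OF almost_hom_axioms D(1) \<phi> t \<alpha> _ that]) (rule st)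
  note nl = linear_mapD(1)[OF bdd_linear_mapD(1)[OF almost_hom.s[OF newton_iter_almost_hom[OF almost_hom_axioms D(1) \<phi>]]]]
  have uc: "x \<in> carrier R" if "x \<in> sub_powers_upto V R M i" for x i using A.upto_carrier[OF Mc] that by blast
  \<comment> \<open>Order \<open>2 ^ k\<close> beats the linear rate \<open>1 / (2 * L)\<close>; the
    delay \<open>2 * L\<close> suffices because \<open>n * (2 * L)\<close> is at most
    \<open>2 ^ (n + 2 * L)\<close>.\<close>
  have exp: "n \<le> 2 ^ k div (2 * L)" if k: "k \<ge> n + 2 * L" for n k
  proof -
    have "n * (2 * L) \<le> 2 ^ n * 2 ^ (2 * L)" by (intro mult_le_mono less_imp_le[OF less_exp])
    also have "\<dots> = 2 ^ (n + 2 * L)" by (simp add: power_add)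
    also have "\<dots> \<le> 2 ^ k" using k by (intro power_increasing) auto
    finally show ?thesis using L by (simp add: less_eq_div_iff_mult_less_eq)
  qed
  have "F.fast R (newton_iter V \<pi> R D E' t) M T (2 * L)"
    unfolding F.fast_def
  proof (intro conjI allI ballI impI)
    fix j k x assume x: "x \<in> sub_powers_upto V R M (Suc j)"
    have "(\<pi> [^]\<^bsub>V\<^esub> j) \<odot>\<^bsub>E'\<^esub> \<alpha> (newton_iter V \<pi> R D E s k x) \<in> F.P (0 div (2 * L)) T"
      by (rule bound) (use G(1)[OF x, of k] in \<open>simp add: add.commute\<close>)
    then show "(\<pi> [^]\<^bsub>V\<^esub> j) \<odot>\<^bsub>E'\<^esub> newton_iter V \<pi> R D E' t k x \<in> T"
      using q[OF uc[OF x]] F.P_0[OF Tc] by simp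
  next
    fix j n k x assume x: "x \<in> sub_powers_upto V R M (Suc j)" and k: "n + 2 * L \<le> k"
    note xc = uc[OF x]
    obtain e where e: "grow V R E s M (int b) (int (Suc j)) (2 ^ k) e"
      "newton_iter V \<pi> R D E s (Suc k) x = newton_iter V \<pi> R D E s k x \<oplus>\<^bsub>E\<^esub> e" using G(2)[OF x, of k] by blast
    have ec: "e \<in> carrier E" by (rule grow_carrier[OF Mc b0 e(1)])
    have "(\<pi> [^]\<^bsub>V\<^esub> j) \<odot>\<^bsub>E'\<^esub> \<alpha> e \<in> F.P (2 ^ k div (2 * L)) T"
      by (rule bound) (use e(1) in \<open>simp add: add.commute\<close>)
    then have 1: "(\<pi> [^]\<^bsub>V\<^esub> j) \<odot>\<^bsub>E'\<^esub> \<alpha> e \<in> F.P n T" by (rule subsetD[OF F.P_antimono[OF F.bddD(1)[OF T(1)] exp[OF k]]])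
    have "newton_iter V \<pi> R D E' t (Suc k) x = newton_iter V \<pi> R D E' t k x \<oplus>\<^bsub>E'\<^esub> \<alpha> e"
      using linear_mapD(2)[OF \<alpha>l nl[OF xc] ec, of k] e(2) q[OF xc] by metis
    moreover have "newton_iter V \<pi> R D E' t k x \<in> carrier E'" using linear_mapD(1)[OF \<alpha>l nl[OF xc], of k] q[OF xc] by simp
    moreover have "\<alpha> e \<in> carrier E'" by (rule linear_mapD(1)[OF \<alpha>l ec])
    ultimately have "newton_iter V \<pi> R D E' t (Suc k) x \<ominus>\<^bsub>E'\<^esub> newton_iter V \<pi> R D E' t k x = \<alpha> e"
      by (metis F.M.a_closed F.M.a_comm F.M.add.inv_solve_right' a_minus_def)
    then show "(\<pi> [^]\<^bsub>V\<^esub> j) \<odot>\<^bsub>E'\<^esub> (newton_iter V \<pi> R D E' t (Suc k) x \<ominus>\<^bsub>E'\<^esub> newton_iter V \<pi> R D E' t k x) \<in> F.P n T"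
      using 1 by simp
  next
    fix n k x y assume xy: "x \<in> M" "y \<in> M" and k: "n + 2 * L \<le> k"
    note c = subsetD[OF Mc xy(1)] subsetD[OF Mc xy(2)]
    let ?C = "curv R E (newton_iter V \<pi> R D E s k) x y"
    have "grow V R E s M (int b) (int 1 + int 1 - int b) (2 ^ k) ?C"
      by (rule G(3)) (use xy A.upto_1[of M] in blast)+
    \<comment> \<open>Both arguments have degree 1, and the credit is given away. The degree 2 is
      \<open>j + 1\<close> for \<open>j = 1\<close>, which is the origin of the factor \<pi> in
      front of the curvature in \<open>fast\<close>.\<close>
    then have g: "grow V R E s M (int b) (int 1 + 1) (2 ^ k) ?C" by (rule grow_mono) simp_all
    have Cc: "?C \<in> carrier E" by (rule grow_carrier[OF Mc b0 g])
    have "(\<pi> [^]\<^bsub>V\<^esub> (1::nat)) \<odot>\<^bsub>E'\<^esub> \<alpha> ?C \<in> F.P (2 ^ k div (2 * L)) T" by (rule bound[OF g])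
    then have "(\<pi> [^]\<^bsub>V\<^esub> (1::nat)) \<odot>\<^bsub>E'\<^esub> \<alpha> ?C \<in> F.P n T"
      by (rule subsetD[OF F.P_antimono[OF F.bddD(1)[OF T(1)] exp[OF k]]])
    moreover have "\<alpha> ?C = curv R E' (newton_iter V \<pi> R D E' t k) x y"
      unfolding curv_def linear_diff[OF E.module_axioms F.module_axioms \<alpha>l E.mul_closed[OF nl[OF c(1)] nl[OF c(2)]] nl[OF A.mul_closed[OF c]]]
        \<alpha>m[OF nl[OF c(1)] nl[OF c(2)]] q[OF c(1)] q[OF c(2)] q[OF A.mul_closed[OF c]] ..
    ultimately show "\<pi> \<odot>\<^bsub>E'\<^esub> curv R E' (newton_iter V \<pi> R D E' t k) x y \<in> F.P n T" using F.pi by simp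
  qed
  then show ?thesis using M0(1,2) T(1,2) by blast
qed

section \<open>The dagger completion of a torsion-free algebra\<close>

text \<open>The counterpart of \<open>alg_simprules\<close> for additive groups; it is used mainly
  in the module of Cauchy sequences.\<close>

lemmas (in module) group_simprules [algebra additive_group "zero M" "add M" "a_inv M" "a_minus M"] =
  M.a_closed M.zero_closed M.a_inv_closed M.minus_closed M.a_assoc M.l_zero M.l_neg M.a_comm
  a_minus_def M.r_zero M.r_neg M.r_neg2 M.r_neg1 M.minus_add M.minus_minus M.add.inv_one M.a_lcomm

section \<open>Torsion-freeness of completions\<close>

context tfalg
begin

text \<open>Sequences that already represent zero in the \<open>\<pi>\<close>-adic completion of one
  bounded submodule. \<open>K\<close> is the smallest closed submodule containing them and may be
  larger.\<close>

definition "nul x \<longleftrightarrow> (\<exists>S\<in>bdd_submodules V A. x \<in> Z S \<and> (\<forall>n. x n \<in> P n S))"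

lemma nulI: "S \<in> bdd_submodules V A \<Longrightarrow> x \<in> Z S \<Longrightarrow> (\<And>n. x n \<in> P n S) \<Longrightarrow> nul x"
  unfolding nul_def by blast

lemma nulE:
  assumes "nul x" obtains S where "S \<in> bdd_submodules V A" "x \<in> Z S" "\<And>n. x n \<in> P n S"
  using assms unfolding nul_def by blast

lemma nul_K: "nul x \<Longrightarrow> x \<in> K"
  by (erule nulE, rule null_in_K)

lemma K_C: "x \<in> K \<Longrightarrow> x \<in> carrier C"
  using Cm.submoduleE(1)[OF K_submodule] by blast

lemma nul_C: "nul x \<Longrightarrow> x \<in> carrier C"
  by (rule K_C[OF nul_K])

lemma nul_diff: assumes "nul x" "nul y" shows "nul (x \<ominus>\<^bsub>C\<^esub> y)"
proof -
  note c = nul_C[OF assms(1)] nul_C[OF assms(2)]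
  obtain S where S: "S \<in> bdd_submodules V A" "x \<in> Z S" "\<And>n. x n \<in> P n S" using assms(1) unfolding nul_def by blast
  obtain T where T: "T \<in> bdd_submodules V A" "y \<in> Z T" "\<And>n. y n \<in> P n T" using assms(2) unfolding nul_def by blast
  obtain U where U: "U \<in> bdd_submodules V A" "S \<subseteq> U" "T \<subseteq> U" using bdd_join[OF S(1) T(1)] .
  show ?thesis
  proof (rule nulI[OF U(1)])
    show "x \<ominus>\<^bsub>C\<^esub> y \<in> Z U"
      by (rule Cm.submodule_minus[OF Z_submodule[OF U(1)] subsetD[OF Z_mono[OF U(2)] S(2)] subsetD[OF Z_mono[OF U(3)] T(2)]])
    show "(x \<ominus>\<^bsub>C\<^esub> y) n \<in> P n U" for n
      unfolding C_minus[OF c]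
      by (rule submodule_minus[OF P_sub[OF bddD(1)[OF U(1)]] subsetD[OF P_mono[OF U(2)] S(3)] subsetD[OF P_mono[OF U(3)] T(3)]])
  qed
qed

text \<open>Cancelling \<pi> lowers the exponent by one, so the term with index \<open>n + 1\<close>
  is used; the Cauchy condition passes from there back to index \<open>n\<close>.\<close>

lemma nul_pi: assumes x: "x \<in> carrier C" and n: "nul (\<pi> \<odot>\<^bsub>C\<^esub> x)" shows "nul x"
proof -
  obtain S where S: "S \<in> bdd_submodules V A" "\<And>n. (\<pi> \<odot>\<^bsub>C\<^esub> x) n \<in> P n S" using n unfolding nul_def by blast
  obtain T where T: "T \<in> bdd_submodules V A" "x \<in> Z T" using x unfolding C_carrier by blast
  obtain U where U: "U \<in> bdd_submodules V A" "S \<subseteq> U" "T \<subseteq> U" using bdd_join[OF S(1) T(1)] .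
  have xZ: "x \<in> Z U" by (rule subsetD[OF Z_mono[OF U(3)] T(2)])
  show ?thesis
  proof (rule nulI[OF U(1) xZ])
    fix n
    have "(\<pi> [^]\<^bsub>V\<^esub> (1::nat)) \<odot>\<^bsub>A\<^esub> x (Suc n) \<in> P (1 + n) U" using subsetD[OF P_mono[OF U(2)] S(2)[of "Suc n"]] pi by simp
    then have "x (Suc n) \<in> P n U" by (rule P_cancel[OF C_val[OF x] bddD(3)[OF U(1)]])
    then have "x (Suc n) \<ominus>\<^bsub>A\<^esub> (x (Suc n) \<ominus>\<^bsub>A\<^esub> x n) \<in> P n U"
      by (rule submodule_minus[OF P_sub[OF bddD(1)[OF U(1)]] _ Z_D(2)[OF xZ]])
    moreover have "x (Suc n) \<ominus>\<^bsub>A\<^esub> (x (Suc n) \<ominus>\<^bsub>A\<^esub> x n) = x n" using C_val[OF x, of n] C_val[OF x, of "Suc n"] by algebra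
    ultimately show "x n \<in> P n U" by simp
  qed
qed

text \<open>The quotient is the sequence of the \<open>x (m + 1) / \<pi>\<close>. The shift of the
  index compensates for the power of \<pi> lost in the Cauchy condition, and the remainder
  \<open>x n - x (n + 1)\<close> is null.\<close>

lemma divide_pi:
  assumes S: "S \<in> bdd_submodules V A" and x: "x \<in> Z S" and x1: "x 1 \<in> P 1 S"
  shows "\<exists>v\<in>Z S. x \<ominus>\<^bsub>C\<^esub> \<pi> \<odot>\<^bsub>C\<^esub> v \<in> Z S \<and> (\<forall>n. (x \<ominus>\<^bsub>C\<^esub> \<pi> \<odot>\<^bsub>C\<^esub> v) n \<in> P n S)"
proof -
  note sS = bddD(1)[OF S] and Sc = bddD(3)[OF S]
  have xc: "x n \<in> carrier A" for n using Z_D(1)[OF x] Sc by blast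
  have "x (Suc m) \<in> P 1 S" for m
  proof -
    have "(x (1 + m) \<ominus>\<^bsub>A\<^esub> x 1) \<oplus>\<^bsub>A\<^esub> x 1 \<in> P 1 S" by (rule submoduleE(5)[OF P_sub[OF sS] Z_tail[OF S x] x1])
    moreover have "(x (1 + m) \<ominus>\<^bsub>A\<^esub> x 1) \<oplus>\<^bsub>A\<^esub> x 1 = x (1 + m)" using xc[of "1 + m"] xc[of 1] by algebra
    ultimately show ?thesis by simp
  qed
  then have "\<exists>s\<in>S. x (Suc m) = \<pi> \<odot>\<^bsub>A\<^esub> s" for m unfolding P_D using pi by simp
  then obtain v where v: "\<And>m. v m \<in> S" "\<And>m. x (Suc m) = \<pi> \<odot>\<^bsub>A\<^esub> v m" by metis
  have vc: "v m \<in> carrier A" for m using v(1) Sc by blast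
  have vZ: "v \<in> Z S"
    unfolding adic_cauchy_def
  proof (intro CollectI allI conjI v(1))
    fix m
    have "\<pi> \<odot>\<^bsub>A\<^esub> (v (Suc m) \<ominus>\<^bsub>A\<^esub> v m) = x (Suc (Suc m)) \<ominus>\<^bsub>A\<^esub> x (Suc m)"
      unfolding v(2) by (rule smult_diff[OF pi vc vc])
    then have "(\<pi> [^]\<^bsub>V\<^esub> (1::nat)) \<odot>\<^bsub>A\<^esub> (v (Suc m) \<ominus>\<^bsub>A\<^esub> v m) \<in> P (1 + m) S" using Z_D(2)[OF x, of "Suc m"] pi by simp
    then show "v (Suc m) \<ominus>\<^bsub>A\<^esub> v m \<in> P m S" by (rule P_cancel[OF M.minus_closed[OF vc vc] Sc])
  qed
  have C: "x \<in> carrier C" "v \<in> carrier C" using C_carrier S x vZ by blast+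
  have "(x \<ominus>\<^bsub>C\<^esub> \<pi> \<odot>\<^bsub>C\<^esub> v) n \<in> P n S" for n
  proof -
    have "\<ominus>\<^bsub>A\<^esub> (x (Suc n) \<ominus>\<^bsub>A\<^esub> x n) \<in> P n S" by (rule submoduleE(3)[OF P_sub[OF sS] Z_D(2)[OF x]])
    moreover have "\<ominus>\<^bsub>A\<^esub> (x (Suc n) \<ominus>\<^bsub>A\<^esub> x n) = x n \<ominus>\<^bsub>A\<^esub> x (Suc n)" using xc[of n] xc[of "Suc n"] by algebra
    moreover have "(x \<ominus>\<^bsub>C\<^esub> \<pi> \<odot>\<^bsub>C\<^esub> v) n = x n \<ominus>\<^bsub>A\<^esub> x (Suc n)"
      unfolding C_minus[OF C(1) Cm.smult_closed[OF pi C(2)]] by (simp add: v(2))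
    ultimately show ?thesis by simp
  qed
  moreover have "x \<ominus>\<^bsub>C\<^esub> \<pi> \<odot>\<^bsub>C\<^esub> v \<in> Z S"
    by (rule Cm.submodule_minus[OF Z_submodule[OF S] x Cm.submoduleE(4)[OF Z_submodule[OF S] pi vZ]])
  ultimately show ?thesis using vZ by blast
qed

text \<open>The null module is \<open>\<pi>\<close>-divisible up to null sequences, because the elements with this property
  form a closed submodule. This is where torsion-freeness of the completion comes from.\<close>

lemma K_divisible:
  assumes "x \<in> K" shows "\<exists>y\<in>K. nul (x \<ominus>\<^bsub>C\<^esub> \<pi> \<odot>\<^bsub>C\<^esub> y)"
proof -
  let ?L = "{x \<in> K. \<exists>y\<in>K. nul (x \<ominus>\<^bsub>C\<^esub> \<pi> \<odot>\<^bsub>C\<^esub> y)}"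
  note Kz = Cm.submodule_zero[OF K_submodule] and Ks = Cm.submoduleE(4)[OF K_submodule] and Ka = Cm.submoduleE(5)[OF K_submodule]
  note pc = Cm.smult_closed[OF pi]
  obtain S0 where S0: "S0 \<in> bdd_submodules V A" by (rule ex_bdd)
  have nul0: "nul \<zero>\<^bsub>C\<^esub>"
    by (rule nulI[OF S0 Cm.submodule_zero[OF Z_submodule[OF S0]]]) (simp add: submodule_zero[OF P_sub[OF bddD(1)[OF S0]]])
  have nul_neg: "nul (\<ominus>\<^bsub>C\<^esub> x)" if "nul x" for x
    using nul_diff[OF nul0 that] nul_C[OF that] by (simp add: a_minus_def del: C_simps)
  have nul_add: "nul (x \<oplus>\<^bsub>C\<^esub> y)" if h: "nul x" "nul y" for x y
    using nul_diff[OF h(1) nul_neg[OF h(2)]] nul_C[OF h(2)] by (simp add: a_minus_def del: C_simps)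
  have nul_smult: "nul (c \<odot>\<^bsub>C\<^esub> x)" if c: "c \<in> carrier V" and x: "nul x" for c x
  proof -
    obtain S where S: "S \<in> bdd_submodules V A" "x \<in> Z S" "\<And>n. x n \<in> P n S" using x unfolding nul_def by blast
    show ?thesis
      by (rule nulI[OF S(1) Cm.submoduleE(4)[OF Z_submodule[OF S(1)] c S(2)]])
         (use submoduleE(4)[OF P_sub[OF bddD(1)[OF S(1)]] c S(3)] in simp)
  qed
  have "submodule ?L V C"
  proof (rule Cm.subI)
    show "?L \<subseteq> carrier C" using K_C by blast
    have "\<zero>\<^bsub>C\<^esub> \<ominus>\<^bsub>C\<^esub> \<pi> \<odot>\<^bsub>C\<^esub> \<zero>\<^bsub>C\<^esub> = \<zero>\<^bsub>C\<^esub>"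
      using Cm.diff_self[OF Cm.M.zero_closed] Cm.smult_r_null[OF pi] by simp
    then show "\<zero>\<^bsub>C\<^esub> \<in> ?L" using Kz nul0 by (intro CollectI conjI bexI[OF _ Kz]) (simp_all only:)
  next
    fix a b assume "a \<in> ?L" "b \<in> ?L"
    then obtain y z where h: "a \<in> K" "b \<in> K" "y \<in> K" "nul (a \<ominus>\<^bsub>C\<^esub> \<pi> \<odot>\<^bsub>C\<^esub> y)" "z \<in> K" "nul (b \<ominus>\<^bsub>C\<^esub> \<pi> \<odot>\<^bsub>C\<^esub> z)" by blast
    note c = K_C[OF h(1)] K_C[OF h(2)] K_C[OF h(3)] K_C[OF h(5)]
    have "(a \<oplus>\<^bsub>C\<^esub> b) \<ominus>\<^bsub>C\<^esub> \<pi> \<odot>\<^bsub>C\<^esub> (y \<oplus>\<^bsub>C\<^esub> z) = (a \<ominus>\<^bsub>C\<^esub> \<pi> \<odot>\<^bsub>C\<^esub> y) \<oplus>\<^bsub>C\<^esub> (b \<ominus>\<^bsub>C\<^esub> \<pi> \<odot>\<^bsub>C\<^esub> z)"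
      unfolding Cm.smult_r_distr[OF pi c(3,4)] using c(1,2) pc[OF c(3)] pc[OF c(4)] by algebra
    then have "nul ((a \<oplus>\<^bsub>C\<^esub> b) \<ominus>\<^bsub>C\<^esub> \<pi> \<odot>\<^bsub>C\<^esub> (y \<oplus>\<^bsub>C\<^esub> z))" using nul_add[OF h(4,6)] by simp
    then show "a \<oplus>\<^bsub>C\<^esub> b \<in> ?L" using Ka[OF h(1,2)] Ka[OF h(3,5)] by blast
  next
    fix k a assume k: "k \<in> carrier V" and "a \<in> ?L"
    then obtain y where h: "a \<in> K" "y \<in> K" "nul (a \<ominus>\<^bsub>C\<^esub> \<pi> \<odot>\<^bsub>C\<^esub> y)" by blast
    note c = K_C[OF h(1)] K_C[OF h(2)]
    have "k \<odot>\<^bsub>C\<^esub> (a \<ominus>\<^bsub>C\<^esub> \<pi> \<odot>\<^bsub>C\<^esub> y) = k \<odot>\<^bsub>C\<^esub> a \<ominus>\<^bsub>C\<^esub> \<pi> \<odot>\<^bsub>C\<^esub> (k \<odot>\<^bsub>C\<^esub> y)"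
      using c k pi pc[OF c(2)] by (simp add: a_minus_def Cm.smult_r_distr Cm.smult_r_minus Cm.smult_assoc1[symmetric] R.m_comm del: C_simps)
    then have "nul (k \<odot>\<^bsub>C\<^esub> a \<ominus>\<^bsub>C\<^esub> \<pi> \<odot>\<^bsub>C\<^esub> (k \<odot>\<^bsub>C\<^esub> y))" using nul_smult[OF k h(3)] by simp
    then show "k \<odot>\<^bsub>C\<^esub> a \<in> ?L" using Ks[OF k h(1)] Ks[OF k h(2)] by blast
  qed
  moreover have "limit_closed V \<pi> A ?L"
    unfolding limit_closed_def
  proof (intro ballI impI)
    fix S x assume S: "S \<in> bdd_submodules V A" and x: "x \<in> Z S"
      and ap: "\<forall>n. \<exists>k\<in>?L \<inter> Z S. x n \<ominus>\<^bsub>A\<^esub> k n \<in> P n S"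
    note sS = bddD(1)[OF S] and ZS = Z_submodule[OF S]
    have ZC: "z \<in> carrier C" if "z \<in> Z S" for z using C_carrier S that by blast
    have "\<forall>n. \<exists>k\<in>K \<inter> Z S. x n \<ominus>\<^bsub>A\<^esub> k n \<in> P n S" using ap by blast
    then have xK: "x \<in> K" using K_closed S x unfolding limit_closed_def by blast
    have "\<forall>n. \<exists>k. k \<in> ?L \<inter> Z S \<and> x n \<ominus>\<^bsub>A\<^esub> k n \<in> P n S" using ap by (simp only: Bex_def simp_thms)
    from choice[OF this] obtain \<kappa> where \<kappa>0: "\<forall>n. \<kappa> n \<in> ?L \<inter> Z S \<and> x n \<ominus>\<^bsub>A\<^esub> \<kappa> n n \<in> P n S" ..
    have \<kappa>: "\<kappa> n \<in> ?L" "\<kappa> n \<in> Z S" "x n \<ominus>\<^bsub>A\<^esub> \<kappa> n n \<in> P n S" for n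
      using \<kappa>0[THEN spec, of n] by (simp_all only: Int_iff)
    have "\<exists>y\<in>K. nul (\<kappa> n \<ominus>\<^bsub>C\<^esub> \<pi> \<odot>\<^bsub>C\<^esub> y)" for n using \<kappa>(1)[of n] by blast
    \<comment> \<open>Each approximation \<open>\<kappa> n\<close> is \<open>\<pi>\<close> times
      \<open>y n\<close> up to a null sequence. The \<open>y n\<close> may lie in different bounded
      submodules, so they cannot simply be passed to a limit; the division is repeated inside
      \<open>S\<close> instead.\<close>
    then obtain y where y: "\<And>n. y n \<in> K" "\<And>n. nul (\<kappa> n \<ominus>\<^bsub>C\<^esub> \<pi> \<odot>\<^bsub>C\<^esub> y n)" by metis
    have xc: "x \<in> carrier C" and \<kappa>c: "\<kappa> n \<in> carrier C" and yc: "y n \<in> carrier C" for n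
      using ZC x \<kappa>(2) K_C y(1) by blast+
    have v1: "(a \<ominus>\<^bsub>C\<^esub> b) n = a n \<ominus>\<^bsub>A\<^esub> b n" if "a \<in> carrier C" "b \<in> carrier C" for a b n using C_minus[OF that] by simp
    have d1: "(\<kappa> (Suc n) \<ominus>\<^bsub>C\<^esub> \<kappa> 1) 1 \<in> P 1 S" and d0: "(x \<ominus>\<^bsub>C\<^esub> \<kappa> 1) 1 \<in> P 1 S" for n
    proof -
      note PS = P_sub[OF sS, of 1]
      have lead: "\<kappa> (Suc n) (Suc n) \<ominus>\<^bsub>A\<^esub> \<kappa> (Suc n) 1 \<in> P 1 S" "x (Suc n) \<ominus>\<^bsub>A\<^esub> x 1 \<in> P 1 S"
        using Z_tail[OF S \<kappa>(2), of "Suc n" 1 n] Z_tail[OF S x, of 1 n] by simp_all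
      have "x (Suc n) \<ominus>\<^bsub>A\<^esub> \<kappa> (Suc n) (Suc n) \<in> P 1 S" using subsetD[OF P_antimono[OF sS, of 1 "Suc n"] \<kappa>(3)] by simp
      note t = submodule_minus[OF PS submoduleE(5)[OF PS lead(2) \<kappa>(3)[of 1]] submoduleE(5)[OF PS this lead(1)]]
      have "((x (Suc n) \<ominus>\<^bsub>A\<^esub> x 1) \<oplus>\<^bsub>A\<^esub> (x 1 \<ominus>\<^bsub>A\<^esub> \<kappa> 1 1)) \<ominus>\<^bsub>A\<^esub>
          ((x (Suc n) \<ominus>\<^bsub>A\<^esub> \<kappa> (Suc n) (Suc n)) \<oplus>\<^bsub>A\<^esub> (\<kappa> (Suc n) (Suc n) \<ominus>\<^bsub>A\<^esub> \<kappa> (Suc n) 1)) = \<kappa> (Suc n) 1 \<ominus>\<^bsub>A\<^esub> \<kappa> 1 1"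
        using C_val[OF xc, of "Suc n"] C_val[OF xc, of 1] C_val[OF \<kappa>c, of "Suc n" "Suc n"] C_val[OF \<kappa>c, of "Suc n" 1] C_val[OF \<kappa>c, of 1 1]
        by algebra
      then show "(\<kappa> (Suc n) \<ominus>\<^bsub>C\<^esub> \<kappa> 1) 1 \<in> P 1 S" using t v1[OF \<kappa>c \<kappa>c] by simp
      show "(x \<ominus>\<^bsub>C\<^esub> \<kappa> 1) 1 \<in> P 1 S" using \<kappa>(3)[of 1] v1[OF xc \<kappa>c] by simp
    qed
    \<comment> \<open>Up to a null sequence \<open>x\<close> is \<open>\<kappa> 1 + \<pi>v\<close>
      with \<open>v\<close> in \<open>Z S\<close>. It remains to show that \<open>v\<close> is in
      \<open>K\<close>, by approximating it within \<open>K \<inter> Z S\<close>.\<close>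
    obtain v where v: "v \<in> Z S" "(x \<ominus>\<^bsub>C\<^esub> \<kappa> 1) \<ominus>\<^bsub>C\<^esub> \<pi> \<odot>\<^bsub>C\<^esub> v \<in> Z S" "\<And>n. ((x \<ominus>\<^bsub>C\<^esub> \<kappa> 1) \<ominus>\<^bsub>C\<^esub> \<pi> \<odot>\<^bsub>C\<^esub> v) n \<in> P n S"
      using divide_pi[OF S Cm.submodule_minus[OF ZS x \<kappa>(2)] d0] by blast
    note vc = ZC[OF v(1)]
    have "\<exists>u\<in>K \<inter> Z S. v n \<ominus>\<^bsub>A\<^esub> u n \<in> P n S" for n
    proof -
      \<comment> \<open>An approximation modulo \<open>\<pi>^(n+1)\<close> is needed, because
        division by \<pi> costs one power.\<close>
      let ?k = "\<kappa> (Suc n)"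
      obtain u where u: "u \<in> Z S" "(?k \<ominus>\<^bsub>C\<^esub> \<kappa> 1) \<ominus>\<^bsub>C\<^esub> \<pi> \<odot>\<^bsub>C\<^esub> u \<in> Z S" "\<And>m. ((?k \<ominus>\<^bsub>C\<^esub> \<kappa> 1) \<ominus>\<^bsub>C\<^esub> \<pi> \<odot>\<^bsub>C\<^esub> u) m \<in> P m S"
        using divide_pi[OF S Cm.submodule_minus[OF ZS \<kappa>(2) \<kappa>(2)] d1] by blast
      note uc = ZC[OF u(1)]
      let ?d = "y (Suc n) \<ominus>\<^bsub>C\<^esub> y 1"
      note dc = Cm.M.minus_closed[OF yc[of "Suc n"] yc[of 1]]
      have sm: "\<pi> \<odot>\<^bsub>C\<^esub> (u \<ominus>\<^bsub>C\<^esub> ?d) = \<pi> \<odot>\<^bsub>C\<^esub> u \<ominus>\<^bsub>C\<^esub> (\<pi> \<odot>\<^bsub>C\<^esub> y (Suc n) \<ominus>\<^bsub>C\<^esub> \<pi> \<odot>\<^bsub>C\<^esub> y 1)"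
        using uc yc[of "Suc n"] yc[of 1] pi by (simp add: a_minus_def Cm.smult_r_distr Cm.smult_r_minus del: C_simps)
      have "nul (((?k \<ominus>\<^bsub>C\<^esub> \<pi> \<odot>\<^bsub>C\<^esub> y (Suc n)) \<ominus>\<^bsub>C\<^esub> (\<kappa> 1 \<ominus>\<^bsub>C\<^esub> \<pi> \<odot>\<^bsub>C\<^esub> y 1)) \<ominus>\<^bsub>C\<^esub> ((?k \<ominus>\<^bsub>C\<^esub> \<kappa> 1) \<ominus>\<^bsub>C\<^esub> \<pi> \<odot>\<^bsub>C\<^esub> u))"
        by (rule nul_diff[OF nul_diff[OF y(2) y(2)] nulI[OF S u(2,3)]])
      moreover have "((?k \<ominus>\<^bsub>C\<^esub> \<pi> \<odot>\<^bsub>C\<^esub> y (Suc n)) \<ominus>\<^bsub>C\<^esub> (\<kappa> 1 \<ominus>\<^bsub>C\<^esub> \<pi> \<odot>\<^bsub>C\<^esub> y 1)) \<ominus>\<^bsub>C\<^esub> ((?k \<ominus>\<^bsub>C\<^esub> \<kappa> 1) \<ominus>\<^bsub>C\<^esub> \<pi> \<odot>\<^bsub>C\<^esub> u)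
          = \<pi> \<odot>\<^bsub>C\<^esub> (u \<ominus>\<^bsub>C\<^esub> ?d)"
        unfolding sm using pc[OF uc] pc[OF yc[of "Suc n"]] pc[OF yc[of 1]] \<kappa>c[of "Suc n"] \<kappa>c[of 1] by algebra
      \<comment> \<open>The quotient \<open>u\<close> formed in \<open>S\<close> and the difference
        of the \<open>y\<close> have the same \<open>\<pi>\<close>-multiple up to a null sequence,
        and \<open>nul_pi\<close> cancels \<pi>. Hence \<open>u\<close> belongs to \<open>K\<close>
        although it was constructed in \<open>Z S\<close>.\<close>
      ultimately have "nul (u \<ominus>\<^bsub>C\<^esub> ?d)" using nul_pi[OF Cm.M.minus_closed[OF uc dc]] by simp
      then have "(u \<ominus>\<^bsub>C\<^esub> ?d) \<oplus>\<^bsub>C\<^esub> ?d \<in> K" by (intro Ka nul_K Cm.submodule_minus[OF K_submodule] y(1))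
      moreover have "(u \<ominus>\<^bsub>C\<^esub> ?d) \<oplus>\<^bsub>C\<^esub> ?d = u" using uc dc by algebra
      ultimately have uK: "u \<in> K" by simp
      have PS: "submodule (P (Suc n) S) V A" by (rule P_sub[OF sS])
      let ?m = "Suc n"
      have "((x ?m \<ominus>\<^bsub>A\<^esub> ?k ?m) \<ominus>\<^bsub>A\<^esub> ((x \<ominus>\<^bsub>C\<^esub> \<kappa> 1) \<ominus>\<^bsub>C\<^esub> \<pi> \<odot>\<^bsub>C\<^esub> v) ?m) \<oplus>\<^bsub>A\<^esub> ((?k \<ominus>\<^bsub>C\<^esub> \<kappa> 1) \<ominus>\<^bsub>C\<^esub> \<pi> \<odot>\<^bsub>C\<^esub> u) ?m \<in> P ?m S"
        by (rule submoduleE(5)[OF PS submodule_minus[OF PS \<kappa>(3) v(3)] u(3)])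
      moreover have "((x ?m \<ominus>\<^bsub>A\<^esub> ?k ?m) \<ominus>\<^bsub>A\<^esub> ((x \<ominus>\<^bsub>C\<^esub> \<kappa> 1) \<ominus>\<^bsub>C\<^esub> \<pi> \<odot>\<^bsub>C\<^esub> v) ?m) \<oplus>\<^bsub>A\<^esub> ((?k \<ominus>\<^bsub>C\<^esub> \<kappa> 1) \<ominus>\<^bsub>C\<^esub> \<pi> \<odot>\<^bsub>C\<^esub> u) ?m
          = \<pi> \<odot>\<^bsub>A\<^esub> (v ?m \<ominus>\<^bsub>A\<^esub> u ?m)"
      proof -
        have e: "((x \<ominus>\<^bsub>C\<^esub> \<kappa> 1) \<ominus>\<^bsub>C\<^esub> \<pi> \<odot>\<^bsub>C\<^esub> v) ?m = (x ?m \<ominus>\<^bsub>A\<^esub> \<kappa> 1 ?m) \<ominus>\<^bsub>A\<^esub> \<pi> \<odot>\<^bsub>A\<^esub> v ?m"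
          "((?k \<ominus>\<^bsub>C\<^esub> \<kappa> 1) \<ominus>\<^bsub>C\<^esub> \<pi> \<odot>\<^bsub>C\<^esub> u) ?m = (?k ?m \<ominus>\<^bsub>A\<^esub> \<kappa> 1 ?m) \<ominus>\<^bsub>A\<^esub> \<pi> \<odot>\<^bsub>A\<^esub> u ?m"
          using v1[OF Cm.M.minus_closed[OF xc \<kappa>c[of 1]] pc[OF vc], of ?m] v1[OF Cm.M.minus_closed[OF \<kappa>c[of ?m] \<kappa>c[of 1]] pc[OF uc], of ?m]
            v1[OF xc \<kappa>c[of 1]] v1[OF \<kappa>c \<kappa>c[of 1]] by simp_all
        show ?thesis
          unfolding e smult_diff[OF pi C_val[OF vc] C_val[OF uc]]
          using C_val[OF xc, of ?m] C_val[OF \<kappa>c[of 1], of ?m] C_val[OF \<kappa>c[of ?m], of ?m] smult_closed[OF pi C_val[OF vc]] smult_closed[OF pi C_val[OF uc]]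
          by algebra
      qed
      ultimately have "(\<pi> [^]\<^bsub>V\<^esub> (1::nat)) \<odot>\<^bsub>A\<^esub> (v ?m \<ominus>\<^bsub>A\<^esub> u ?m) \<in> P (1 + n) S" using pi by simp
      then have 1: "v ?m \<ominus>\<^bsub>A\<^esub> u ?m \<in> P n S" by (rule P_cancel[OF M.minus_closed[OF C_val[OF vc] C_val[OF uc]] bddD(3)[OF S]])
      have "((v ?m \<ominus>\<^bsub>A\<^esub> u ?m) \<ominus>\<^bsub>A\<^esub> (v ?m \<ominus>\<^bsub>A\<^esub> v n)) \<oplus>\<^bsub>A\<^esub> (u ?m \<ominus>\<^bsub>A\<^esub> u n) \<in> P n S"
        by (rule submoduleE(5)[OF P_sub[OF sS] submodule_minus[OF P_sub[OF sS] 1 Z_D(2)[OF v(1)]] Z_D(2)[OF u(1)]])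
      moreover have "((v ?m \<ominus>\<^bsub>A\<^esub> u ?m) \<ominus>\<^bsub>A\<^esub> (v ?m \<ominus>\<^bsub>A\<^esub> v n)) \<oplus>\<^bsub>A\<^esub> (u ?m \<ominus>\<^bsub>A\<^esub> u n) = v n \<ominus>\<^bsub>A\<^esub> u n"
        using C_val[OF vc, of ?m] C_val[OF vc, of n] C_val[OF uc, of ?m] C_val[OF uc, of n] by algebra
      ultimately show ?thesis using uK u(1) by (intro bexI[of _ u]) auto
    qed
    then have vK: "v \<in> K" using K_closed S v(1) unfolding limit_closed_def by blast
    let ?y = "y 1 \<oplus>\<^bsub>C\<^esub> v"
    have "nul ((\<kappa> 1 \<ominus>\<^bsub>C\<^esub> \<pi> \<odot>\<^bsub>C\<^esub> y 1) \<oplus>\<^bsub>C\<^esub> ((x \<ominus>\<^bsub>C\<^esub> \<kappa> 1) \<ominus>\<^bsub>C\<^esub> \<pi> \<odot>\<^bsub>C\<^esub> v))" by (rule nul_add[OF y(2) nulI[OF S v(2,3)]])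
    moreover have "(\<kappa> 1 \<ominus>\<^bsub>C\<^esub> \<pi> \<odot>\<^bsub>C\<^esub> y 1) \<oplus>\<^bsub>C\<^esub> ((x \<ominus>\<^bsub>C\<^esub> \<kappa> 1) \<ominus>\<^bsub>C\<^esub> \<pi> \<odot>\<^bsub>C\<^esub> v) = x \<ominus>\<^bsub>C\<^esub> \<pi> \<odot>\<^bsub>C\<^esub> ?y"
      unfolding Cm.smult_r_distr[OF pi yc vc] using \<kappa>c[of 1] xc pc[OF yc[of 1]] pc[OF vc] by algebra
    ultimately have "nul (x \<ominus>\<^bsub>C\<^esub> \<pi> \<odot>\<^bsub>C\<^esub> ?y)" by simp
    then show "x \<in> ?L" using xK Ka[OF y(1)[of 1] vK] by blast
  qed
  ultimately have "K \<subseteq> ?L" unfolding null_module_def by blast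
  then show ?thesis using assms by blast
qed

text \<open>Divide \<open>\<pi>z\<close> within \<open>K\<close> up to a null sequence and cancel
  \<pi>. This is injectivity of multiplication by \<pi> on the completion.\<close>

lemma nul_pi_K:
  assumes z: "z \<in> carrier C" and k: "\<pi> \<odot>\<^bsub>C\<^esub> z \<in> K"
  shows "z \<in> K"
proof -
  obtain y where y: "y \<in> K" "nul (\<pi> \<odot>\<^bsub>C\<^esub> z \<ominus>\<^bsub>C\<^esub> \<pi> \<odot>\<^bsub>C\<^esub> y)" using K_divisible[OF k] by blast
  note yc = K_C[OF y(1)]
  have "\<pi> \<odot>\<^bsub>C\<^esub> z \<ominus>\<^bsub>C\<^esub> \<pi> \<odot>\<^bsub>C\<^esub> y = \<pi> \<odot>\<^bsub>C\<^esub> (z \<ominus>\<^bsub>C\<^esub> y)"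
    using z yc pi by (simp add: a_minus_def Cm.smult_r_distr Cm.smult_r_minus del: C_simps)
  then have "nul (z \<ominus>\<^bsub>C\<^esub> y)" using nul_pi[OF Cm.M.minus_closed[OF z yc]] y(2) by simp
  then have "(z \<ominus>\<^bsub>C\<^esub> y) \<oplus>\<^bsub>C\<^esub> y \<in> K" by (intro Cm.submoduleE(5)[OF K_submodule] nul_K y(1))
  moreover have "(z \<ominus>\<^bsub>C\<^esub> y) \<oplus>\<^bsub>C\<^esub> y = z" using z yc by algebra
  ultimately show ?thesis by simp
qed

text \<open>Change \<open>x\<close> by an element of \<open>K\<close> so that
  \<open>z - \<pi>x\<close> becomes null. Then \<open>z 1 = \<pi>v\<close> for some
  \<open>v\<close>, which lies in \<open>U\<close> but not necessarily in \<open>S\<close>.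
  Subtracting \<pi> times the constant sequence \<open>v\<close> from \<open>z\<close> leaves a
  sequence that is zero at index 1 and can be divided within \<open>Z S\<close>; the quotient plus
  \<open>v\<close> represents the class of \<open>x\<close>.\<close>

lemma cls_cover:
  assumes x: "x \<in> carrier C" and z: "S \<in> bdd_submodules V A" "z \<in> Z S" and eq: "cls (\<pi> \<odot>\<^bsub>C\<^esub> x) = cls z"
    and U: "U \<in> bdd_submodules V A" "S \<subseteq> U" "{v \<in> carrier A. \<pi> \<odot>\<^bsub>A\<^esub> v \<in> S} \<subseteq> U"
  shows "cls x \<in> cls ` Z U"
proof -
  note px = Cm.smult_closed[OF pi x]
  have zc: "z \<in> carrier C" using C_carrier z by blast
  have "z \<ominus>\<^bsub>C\<^esub> \<pi> \<odot>\<^bsub>C\<^esub> x \<in> K" using Qc.cls_eq[OF zc px] eq by simp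
  then obtain y where y: "y \<in> K" "nul ((z \<ominus>\<^bsub>C\<^esub> \<pi> \<odot>\<^bsub>C\<^esub> x) \<ominus>\<^bsub>C\<^esub> \<pi> \<odot>\<^bsub>C\<^esub> y)" using K_divisible by blast
  note yc = K_C[OF y(1)]
  let ?x = "x \<oplus>\<^bsub>C\<^esub> y"
  have xc: "?x \<in> carrier C" using x yc by (rule Cm.M.a_closed)
  have "(z \<ominus>\<^bsub>C\<^esub> \<pi> \<odot>\<^bsub>C\<^esub> x) \<ominus>\<^bsub>C\<^esub> \<pi> \<odot>\<^bsub>C\<^esub> y = z \<ominus>\<^bsub>C\<^esub> \<pi> \<odot>\<^bsub>C\<^esub> ?x"
    unfolding Cm.smult_r_distr[OF pi x yc] using zc px Cm.smult_closed[OF pi yc] by algebra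
  then have n: "nul (z \<ominus>\<^bsub>C\<^esub> \<pi> \<odot>\<^bsub>C\<^esub> ?x)" using y(2) by simp
  then obtain T where T: "T \<in> bdd_submodules V A" "\<And>n. (z \<ominus>\<^bsub>C\<^esub> \<pi> \<odot>\<^bsub>C\<^esub> ?x) n \<in> P n T" unfolding nul_def by blast
  obtain t where t: "t \<in> T" "(z \<ominus>\<^bsub>C\<^esub> \<pi> \<odot>\<^bsub>C\<^esub> ?x) 1 = (\<pi> [^]\<^bsub>V\<^esub> (1::nat)) \<odot>\<^bsub>A\<^esub> t" using T(2)[of 1] unfolding P_D by blast
  have tc: "t \<in> carrier A" using t(1) bddD(4)[OF T(1)] by blast
  define v where "v = t \<oplus>\<^bsub>A\<^esub> ?x 1"
  have vc: "v \<in> carrier A" unfolding v_def by (rule M.a_closed[OF tc C_val[OF xc]])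
  have pv: "\<pi> \<odot>\<^bsub>A\<^esub> v = z 1"
  proof -
    have "z 1 \<ominus>\<^bsub>A\<^esub> \<pi> \<odot>\<^bsub>A\<^esub> ?x 1 = \<pi> \<odot>\<^bsub>A\<^esub> t"
      using fun_cong[OF C_minus[OF zc Cm.smult_closed[OF pi xc]], of 1] t(2) pi by simp
    then have "z 1 = \<pi> \<odot>\<^bsub>A\<^esub> t \<oplus>\<^bsub>A\<^esub> \<pi> \<odot>\<^bsub>A\<^esub> ?x 1"
      using C_val[OF zc, of 1] smult_closed[OF pi tc] smult_closed[OF pi C_val[OF xc, of 1]]
      by (metis M.add.inv_solve_right' a_minus_def)
    then show ?thesis unfolding v_def by (simp only: smult_r_distr[OF pi tc C_val[OF xc]])
  qed
  have vU: "v \<in> U" using U(3) vc pv adic_cauchyD(1)[OF z(2), of 1] by auto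
  let ?v = "\<lambda>n::nat. v"
  have vZ: "?v \<in> Z U" by (rule Z_const[OF U(1) vU])
  have cv: "?v \<in> carrier C" by (rule const_C[OF vc])
  have c1: "(\<lambda>n. z 1) \<in> Z S" by (rule Z_const[OF z(1) adic_cauchyD(1)[OF z(2)]])
  let ?z = "z \<ominus>\<^bsub>C\<^esub> \<pi> \<odot>\<^bsub>C\<^esub> ?v"
  have "\<pi> \<odot>\<^bsub>C\<^esub> ?v = (\<lambda>n. z 1)" using pv by simp
  then have zZ: "?z \<in> Z S" using Cm.submodule_minus[OF Z_submodule[OF z(1)] z(2) c1] by simp
  have "?z 1 = z 1 \<ominus>\<^bsub>A\<^esub> \<pi> \<odot>\<^bsub>A\<^esub> v" using fun_cong[OF C_minus[OF zc Cm.smult_closed[OF pi cv]], of 1] by simp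
  then have "?z 1 = \<zero>\<^bsub>A\<^esub>" using diff_self[OF C_val[OF zc, of 1]] pv by simp
  then have z1: "?z 1 \<in> P 1 S" using submodule_zero[OF P_sub[OF bddD(1)[OF z(1)]], of 1] by simp
  obtain u where u: "u \<in> Z S" "?z \<ominus>\<^bsub>C\<^esub> \<pi> \<odot>\<^bsub>C\<^esub> u \<in> Z S" "\<And>n. (?z \<ominus>\<^bsub>C\<^esub> \<pi> \<odot>\<^bsub>C\<^esub> u) n \<in> P n S"
    using divide_pi[OF z(1) zZ z1] by blast
  have uc: "u \<in> carrier C" using C_carrier z(1) u(1) by blast
  let ?w = "?v \<oplus>\<^bsub>C\<^esub> u"
  have wc: "?w \<in> carrier C" using cv uc by (rule Cm.M.a_closed)
  have wZ: "?w \<in> Z U" by (rule Cm.submoduleE(5)[OF Z_submodule[OF U(1)] vZ subsetD[OF Z_mono[OF U(2)] u(1)]])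
  have "nul ((?z \<ominus>\<^bsub>C\<^esub> \<pi> \<odot>\<^bsub>C\<^esub> u) \<ominus>\<^bsub>C\<^esub> (z \<ominus>\<^bsub>C\<^esub> \<pi> \<odot>\<^bsub>C\<^esub> ?x))" by (rule nul_diff[OF nulI[OF z(1) u(2,3)] n])
  moreover have "(?z \<ominus>\<^bsub>C\<^esub> \<pi> \<odot>\<^bsub>C\<^esub> u) \<ominus>\<^bsub>C\<^esub> (z \<ominus>\<^bsub>C\<^esub> \<pi> \<odot>\<^bsub>C\<^esub> ?x) = \<pi> \<odot>\<^bsub>C\<^esub> (?x \<ominus>\<^bsub>C\<^esub> ?w)"
  proof -
    have e: "\<pi> \<odot>\<^bsub>C\<^esub> (?x \<ominus>\<^bsub>C\<^esub> ?w) = \<pi> \<odot>\<^bsub>C\<^esub> ?x \<ominus>\<^bsub>C\<^esub> (\<pi> \<odot>\<^bsub>C\<^esub> ?v \<oplus>\<^bsub>C\<^esub> \<pi> \<odot>\<^bsub>C\<^esub> u)"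
      unfolding Cm.smult_r_distr[OF pi cv uc, symmetric] using xc wc pi
      by (simp only: a_minus_def Cm.smult_r_distr Cm.smult_r_minus Cm.M.a_inv_closed)
    have "((a \<ominus>\<^bsub>C\<^esub> b) \<ominus>\<^bsub>C\<^esub> c) \<ominus>\<^bsub>C\<^esub> (a \<ominus>\<^bsub>C\<^esub> d) = d \<ominus>\<^bsub>C\<^esub> (b \<oplus>\<^bsub>C\<^esub> c)"
      if "a \<in> carrier C" "b \<in> carrier C" "c \<in> carrier C" "d \<in> carrier C" for a b c d
      using that by algebra
    from this[OF zc Cm.smult_closed[OF pi cv] Cm.smult_closed[OF pi uc] Cm.smult_closed[OF pi xc]]
    show ?thesis unfolding e .
  qed
  ultimately have "nul (?x \<ominus>\<^bsub>C\<^esub> ?w)" using nul_pi[OF Cm.M.minus_closed[OF xc wc]] by simp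
  then have k: "(?x \<ominus>\<^bsub>C\<^esub> ?w) \<ominus>\<^bsub>C\<^esub> y \<in> K" by (intro Cm.submodule_minus[OF K_submodule] nul_K y(1))
  have "((a \<oplus>\<^bsub>C\<^esub> b) \<ominus>\<^bsub>C\<^esub> c) \<ominus>\<^bsub>C\<^esub> b = a \<ominus>\<^bsub>C\<^esub> c" if "a \<in> carrier C" "b \<in> carrier C" "c \<in> carrier C" for a b c
    using that by algebra
  note this[OF x yc wc]
  then have "cls x = cls ?w" using Qc.cls_eq[OF x wc] k by simp
  then show ?thesis using wZ by blast
qed

lemma completion_torsion_free: "torsion_free \<pi> (completion V \<pi> A)"
  unfolding torsion_free_def bornological_embedding_def completion_def
proof (intro conjI allI impI)
  note sm = Qc.Q_smult[OF pi]
  show "(\<lambda>x. \<pi> \<odot>\<^bsub>QC\<^esub> x) \<in> carrier QC \<rightarrow> carrier QC" using Qc.Qm.smult_closed[OF pi] by blast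
  show "inj_on (\<lambda>x. \<pi> \<odot>\<^bsub>QC\<^esub> x) (carrier QC)"
  proof (rule inj_onI)
    fix X Y assume "X \<in> carrier QC" "Y \<in> carrier QC" and eq: "\<pi> \<odot>\<^bsub>QC\<^esub> X = \<pi> \<odot>\<^bsub>QC\<^esub> Y"
    then obtain x y where x: "x \<in> carrier C" "X = cls x" and y: "y \<in> carrier C" "Y = cls y" unfolding Qc.Q_carrier by blast
    have "cls (\<pi> \<odot>\<^bsub>C\<^esub> x) = cls (\<pi> \<odot>\<^bsub>C\<^esub> y)" using eq unfolding x(2) y(2) sm[OF x(1)] sm[OF y(1)] .
    then have "\<pi> \<odot>\<^bsub>C\<^esub> x \<ominus>\<^bsub>C\<^esub> \<pi> \<odot>\<^bsub>C\<^esub> y \<in> K"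
      using Qc.cls_eq[OF Cm.smult_closed[OF pi x(1)] Cm.smult_closed[OF pi y(1)]] by simp
    moreover have "\<pi> \<odot>\<^bsub>C\<^esub> x \<ominus>\<^bsub>C\<^esub> \<pi> \<odot>\<^bsub>C\<^esub> y = \<pi> \<odot>\<^bsub>C\<^esub> (x \<ominus>\<^bsub>C\<^esub> y)"
      using x(1) y(1) pi by (simp add: a_minus_def Cm.smult_r_distr Cm.smult_r_minus del: C_simps)
    ultimately have "x \<ominus>\<^bsub>C\<^esub> y \<in> K" using nul_pi_K[OF Cm.M.minus_closed[OF x(1) y(1)]] by simp
    then show "X = Y" unfolding x(2) y(2) using Qc.cls_eq[OF x(1) y(1)] by simp
  qed
  have Qb: "born_module V QC" by (rule Qc.Q_born)
  fix B assume B: "B \<subseteq> carrier QC"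
  show "B \<in> bounded QC \<longleftrightarrow> (\<lambda>x. \<pi> \<odot>\<^bsub>QC\<^esub> x) ` B \<in> bounded QC"
  proof
    assume "B \<in> bounded QC"
    then show "(\<lambda>x. \<pi> \<odot>\<^bsub>QC\<^esub> x) ` B \<in> bounded QC"
      using bmod_ctx.scaled_bdd[OF bmod_ctx.intro[OF Qb pi] _ pi] unfolding scaled_def by blast
  next
    assume "(\<lambda>x. \<pi> \<odot>\<^bsub>QC\<^esub> x) ` B \<in> bounded QC"
    then obtain B' where B': "(\<lambda>x. \<pi> \<odot>\<^bsub>QC\<^esub> x) ` B = cls ` B'" "B' \<in> bounded C" unfolding quot_simps(5) by blast
    obtain S where S: "S \<in> bdd_submodules V A" "B' \<subseteq> Z S" using B'(2) by (auto simp: cauchy_module_def)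
    \<comment> \<open>Division by \<pi> can leave \<open>S\<close>, but torsion-freeness of
      \<open>A\<close> keeps the quotients in a bounded set.\<close>
    let ?S1 = "{v \<in> carrier A. \<pi> \<odot>\<^bsub>A\<^esub> v \<in> S}"
    have "?S1 \<in> bounded A"
    proof (rule pi_bdd)
      show "scaled A \<pi> ?S1 \<in> bounded A" by (rule bd(3)[OF bddD(2)[OF S(1)]]) (auto simp: scaled_def)
    qed blast
    from bd(6)[OF bd(2)[OF bddD(2)[OF S(1)] this]]
    obtain U where U: "U \<in> bdd_submodules V A" "S \<union> ?S1 \<subseteq> U" by blast
    have U': "S \<subseteq> U" "?S1 \<subseteq> U" using U(2) by simp_all
    have "X \<in> cls ` Z U" if X: "X \<in> B" for X
    proof -
      obtain x where x: "x \<in> carrier C" "X = cls x" using B X unfolding Qc.Q_carrier by blast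
      have "\<pi> \<odot>\<^bsub>QC\<^esub> X \<in> cls ` B'" using B'(1) X by blast
      then obtain z where z: "z \<in> Z S" "\<pi> \<odot>\<^bsub>QC\<^esub> X = cls z" using S(2) by blast
      have "cls (\<pi> \<odot>\<^bsub>C\<^esub> x) = cls z" using z(2) unfolding x(2) sm[OF x(1)] .
      then show ?thesis unfolding x(2) by (rule cls_cover[OF x(1) S(1) z(1) _ U(1) U'])
    qed
    then have "B \<subseteq> cls ` Z U" by blast
    moreover have "cls ` Z U \<in> bounded QC" using U(1) unfolding quot_simps(5) by (auto simp: cauchy_module_def)
    ultimately show "B \<in> bounded QC" by (rule born_moduleD(3)[OF Qb, rotated])
  qed
qed

end

section \<open>Multiplication on the completion\<close>

context balg
begin

lemma C_mult [simp]: "x \<otimes>\<^bsub>C\<^esub> y = (\<lambda>n. x n \<otimes>\<^bsub>A\<^esub> y n)" by (simp add: cauchy_module_def)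

lemma Z_mult:
  assumes S: "S \<in> bdd_submodules V A" "x \<in> Z S" and T: "T \<in> bdd_submodules V A" "y \<in> Z T"
    and U: "submodule U V A" "set_prod A S T \<subseteq> U"
  shows "x \<otimes>\<^bsub>C\<^esub> y \<in> Z U"
  unfolding adic_cauchy_def
proof (intro CollectI allI conjI)
  fix n
  have xc: "x i \<in> S" "y i \<in> T" "x i \<in> carrier A" "y i \<in> carrier A" for i
    using adic_cauchyD(1)[OF S(2)] adic_cauchyD(1)[OF T(2)] bddD(4)[OF S(1)] bddD(4)[OF T(1)] by blast+
  have p: "a \<otimes>\<^bsub>A\<^esub> b \<in> U" if "a \<in> S" "b \<in> T" for a b using U(2) set_prodI[OF that] by blast
  show "(x \<otimes>\<^bsub>C\<^esub> y) n \<in> U" using p[OF xc(1,2)] by simp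
  obtain s where s: "s \<in> S" "x (Suc n) \<ominus>\<^bsub>A\<^esub> x n = (\<pi> [^]\<^bsub>V\<^esub> n) \<odot>\<^bsub>A\<^esub> s" using adic_cauchyD(2)[OF S(2), of n] unfolding P_D by blast
  obtain t where t: "t \<in> T" "y (Suc n) \<ominus>\<^bsub>A\<^esub> y n = (\<pi> [^]\<^bsub>V\<^esub> n) \<odot>\<^bsub>A\<^esub> t" using adic_cauchyD(2)[OF T(2), of n] unfolding P_D by blast
  have "(x (Suc n) \<otimes>\<^bsub>A\<^esub> y (Suc n)) \<ominus>\<^bsub>A\<^esub> (x n \<otimes>\<^bsub>A\<^esub> y n) =
      (x (Suc n) \<ominus>\<^bsub>A\<^esub> x n) \<otimes>\<^bsub>A\<^esub> y (Suc n) \<oplus>\<^bsub>A\<^esub> x n \<otimes>\<^bsub>A\<^esub> (y (Suc n) \<ominus>\<^bsub>A\<^esub> y n)"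
    using xc(3,4)[of "Suc n"] xc(3,4)[of n] by algebra
  also have "\<dots> = (\<pi> [^]\<^bsub>V\<^esub> n) \<odot>\<^bsub>A\<^esub> (s \<otimes>\<^bsub>A\<^esub> y (Suc n)) \<oplus>\<^bsub>A\<^esub> (\<pi> [^]\<^bsub>V\<^esub> n) \<odot>\<^bsub>A\<^esub> (x n \<otimes>\<^bsub>A\<^esub> t)"
    unfolding s(2) t(2) mul_smult_l[OF pin bddD(4)[OF S(1) s(1)] xc(4)] mul_smult_r[OF pin xc(3) bddD(4)[OF T(1) t(1)]] ..
  also have "\<dots> \<in> P n U" by (intro submoduleE(5)[OF P_sub[OF U(1)]] P_I p s(1) t(1) xc)
  finally show "(x \<otimes>\<^bsub>C\<^esub> y) (Suc n) \<ominus>\<^bsub>A\<^esub> (x \<otimes>\<^bsub>C\<^esub> y) n \<in> P n U" by simp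
qed

lemma prod_cover:
  assumes "S \<in> bdd_submodules V A" "T \<in> bdd_submodules V A"
  obtains U where "U \<in> bdd_submodules V A" "set_prod A S T \<subseteq> U"
  using bd(6)[OF mul_bdd[OF bddD(2)[OF assms(1)] bddD(2)[OF assms(2)]]] by blast

lemma C_mul_closed: assumes x: "x \<in> carrier C" and y: "y \<in> carrier C" shows "x \<otimes>\<^bsub>C\<^esub> y \<in> carrier C"
proof -
  obtain S where S: "S \<in> bdd_submodules V A" "x \<in> Z S" using x C_carrier by blast
  obtain T where T: "T \<in> bdd_submodules V A" "y \<in> Z T" using y C_carrier by blast
  obtain U where U: "U \<in> bdd_submodules V A" "set_prod A S T \<subseteq> U" using prod_cover[OF S(1) T(1)] .
  show ?thesis using Z_mult[OF S T bddD(1)[OF U(1)] U(2)] U(1) C_carrier by blast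
qed

lemma K_sub_C: "K \<subseteq> carrier C" by (rule Cm.submoduleE(1)[OF K_submodule])

lemma C_mul_linear: "x \<in> carrier C \<Longrightarrow> linear_map V C C (\<lambda>y. x \<otimes>\<^bsub>C\<^esub> y)" "x \<in> carrier C \<Longrightarrow> linear_map V C C (\<lambda>y. y \<otimes>\<^bsub>C\<^esub> x)"
proof -
  assume x: "x \<in> carrier C"
  show "linear_map V C C (\<lambda>y. x \<otimes>\<^bsub>C\<^esub> y)"
    by (rule linear_mapI[OF C_mul_closed[OF x]]) (use C_val x in \<open>simp_all add: mul_r_distr mul_smult_r\<close>)
  show "linear_map V C C (\<lambda>y. y \<otimes>\<^bsub>C\<^esub> x)"
    by (rule linear_mapI[OF C_mul_closed[OF _ x]]) (use C_val x in \<open>simp_all add: mul_l_distr mul_smult_l\<close>)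
qed

text \<open>\<open>K\<close> is the smallest closed submodule, so it suffices that the sequences
  whose product with \<open>y\<close> lies in \<open>K\<close> form a closed submodule. Products
  remain in \<open>K\<close> although its elements need not be null in any bounded
  submodule.\<close>

lemma K_ideal: assumes k: "k \<in> K" and y: "y \<in> carrier C"
  shows "k \<otimes>\<^bsub>C\<^esub> y \<in> K" "y \<otimes>\<^bsub>C\<^esub> k \<in> K"
proof -
  obtain T where T: "T \<in> bdd_submodules V A" "y \<in> Z T" using y C_carrier by blast
  \<comment> \<open>A map that sends the Cauchy sequences of each \<open>S\<close> to those of some
    \<open>U\<close> and respects approximation at each index pulls the closed set \<open>K\<close>
    back to a closed set.\<close>
  have lc: "limit_closed V \<pi> A {x \<in> carrier C. m x \<in> K}"
    if m: "\<And>S. S \<in> bdd_submodules V A \<Longrightarrow> \<exists>U\<in>bdd_submodules V A. (\<forall>x\<in>Z S. m x \<in> Z U) \<and>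
      (\<forall>x\<in>Z S. \<forall>z\<in>Z S. \<forall>n. x n \<ominus>\<^bsub>A\<^esub> z n \<in> P n S \<longrightarrow> m x n \<ominus>\<^bsub>A\<^esub> m z n \<in> P n U)" for m
    unfolding limit_closed_def
  proof (intro ballI impI)
    fix S x assume S: "S \<in> bdd_submodules V A" and x: "x \<in> Z S"
      and ap: "\<forall>n. \<exists>k\<in>{x \<in> carrier C. m x \<in> K} \<inter> Z S. x n \<ominus>\<^bsub>A\<^esub> k n \<in> P n S"
    obtain U where U: "U \<in> bdd_submodules V A" "\<forall>x\<in>Z S. m x \<in> Z U"
      "\<forall>x\<in>Z S. \<forall>z\<in>Z S. \<forall>n. x n \<ominus>\<^bsub>A\<^esub> z n \<in> P n S \<longrightarrow> m x n \<ominus>\<^bsub>A\<^esub> m z n \<in> P n U" using m[OF S] by blast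
    have "\<exists>k\<in>K \<inter> Z U. m x n \<ominus>\<^bsub>A\<^esub> k n \<in> P n U" for n
    proof -
      obtain k where h: "m k \<in> K" "k \<in> Z S" "x n \<ominus>\<^bsub>A\<^esub> k n \<in> P n S" using ap[THEN spec, of n] by blast
      have "m x n \<ominus>\<^bsub>A\<^esub> m k n \<in> P n U" using U(3) x h(2,3) by blast
      then show ?thesis using h(1) U(2) h(2) by (intro bexI[of _ "m k"]) simp_all
    qed
    then have "m x \<in> K" using K_closed U(1,2) x unfolding limit_closed_def by blast
    then show "x \<in> {x \<in> carrier C. m x \<in> K}" using C_carrier S x by blast
  qed
  have le: "a \<in> S \<and> b \<in> T \<Longrightarrow> a \<otimes>\<^bsub>A\<^esub> b \<in> U" if "set_prod A S T \<subseteq> U" for a b S T U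
    using that set_prodI[of a S b T] by blast
  have 1: "submodule {x \<in> carrier C. x \<otimes>\<^bsub>C\<^esub> y \<in> K} V C" "submodule {x \<in> carrier C. y \<otimes>\<^bsub>C\<^esub> x \<in> K} V C"
    using linear_preimage[OF Cm.module_axioms Cm.module_axioms C_mul_linear(2)[OF y] K_submodule]
      linear_preimage[OF Cm.module_axioms Cm.module_axioms C_mul_linear(1)[OF y] K_submodule] by simp_all
  have 2: "limit_closed V \<pi> A {x \<in> carrier C. x \<otimes>\<^bsub>C\<^esub> y \<in> K}"
  proof (rule lc)
    fix S assume S: "S \<in> bdd_submodules V A"
    obtain U where U: "U \<in> bdd_submodules V A" "set_prod A S T \<subseteq> U" using prod_cover[OF S T(1)] .
    have "(x \<otimes>\<^bsub>C\<^esub> y) n \<ominus>\<^bsub>A\<^esub> (z \<otimes>\<^bsub>C\<^esub> y) n \<in> P n U" if xz: "x \<in> Z S" "z \<in> Z S" "x n \<ominus>\<^bsub>A\<^esub> z n \<in> P n S" for x z n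
    proof -
      note c = bddD(4)[OF S adic_cauchyD(1)[OF xz(1)]] bddD(4)[OF S adic_cauchyD(1)[OF xz(2)]]
        and yT = adic_cauchyD(1)[OF T(2)] and yc = bddD(4)[OF T(1) adic_cauchyD(1)[OF T(2)]]
      obtain s where s: "s \<in> S" "x n \<ominus>\<^bsub>A\<^esub> z n = (\<pi> [^]\<^bsub>V\<^esub> n) \<odot>\<^bsub>A\<^esub> s" using xz(3) unfolding P_D by blast
      have "(x n \<otimes>\<^bsub>A\<^esub> y n) \<ominus>\<^bsub>A\<^esub> (z n \<otimes>\<^bsub>A\<^esub> y n) = (x n \<ominus>\<^bsub>A\<^esub> z n) \<otimes>\<^bsub>A\<^esub> y n" using c(1)[of n] c(2)[of n] yc[of n] by algebra
      also have "\<dots> = (\<pi> [^]\<^bsub>V\<^esub> n) \<odot>\<^bsub>A\<^esub> (s \<otimes>\<^bsub>A\<^esub> y n)" unfolding s(2) by (rule mul_smult_l[OF pin bddD(4)[OF S s(1)] yc])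
      also have "\<dots> \<in> P n U" by (rule P_I[OF le[OF U(2)]]) (use s(1) yT in simp)
      finally show ?thesis by simp
    qed
    then show "\<exists>U\<in>bdd_submodules V A. (\<forall>x\<in>Z S. x \<otimes>\<^bsub>C\<^esub> y \<in> Z U) \<and> (\<forall>x\<in>Z S. \<forall>z\<in>Z S. \<forall>n. x n \<ominus>\<^bsub>A\<^esub> z n \<in> P n S \<longrightarrow>
        (x \<otimes>\<^bsub>C\<^esub> y) n \<ominus>\<^bsub>A\<^esub> (z \<otimes>\<^bsub>C\<^esub> y) n \<in> P n U)"
      using U(1) Z_mult[OF S _ T bddD(1)[OF U(1)] U(2)] by (intro bexI[OF _ U(1)] conjI ballI allI impI)
  qed
  have 3: "limit_closed V \<pi> A {x \<in> carrier C. y \<otimes>\<^bsub>C\<^esub> x \<in> K}"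
  proof (rule lc)
    fix S assume S: "S \<in> bdd_submodules V A"
    obtain U where U: "U \<in> bdd_submodules V A" "set_prod A T S \<subseteq> U" using prod_cover[OF T(1) S] .
    have "(y \<otimes>\<^bsub>C\<^esub> x) n \<ominus>\<^bsub>A\<^esub> (y \<otimes>\<^bsub>C\<^esub> z) n \<in> P n U" if xz: "x \<in> Z S" "z \<in> Z S" "x n \<ominus>\<^bsub>A\<^esub> z n \<in> P n S" for x z n
    proof -
      note c = bddD(4)[OF S adic_cauchyD(1)[OF xz(1)]] bddD(4)[OF S adic_cauchyD(1)[OF xz(2)]]
        and yT = adic_cauchyD(1)[OF T(2)] and yc = bddD(4)[OF T(1) adic_cauchyD(1)[OF T(2)]]
      obtain s where s: "s \<in> S" "x n \<ominus>\<^bsub>A\<^esub> z n = (\<pi> [^]\<^bsub>V\<^esub> n) \<odot>\<^bsub>A\<^esub> s" using xz(3) unfolding P_D by blast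
      have "(y n \<otimes>\<^bsub>A\<^esub> x n) \<ominus>\<^bsub>A\<^esub> (y n \<otimes>\<^bsub>A\<^esub> z n) = y n \<otimes>\<^bsub>A\<^esub> (x n \<ominus>\<^bsub>A\<^esub> z n)" using c(1)[of n] c(2)[of n] yc[of n] by algebra
      also have "\<dots> = (\<pi> [^]\<^bsub>V\<^esub> n) \<odot>\<^bsub>A\<^esub> (y n \<otimes>\<^bsub>A\<^esub> s)" unfolding s(2) by (rule mul_smult_r[OF pin yc bddD(4)[OF S s(1)]])
      also have "\<dots> \<in> P n U" by (rule P_I[OF le[OF U(2)]]) (use s(1) yT in simp)
      finally show ?thesis by simp
    qed
    then show "\<exists>U\<in>bdd_submodules V A. (\<forall>x\<in>Z S. y \<otimes>\<^bsub>C\<^esub> x \<in> Z U) \<and> (\<forall>x\<in>Z S. \<forall>z\<in>Z S. \<forall>n. x n \<ominus>\<^bsub>A\<^esub> z n \<in> P n S \<longrightarrow>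
        (y \<otimes>\<^bsub>C\<^esub> x) n \<ominus>\<^bsub>A\<^esub> (y \<otimes>\<^bsub>C\<^esub> z) n \<in> P n U)"
      using U(1) Z_mult[OF T S _ bddD(1)[OF U(1)] U(2)] by (intro bexI[OF _ U(1)] conjI ballI allI impI)
  qed
  have "K \<subseteq> L" if "submodule L V C" "limit_closed V \<pi> A L" for L using that unfolding null_module_def by blast
  from this[OF 1(1) 2] this[OF 1(2) 3] show "k \<otimes>\<^bsub>C\<^esub> y \<in> K" "y \<otimes>\<^bsub>C\<^esub> k \<in> K" using k by blast+
qed

lemma Q_mult:
  assumes x: "x \<in> carrier C" and y: "y \<in> carrier C"
  shows "cls x \<otimes>\<^bsub>completion V \<pi> A\<^esub> cls y = cls (x \<otimes>\<^bsub>C\<^esub> y)"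
proof -
  have "cls (x' \<otimes>\<^bsub>C\<^esub> y') = cls (x \<otimes>\<^bsub>C\<^esub> y)" if "x' \<in> cls x" "y' \<in> cls y" for x' y'
  proof -
    obtain k l where k: "k \<in> K" "x' = k \<oplus>\<^bsub>C\<^esub> x" "l \<in> K" "y' = l \<oplus>\<^bsub>C\<^esub> y" using \<open>x' \<in> cls x\<close> \<open>y' \<in> cls y\<close> Qc.cls_mem by blast
    have kc: "k \<in> carrier C" "l \<in> carrier C" using k(1,3) K_sub_C by blast+
    have c: "x' \<in> carrier C" "y' \<in> carrier C" unfolding k(2,4) by (rule Cm.M.a_closed[OF kc(1) x] Cm.M.a_closed[OF kc(2) y])+
    have e1: "x' \<otimes>\<^bsub>C\<^esub> y' = k \<otimes>\<^bsub>C\<^esub> y' \<oplus>\<^bsub>C\<^esub> x \<otimes>\<^bsub>C\<^esub> y'" unfolding k(2) by (rule linear_mapD(2)[OF C_mul_linear(2)[OF c(2)] kc(1) x])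
    have e2: "x \<otimes>\<^bsub>C\<^esub> y' = x \<otimes>\<^bsub>C\<^esub> l \<oplus>\<^bsub>C\<^esub> x \<otimes>\<^bsub>C\<^esub> y" unfolding k(4) by (rule linear_mapD(2)[OF C_mul_linear(1)[OF x] kc(2) y])
    have "k \<otimes>\<^bsub>C\<^esub> y' \<oplus>\<^bsub>C\<^esub> x \<otimes>\<^bsub>C\<^esub> l \<in> K" by (rule Cm.submoduleE(5)[OF K_submodule K_ideal(1)[OF k(1) c(2)] K_ideal(2)[OF k(3) x]])
    moreover have "k \<otimes>\<^bsub>C\<^esub> y' \<oplus>\<^bsub>C\<^esub> x \<otimes>\<^bsub>C\<^esub> l = x' \<otimes>\<^bsub>C\<^esub> y' \<ominus>\<^bsub>C\<^esub> x \<otimes>\<^bsub>C\<^esub> y"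
      unfolding e1 e2 using C_mul_closed[OF kc(1) c(2)] C_mul_closed[OF x kc(2)] C_mul_closed[OF x y]
      by (simp add: a_minus_def Cm.M.a_assoc Cm.M.r_neg del: C_simps C_mult)
    ultimately show ?thesis using Qc.cls_eq[OF C_mul_closed[OF c] C_mul_closed[OF x y]] by simp
  qed
  then have "(\<Union>x'\<in>cls x. \<Union>y'\<in>cls y. cls (x' \<otimes>\<^bsub>C\<^esub> y')) = (\<Union>x'\<in>cls x. \<Union>y'\<in>cls y. cls (x \<otimes>\<^bsub>C\<^esub> y))" by (intro SUP_cong refl)
  also have "\<dots> = cls (x \<otimes>\<^bsub>C\<^esub> y)" using Qc.asub.a_rcos_self[OF x] Qc.asub.a_rcos_self[OF y] by blast
  finally show ?thesis by (simp add: completion_def quot_module_def)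
qed

lemma completion_alg: "balg V \<pi> (completion V \<pi> A)"
proof
  have car: "carrier (completion V \<pi> A) = cls ` carrier C" unfolding completion_def by (rule Qc.Q_carrier)
  have add: "cls x \<oplus>\<^bsub>completion V \<pi> A\<^esub> cls y = cls (x \<oplus>\<^bsub>C\<^esub> y)" if "x \<in> carrier C" "y \<in> carrier C" for x y
    unfolding completion_def by (rule Qc.Q_add[OF that])
  have sm: "c \<odot>\<^bsub>completion V \<pi> A\<^esub> cls y = cls (c \<odot>\<^bsub>C\<^esub> y)" if "c \<in> carrier V" "y \<in> carrier C" for c y
    unfolding completion_def by (rule Qc.Q_smult[OF that])
  note ops = add sm Q_mult C_mul_closed Cm.M.a_closed Cm.smult_closed
  show "born_algebra V (completion V \<pi> A)"
    unfolding born_algebra_def car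
  proof (intro conjI)
    show "born_module V (completion V \<pi> A)" using completion_complete by (simp add: complete_born_module_def)
    show "\<forall>B\<in>bounded (completion V \<pi> A). \<forall>C\<in>bounded (completion V \<pi> A). set_prod (completion V \<pi> A) B C \<in> bounded (completion V \<pi> A)"
    proof (intro ballI)
      fix X Y assume "X \<in> bounded (completion V \<pi> A)" "Y \<in> bounded (completion V \<pi> A)"
      then obtain B B' where B: "X = cls ` B" "B \<in> bounded C" "Y = cls ` B'" "B' \<in> bounded C" unfolding completion_def quot_simps(5) by blast
      obtain S where S: "S \<in> bdd_submodules V A" "B \<subseteq> Z S" using B(2) by (auto simp: cauchy_module_def)
      obtain T where T: "T \<in> bdd_submodules V A" "B' \<subseteq> Z T" using B(4) by (auto simp: cauchy_module_def)
      obtain U where U: "U \<in> bdd_submodules V A" "set_prod A S T \<subseteq> U" using prod_cover[OF S(1) T(1)] .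
      have "set_prod (completion V \<pi> A) X Y \<subseteq> cls ` Z U"
      proof
        fix z assume "z \<in> set_prod (completion V \<pi> A) X Y"
        then obtain x y where z: "z = cls x \<otimes>\<^bsub>completion V \<pi> A\<^esub> cls y" "x \<in> B" "y \<in> B'" unfolding set_prod_def B(1,3) by blast
        have xy: "x \<in> Z S" "y \<in> Z T" using z(2,3) S(2) T(2) by blast+
        have "x \<in> carrier C" "y \<in> carrier C" using xy S(1) T(1) C_carrier by blast+
        then have "z = cls (x \<otimes>\<^bsub>C\<^esub> y)" unfolding z(1) by (rule Q_mult)
        then show "z \<in> cls ` Z U" using Z_mult[OF S(1) xy(1) T(1) xy(2) bddD(1)[OF U(1)] U(2)] by blast
      qed
      moreover have "cls ` Z U \<in> bounded (completion V \<pi> A)"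
        using U(1) unfolding completion_def quot_simps(5) by (auto simp: cauchy_module_def)
      ultimately show "set_prod (completion V \<pi> A) X Y \<in> bounded (completion V \<pi> A)"
        using born_moduleD(3)[of V "completion V \<pi> A"] completion_complete by (auto simp: complete_born_module_def)
    qed
  qed (use C_val in \<open>auto simp: ops mul_assoc mul_l_distr mul_r_distr mul_smult_l mul_smult_r simp del: C_simps C_mult,
      auto simp: mul_assoc mul_l_distr mul_r_distr mul_smult_l mul_smult_r\<close>)
qed (rule pi)

lemma to_completion_mult:
  assumes "x \<in> carrier A" "y \<in> carrier A"
  shows "to_completion V \<pi> A (x \<otimes>\<^bsub>A\<^esub> y) = to_completion V \<pi> A x \<otimes>\<^bsub>completion V \<pi> A\<^esub> to_completion V \<pi> A y"
  unfolding to_completion_def Q_mult[OF const_C[OF assms(1)] const_C[OF assms(2)]] by simp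

end


text \<open>The summand with \<open>i = 0\<close> is \<open>M\<close>. For \<open>i \<ge> 1\<close>
  one factor \<pi> is taken out of \<open>\<pi>^i M^(i+1)\<close>, and the rest has linear growth
  over \<open>M + M^2 + M^3\<close>, because \<open>(i + 1) div 3 \<le> i - 1\<close>.\<close>

lemma (in balg) lg_decomp:
  assumes M: "M \<in> bdd_submodules V A" and x: "x \<in> lg M"
  shows "\<exists>m\<in>M. \<exists>t\<in>lg (sub_powers_upto V A M 3). x = m \<oplus>\<^bsub>A\<^esub> \<pi> \<odot>\<^bsub>A\<^esub> t"
proof -
  let ?N = "sub_powers_upto V A M 3"
  note Mc = bddD(3)[OF M] and Ms = bddD(1)[OF M]
  note sN = lg_sub(1)[OF upto_carrier[OF Mc, of 3]]
  have "lg M \<subseteq> span_in V A (M \<union> scaled A \<pi> (lg ?N))"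
    unfolding lg_def[of M]
  proof (intro span_mono UN_least subsetI)
    fix i y assume "y \<in> scaled A (\<pi> [^]\<^bsub>V\<^esub> i) (sub_power V A M (Suc i))"
    then obtain a where a: "a \<in> sub_power V A M (Suc i)" "y = (\<pi> [^]\<^bsub>V\<^esub> i) \<odot>\<^bsub>A\<^esub> a" unfolding scaled_def by blast
    have ac: "a \<in> carrier A" using power_carrier[OF Mc] a(1) by blast
    show "y \<in> M \<union> scaled A \<pi> (lg ?N)"
    proof (cases i)
      case 0
      then have "a \<in> M" using a(1) span_least[OF Ms order_refl] by (auto simp: sub_power_def)
      then show ?thesis using a(2) 0 ac by simp
    next
      case (Suc j)
      have "a \<in> sub_powers_upto V A M (Suc i)" using power_upto[of "Suc i" "Suc i" M] a(1) by auto
      then have 1: "(\<pi> [^]\<^bsub>V\<^esub> (Suc i div 3)) \<odot>\<^bsub>A\<^esub> a \<in> lg ?N" by (rule upto_lg[OF Mc, rotated]) simp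
      have le: "Suc i div 3 \<le> j" using Suc by linarith
      have "(\<pi> [^]\<^bsub>V\<^esub> j) \<odot>\<^bsub>A\<^esub> a = (\<pi> [^]\<^bsub>V\<^esub> (j - Suc i div 3)) \<odot>\<^bsub>A\<^esub> ((\<pi> [^]\<^bsub>V\<^esub> (Suc i div 3)) \<odot>\<^bsub>A\<^esub> a)"
        using smult_pow_add[OF pi ac, of "j - Suc i div 3" "Suc i div 3"] le by simp
      also have "\<dots> \<in> lg ?N" by (rule submoduleE(4)[OF sN pin 1])
      finally have "\<pi> \<odot>\<^bsub>A\<^esub> ((\<pi> [^]\<^bsub>V\<^esub> j) \<odot>\<^bsub>A\<^esub> a) \<in> scaled A \<pi> (lg ?N)" unfolding scaled_def by (rule imageI)
      moreover have "y = \<pi> \<odot>\<^bsub>A\<^esub> ((\<pi> [^]\<^bsub>V\<^esub> j) \<odot>\<^bsub>A\<^esub> a)"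
        unfolding a(2) Suc using smult_pow_add[OF pi ac, of 1 j] pi by simp
      ultimately show ?thesis by simp
    qed
  qed
  then have "x \<in> span_in V A (M \<union> scaled A \<pi> (lg ?N))" using x by blast
  from span_Un_decomp[OF Ms scaled_submodule(1)[OF pi sN] this] show ?thesis unfolding scaled_def by blast
qed

context tfalg
begin

text \<open>If \<open>\<pi>x\<close> has linear growth, then \<open>lg_decomp\<close> writes it as
  \<open>m + \<pi>t\<close>, so \<open>x - t\<close> is a quotient of the bounded part by \<pi>.
  Only this bounded part has to be divided, where torsion-freeness of \<open>A\<close>
  applies.\<close>

lemma lg_torsion_free: "torsion_free \<pi> Alg"
  unfolding torsion_free_def bornological_embedding_def
proof (intro conjI allI impI)
  show "(\<lambda>x. \<pi> \<odot>\<^bsub>Alg\<^esub> x) \<in> carrier Alg \<rightarrow> carrier Alg" using smult_closed[OF pi] by simp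
  show "inj_on (\<lambda>x. \<pi> \<odot>\<^bsub>Alg\<^esub> x) (carrier Alg)" using pi_inj by (auto intro: inj_onI)
  fix B assume B: "B \<subseteq> carrier Alg"
  then have Bc: "B \<subseteq> carrier A" by simp
  show "B \<in> bounded Alg \<longleftrightarrow> (\<lambda>x. \<pi> \<odot>\<^bsub>Alg\<^esub> x) ` B \<in> bounded Alg"
  proof
    assume "B \<in> bounded Alg"
    then show "(\<lambda>x. \<pi> \<odot>\<^bsub>Alg\<^esub> x) ` B \<in> bounded Alg"
      using bmod_ctx.scaled_bdd[OF bmod_ctx.intro[OF lg_born pi] _ pi] unfolding scaled_def by blast
  next
    assume "(\<lambda>x. \<pi> \<odot>\<^bsub>Alg\<^esub> x) ` B \<in> bounded Alg"
    then have "(\<lambda>x. \<pi> \<odot>\<^bsub>A\<^esub> x) ` B \<in> linear_growth V \<pi> A" by simp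
    then obtain M where M: "M \<in> bdd_submodules V A" "(\<lambda>x. \<pi> \<odot>\<^bsub>A\<^esub> x) ` B \<subseteq> lg M" unfolding linear_growth_iff by blast
    let ?N = "sub_powers_upto V A M 3"
    let ?M1 = "{v \<in> carrier A. \<pi> \<odot>\<^bsub>A\<^esub> v \<in> M}"
    have "?M1 \<in> bounded A"
    proof (rule pi_bdd)
      show "scaled A \<pi> ?M1 \<in> bounded A" by (rule bd(3)[OF bddD(2)[OF M(1)]]) (auto simp: scaled_def)
    qed blast
    from bd(6)[OF bd(2)[OF this bddD(2)[OF upto_bdd[OF bddD(2)[OF M(1)], of 3]]]]
    obtain U where U: "U \<in> bdd_submodules V A" "?M1 \<union> ?N \<subseteq> U" by blast
    note Uc = bddD(3)[OF U(1)]
    have "x \<in> lg U" if x: "x \<in> B" for x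
    proof -
      have xc: "x \<in> carrier A" using Bc x by blast
      have "\<pi> \<odot>\<^bsub>A\<^esub> x \<in> lg M" using M(2) x by blast
      from lg_decomp[OF M(1) this] obtain m t where mt: "m \<in> M" "t \<in> lg ?N" "\<pi> \<odot>\<^bsub>A\<^esub> x = m \<oplus>\<^bsub>A\<^esub> \<pi> \<odot>\<^bsub>A\<^esub> t" by blast
      have c: "m \<in> carrier A" "t \<in> carrier A" using mt(1,2) bddD(4)[OF M(1)] lg_sub(2)[OF upto_carrier[OF bddD(3)[OF M(1)], of 3]] by blast+
      have "\<pi> \<odot>\<^bsub>A\<^esub> (x \<ominus>\<^bsub>A\<^esub> t) = m"
        unfolding smult_diff[OF pi xc c(2)] mt(3) using c(1) smult_closed[OF pi c(2)] by algebra
      then have "x \<ominus>\<^bsub>A\<^esub> t \<in> U" using U(2) mt(1) M.minus_closed[OF xc c(2)] by auto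
      then have "x \<ominus>\<^bsub>A\<^esub> t \<in> lg U" using lg_incl[OF Uc] by blast
      moreover have "t \<in> lg U" using lg_mono[of ?N U] U(2) mt(2) by blast
      ultimately have "(x \<ominus>\<^bsub>A\<^esub> t) \<oplus>\<^bsub>A\<^esub> t \<in> lg U" by (rule submoduleE(5)[OF lg_sub(1)[OF Uc]])
      moreover have "(x \<ominus>\<^bsub>A\<^esub> t) \<oplus>\<^bsub>A\<^esub> t = x" using xc c(2) by algebra
      ultimately show ?thesis by simp
    qed
    then have "B \<in> linear_growth V \<pi> A" unfolding linear_growth_iff using U(1) by blast
    then show "B \<in> bounded Alg" by simp
  qed
qed

lemma lg_tfalg: "tfalg V \<pi> Alg"
  by (intro tfalg.intro lg_alg tfalg_axioms.intro lg_torsion_free)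

text \<open>Torsion-freeness passes in two stages: to the linear growth bornology, and from there to
  the completion for it.\<close>

lemma dagger_completion_ctf: "ctf V \<pi> (dagger_completion V \<pi> A)"
proof -
  interpret L: tfalg V \<pi> Alg by (rule lg_tfalg)
  show ?thesis unfolding dagger_completion_def
    by (intro ctf.intro calg.intro tfalg.intro L.completion_alg calg_axioms.intro tfalg_axioms.intro
        L.completion_complete L.completion_torsion_free)
qed

end

section \<open>Analytically nilpotent pro-algebras\<close>

lemma bdd_alg_homD:
  assumes "bdd_alg_hom V A B f"
  shows "bdd_linear_map V A B f" "x \<in> carrier A \<Longrightarrow> f x \<in> carrier B"
    "x \<in> carrier A \<Longrightarrow> y \<in> carrier A \<Longrightarrow> f (x \<otimes>\<^bsub>A\<^esub> y) = f x \<otimes>\<^bsub>B\<^esub> f y"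
  using assms by (auto simp: bdd_alg_hom_def bdd_linear_map_def linear_map_def)

lemma bdd_alg_hom_comp:
  assumes f: "bdd_alg_hom V A B f" and g: "bdd_alg_hom V B E g"
  shows "bdd_alg_hom V A E (\<lambda>x. g (f x))"
  using bdd_linear_map_comp[OF bdd_alg_homD(1)[OF f] bdd_alg_homD(1)[OF g]] bdd_alg_homD[OF f] bdd_alg_homD(3)[OF g]
  by (simp add: bdd_alg_hom_def)

lemma fold_prods_image:
  assumes A: "balg V \<pi> A" and f: "bdd_alg_hom V A B f" and X: "X \<subseteq> carrier A"
  shows "f ` fold_prods A X k = fold_prods B (f ` X) k"
proof (induction k)
  case (Suc k)
  interpret A: balg V \<pi> A by (rule A)
  show ?case
  proof (cases k)
    case (Suc l)
    have "f ` set_prod A X (fold_prods A X k) = set_prod B (f ` X) (f ` fold_prods A X k)"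
    proof (intro subset_antisym subsetI)
      fix z assume "z \<in> f ` set_prod A X (fold_prods A X k)"
      then obtain x y where z: "z = f (x \<otimes>\<^bsub>A\<^esub> y)" "x \<in> X" "y \<in> fold_prods A X k" unfolding set_prod_def by blast
      have "z = f x \<otimes>\<^bsub>B\<^esub> f y" unfolding z(1)
        by (rule bdd_alg_homD(3)[OF f subsetD[OF X z(2)] subsetD[OF A.fold_carrier[OF X] z(3)]])
      then show "z \<in> set_prod B (f ` X) (f ` fold_prods A X k)" using z(2,3) unfolding set_prod_def by blast
    next
      fix z assume "z \<in> set_prod B (f ` X) (f ` fold_prods A X k)"
      then obtain x y where z: "z = f x \<otimes>\<^bsub>B\<^esub> f y" "x \<in> X" "y \<in> fold_prods A X k" unfolding set_prod_def by blast
      have "f (x \<otimes>\<^bsub>A\<^esub> y) = z" unfolding z(1)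
        by (rule bdd_alg_homD(3)[OF f subsetD[OF X z(2)] subsetD[OF A.fold_carrier[OF X] z(3)]])
      then show "z \<in> f ` set_prod A X (fold_prods A X k)" using z(2,3) unfolding set_prod_def by blast
    qed
    then show ?thesis using Suc.IH Suc by simp
  qed simp
qed simp

lemma bdd_submodule_image:
  assumes "born_module V M" "born_module V N" "bdd_linear_map V M N f" "S \<in> bdd_submodules V M"
  shows "f ` S \<in> bdd_submodules V N"
  using linear_image[OF born_moduleD(1)[OF assms(1)] born_moduleD(1)[OF assms(2)] bdd_linear_mapD(1)[OF assms(3)] bdd_submodulesD(2)[OF assms(4)]]
    bdd_linear_mapD(2)[OF assms(3) bdd_submodulesD(1)[OF assms(4)]]
  by (simp add: bdd_submodules_def)

text \<open>A block of \<open>2l\<close> factors maps to \<open>\<pi>\<^sup>2YY\<close> for a bounded set \<open>Y\<close> and hence to \<open>\<pi>\<^sup>2T\<close> for a bounded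
  submodule \<open>T\<close> of the dagger algebra with \<open>\<pi>TT \<subseteq> T\<close>; one factor \<open>\<pi>\<close> for each block pays for the product
  of the blocks.\<close>

lemma nilpotent_blocks:
  assumes X: "balg V \<pi> X" and Y: "tfalg V \<pi> Y" and B: "balg V \<pi> B" "semi_dagger V \<pi> B"
    and \<beta>: "bdd_alg_hom V X Y \<beta>" and \<theta>: "bdd_alg_hom V Y B \<theta>" and l: "l \<ge> 1"
    and nil: "\<beta> ` sub_power V X (carrier X) l \<subseteq> scaled Y \<pi> (carrier Y)"
    and W: "W \<in> bounded X"
  shows "\<exists>T\<in>bdd_submodules V B. \<forall>k\<ge>1. (\<lambda>x. \<theta> (\<beta> x)) ` fold_prods X W k \<subseteq> scaled B (\<pi> [^]\<^bsub>V\<^esub> (k div (2 * l))) T"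
proof -
  interpret X: balg V \<pi> X by (rule X)
  interpret Y: tfalg V \<pi> Y by (rule Y)
  interpret B: balg V \<pi> B by (rule B)
  note Wc = X.bd(4)[OF W] and \<beta>D = bdd_alg_homD[OF \<beta>] and \<theta>D = bdd_alg_homD[OF \<theta>]
  note bl = linear_mapD[OF bdd_linear_mapD(1)[OF \<beta>D(1)]] and tl = linear_mapD[OF bdd_linear_mapD(1)[OF \<theta>D(1)]]
  note fc = X.fold_carrier[OF Wc]
  \<comment> \<open>The quotients by \<pi> of the images of \<open>l\<close>-fold products. They are
    bounded by torsion-freeness of \<open>Y\<close>, whereas nilpotency alone places them only in
    the whole carrier.\<close>
  define Y0 where "Y0 = {y \<in> carrier Y. \<pi> \<odot>\<^bsub>Y\<^esub> y \<in> \<beta> ` fold_prods X W l}"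
  have bb: "\<beta> ` fold_prods X W k \<in> bounded Y" for k by (rule bdd_linear_mapD(2)[OF \<beta>D(1) X.fold_bdd[OF W]])
  have Y0: "Y0 \<in> bounded Y"
  proof (rule Y.pi_bdd)
    show "scaled Y \<pi> Y0 \<in> bounded Y" by (rule Y.bd(3)[OF bb[of l]]) (auto simp: scaled_def Y0_def)
  qed (auto simp: Y0_def)
  have Y0c: "Y0 \<subseteq> carrier Y" by (auto simp: Y0_def)
  have div: "\<exists>y\<in>Y0. \<beta> z = \<pi> \<odot>\<^bsub>Y\<^esub> y" if z: "z \<in> fold_prods X W l" for z
  proof -
    have m: "fold_prods X W k \<subseteq> fold_prods X (carrier X) k" for k
    proof (induction k)
      case (Suc k) then show ?case using Wc by (cases k) (auto simp: set_prod_def)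
    qed simp
    have "z \<in> sub_power V X (carrier X) l" unfolding sub_power_def using subsetD[OF X.span_sup subsetD[OF m z]] .
    then have "\<beta> z \<in> scaled Y \<pi> (carrier Y)" using nil by blast
    then obtain y where y: "y \<in> carrier Y" "\<beta> z = \<pi> \<odot>\<^bsub>Y\<^esub> y" unfolding scaled_def by blast
    have "\<pi> \<odot>\<^bsub>Y\<^esub> y \<in> \<beta> ` fold_prods X W l" using z y(2) by (metis imageI)
    then have "y \<in> Y0" using y(1) unfolding Y0_def by simp
    then show ?thesis using y(2) by blast
  qed
  \<comment> \<open>Besides the products of two quotients, the images of all products shorter than a
    block are included, to start the induction.\<close>
  define R where "R = set_prod Y Y0 Y0 \<union> \<beta> ` (\<Union>k\<in>{1..<2*l}. fold_prods X W k)"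
  have "(\<Union>k\<in>{1..<j}. fold_prods X W k) \<in> bounded X" for j
  proof (induction j)
    case 0 then show ?case using X.bd(3)[OF W, of "{}"] by simp
  next
    case (Suc j)
    show ?case
    proof (cases "1 \<le> j")
      case True
      then show ?thesis using X.bd(2)[OF Suc X.fold_bdd[OF W, of j]] by (simp add: atLeastLessThanSuc Un_commute)
    qed (use X.bd(3)[OF W, of "{}"] in simp)
  qed
  then have "R \<in> bounded Y" unfolding R_def by (intro Y.bd(2) Y.mul_bdd Y0 bdd_linear_mapD(2)[OF \<beta>D(1)])
  then have "\<theta> ` R \<in> bounded B" by (rule bdd_linear_mapD(2)[OF \<theta>D(1)])
  then obtain T where T: "T \<in> bdd_submodules V B" "\<theta> ` R \<subseteq> T" "scaled B \<pi> (set_prod B T T) \<subseteq> T"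
    using B(2) unfolding semi_dagger_def by blast
  note Tc = B.bddD(3)[OF T(1)]
  have T2: "\<pi> \<odot>\<^bsub>B\<^esub> (s \<otimes>\<^bsub>B\<^esub> t) \<in> T" if "s \<in> T" "t \<in> T" for s t
    using T(3) B.set_prodI[OF that] unfolding scaled_def by blast
  have block: "\<exists>t\<in>T. \<theta> (\<beta> z) = \<pi> \<odot>\<^bsub>B\<^esub> (\<pi> \<odot>\<^bsub>B\<^esub> t)" if z: "z \<in> fold_prods X W (2 * l)" for z
  proof -
    have "z \<in> fold_prods X W (l + l)" using z by (simp add: mult_2)
    then obtain a b where ab: "a \<in> fold_prods X W l" "b \<in> fold_prods X W l" "z = a \<otimes>\<^bsub>X\<^esub> b" using X.fold_split[OF Wc l l] by blast
    obtain c where c: "c \<in> Y0" "\<beta> a = \<pi> \<odot>\<^bsub>Y\<^esub> c" using div[OF ab(1)] by blast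
    obtain d where d: "d \<in> Y0" "\<beta> b = \<pi> \<odot>\<^bsub>Y\<^esub> d" using div[OF ab(2)] by blast
    note cd = subsetD[OF Y0c c(1)] subsetD[OF Y0c d(1)]
    have "\<beta> z = \<beta> a \<otimes>\<^bsub>Y\<^esub> \<beta> b" unfolding ab(3) by (rule \<beta>D(3)[OF subsetD[OF fc ab(1)] subsetD[OF fc ab(2)]])
    also have "\<dots> = \<pi> \<odot>\<^bsub>Y\<^esub> (\<pi> \<odot>\<^bsub>Y\<^esub> (c \<otimes>\<^bsub>Y\<^esub> d))"
      unfolding c(2) d(2) using cd Y.pi by (simp add: Y.mul_smult_l Y.mul_smult_r)
    finally have "\<theta> (\<beta> z) = \<pi> \<odot>\<^bsub>B\<^esub> (\<pi> \<odot>\<^bsub>B\<^esub> \<theta> (c \<otimes>\<^bsub>Y\<^esub> d))"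
      using tl(3)[OF Y.pi] cd Y.pi by simp
    moreover have "c \<otimes>\<^bsub>Y\<^esub> d \<in> R" unfolding R_def using Y.set_prodI[OF c(1) d(1)] by blast
    ultimately show ?thesis using T(2) by blast
  qed
  have "\<exists>t\<in>T. \<theta> (\<beta> z) = (\<pi> [^]\<^bsub>V\<^esub> (k div (2 * l))) \<odot>\<^bsub>B\<^esub> t" if "k \<ge> 1" "z \<in> fold_prods X W k" for k z
    using that
  proof (induction k arbitrary: z rule: less_induct)
    case (less k)
    consider "k < 2 * l" | "k = 2 * l" | "k > 2 * l" by linarith
    then show ?case
    proof cases
      case 1
      have "z \<in> (\<Union>k\<in>{1..<2*l}. fold_prods X W k)" by (rule UN_I[of k]) (use less.prems 1 in auto)
      then have "\<beta> z \<in> R" unfolding R_def by (intro UnI2 imageI)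
      then have "\<theta> (\<beta> z) \<in> T" using T(2) by blast
      then show ?thesis using 1 Tc by (intro bexI[of _ "\<theta> (\<beta> z)"]) (auto simp: subset_iff)
    next
      case 2
      obtain t where t: "t \<in> T" "\<theta> (\<beta> z) = \<pi> \<odot>\<^bsub>B\<^esub> (\<pi> \<odot>\<^bsub>B\<^esub> t)" using block less.prems(2) 2 by blast
      have "\<pi> \<odot>\<^bsub>B\<^esub> t \<in> T" by (rule B.submoduleE(4)[OF B.bddD(1)[OF T(1)] B.pi t(1)])
      then show ?thesis using t(2) 2 l B.pi by (intro bexI[of _ "\<pi> \<odot>\<^bsub>B\<^esub> t"]) simp_all
    next
      case 3
      then have k: "1 \<le> k - 2 * l" "2 * l + (k - 2 * l) = k" "1 \<le> 2 * l" using l by linarith+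
      obtain a b where ab: "a \<in> fold_prods X W (2 * l)" "b \<in> fold_prods X W (k - 2 * l)" "z = a \<otimes>\<^bsub>X\<^esub> b"
        using X.fold_split[OF Wc k(3,1), of z] less.prems(2) k(2) by auto
      obtain s where s: "s \<in> T" "\<theta> (\<beta> a) = \<pi> \<odot>\<^bsub>B\<^esub> (\<pi> \<odot>\<^bsub>B\<^esub> s)" using block[OF ab(1)] by blast
      let ?q = "(k - 2 * l) div (2 * l)"
      obtain t where t: "t \<in> T" "\<theta> (\<beta> b) = (\<pi> [^]\<^bsub>V\<^esub> ?q) \<odot>\<^bsub>B\<^esub> t"
        using less.IH[OF _ k(1) ab(2)] k by auto
      note ac = subsetD[OF fc ab(1)] subsetD[OF fc ab(2)] and st = subsetD[OF Tc s(1)] subsetD[OF Tc t(1)]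
      have q: "k div (2 * l) = Suc ?q" using 3 l le_div_geq[of "2 * l" k] by simp
      have "\<theta> (\<beta> z) = \<theta> (\<beta> a) \<otimes>\<^bsub>B\<^esub> \<theta> (\<beta> b)"
        unfolding ab(3) \<beta>D(3)[OF ac] by (rule \<theta>D(3)[OF \<beta>D(2)[OF ac(1)] \<beta>D(2)[OF ac(2)]])
      also have "\<dots> = \<pi> \<odot>\<^bsub>B\<^esub> (\<pi> \<odot>\<^bsub>B\<^esub> ((\<pi> [^]\<^bsub>V\<^esub> ?q) \<odot>\<^bsub>B\<^esub> (s \<otimes>\<^bsub>B\<^esub> t)))"
        unfolding s(2) t(2) B.mul_smult_l[OF B.pi B.smult_closed[OF B.pi st(1)] B.smult_closed[OF B.pin st(2)]]
          B.mul_smult_l[OF B.pi st(1) B.smult_closed[OF B.pin st(2)]] B.mul_smult_r[OF B.pin st] ..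
      \<comment> \<open>Of the two factors \<pi> of the block, one remains outside and raises the
        exponent; the other forms \<open>\<pi>st\<close>, which lies in \<open>T\<close>
        again.\<close>
      also have "\<dots> = (\<pi> [^]\<^bsub>V\<^esub> Suc ?q) \<odot>\<^bsub>B\<^esub> (\<pi> \<odot>\<^bsub>B\<^esub> (s \<otimes>\<^bsub>B\<^esub> t))"
        using st B.pi B.pin by (simp add: B.smult_assoc1[symmetric] X.R.m_comm X.R.m_assoc)
      finally show ?thesis unfolding q using T2[OF s(1) t(1)] by blast
    qed
  qed
  then show ?thesis using T(1) unfolding scaled_def by blast
qed


section \<open>Kernels of pro-algebra extensions\<close>

text \<open>The test objects of \<open>pro_kernel\<close> have elements of a prescribed type, so a
  submodule \<open>S\<close> of \<open>M\<close> is copied along an injection \<open>g\<close> into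
  that type. The operations decode by \<open>g\<close>, compute in \<open>M\<close> and encode
  again.\<close>

definition subobject :: "('b \<Rightarrow> 't) \<Rightarrow> ('v, 'b) bmod \<Rightarrow> 'b set \<Rightarrow> ('v, 't) bmod" where
  "subobject g M S =
    \<lparr>carrier = g ` S, monoid.mult = undefined, one = undefined, ring.zero = g \<zero>\<^bsub>M\<^esub>,
     add = (\<lambda>x y. g (inv_into UNIV g x \<oplus>\<^bsub>M\<^esub> inv_into UNIV g y)), smult = (\<lambda>c x. g (c \<odot>\<^bsub>M\<^esub> inv_into UNIV g x)),
     bounded = {g ` B | B. B \<in> bounded M \<and> B \<subseteq> S}\<rparr>"

lemma subobject_simps:
  "carrier (subobject g M S) = g ` S" "\<zero>\<^bsub>subobject g M S\<^esub> = g \<zero>\<^bsub>M\<^esub>"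
  "bounded (subobject g M S) = {g ` B | B. B \<in> bounded M \<and> B \<subseteq> S}"
  "inj g \<Longrightarrow> g x \<oplus>\<^bsub>subobject g M S\<^esub> g y = g (x \<oplus>\<^bsub>M\<^esub> y)"
  "inj g \<Longrightarrow> c \<odot>\<^bsub>subobject g M S\<^esub> g x = g (c \<odot>\<^bsub>M\<^esub> x)"
  by (simp_all add: subobject_def)

lemma subobject_born:
  assumes M: "born_module V M" and S: "submodule S V M" and g: "inj g"
  shows "born_module V (subobject g M S)"
proof (rule born_moduleI)
  interpret M: module V M by (rule born_moduleD(1)[OF M])
  let ?N = "subobject g M S"
  note Sc = subsetD[OF M.submoduleE(1)[OF S]] and S0 = M.submodule_zero[OF S]
    and Sn = M.submoduleE(3)[OF S] and Sm = M.submoduleE(4)[OF S] and Sa = M.submoduleE(5)[OF S]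
  note simps = subobject_simps(1,2) subobject_simps(4,5)[OF g]
  show N: "module V ?N"
  proof (rule moduleI[OF M.R.is_cring])
    show "abelian_group ?N"
    proof (rule abelian_groupI)
      show "\<exists>y\<in>carrier ?N. y \<oplus>\<^bsub>?N\<^esub> x = \<zero>\<^bsub>?N\<^esub>" if x: "x \<in> carrier ?N" for x
      proof -
        obtain a where a: "a \<in> S" "x = g a" using x unfolding simps by blast
        show ?thesis by (rule bexI[of _ "g (\<ominus>\<^bsub>M\<^esub> a)"]) (use a Sn[OF a(1)] M.M.l_neg[OF Sc[OF a(1)]] in \<open>simp_all add: simps\<close>)
      qed
    qed (auto simp: simps S0 Sa Sc M.M.a_ac)
  qed (auto simp: simps Sm Sc M.smult_l_distr M.smult_r_distr M.smult_assoc1)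
  have sub: "submodule (g ` T) V ?N" if T: "submodule T V M" "T \<subseteq> S" for T
  proof -
    interpret N: module V ?N by (rule N)
    note E = M.submodule_zero[OF T(1)] M.submoduleE(4,5)[OF T(1)]
    show ?thesis by (rule N.subI) (use E T(2) in \<open>auto simp: simps\<close>)
  qed
  show "\<exists>X\<in>bounded ?N. submodule X V ?N \<and> B \<subseteq> X" if B: "B \<in> bounded ?N" for B
  proof -
    obtain B' where B': "B = g ` B'" "B' \<in> bounded M" "B' \<subseteq> S" using B unfolding subobject_simps(3) by blast
    obtain X where X: "X \<in> bounded M" "submodule X V M" "B' \<subseteq> X" using born_moduleD(6)[OF M B'(2)] unfolding bdd_submodules_def by blast
    have "X \<inter> S \<in> bounded M" by (rule born_moduleD(3)[OF M X(1)]) blast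
    moreover have "submodule (X \<inter> S) V M"
      by (rule M.subI; (elim IntE)?; (intro IntI subsetI S0 Sa Sm M.submodule_zero[OF X(2)] M.submoduleE(4,5)[OF X(2)])?)
         (simp_all add: Sc)
    ultimately have "g ` (X \<inter> S) \<in> bounded ?N" "submodule (g ` (X \<inter> S)) V ?N" using sub[of "X \<inter> S"] unfolding subobject_simps(3) by blast+
    then show ?thesis using B'(1,3) X(3) by blast
  qed
  show "X \<in> bounded ?N" if "Y \<in> bounded ?N" "X \<subseteq> Y" for X Y
  proof -
    obtain B where B: "Y = g ` B" "B \<in> bounded M" "B \<subseteq> S" using \<open>Y \<in> bounded ?N\<close> unfolding subobject_simps(3) by blast
    obtain C where C: "X = g ` C" "C \<subseteq> B" using \<open>X \<subseteq> Y\<close> unfolding B(1) by (rule subset_imageE)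
    show ?thesis unfolding subobject_simps(3) C(1) using born_moduleD(3)[OF M B(2) C(2)] C(2) B(3) by blast
  qed
  show "X \<union> Y \<in> bounded ?N" if "X \<in> bounded ?N" "Y \<in> bounded ?N" for X Y
  proof -
    obtain B where B: "X = g ` B" "B \<in> bounded M" "B \<subseteq> S" using \<open>X \<in> bounded ?N\<close> unfolding subobject_simps(3) by blast
    obtain C where C: "Y = g ` C" "C \<in> bounded M" "C \<subseteq> S" using \<open>Y \<in> bounded ?N\<close> unfolding subobject_simps(3) by blast
    show ?thesis unfolding subobject_simps(3) B(1) C(1) image_Un[symmetric] using born_moduleD(2)[OF M B(2) C(2)] B(3) C(3) by blast
  qed
  show "\<exists>B\<in>bounded ?N. x \<in> B" if x: "x \<in> carrier ?N" for x
  proof -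
    obtain a where a: "a \<in> S" "x = g a" using x unfolding simps by blast
    have "{a} \<in> bounded M" by (rule born_moduleD(5)[OF M]) (use Sc a(1) in auto)
    then show ?thesis unfolding subobject_simps(3) using a by blast
  qed
qed

lemma subobject_map:
  assumes f: "bdd_linear_map V M N f" and S: "S \<subseteq> carrier M" "f ` S \<subseteq> T" and g: "inj g"
  shows "bdd_linear_map V (subobject g M S) (subobject g N T) (\<lambda>x. g (f (inv_into UNIV g x)))"
proof (rule bdd_linear_mapI)
  note fl = linear_mapD[OF bdd_linear_mapD(1)[OF f]]
  show "linear_map V (subobject g M S) (subobject g N T) (\<lambda>x. g (f (inv_into UNIV g x)))"
    by (rule linear_mapI) (use S g fl in \<open>auto simp: subobject_simps subset_iff\<close>)
  fix B assume "B \<in> bounded (subobject g M S)"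
  then obtain B' where B': "B = g ` B'" "B' \<in> bounded M" "B' \<subseteq> S" unfolding subobject_simps(3) by blast
  have "(\<lambda>x. g (f (inv_into UNIV g x))) ` B = g ` (f ` B')" unfolding B'(1) using g by (simp add: image_image)
  then show "(\<lambda>x. g (f (inv_into UNIV g x))) ` B \<in> bounded (subobject g N T)"
    unfolding subobject_simps(3) using bdd_linear_mapD(2)[OF f B'(2)] B'(3) S(2) by blast
qed

lemma subobject_incl:
  assumes f: "bdd_linear_map V M N f" and S: "S \<subseteq> carrier M" and g: "inj g"
  shows "bdd_linear_map V (subobject g M S) N (\<lambda>x. f (inv_into UNIV g x))"
proof (rule bdd_linear_mapI)
  note fl = linear_mapD[OF bdd_linear_mapD(1)[OF f]]
  show "linear_map V (subobject g M S) N (\<lambda>x. f (inv_into UNIV g x))"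
    by (rule linear_mapI) (use S g fl in \<open>auto simp: subobject_simps subset_iff\<close>)
  fix B assume "B \<in> bounded (subobject g M S)"
  then obtain B' where B': "B = g ` B'" "B' \<in> bounded M" "B' \<subseteq> S" unfolding subobject_simps(3) by blast
  have "(\<lambda>x. f (inv_into UNIV g x)) ` B = f ` B'" unfolding B'(1) using g by (simp add: image_image)
  then show "(\<lambda>x. f (inv_into UNIV g x)) ` B \<in> bounded N" using bdd_linear_mapD(2)[OF f B'(2)] by simp
qed


section \<open>Morphisms of projective systems\<close>

lemma pro_moduleD:
  assumes "pro_module V A"
  shows "n \<in> pro_index A \<Longrightarrow> pro_le A n n"
    and "l \<in> pro_index A \<Longrightarrow> m \<in> pro_index A \<Longrightarrow> n \<in> pro_index A \<Longrightarrow> pro_le A l m \<Longrightarrow> pro_le A m n \<Longrightarrow> pro_le A l n"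
    and "m \<in> pro_index A \<Longrightarrow> n \<in> pro_index A \<Longrightarrow> \<exists>k\<in>pro_index A. pro_le A m k \<and> pro_le A n k"
    and "n \<in> pro_index A \<Longrightarrow> born_module V (pro_obj A n)"
    and "m \<in> pro_index A \<Longrightarrow> n \<in> pro_index A \<Longrightarrow> pro_le A m n \<Longrightarrow>
      bdd_linear_map V (pro_obj A n) (pro_obj A m) (pro_map A m n)"
    and "n \<in> pro_index A \<Longrightarrow> x \<in> carrier (pro_obj A n) \<Longrightarrow> pro_map A n n x = x"
    and "l \<in> pro_index A \<Longrightarrow> m \<in> pro_index A \<Longrightarrow> n \<in> pro_index A \<Longrightarrow> pro_le A l m \<Longrightarrow> pro_le A m n \<Longrightarrow>
      x \<in> carrier (pro_obj A n) \<Longrightarrow> pro_map A l m (pro_map A m n x) = pro_map A l n x"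
    and "m \<in> pro_index A \<Longrightarrow> n \<in> pro_index A \<Longrightarrow> pro_le A m n \<Longrightarrow> x \<in> carrier (pro_obj A n) \<Longrightarrow>
      pro_map A m n x \<in> carrier (pro_obj A m)"
proof -
  note h = assms[unfolded pro_module_def]
  note d = h[THEN conjunct1, unfolded directed_def]
  show "n \<in> pro_index A \<Longrightarrow> pro_le A n n" using d by blast
  show "l \<in> pro_index A \<Longrightarrow> m \<in> pro_index A \<Longrightarrow> n \<in> pro_index A \<Longrightarrow> pro_le A l m \<Longrightarrow> pro_le A m n \<Longrightarrow> pro_le A l n"
    using d by metis
  show "m \<in> pro_index A \<Longrightarrow> n \<in> pro_index A \<Longrightarrow> \<exists>k\<in>pro_index A. pro_le A m k \<and> pro_le A n k" using d by metis
  show "n \<in> pro_index A \<Longrightarrow> born_module V (pro_obj A n)" using h by metis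
  show 1: "m \<in> pro_index A \<Longrightarrow> n \<in> pro_index A \<Longrightarrow> pro_le A m n \<Longrightarrow>
      bdd_linear_map V (pro_obj A n) (pro_obj A m) (pro_map A m n)" using h by metis
  show "n \<in> pro_index A \<Longrightarrow> x \<in> carrier (pro_obj A n) \<Longrightarrow> pro_map A n n x = x" using h by metis
  show "l \<in> pro_index A \<Longrightarrow> m \<in> pro_index A \<Longrightarrow> n \<in> pro_index A \<Longrightarrow> pro_le A l m \<Longrightarrow> pro_le A m n \<Longrightarrow>
      x \<in> carrier (pro_obj A n) \<Longrightarrow> pro_map A l m (pro_map A m n x) = pro_map A l n x" using h by metis
  show "m \<in> pro_index A \<Longrightarrow> n \<in> pro_index A \<Longrightarrow> pro_le A m n \<Longrightarrow> x \<in> carrier (pro_obj A n) \<Longrightarrow>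
      pro_map A m n x \<in> carrier (pro_obj A m)"
    by (rule linear_mapD(1)[OF bdd_linear_mapD(1)[OF 1]])
qed

lemma same_germD:
  assumes "same_germ A (l, f) (l', f')"
  obtains k where "k \<in> pro_index A" "pro_le A l k" "pro_le A l' k"
    "\<And>x. x \<in> carrier (pro_obj A k) \<Longrightarrow> f (pro_map A l k x) = f' (pro_map A l' k x)"
  using assms unfolding same_germ_def by auto

lemma same_germI:
  assumes "k \<in> pro_index A" "pro_le A l k" "pro_le A l' k"
    "\<And>x. x \<in> carrier (pro_obj A k) \<Longrightarrow> f (pro_map A l k x) = f' (pro_map A l' k x)"
  shows "same_germ A (l, f) (l', f')"
  using assms unfolding same_germ_def by auto

lemma pro_linearD:
  assumes "pro_linear V A B \<phi>" "n \<in> pro_index B"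
  shows "fst (\<phi> n) \<in> pro_index A" "bdd_linear_map V (pro_obj A (fst (\<phi> n))) (pro_obj B n) (snd (\<phi> n))"
    "x \<in> carrier (pro_obj A (fst (\<phi> n))) \<Longrightarrow> snd (\<phi> n) x \<in> carrier (pro_obj B n)"
  using assms unfolding pro_linear_def bdd_linear_map_def linear_map_def by blast+

lemma pro_linear_compatible:
  assumes "pro_linear V A B \<phi>" "m \<in> pro_index B" "n \<in> pro_index B" "pro_le B m n"
  obtains k where "k \<in> pro_index A" "pro_le A (fst (\<phi> m)) k" "pro_le A (fst (\<phi> n)) k"
    "\<And>x. x \<in> carrier (pro_obj A k) \<Longrightarrow>
      snd (\<phi> m) (pro_map A (fst (\<phi> m)) k x) = pro_map B m n (snd (\<phi> n) (pro_map A (fst (\<phi> n)) k x))"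
proof -
  have "same_germ A (fst (\<phi> m), snd (\<phi> m)) (fst (\<phi> n), pro_map B m n \<circ> snd (\<phi> n))"
    using assms unfolding pro_linear_def pro_compatible_def by auto
  then show thesis by (rule same_germD) (rule that, auto)
qed

text \<open>The kernel of \<open>p\<close> is the system of the kernels of \<open>p\<^sub>0\<alpha>\<^bsub>l,n\<^esub>\<close>; only the lifting part of the universal
  property of \<open>J\<close> is needed to map it to \<open>J\<close>.\<close>

lemma kernel_lift:
  fixes J :: "('v, 'j) pro" and E :: "('v, 'e) pro" and A :: "('v, 'a) bmod"
  assumes k: "pro_kernel TYPE('j + 'e + 'a) V J E (constant_pro A) \<iota> p"
    and J: "pro_module V J" and E: "pro_module V E" and A: "born_module V A"
    and p: "pro_linear V E (constant_pro A) p"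
    and m: "m \<in> pro_index E" and a: "a \<in> pro_index J" "pro_le J (fst (\<iota> m)) a"
  obtains n h where "n \<in> pro_index E" "pro_le E m n" "pro_le E (fst (p 0)) n"
    "\<And>W. W \<in> bounded (pro_obj E n) \<Longrightarrow>
      W \<subseteq> {x \<in> carrier (pro_obj E n). snd (p 0) (pro_map E (fst (p 0)) n x) = \<zero>\<^bsub>A\<^esub>} \<Longrightarrow> h ` W \<in> bounded (pro_obj J a)"
    "\<And>x. x \<in> carrier (pro_obj E n) \<Longrightarrow> snd (p 0) (pro_map E (fst (p 0)) n x) = \<zero>\<^bsub>A\<^esub> \<Longrightarrow>
      h x \<in> carrier (pro_obj J a) \<and> snd (\<iota> m) (pro_map J (fst (\<iota> m)) a (h x)) = pro_map E m n x"
proof -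
  note ED = pro_moduleD[OF E] and JD = pro_moduleD[OF J]
  define l p0 where "l = fst (p 0)" and "p0 = snd (p 0)"
  have l: "l \<in> pro_index E" and p0: "bdd_linear_map V (pro_obj E l) A p0"
    using pro_linearD(1,2)[OF p, of 0] unfolding l_def p0_def by (simp_all add: constant_pro_def)
  note mA = born_moduleD(1)[OF A]
  define g :: "'e \<Rightarrow> 'j + 'e + 'a" where "g = (\<lambda>x. Inr (Inl x))"
  have g: "inj g" unfolding g_def by (auto intro: injI)
  note gi = inv_into_f_f[OF g UNIV_I]
  let ?g = "inv_into UNIV g"
  define K where "K n = {x \<in> carrier (pro_obj E n). p0 (pro_map E l n x) = \<zero>\<^bsub>A\<^esub>}" for n
  have Kc: "K n \<subseteq> carrier (pro_obj E n)" for n unfolding K_def by blast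
  have Ksub: "submodule (K n) V (pro_obj E n)" if n: "n \<in> pro_index E" "pro_le E l n" for n
  proof -
    interpret M: module V A by (rule mA)
    have "submodule {\<zero>\<^bsub>A\<^esub>} V A" by (rule M.subI) auto
    from linear_preimage[OF born_moduleD(1)[OF ED(4)[OF n(1)]] mA
        linear_map_comp[OF bdd_linear_mapD(1)[OF ED(5)[OF l n]] bdd_linear_mapD(1)[OF p0]] this]
    show ?thesis unfolding K_def by simp
  qed
  have Kmap: "pro_map E i j ` K j \<subseteq> K i" if ij: "i \<in> pro_index E" "j \<in> pro_index E" "pro_le E l i" "pro_le E i j" for i j
  proof (rule image_subsetI)
    fix x assume x: "x \<in> K j"
    then have xc: "x \<in> carrier (pro_obj E j)" using Kc by blast
    show "pro_map E i j x \<in> K i"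
      using x ED(7)[OF l ij(1,2,3,4) xc] ED(8)[OF ij(1,2,4) xc] unfolding K_def by simp
  qed
  \<comment> \<open>The index set is cut down to the indices above \<open>l\<close>, since only from
    there is the composite to \<open>A\<close> defined.\<close>
  define P where "P = \<lparr>pro_index = {n \<in> pro_index E. pro_le E l n}, pro_le = pro_le E,
      pro_obj = (\<lambda>n. subobject g (pro_obj E n) (K n)), pro_map = (\<lambda>i j x. g (pro_map E i j (?g x)))\<rparr>"
  have PI: "n \<in> pro_index P \<longleftrightarrow> n \<in> pro_index E \<and> pro_le E l n" for n by (simp add: P_def)
  have Pc: "carrier (pro_obj P n) = g ` K n" for n by (simp add: P_def subobject_simps)
  have Ple: "pro_le P = pro_le E" by (simp add: P_def)
  have Pm: "pro_map P i j (g x) = g (pro_map E i j x)" for i j x by (simp add: P_def gi)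
  have Pmod: "pro_module V P"
    unfolding pro_module_def directed_def Ple
  proof (intro conjI ballI impI)
    show "pro_index P \<noteq> {}" using PI[of l] l ED(1)[OF l] by blast
    show "pro_le E i i" if "i \<in> pro_index P" for i using ED(1) that PI by blast
    show "pro_le E i k" if "i \<in> pro_index P" "j \<in> pro_index P" "k \<in> pro_index P" "pro_le E i j" "pro_le E j k" for i j k
      using ED(2)[of i j k] that PI by blast
    show "\<exists>k\<in>pro_index P. pro_le E i k \<and> pro_le E j k" if ij: "i \<in> pro_index P" "j \<in> pro_index P" for i j
    proof -
      obtain k where k: "k \<in> pro_index E" "pro_le E i k" "pro_le E j k" using ED(3) ij PI by blast
      moreover have "pro_le E l k" using ED(2)[of l i k] l ij(1) k PI by blast
      ultimately show ?thesis using PI by blast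
    qed
    show "born_module V (pro_obj P n)" if "n \<in> pro_index P" for n
      unfolding P_def using subobject_born[OF ED(4) Ksub g] that PI by simp
    show "bdd_linear_map V (pro_obj P n) (pro_obj P i) (pro_map P i n)"
      if ij: "i \<in> pro_index P" "n \<in> pro_index P" "pro_le E i n" for i n
    proof -
      have 1: "i \<in> pro_index E" "n \<in> pro_index E" "pro_le E l i" using ij PI by blast+
      show ?thesis unfolding P_def pro.simps by (rule subobject_map[OF ED(5)[OF 1(1,2) ij(3)] Kc Kmap[OF 1 ij(3)] g])
    qed
    show "pro_map P n n x = x" if "n \<in> pro_index P" "x \<in> carrier (pro_obj P n)" for n x
    proof -
      obtain y where y: "y \<in> K n" "x = g y" using \<open>x \<in> _\<close> unfolding Pc by blast
      show ?thesis unfolding y(2) Pm using ED(6)[of n y] subsetD[OF Kc y(1)] \<open>n \<in> _\<close> PI by auto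
    qed
    show "pro_map P i j (pro_map P j k x) = pro_map P i k x"
      if ij: "i \<in> pro_index P" "j \<in> pro_index P" "k \<in> pro_index P" "pro_le E i j" "pro_le E j k"
        and x: "x \<in> carrier (pro_obj P k)" for i j k x
    proof -
      obtain y where y: "y \<in> K k" "x = g y" using x unfolding Pc by blast
      have "pro_map E i j (pro_map E j k y) = pro_map E i k y" by (rule ED(7)) (use ij PI y(1) Kc in blast)+
      then show ?thesis unfolding y(2) Pm by simp
    qed
  qed
  have "\<exists>k\<in>pro_index E. pro_le E l k \<and> pro_le E i k" if "i \<in> pro_index E" for i using ED(3)[OF l that] .
  \<comment> \<open>The inclusion into level \<open>i\<close> must start at an index of
    \<open>P\<close>, so for each \<open>i\<close> an index above both \<open>i\<close> and
    \<open>l\<close> is chosen.\<close>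
  then obtain c where c: "\<And>i. i \<in> pro_index E \<Longrightarrow> c i \<in> pro_index E" "\<And>i. i \<in> pro_index E \<Longrightarrow> pro_le E l (c i)"
    "\<And>i. i \<in> pro_index E \<Longrightarrow> pro_le E i (c i)" by metis
  define \<gamma> where "\<gamma> i = (c i, \<lambda>x. pro_map E i (c i) (?g x))" for i
  have "pro_linear V P E \<gamma>"
    unfolding pro_linear_def pro_compatible_def
  proof (intro conjI ballI impI)
    fix i assume i: "i \<in> pro_index E"
    show "fst (\<gamma> i) \<in> pro_index P" using c[OF i] PI by (simp add: \<gamma>_def)
    show "bdd_linear_map V (pro_obj P (fst (\<gamma> i))) (pro_obj E i) (snd (\<gamma> i))"
      unfolding \<gamma>_def fst_conv snd_conv P_def pro.simps by (rule subobject_incl[OF ED(5)[OF i c(1,3)[OF i]] Kc g])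
  next
    fix i j assume ij: "i \<in> pro_index E" "j \<in> pro_index E" "pro_le E i j"
    obtain k where k: "k \<in> pro_index E" "pro_le E (c i) k" "pro_le E (c j) k" using ED(3)[OF c(1)[OF ij(1)] c(1)[OF ij(2)]] by blast
    have kl: "pro_le E l k" by (rule ED(2)[OF l c(1)[OF ij(1)] k(1) c(2)[OF ij(1)] k(2)])
    have jk: "pro_le E j k" by (rule ED(2)[OF ij(2) c(1)[OF ij(2)] k(1) c(3)[OF ij(2)] k(3)])
    show "same_germ P (\<gamma> i) (fst (\<gamma> j), pro_map E i j \<circ> snd (\<gamma> j))"
      unfolding \<gamma>_def fst_conv snd_conv
    proof (rule same_germI[of k])
      show "k \<in> pro_index P" using k(1) kl PI by blast
      show "pro_le P (c i) k" "pro_le P (c j) k" using k by (simp_all add: Ple)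
      fix x assume "x \<in> carrier (pro_obj P k)"
      then obtain y where y: "y \<in> K k" "x = g y" unfolding Pc by blast
      have yc: "y \<in> carrier (pro_obj E k)" using y(1) Kc by blast
      show "pro_map E i (c i) (?g (pro_map P (c i) k x)) = (pro_map E i j \<circ> (\<lambda>x. pro_map E j (c j) (?g x))) (pro_map P (c j) k x)"
        unfolding y(2) Pm gi o_def ED(7)[OF ij(1) c(1)[OF ij(1)] k(1) c(3)[OF ij(1)] k(2) yc]
          ED(7)[OF ij(2) c(1)[OF ij(2)] k(1) c(3)[OF ij(2)] k(3) yc] ED(7)[OF ij(1,2) k(1) ij(3) jk yc] ..
    qed
  qed
  moreover have "pro_is_zero P (constant_pro A) (pro_comp p \<gamma>)"
    unfolding pro_is_zero_def
  proof (intro ballI)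
    fix i assume i0: "i \<in> pro_index (constant_pro A)"
    then have i: "i = 0" by (simp add: constant_pro_def)
    show "same_germ P (pro_comp p \<gamma> i) (fst (pro_comp p \<gamma> i), \<lambda>x. \<zero>\<^bsub>pro_obj (constant_pro A) i\<^esub>)"
      unfolding i pro_comp_def fst_conv snd_conv l_def[symmetric] p0_def[symmetric] \<gamma>_def
    proof (rule same_germI[of "c l"])
      show "c l \<in> pro_index P" using c[OF l] PI by blast
      show "pro_le P (c l) (c l)" "pro_le P (c l) (c l)" using ED(1)[OF c(1)[OF l]] by (simp_all add: Ple)
      fix x assume "x \<in> carrier (pro_obj P (c l))"
      then obtain y where y: "y \<in> K (c l)" "x = g y" unfolding Pc by blast
      have yc: "y \<in> carrier (pro_obj E (c l))" using y(1) Kc by blast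
      show "(p0 \<circ> (\<lambda>x. pro_map E l (c l) (?g x))) (pro_map P (c l) (c l) x) = \<zero>\<^bsub>pro_obj (constant_pro A) 0\<^esub>"
        unfolding y(2) Pm gi o_def ED(6)[OF c(1)[OF l] yc] using y(1) by (simp add: K_def constant_pro_def)
    qed
  qed
  ultimately have "\<exists>h. pro_linear V P J h \<and> pro_eq P E (pro_comp \<iota> h) \<gamma>"
    using k Pmod unfolding pro_kernel_def by blast
  then obtain \<eta> where \<eta>: "pro_linear V P J \<eta>" "pro_eq P E (pro_comp \<iota> \<eta>) \<gamma>" by blast
  have \<iota>: "pro_linear V J E \<iota>" using k unfolding pro_kernel_def by blast
  define j where "j = fst (\<iota> m)"
  have j: "j \<in> pro_index J" unfolding j_def by (rule pro_linearD(1)[OF \<iota> m])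
  define d e where "d = fst (\<eta> j)" and "e = fst (\<eta> a)"
  have d: "d \<in> pro_index P" "e \<in> pro_index P" unfolding d_def e_def by (rule pro_linearD(1)[OF \<eta>(1)], rule j a)+
  \<comment> \<open>The equation between \<open>\<iota>\<eta>\<close> and \<gamma> holds only as an
    equality of germs, and so does the compatibility of \<eta> between the levels \<open>j\<close>
    and \<open>a\<close>. The index \<open>n\<close> below lies above the indices where both become
    true equations.\<close>
  have "same_germ P (pro_comp \<iota> \<eta> m) (\<gamma> m)" using \<eta>(2) m unfolding pro_eq_def by blast
  then have "same_germ P (d, snd (\<iota> m) \<circ> snd (\<eta> j)) (c m, \<lambda>x. pro_map E m (c m) (?g x))"
    unfolding pro_comp_def \<gamma>_def d_def j_def .
  then obtain k1 where k1: "k1 \<in> pro_index P" "pro_le P d k1" "pro_le P (c m) k1"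
    "\<And>x. x \<in> carrier (pro_obj P k1) \<Longrightarrow> (snd (\<iota> m) \<circ> snd (\<eta> j)) (pro_map P d k1 x) = pro_map E m (c m) (?g (pro_map P (c m) k1 x))"
    by (rule same_germD) (assumption | rule that)+
  obtain k2 where k2: "k2 \<in> pro_index P" "pro_le P d k2" "pro_le P e k2"
    "\<And>x. x \<in> carrier (pro_obj P k2) \<Longrightarrow> snd (\<eta> j) (pro_map P d k2 x) = pro_map J j a (snd (\<eta> a) (pro_map P e k2 x))"
    using pro_linear_compatible[OF \<eta>(1) j a(1) a(2)[folded j_def]] unfolding d_def e_def by blast
  note PD = pro_moduleD[OF Pmod]
  obtain n where n: "n \<in> pro_index P" "pro_le P k1 n" "pro_le P k2 n" using PD(3)[OF k1(1) k2(1)] by blast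
  define h where "h x = snd (\<eta> a) (pro_map P e n (g x))" for x
  have en: "pro_le P e n" by (rule PD(2)[OF d(2) k2(1) n(1) k2(3) n(3)])
  have nE: "n \<in> pro_index E" "pro_le E l n" using n(1) PI by blast+
  have cm: "c m \<in> pro_index P" using c(1,2)[OF m] PI by blast
  have cn: "pro_le E (c m) n" using PD(2)[OF cm k1(1) n(1) k1(3) n(2)] by (simp add: Ple)
  have mn: "pro_le E m n" by (rule ED(2)[OF m c(1)[OF m] nE(1) c(3)[OF m] cn])
  show thesis
  proof (rule that[of n h])
    show "n \<in> pro_index E" "pro_le E m n" "pro_le E (fst (p 0)) n" using nE mn by (simp_all add: l_def)
    note K_def' = K_def[of n, unfolded l_def p0_def, symmetric]
    show "h ` W \<in> bounded (pro_obj J a)"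
      if W: "W \<in> bounded (pro_obj E n)" "W \<subseteq> {x \<in> carrier (pro_obj E n). snd (p 0) (pro_map E (fst (p 0)) n x) = \<zero>\<^bsub>A\<^esub>}" for W
    proof -
      have "W \<subseteq> K n" using W(2) unfolding K_def' .
      then have "g ` W \<in> bounded (pro_obj P n)" using W(1) unfolding P_def by (auto simp: subobject_simps)
      then have "snd (\<eta> a) ` pro_map P e n ` g ` W \<in> bounded (pro_obj J a)"
        using bdd_linear_mapD(2)[OF PD(5)[OF d(2) n(1) en]] bdd_linear_mapD(2)[OF pro_linearD(2)[OF \<eta>(1) a(1)]] unfolding e_def by blast
      then show ?thesis unfolding image_image h_def .
    qed
    fix x assume "x \<in> carrier (pro_obj E n)" "snd (p 0) (pro_map E (fst (p 0)) n x) = \<zero>\<^bsub>A\<^esub>"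
    then have xK: "x \<in> K n" unfolding K_def l_def p0_def by blast
    then have gx: "g x \<in> carrier (pro_obj P n)" unfolding Pc by blast
    have xc: "x \<in> carrier (pro_obj E n)" using xK Kc by blast
    note y1 = PD(8)[OF k1(1) n(1,2) gx] and y2 = PD(8)[OF k2(1) n(1,3) gx]
    have "pro_map J j a (h x) = snd (\<eta> j) (pro_map P d k2 (pro_map P k2 n (g x)))"
      unfolding k2(4)[OF y2] h_def PD(7)[OF d(2) k2(1) n(1) k2(3) n(3) gx] ..
    also have "\<dots> = snd (\<eta> j) (pro_map P d k1 (pro_map P k1 n (g x)))"
      unfolding PD(7)[OF d(1) k2(1) n(1) k2(2) n(3) gx] PD(7)[OF d(1) k1(1) n(1) k1(2) n(2) gx] ..
    finally have "snd (\<iota> m) (pro_map J j a (h x)) = pro_map E m (c m) (?g (pro_map P (c m) n (g x)))"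
      using k1(4)[OF y1] unfolding PD(7)[OF cm k1(1) n(1) k1(3) n(2) gx] by simp
    also have "\<dots> = pro_map E m n x" unfolding Pm gi by (rule ED(7)[OF m c(1)[OF m] nE(1) c(3)[OF m] cn xc])
    finally have "snd (\<iota> m) (pro_map J j a (h x)) = pro_map E m n x" .
    moreover have "h x \<in> carrier (pro_obj J a)"
      unfolding h_def by (rule pro_linearD(3)[OF \<eta>(1) a(1)]) (use PD(8)[OF d(2) n(1) en gx] in \<open>simp add: e_def\<close>)
    ultimately show "h x \<in> carrier (pro_obj J a) \<and> snd (\<iota> m) (pro_map J (fst (\<iota> m)) a (h x)) = pro_map E m n x"
      unfolding j_def by blast
  qed
qed


text \<open>The predicate and the locale differ in that the locale also records that \<pi> belongs
  to \<open>V\<close>.\<close>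

lemma ctf_algebra_iff: "\<pi> \<in> carrier V \<Longrightarrow> ctf_algebra V \<pi> A \<longleftrightarrow> ctf V \<pi> A"
  unfolding ctf_algebra_def ctf_def calg_def tfalg_def calg_axioms_def tfalg_axioms_def balg_def by blast

lemma pro_algebraD:
  assumes "pro_algebra V \<pi> A"
  shows "pro_module V A" "n \<in> pro_index A \<Longrightarrow> \<pi> \<in> carrier V \<Longrightarrow> ctf V \<pi> (pro_obj A n)"
    "m \<in> pro_index A \<Longrightarrow> n \<in> pro_index A \<Longrightarrow> pro_le A m n \<Longrightarrow> bdd_alg_hom V (pro_obj A n) (pro_obj A m) (pro_map A m n)"
  using assms ctf_algebra_iff[of \<pi> V "pro_obj A n"] unfolding pro_algebra_def by blast+

lemma pro_alg_homD:
  assumes "pro_alg_hom V A B \<phi>"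
  shows "pro_linear V A B \<phi>" "n \<in> pro_index B \<Longrightarrow> fst (\<phi> n) \<in> pro_index A"
    "n \<in> pro_index B \<Longrightarrow> bdd_alg_hom V (pro_obj A (fst (\<phi> n))) (pro_obj B n) (snd (\<phi> n))"
  using assms bdd_alg_homD(1) unfolding pro_alg_hom_def pro_linear_def by blast+

text \<open>On the kernel the structure map from level \<open>n\<close> to level \<open>m\<close> of
  \<open>E\<close> passes through the levels \<open>a\<close>, \<open>k\<close> of \<open>J\<close>,
  level \<open>b\<close> of the dagger system \<open>B\<close>, level \<open>j\<close> of
  \<open>J\<close>, and then \<iota>. The map from \<open>a\<close> to \<open>k\<close> gains \<pi>
  from \<open>l\<close> factors, and \<open>B\<close> controls the products of blocks. The rate
  \<open>L = 2 * l\<close> is the block length in \<open>nilpotent_blocks\<close>.\<close>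

lemma kernel_nilpotent:
  fixes J :: "('v, 'j) pro" and E :: "('v, 'e) pro" and A :: "('v, 'a) bmod"
  assumes ext: "pro_extension V \<pi> J E (constant_pro A) \<iota> p"
    and nil: "analytically_nilpotent TYPE('u) V \<pi> J" and \<pi>: "\<pi> \<in> carrier V"
    and m: "m \<in> pro_index E"
  obtains n L where "n \<in> pro_index E" "pro_le E m n" "pro_le E (fst (p 0)) n" "L \<ge> (1::nat)"
    "\<And>W. W \<in> bounded (pro_obj E n) \<Longrightarrow>
      W \<subseteq> {x \<in> carrier (pro_obj E n). snd (p 0) (pro_map E (fst (p 0)) n x) = \<zero>\<^bsub>A\<^esub>} \<Longrightarrow>
      \<exists>W'\<in>bdd_submodules V (pro_obj E m). \<forall>k\<ge>1.
        pro_map E m n ` fold_prods (pro_obj E n) W k \<subseteq> scaled (pro_obj E m) (\<pi> [^]\<^bsub>V\<^esub> (k div L)) W'"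
proof -
  have J: "pro_algebra V \<pi> J" and E: "pro_algebra V \<pi> E" and A: "pro_algebra V \<pi> (constant_pro A)"
    and \<iota>: "pro_alg_hom V J E \<iota>" and p: "pro_alg_hom V E (constant_pro A) p"
    and ker: "pro_kernel TYPE('j + 'e + 'a) V J E (constant_pro A) \<iota> p"
    using ext unfolding pro_extension_def by blast+
  obtain B :: "('v, 'u) pro" and \<phi> \<psi> where B: "pro_algebra V \<pi> B" "\<And>n. n \<in> pro_index B \<Longrightarrow> dagger_algebra V \<pi> (pro_obj B n)"
    and \<phi>: "pro_alg_hom V J B \<phi>" and \<psi>: "pro_alg_hom V B J \<psi>" and id: "pro_eq J J (pro_comp \<psi> \<phi>) pro_id"
    using nil unfolding analytically_nilpotent_def pro_alg_iso_def by blast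
  note JM = pro_moduleD[OF pro_algebraD(1)[OF J]] and EM = pro_moduleD[OF pro_algebraD(1)[OF E]]
  have bA: "born_module V A" using pro_moduleD(4)[OF pro_algebraD(1)[OF A], of 0] by (simp add: constant_pro_def)
  define j b q where "j = fst (\<iota> m)" and "b = fst (\<psi> j)" and "q = fst (\<phi> b)"
  have j: "j \<in> pro_index J" unfolding j_def by (rule pro_alg_homD(2)[OF \<iota> m])
  have b: "b \<in> pro_index B" unfolding b_def by (rule pro_alg_homD(2)[OF \<psi> j])
  have q: "q \<in> pro_index J" unfolding q_def by (rule pro_alg_homD(2)[OF \<phi> b])
  have "same_germ J (pro_comp \<psi> \<phi> j) (pro_id j)" using id j unfolding pro_eq_def by blast
  then have "same_germ J (q, snd (\<psi> j) \<circ> snd (\<phi> b)) (j, \<lambda>x. x)" unfolding pro_comp_def pro_id_def q_def b_def .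
  then obtain k where k: "k \<in> pro_index J" "pro_le J q k" "pro_le J j k"
    "\<And>x. x \<in> carrier (pro_obj J k) \<Longrightarrow> (snd (\<psi> j) \<circ> snd (\<phi> b)) (pro_map J q k x) = pro_map J j k x"
    by (rule same_germD) (assumption | rule that)+
  obtain a l where a: "a \<in> pro_index J" "pro_le J k a" "l \<ge> 1"
    "pro_map J k a ` sub_power V (pro_obj J a) (carrier (pro_obj J a)) l \<subseteq> scaled (pro_obj J k) \<pi> (carrier (pro_obj J k))"
    using nil k(1) unfolding analytically_nilpotent_def nilpotent_mod_def by blast
  have ja: "pro_le J j a" by (rule JM(2)[OF j k(1) a(1) k(3) a(2)])
  obtain n h where n: "n \<in> pro_index E" "pro_le E m n" "pro_le E (fst (p 0)) n"
    and hb: "\<And>W. W \<in> bounded (pro_obj E n) \<Longrightarrow>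
      W \<subseteq> {x \<in> carrier (pro_obj E n). snd (p 0) (pro_map E (fst (p 0)) n x) = \<zero>\<^bsub>A\<^esub>} \<Longrightarrow> h ` W \<in> bounded (pro_obj J a)"
    and h: "\<And>x. x \<in> carrier (pro_obj E n) \<Longrightarrow> snd (p 0) (pro_map E (fst (p 0)) n x) = \<zero>\<^bsub>A\<^esub> \<Longrightarrow>
      h x \<in> carrier (pro_obj J a) \<and> snd (\<iota> m) (pro_map J (fst (\<iota> m)) a (h x)) = pro_map E m n x"
    by (rule kernel_lift[OF ker pro_algebraD(1)[OF J] pro_algebraD(1)[OF E] bA pro_alg_homD(1)[OF p] m a(1) ja[unfolded j_def]])
       blast
  note ctfJ = pro_algebraD(2)[OF J _ \<pi>] and ctfE = pro_algebraD(2)[OF E _ \<pi>] and ctfB = pro_algebraD(2)[OF B(1) _ \<pi>]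
  note bal = calg.axioms(1)[OF ctf.axioms(1)]
  note \<beta> = pro_algebraD(3)[OF J k(1) a(1,2)]
  have \<theta>: "bdd_alg_hom V (pro_obj J k) (pro_obj B b) (\<lambda>x. snd (\<phi> b) (pro_map J q k x))"
    by (rule bdd_alg_hom_comp[OF pro_algebraD(3)[OF J q k(1,2)]]) (use pro_alg_homD(3)[OF \<phi> b] in \<open>simp add: q_def\<close>)
  have \<rho>: "bdd_alg_hom V (pro_obj B b) (pro_obj E m) (\<lambda>x. snd (\<iota> m) (snd (\<psi> j) x))"
    by (rule bdd_alg_hom_comp[OF pro_alg_homD(3)[OF \<psi> j, folded b_def]]) (use pro_alg_homD(3)[OF \<iota> m] in \<open>simp add: j_def\<close>)
  have \<sigma>: "bdd_alg_hom V (pro_obj J a) (pro_obj E m) (\<lambda>x. snd (\<iota> m) (pro_map J j a x))"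
    by (rule bdd_alg_hom_comp[OF pro_algebraD(3)[OF J j a(1) ja]]) (use pro_alg_homD(3)[OF \<iota> m] in \<open>simp add: j_def\<close>)
  have sd: "semi_dagger V \<pi> (pro_obj B b)" using B(2)[OF b] by (simp add: dagger_algebra_def)
  show thesis
  proof (rule that[of n "2 * l"])
    show "n \<in> pro_index E" "pro_le E m n" "pro_le E (fst (p 0)) n" "1 \<le> 2 * l" using n a(3) by simp_all
    fix W assume W: "W \<in> bounded (pro_obj E n)"
      "W \<subseteq> {x \<in> carrier (pro_obj E n). snd (p 0) (pro_map E (fst (p 0)) n x) = \<zero>\<^bsub>A\<^esub>}"
    let ?X = "h ` W"
    have hW: "?X \<in> bounded (pro_obj J a)" by (rule hb[OF W])
    interpret X: balg V \<pi> "pro_obj J a" by (rule bal[OF ctfJ[OF a(1)]])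
    have Xc: "?X \<subseteq> carrier (pro_obj J a)" by (rule X.bd(4)[OF hW])
    obtain T where T: "T \<in> bdd_submodules V (pro_obj B b)" "\<And>k'. k' \<ge> 1 \<Longrightarrow>
        (\<lambda>x. snd (\<phi> b) (pro_map J q k (pro_map J k a x))) ` fold_prods (pro_obj J a) ?X k' \<subseteq>
        scaled (pro_obj B b) (\<pi> [^]\<^bsub>V\<^esub> (k' div (2 * l))) T"
      using nilpotent_blocks[OF bal[OF ctfJ[OF a(1)]] ctf.axioms(2)[OF ctfJ[OF k(1)]] bal[OF ctfB[OF b]] sd \<beta> \<theta> a(3,4) hW] by blast
    let ?W = "(\<lambda>x. snd (\<iota> m) (snd (\<psi> j) x)) ` T"
    have "?W \<in> bdd_submodules V (pro_obj E m)"
      by (rule bdd_submodule_image[OF balg.born[OF bal[OF ctfB[OF b]]] EM(4)[OF m] bdd_alg_homD(1)[OF \<rho>] T(1)])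
    moreover have "pro_map E m n ` fold_prods (pro_obj E n) W k' \<subseteq> scaled (pro_obj E m) (\<pi> [^]\<^bsub>V\<^esub> (k' div (2 * l))) ?W"
      if k': "k' \<ge> 1" for k'
    proof
      fix z assume z: "z \<in> pro_map E m n ` fold_prods (pro_obj E n) W k'"
      have Wc: "W \<subseteq> carrier (pro_obj E n)" using W(2) by blast
      \<comment> \<open>The lift \<open>h\<close> is merely linear. But \<open>W\<close> and its
        lift have the same image at level \<open>m\<close>, and the maps to that level are
        homomorphisms, so the products may be formed in \<open>J\<close> instead of
        \<open>E\<close>.\<close>
      have "pro_map E m n ` W = (\<lambda>x. snd (\<iota> m) (pro_map J j a x)) ` ?X"
        unfolding image_image using h W(2) by (intro image_cong refl) (auto simp: j_def)
      then have "z \<in> (\<lambda>x. snd (\<iota> m) (pro_map J j a x)) ` fold_prods (pro_obj J a) ?X k'"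
        using z unfolding fold_prods_image[OF bal[OF ctfE[OF n(1)]] pro_algebraD(3)[OF E m n(1,2)] Wc]
          fold_prods_image[OF bal[OF ctfJ[OF a(1)]] \<sigma> Xc] by simp
      then obtain y where y: "y \<in> fold_prods (pro_obj J a) ?X k'" "z = snd (\<iota> m) (pro_map J j a y)" by blast
      have yc: "y \<in> carrier (pro_obj J a)" using X.fold_carrier[OF Xc] y(1) by blast
      obtain t where t: "t \<in> T" "snd (\<phi> b) (pro_map J q k (pro_map J k a y)) = (\<pi> [^]\<^bsub>V\<^esub> (k' div (2 * l))) \<odot>\<^bsub>pro_obj B b\<^esub> t"
        using T(2)[OF k'] y(1) unfolding scaled_def by blast
      have tc: "t \<in> carrier (pro_obj B b)" using t(1) balg.born[OF bal[OF ctfB[OF b]]] T(1) born_moduleD(4) bdd_submodulesD(1) by blast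
      have "z = snd (\<iota> m) (snd (\<psi> j) (snd (\<phi> b) (pro_map J q k (pro_map J k a y))))"
        unfolding y(2) JM(7)[OF j k(1) a(1) k(3) a(2) yc, symmetric] using k(4)[OF JM(8)[OF k(1) a(1,2) yc]] by simp
      also have "\<dots> = (\<pi> [^]\<^bsub>V\<^esub> (k' div (2 * l))) \<odot>\<^bsub>pro_obj E m\<^esub> snd (\<iota> m) (snd (\<psi> j) t)"
        unfolding t(2) by (rule linear_mapD(3)[OF bdd_linear_mapD(1)[OF bdd_alg_homD(1)[OF \<rho>]] X.pin tc])
      finally show "z \<in> scaled (pro_obj E m) (\<pi> [^]\<^bsub>V\<^esub> (k' div (2 * l))) ?W" using t(1) unfolding scaled_def by blast
    qed
    ultimately show "\<exists>W'\<in>bdd_submodules V (pro_obj E m). \<forall>k\<ge>1.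
        pro_map E m n ` fold_prods (pro_obj E n) W k \<subseteq> scaled (pro_obj E m) (\<pi> [^]\<^bsub>V\<^esub> (k div (2 * l))) W'" by blast
  qed
qed

section \<open>Lifting the section to an algebra homomorphism\<close>

lemma completion_unique:
  assumes M: "born_module V M" and \<pi>: "\<pi> \<in> carrier V" and N: "complete_born_module V \<pi> N"
    and g: "bdd_linear_map V (completion V \<pi> M) N g" and h: "bdd_linear_map V (completion V \<pi> M) N h"
    and eq: "\<And>x. x \<in> carrier M \<Longrightarrow> g (to_completion V \<pi> M x) = h (to_completion V \<pi> M x)"
    and X: "X \<in> carrier (completion V \<pi> M)"
  shows "g X = h X"
proof -
  from completion_universal(3)[OF M \<pi> N bdd_linear_map_comp[OF completion_universal(2)[OF M \<pi>] h]]
  obtain e where e: "\<And>h'. bdd_linear_map V (completion V \<pi> M) N h' \<Longrightarrow>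
      (\<And>x. x \<in> carrier M \<Longrightarrow> h' (to_completion V \<pi> M x) = h (to_completion V \<pi> M x)) \<Longrightarrow> h' X = e X"
    using X by blast
  have "g X = e X" by (rule e[OF g eq])
  moreover have "h X = e X" by (rule e[OF h refl])
  ultimately show ?thesis by simp
qed

text \<open>Multiplicativity is extended one variable at a time. With the first factor in the image
  of \<open>A\<close>, uniqueness gives it for all second factors; with any second factor fixed,
  uniqueness gives it for all first factors.\<close>

lemma (in balg) completion_extend:
  assumes N: "calg V \<pi> N" and f: "bdd_alg_hom V A N f"
  obtains g where "bdd_alg_hom V (completion V \<pi> A) N g" "\<And>x. x \<in> carrier A \<Longrightarrow> g (to_completion V \<pi> A x) = f x"
proof -
  interpret N: calg V \<pi> N by (rule N)
  interpret Q: balg V \<pi> "completion V \<pi> A" by (rule completion_alg)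
  let ?c = "to_completion V \<pi> A"
  obtain g where g: "bdd_linear_map V (completion V \<pi> A) N g" "\<And>x. x \<in> carrier A \<Longrightarrow> g (?c x) = f x"
    using completion_universal(3)[OF born pi N.compl bdd_alg_homD(1)[OF f]] by blast
  note gc = linear_mapD(1)[OF bdd_linear_mapD(1)[OF g(1)]]
    and cc = linear_mapD(1)[OF bdd_linear_mapD(1)[OF to_completion_linear]]
  note bl = bdd_bilinear_right[OF Q.mul_bilinear Q.born Q.born] bdd_bilinear_left[OF Q.mul_bilinear Q.born Q.born]
    bdd_bilinear_right[OF N.mul_bilinear N.born N.born] bdd_bilinear_left[OF N.mul_bilinear N.born N.born]
  have 1: "g (?c x \<otimes>\<^bsub>completion V \<pi> A\<^esub> Y) = g (?c x) \<otimes>\<^bsub>N\<^esub> g Y" if x: "x \<in> carrier A" and Y: "Y \<in> carrier (completion V \<pi> A)" for x Y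
  proof (rule completion_unique[OF born pi N.compl bdd_linear_map_comp[OF bl(1)[OF cc[OF x]] g(1)] bdd_linear_map_comp[OF g(1) bl(3)[OF gc[OF cc[OF x]]]] _ Y])
    fix y assume y: "y \<in> carrier A"
    show "g (?c x \<otimes>\<^bsub>completion V \<pi> A\<^esub> ?c y) = g (?c x) \<otimes>\<^bsub>N\<^esub> g (?c y)"
      unfolding to_completion_mult[OF x y, symmetric] g(2)[OF mul_closed[OF x y]] g(2)[OF x] g(2)[OF y] by (rule bdd_alg_homD(3)[OF f x y])
  qed
  have "g (X \<otimes>\<^bsub>completion V \<pi> A\<^esub> Y) = g X \<otimes>\<^bsub>N\<^esub> g Y"
    if X: "X \<in> carrier (completion V \<pi> A)" and Y: "Y \<in> carrier (completion V \<pi> A)" for X Y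
    by (rule completion_unique[OF born pi N.compl bdd_linear_map_comp[OF bl(2)[OF Y] g(1)] bdd_linear_map_comp[OF g(1) bl(4)[OF gc[OF Y]]] 1[OF _ Y] X])
  then have "bdd_alg_hom V (completion V \<pi> A) N g" using g(1) by (simp add: bdd_alg_hom_def)
  then show thesis using g(2) by (rule that)
qed

lemma (in almost_hom) newton_iter_multiplicative:
  assumes D: "connection V \<pi> R D" "finite_degree V \<pi> R D"
    and mult: "\<And>x y. x \<in> carrier R \<Longrightarrow> y \<in> carrier R \<Longrightarrow> s (x \<otimes>\<^bsub>R\<^esub> y) = s x \<otimes>\<^bsub>E\<^esub> s y" and x: "x \<in> carrier R"
  shows "newton_iter V \<pi> R D E s k x = s x"
  using x
proof (induction k arbitrary: x)
  case (Suc k)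
  note ah = newton_iter_almost_hom[OF almost_hom_axioms D(1) phi_bdd[OF D], of k]
  show ?case unfolding newton_iter_simps
    using almost_hom.newton_multiplicative[OF ah D(1) _ Suc.prems] Suc.IH mult Suc.prems by simp
qed (simp add: newton_iter_simps)

text \<open>Bounded linear maps carry limits to limits, and limits in a complete algebra are unique.
  Relations between the Newton iterates pass to their limits in this way.\<close>

lemma (in ctf) tends_hom_unique:
  assumes B: "calg V \<pi> B" and f: "bdd_linear_map V A B f" and z: "\<And>k. z k \<in> carrier A" and y: "tends z y"
    and w: "\<And>k. f (z k) = w k" "calg.tends V \<pi> B w v"
  shows "f y = v"
proof -
  interpret B: calg V \<pi> B by (rule B)
  have "B.tends w (f y)"
    using tends_linear[OF B.born f z y] unfolding w(1) B.tends_def .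
  then show ?thesis
    by (rule B.tends_unique[rotated, OF _ w(2)]) (use linear_mapD(1)[OF bdd_linear_mapD(1)[OF f] z] w(1) in metis)
qed


text \<open>Restrict the linear section to \<open>R\<close> along \<tau>. As \<tau> is
  multiplicative and \<open>p\<close> is a homomorphism, the curvature of the restriction dies in
  the dagger completion, so it takes values in the kernel. Relations between the limits at different
  levels are checked on \<open>R\<close>, which is dense.\<close>

lemma dagger_completion_splits:
  fixes V :: "('v, 'k) ring_scheme" and R :: "('v, 'r) bmod" and J :: "('v, 'j) pro" and E :: "('v, 'e) pro"
  assumes R: "ctf V \<pi> R" and D: "connection V \<pi> R D" "finite_degree V \<pi> R D"
    and ext: "pro_extension V \<pi> J E (constant_pro (dagger_completion V \<pi> R)) \<iota> p"
    and ss: "semi_split V E (constant_pro (dagger_completion V \<pi> R)) p"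
    and nil: "analytically_nilpotent TYPE('u) V \<pi> J"
  shows "splits V E (constant_pro (dagger_completion V \<pi> R)) p"
proof -
  interpret R: ctf V \<pi> R by (rule R)
  interpret forms V \<pi> R by (rule forms.intro[OF R.balg_axioms])
  interpret L: tfalg V \<pi> R.Alg by (rule R.lg_tfalg)
  define A where "A = dagger_completion V \<pi> R"
  define \<tau> where "\<tau> = to_completion V \<pi> R.Alg"
  have A_completion: "A = completion V \<pi> R.Alg" by (simp add: A_def dagger_completion_def)
  interpret A: ctf V \<pi> A unfolding A_def by (rule R.dagger_completion_ctf)
  note ext = ext[folded A_def] and ss = ss[folded A_def]
  have pE: "pro_algebra V \<pi> E" and p: "pro_alg_hom V E (constant_pro A) p"
    using ext unfolding pro_extension_def by blast+
  note EM = pro_moduleD[OF pro_algebraD(1)[OF pE]] and EC = pro_algebraD(2)[OF pE _ R.pi] and EH = pro_algebraD(3)[OF pE]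
  define l p0 where "l = fst (p 0)" and "p0 = snd (p 0)"
  have l: "l \<in> pro_index E" and p0: "bdd_alg_hom V (pro_obj E l) A p0"
    using pro_alg_homD(2,3)[OF p, of 0] unfolding l_def p0_def by (simp_all add: constant_pro_def)
  obtain \<sigma> where \<sigma>: "pro_linear V (constant_pro A) E \<sigma>" "pro_eq (constant_pro A) (constant_pro A) (pro_comp p \<sigma>) pro_id"
    using ss unfolding semi_split_def by blast
  define s where "s n = snd (\<sigma> n)" for n
  have s: "bdd_linear_map V A (pro_obj E n) (s n)" if "n \<in> pro_index E" for n
    using pro_linearD(2)[OF \<sigma>(1) that] by (simp add: constant_pro_def s_def)
  \<comment> \<open>A constant source has a single index and identity structure maps, so equality of
    germs is equality of maps.\<close>
  have s_compat: "pro_map E m n (s n x) = s m x"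
    if "m \<in> pro_index E" "n \<in> pro_index E" "pro_le E m n" "x \<in> carrier A" for m n x
    by (rule pro_linear_compatible[OF \<sigma>(1) that(1-3)]) (use that(4) in \<open>simp add: constant_pro_def s_def\<close>)
  have s_sec: "p0 (s l x) = x" if "x \<in> carrier A" for x
  proof -
    have "same_germ (constant_pro A) (pro_comp p \<sigma> 0) (pro_id 0)" using \<sigma>(2) by (simp add: pro_eq_def constant_pro_def)
    then show ?thesis using that by (auto simp: same_germ_def pro_comp_def pro_id_def constant_pro_def p0_def l_def s_def)
  qed
  have \<tau>: "bdd_linear_map V R.Alg A \<tau>" unfolding A_completion \<tau>_def by (rule L.to_completion_linear)
  have \<tau>_mult: "\<tau> (x \<otimes>\<^bsub>R\<^esub> y) = \<tau> x \<otimes>\<^bsub>A\<^esub> \<tau> y" if "x \<in> carrier R" "y \<in> carrier R" for x y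
    unfolding A_completion \<tau>_def using L.to_completion_mult that by simp
  have \<tau>c: "\<tau> x \<in> carrier A" if "x \<in> carrier R" for x
    using linear_mapD(1)[OF bdd_linear_mapD(1)[OF \<tau>]] that by simp
  \<comment> \<open>A bounded submodule \<open>M\<close> is contained in \<open>lg M\<close>, so
    boundedness for linear growth is the stronger condition on a map. The Newton iteration itself
    uses the original bornology of \<open>R\<close>.\<close>
  have incl: "bdd_linear_map V R N f" if f: "bdd_linear_map V R.Alg N f" for N :: "('v, 'z) bmod" and f
  proof (rule bdd_linear_mapI)
    show "linear_map V R N f" using bdd_linear_mapD(1)[OF f] by (simp add: linear_map_def)
    fix B assume "B \<in> bounded R"
    then obtain M where M: "M \<in> bdd_submodules V R" "B \<subseteq> M" using R.bd(6) by blast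
    have "B \<subseteq> R.lg M" using M(2) R.lg_incl[OF R.bddD(3)[OF M(1)]] by (rule order_trans)
    then have "B \<in> bounded R.Alg" using R.linear_growth_iff M(1) by auto
    then show "f ` B \<in> bounded N" by (rule bdd_linear_mapD(2)[OF f])
  qed
  define t where "t n x = s n (\<tau> x)" for n x
  have t: "bdd_linear_map V R.Alg (pro_obj E n) (t n)" if "n \<in> pro_index E" for n
    unfolding t_def by (rule bdd_linear_map_comp[OF \<tau> s[OF that]])
  note calgE = ctf.axioms(1)[OF EC]
  have ah: "almost_hom V \<pi> R (pro_obj E n) (t n)" if "n \<in> pro_index E" for n
    by (intro almost_hom.intro almost_hom_axioms.intro forms_axioms calgE[OF that] incl[OF t[OF that]])
  have t_compat: "pro_map E m n (t n x) = t m x"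
    if "m \<in> pro_index E" "n \<in> pro_index E" "pro_le E m n" "x \<in> carrier R" for m n x
    unfolding t_def by (rule s_compat[OF that(1-3) \<tau>c[OF that(4)]])
  note \<phi> = phi_bdd[OF D]
  let ?q = "\<lambda>n. newton_iter V \<pi> R D (pro_obj E n) (t n)"
  note qa = newton_iter_almost_hom[OF ah D(1) \<phi>]
  note qc = linear_mapD(1)[OF bdd_linear_mapD(1)[OF almost_hom.s[OF qa]]]
  have "\<exists>f. bdd_linear_map V R.Alg (pro_obj E m) f \<and> (\<forall>x\<in>carrier R. calg.tends V \<pi> (pro_obj E m) (\<lambda>k. ?q m k x) (f x)) \<and>
      (\<forall>x\<in>carrier R. \<forall>y\<in>carrier R. f (x \<otimes>\<^bsub>R\<^esub> y) = f x \<otimes>\<^bsub>pro_obj E m\<^esub> f y)" if m: "m \<in> pro_index E" for m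
  proof (rule ctf.limit_hom[OF EC[OF m] R.balg_axioms])
    show "linear_map V R (pro_obj E m) (?q m k)" for k by (rule bdd_linear_mapD(1)[OF almost_hom.s[OF qa[OF m]]])
    fix B assume B: "B \<in> bounded R"
    \<comment> \<open>For the target level \<open>m\<close> the curvature is small only after a map
      from a deeper level \<open>n\<close>, which depends on \<open>m\<close>; \<open>n\<close> also
      lies above \<open>l\<close>, so that the kernel can be tested there.\<close>
    obtain n K where n: "n \<in> pro_index E" "pro_le E m n" "pro_le E l n" "K \<ge> (1::nat)"
      and nl: "\<And>W. W \<in> bounded (pro_obj E n) \<Longrightarrow> W \<subseteq> {x \<in> carrier (pro_obj E n). p0 (pro_map E l n x) = \<zero>\<^bsub>A\<^esub>} \<Longrightarrow>
        \<exists>W'\<in>bdd_submodules V (pro_obj E m). \<forall>k\<ge>1.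
          pro_map E m n ` fold_prods (pro_obj E n) W k \<subseteq> scaled (pro_obj E m) (\<pi> [^]\<^bsub>V\<^esub> (k div K)) W'"
      using kernel_nilpotent[OF ext nil R.pi m] unfolding l_def p0_def by blast
    interpret En: almost_hom V \<pi> R "pro_obj E n" "t n" by (rule ah[OF n(1)])
    have p0n: "bdd_alg_hom V (pro_obj E n) A (\<lambda>x. p0 (pro_map E l n x))" by (rule bdd_alg_hom_comp[OF EH[OF l n(1,3)] p0])
    have p0t: "p0 (pro_map E l n (t n x)) = \<tau> x" if "x \<in> carrier R" for x
      unfolding t_compat[OF l n(1,3) that] using s_sec[OF \<tau>c[OF that]] by (simp add: t_def)
    let ?K = "{x \<in> carrier (pro_obj E n). p0 (pro_map E l n x) = \<zero>\<^bsub>A\<^esub>}"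
    note p0l = bdd_linear_mapD(1)[OF bdd_alg_homD(1)[OF p0n]]
    have "submodule {\<zero>\<^bsub>A\<^esub>} V A" by (rule A.subI) auto
    from linear_preimage[OF En.E.module_axioms A.module_axioms p0l this] have K: "submodule ?K V (pro_obj E n)" by simp
    have w: "En.w x y \<in> ?K" if xy: "x \<in> carrier R" "y \<in> carrier R" for x y
    proof -
      note c = En.sl(1)[OF xy(1)] En.sl(1)[OF xy(2)] En.sl(1)[OF R.mul_closed[OF xy]]
      have "p0 (pro_map E l n (En.w x y)) = \<tau> x \<otimes>\<^bsub>A\<^esub> \<tau> y \<ominus>\<^bsub>A\<^esub> \<tau> (x \<otimes>\<^bsub>R\<^esub> y)"
        unfolding curv_def linear_diff[OF En.E.module_axioms A.module_axioms p0l En.E.mul_closed[OF c(1,2)] c(3)]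
          bdd_alg_homD(3)[OF p0n c(1,2)] p0t[OF xy(1)] p0t[OF xy(2)] p0t[OF R.mul_closed[OF xy]] ..
      also have "\<dots> = \<zero>\<^bsub>A\<^esub>" unfolding \<tau>_mult[OF xy] by (rule A.diff_self[OF A.mul_closed[OF \<tau>c[OF xy(1)] \<tau>c[OF xy(2)]]])
      finally show ?thesis using En.w_carrier[OF xy] by simp
    qed
    show "\<exists>M\<in>bdd_submodules V R. \<exists>T\<in>bdd_submodules V (pro_obj E m). \<exists>j.
        B \<subseteq> M \<and> adic_complete V \<pi> (pro_obj E m) T \<and> ctf.fast V \<pi> (pro_obj E m) R (?q m) M T j"
      by (rule En.newton_fast[OF t[OF n(1)] D EC[OF m] EH[OF m n(1,2)] ah[OF m] t_compat[OF m n(1,2)] K w n(4) nl[OF bdd_submodulesD(1)] B])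
  qed
  then obtain f where f: "\<And>m. m \<in> pro_index E \<Longrightarrow> bdd_linear_map V R.Alg (pro_obj E m) (f m)"
      "\<And>m x. m \<in> pro_index E \<Longrightarrow> x \<in> carrier R \<Longrightarrow> calg.tends V \<pi> (pro_obj E m) (\<lambda>k. ?q m k x) (f m x)"
      "\<And>m x y. m \<in> pro_index E \<Longrightarrow> x \<in> carrier R \<Longrightarrow> y \<in> carrier R \<Longrightarrow> f m (x \<otimes>\<^bsub>R\<^esub> y) = f m x \<otimes>\<^bsub>pro_obj E m\<^esub> f m y"
    by metis
  have "\<exists>g. bdd_alg_hom V A (pro_obj E m) g \<and> (\<forall>x\<in>carrier R. g (\<tau> x) = f m x)" if m: "m \<in> pro_index E" for m
  proof -
    have "bdd_alg_hom V R.Alg (pro_obj E m) (f m)" using f(1,3)[OF m] by (simp add: bdd_alg_hom_def)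
    then obtain g where "bdd_alg_hom V (completion V \<pi> R.Alg) (pro_obj E m) g" "\<And>x. x \<in> carrier R.Alg \<Longrightarrow> g (to_completion V \<pi> R.Alg x) = f m x"
      using L.completion_extend[OF calgE[OF m]] by metis
    then show ?thesis unfolding A_completion \<tau>_def by auto
  qed
  then obtain g where g: "\<And>m. m \<in> pro_index E \<Longrightarrow> bdd_alg_hom V A (pro_obj E m) (g m)"
      "\<And>m x. m \<in> pro_index E \<Longrightarrow> x \<in> carrier R \<Longrightarrow> g m (\<tau> x) = f m x" by metis
  have dense: "h X = h' X" if h: "bdd_linear_map V A N h" "bdd_linear_map V A N h'" and N: "complete_born_module V \<pi> N"
    and eq: "\<And>x. x \<in> carrier R \<Longrightarrow> h (\<tau> x) = h' (\<tau> x)" and X: "X \<in> carrier A" for N :: "('v, 'z) bmod" and h h' X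
    by (rule completion_unique[OF L.born R.pi N h[unfolded A_completion] _ X[unfolded A_completion]]) (use eq in \<open>simp add: \<tau>_def\<close>)
  have g_compat: "pro_map E m n (g n X) = g m X"
    if mn: "m \<in> pro_index E" "n \<in> pro_index E" "pro_le E m n" and X: "X \<in> carrier A" for m n X
  proof (rule dense[OF bdd_linear_map_comp[OF bdd_alg_homD(1)[OF g(1)[OF mn(2)]] EM(5)[OF mn]] bdd_alg_homD(1)[OF g(1)[OF mn(1)]] calg.compl[OF calgE[OF mn(1)]] _ X])
    fix x assume x: "x \<in> carrier R"
    show "pro_map E m n (g n (\<tau> x)) = g m (\<tau> x)"
      unfolding g(2)[OF mn(1) x] g(2)[OF mn(2) x]
      by (rule ctf.tends_hom_unique[OF EC[OF mn(2)] calgE[OF mn(1)] EM(5)[OF mn] qc[OF mn(2) x] f(2)[OF mn(2) x] _ f(2)[OF mn(1) x]])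
         (rule newton_iter_natural[OF ah[OF mn(2)] D(1) \<phi> ah[OF mn(1)] EH[OF mn] t_compat[OF mn] x])
  qed
  have g_sec: "p0 (g l X) = X" if X: "X \<in> carrier A" for X
  proof (rule dense[OF bdd_linear_map_comp[OF bdd_alg_homD(1)[OF g(1)[OF l]] bdd_alg_homD(1)[OF p0]] bdd_linear_map_id[OF A.module_axioms] A.compl _ X])
    fix x assume x: "x \<in> carrier R"
    \<comment> \<open>Pushed forward to the dagger completion, the iteration starts at \<tau>. This
      map is multiplicative, so the iteration is constant there and the limit is still a
      section.\<close>
    have a\<tau>: "almost_hom V \<pi> R A \<tau>"
      by (intro almost_hom.intro almost_hom_axioms.intro forms_axioms A.calg_axioms incl[OF \<tau>])
    show "p0 (g l (\<tau> x)) = \<tau> x"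
      unfolding g(2)[OF l x]
    proof (rule ctf.tends_hom_unique[OF EC[OF l] A.calg_axioms bdd_alg_homD(1)[OF p0] qc[OF l x] f(2)[OF l x] _ A.tends_const[OF \<tau>c[OF x]]])
      fix k
      have "p0 (?q l k x) = newton_iter V \<pi> R D A \<tau> k x"
        by (rule newton_iter_natural[OF ah[OF l] D(1) \<phi> a\<tau> p0 _ x]) (simp add: t_def s_sec \<tau>c)
      also have "\<dots> = \<tau> x" by (rule almost_hom.newton_iter_multiplicative[OF a\<tau> D \<tau>_mult x])
      finally show "p0 (?q l k x) = \<tau> x" .
    qed
  qed
  have "pro_alg_hom V (constant_pro A) E (\<lambda>n. (0, g n))"
    unfolding pro_alg_hom_def pro_compatible_def
    using g(1) g_compat by (auto simp: constant_pro_def same_germ_def)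
  moreover have "pro_eq (constant_pro A) (constant_pro A) (pro_comp p (\<lambda>n. (0, g n))) pro_id"
    using g_sec by (auto simp: pro_eq_def pro_comp_def pro_id_def same_germ_def constant_pro_def l_def p0_def)
  ultimately show ?thesis unfolding splits_def A_def by blast
qed

theorem theorem8p1p9:
  fixes V :: "('v, 'k) ring_scheme" and \<pi> :: 'v and R :: "('v, 'r) bmod"
  assumes "complete_dvr V \<pi>"
    and "ctf_algebra V \<pi> R"
    and "\<exists>D. connection V \<pi> R D \<and> finite_degree V \<pi> R D"
  shows "analytically_quasi_free TYPE('u) V \<pi> (constant_pro (dagger_completion V \<pi> R))"
proof -
  have \<pi>: "\<pi> \<in> carrier V" using assms(1) by (simp add: complete_dvr_def)
  have R: "ctf V \<pi> R" using assms(2) ctf_algebra_iff[OF \<pi>] by blast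
  interpret R: ctf V \<pi> R by (rule R)
  interpret A: ctf V \<pi> "dagger_completion V \<pi> R" by (rule R.dagger_completion_ctf)
  obtain D where D: "connection V \<pi> R D" "finite_degree V \<pi> R D" using assms(3) by blast
  have id: "bdd_linear_map V (dagger_completion V \<pi> R) (dagger_completion V \<pi> R) (\<lambda>x. x)"
    by (rule bdd_linear_map_id[OF A.module_axioms])
  have "pro_algebra V \<pi> (constant_pro (dagger_completion V \<pi> R))"
    using A.born id iffD2[OF ctf_algebra_iff[OF \<pi>] A.ctf_axioms]
    unfolding pro_algebra_def pro_module_def by (simp add: constant_pro_def directed_def bdd_alg_hom_def)
  then show ?thesis
    unfolding analytically_quasi_free_def using dagger_completion_splits[OF R D] by blast
qed

end
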